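(* Let $\epsilon > 0$ be a fixed constant and $\delta \in (0,1)$. There is a randomized algorithm which, given a full-rank symmetric positive definite $\mathbf{K} \in \mathbb{R}^{d\times d}$, computes $w \in \mathbb{R}^d_{\ge 0}$ such that, with $\mathbf{W} = \mathrm{diag}(w)$, $\kappa(\mathbf{W}^{1/2}\mathbf{K}\mathbf{W}^{1/2}) \le (1+\epsilon)\kappa^\star_o(\mathbf{K})$ with probability at least $1-\delta$, in time \[O\left(\mathcal{T}_{\textup{mv}}(\mathbf{K}) \cdot (\kappa^\star_o(\mathbf{K}))^{1.5}\cdot \log^8\left(\frac{d\kappa^\star_o(\mathbf{K})}{\delta}\right)\right).\]
   Context: For a positive definite matrix $\mathbf{M}$, $\kappa(\mathbf{M}) := \lambda_{\max}(\mathbf{M})/\lambda_{\min}(\mathbf{M})$. For positive definite $\mathbf{K}$, $\kappa^\star_o(\mathbf{K}) := \min_{\text{diagonal } \mathbf{W} \succeq \mathbf{0}} \kappa(\mathbf{W}^{1/2}\mathbf{K}\mathbf{W}^{1/2})$ (the optimal outer scaling condition number). $\mathcal{T}_{\textup{mv}}(\mathbf{K})$ is the time to multiply a vector by $\mathbf{K}$. Constants hidden in $O(\cdot)$ may depend on $\epsilon$. *)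

theory Defs
  imports
    "HOL-Probability.Probability"
    "Jordan_Normal_Form.Spectral_Radius"
    "Jordan_Normal_Form.DL_Rank"
begin

section \<open>Condition numbers and optimal outer scaling\<close>

definition positive_definite :: "nat \<Rightarrow> real mat \<Rightarrow> bool" where
  "positive_definite d M \<longleftrightarrow>
     M \<in> carrier_mat d d \<and> transpose_mat M = M \<and>
     (\<forall>x \<in> carrier_vec d. x \<noteq> 0\<^sub>v d \<longrightarrow> scalar_prod x (M *\<^sub>v x) > 0)"

text \<open>Meaningful only for positive definite matrices of dimension at least 1: for a
  singular matrix the quotient would be 0 by the convention for division by 0. Every use
  below is therefore guarded by \<^const>\<open>positive_definite\<close>.\<close>
definition cond_number :: "real mat \<Rightarrow> real" where
  "cond_number M = Max (spectrum M) / Min (spectrum M)"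

definition outer_scale :: "nat \<Rightarrow> real mat \<Rightarrow> real vec \<Rightarrow> real mat" where
  "outer_scale d K w =
     mat_diag d (\<lambda>i. sqrt (vec_index w i)) * K * mat_diag d (\<lambda>i. sqrt (vec_index w i))"

definition nonneg_vec :: "nat \<Rightarrow> real vec \<Rightarrow> bool" where
  "nonneg_vec d w \<longleftrightarrow> w \<in> carrier_vec d \<and> (\<forall>i<d. 0 \<le> vec_index w i)"

text \<open>Weights for which the scaled matrix is singular have condition number \<open>\<infinity>\<close> and do not
  take part in the minimum. For positive definite \<open>K\<close> the infimum is attained.\<close>
definition opt_outer_cond :: "nat \<Rightarrow> real mat \<Rightarrow> real" where
  "opt_outer_cond d K =
     Inf {cond_number (outer_scale d K w) | w.
            nonneg_vec d w \<and> positive_definite d (outer_scale d K w)}"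


section \<open>A randomized real RAM with matrix input\<close>

text \<open>The memory consists of natural number cells, used for indices and counters, and of
  real cells holding exact real numbers. An operand is either a fixed cell or a cell whose
  index is stored in a natural number cell (indirect addressing). The input matrix is
  read-only; it can be read entry by entry or multiplied with a vector stored in memory.
  Randomness is a sequence of coin flips.\<close>

datatype addr = At nat | Ptr nat

datatype arith = Plus | Minus | Times | Divide

datatype instr =
    NConst addr nat
  | NAdd addr addr addr
  | NSub addr addr addr
  | ROfNat addr addr
  | RArith arith addr addr addr
  | RSqrt addr addr
  | Flip addr
  | Entry addr addr addr
  | MatVec addr addr

datatype test = NLess addr addr | RLess addr addr

datatype prog =
    Skip
  | Do instr
  | Seq prog prog
  | Cond test prog prog
  | While test prog

record state =
  nmem :: "nat \<Rightarrow> nat"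
  rmem :: "nat \<Rightarrow> real"
  flips :: nat

fun loc :: "state \<Rightarrow> addr \<Rightarrow> nat" where
  "loc s (At k) = k"
| "loc s (Ptr k) = nmem s k"

abbreviation nval :: "state \<Rightarrow> addr \<Rightarrow> nat" where
  "nval s a \<equiv> nmem s (loc s a)"

abbreviation rval :: "state \<Rightarrow> addr \<Rightarrow> real" where
  "rval s a \<equiv> rmem s (loc s a)"

definition nset :: "addr \<Rightarrow> nat \<Rightarrow> state \<Rightarrow> state" where
  "nset a n s = s\<lparr>nmem := (nmem s)(loc s a := n)\<rparr>"

definition rset :: "addr \<Rightarrow> real \<Rightarrow> state \<Rightarrow> state" where
  "rset a x s = s\<lparr>rmem := (rmem s)(loc s a := x)\<rparr>"

definition read_vec :: "nat \<Rightarrow> nat \<Rightarrow> state \<Rightarrow> real vec" where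
  "read_vec d p s = Matrix.vec d (\<lambda>i. rmem s (p + i))"

definition write_vec :: "nat \<Rightarrow> real vec \<Rightarrow> state \<Rightarrow> state" where
  "write_vec p v s =
     s\<lparr>rmem := (\<lambda>k. if p \<le> k \<and> k < p + dim_vec v then vec_index v (k - p) else rmem s k)\<rparr>"

fun arith_op :: "arith \<Rightarrow> real \<Rightarrow> real \<Rightarrow> real" where
  "arith_op Plus x y = x + y"
| "arith_op Minus x y = x - y"
| "arith_op Times x y = x * y"
| "arith_op Divide x y = x / y"

text \<open>\<open>K\<close> is the input matrix and \<open>\<omega>\<close> the sequence of coin flips. In \<open>MatVec a b\<close> the two
  operands are the first cells of the target and of the source vector.\<close>
fun effect :: "real mat \<Rightarrow> (nat \<Rightarrow> bool) \<Rightarrow> instr \<Rightarrow> state \<Rightarrow> state" where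
  "effect K \<omega> (NConst a n) s = nset a n s"
| "effect K \<omega> (NAdd a b c) s = nset a (nval s b + nval s c) s"
| "effect K \<omega> (NSub a b c) s = nset a (nval s b - nval s c) s"
| "effect K \<omega> (ROfNat a b) s = rset a (of_nat (nval s b)) s"
| "effect K \<omega> (RArith f a b c) s = rset a (arith_op f (rval s b) (rval s c)) s"
| "effect K \<omega> (RSqrt a b) s = rset a (sqrt (rval s b)) s"
| "effect K \<omega> (Flip a) s = (nset a (of_bool (\<omega> (flips s))) s)\<lparr>flips := Suc (flips s)\<rparr>"
| "effect K \<omega> (Entry a b c) s =
     rset a (if nval s b < dim_row K \<and> nval s c < dim_col K
             then K $$ (nval s b, nval s c) else 0) s"
| "effect K \<omega> (MatVec a b) s =
     write_vec (loc s a) (K *\<^sub>v read_vec (dim_col K) (loc s b) s) s"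

text \<open>\<open>T\<close> is the time to multiply a vector by the input matrix.\<close>
fun cost :: "real \<Rightarrow> instr \<Rightarrow> real" where
  "cost T (MatVec a b) = T"
| "cost T _ = 1"

fun holds :: "test \<Rightarrow> state \<Rightarrow> bool" where
  "holds (NLess a b) s \<longleftrightarrow> nval s a < nval s b"
| "holds (RLess a b) s \<longleftrightarrow> rval s a < rval s b"

text \<open>\<open>exec K T \<omega> P s t s'\<close>: started in \<open>s\<close>, the program \<open>P\<close> halts in \<open>s'\<close> after time \<open>t\<close>.\<close>
inductive exec ::
  "real mat \<Rightarrow> real \<Rightarrow> (nat \<Rightarrow> bool) \<Rightarrow> prog \<Rightarrow> state \<Rightarrow> real \<Rightarrow> state \<Rightarrow> bool"
  for K :: "real mat" and T :: real and \<omega> :: "nat \<Rightarrow> bool" where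
  Skip: "exec K T \<omega> Skip s 0 s"
| Do: "exec K T \<omega> (Do c) s (cost T c) (effect K \<omega> c s)"
| Seq: "exec K T \<omega> P s t s' \<Longrightarrow> exec K T \<omega> Q s' t' s'' \<Longrightarrow> exec K T \<omega> (Seq P Q) s (t + t') s''"
| Cond_True: "holds b s \<Longrightarrow> exec K T \<omega> P s t s' \<Longrightarrow> exec K T \<omega> (Cond b P Q) s (1 + t) s'"
| Cond_False: "\<not> holds b s \<Longrightarrow> exec K T \<omega> Q s t s' \<Longrightarrow> exec K T \<omega> (Cond b P Q) s (1 + t) s'"
| While_False: "\<not> holds b s \<Longrightarrow> exec K T \<omega> (While b P) s 1 s"
| While_True: "holds b s \<Longrightarrow> exec K T \<omega> P s t s' \<Longrightarrow> exec K T \<omega> (While b P) s' t' s'' \<Longrightarrow>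
    exec K T \<omega> (While b P) s (1 + t + t') s''"

inductive_cases SkipE: "exec K T \<omega> Skip s t s'"
inductive_cases DoE: "exec K T \<omega> (Do c) s t s'"
inductive_cases SeqE: "exec K T \<omega> (Seq P Q) s t s'"
inductive_cases CondE: "exec K T \<omega> (Cond b P Q) s t s'"
inductive_cases WhileE: "exec K T \<omega> (While b P) s t s'"

lemma exec_deterministic:
  "exec K T \<omega> P s t s' \<Longrightarrow> exec K T \<omega> P s u s'' \<Longrightarrow> u = t \<and> s'' = s'"
proof (induction arbitrary: u s'' rule: exec.induct)
  case (Skip s)
  then show ?case by (auto elim: SkipE)
next
  case (Do c s)
  then show ?case by (auto elim: DoE)
next
  case (Seq P s t s' Q t' s'')
  from Seq.prems show ?case by (rule SeqE) (use Seq.IH in blast)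
next
  case (Cond_True b s P t s' Q)
  from Cond_True.prems show ?case by (rule CondE) (use Cond_True in blast)+
next
  case (Cond_False b s Q t s' P)
  from Cond_False.prems show ?case by (rule CondE) (use Cond_False in blast)+
next
  case (While_False b s P)
  from While_False.prems show ?case by (rule WhileE) (use While_False in blast)+
next
  case (While_True b s P t s' t' s'')
  from While_True.prems show ?case by (rule WhileE) (use While_True in blast)+
qed

text \<open>The dimension is the initial content of natural number cell 0, the failure
  probability that of real cell 0; the output is read from the first \<open>d\<close> real cells.\<close>
definition init_state :: "nat \<Rightarrow> real \<Rightarrow> state" where
  "init_state d \<delta> = \<lparr>nmem = (\<lambda>_. 0)(0 := d), rmem = (\<lambda>_. 0)(0 := \<delta>), flips = 0\<rparr>"

definition output_vec :: "nat \<Rightarrow> state \<Rightarrow> real vec" where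
  "output_vec d s = read_vec d 0 s"

definition fair_coins :: "(nat \<Rightarrow> bool) measure" where
  "fair_coins = (\<Pi>\<^sub>M i\<in>UNIV. measure_pmf (bernoulli_pmf (1/2)))"

text \<open>The maximum with 1 matters only for \<open>d = 1\<close>, where \<open>ln (d * \<kappa> / \<delta>)\<close> can be arbitrarily
  close to 0; for \<open>d \<ge> 2\<close> it is at least \<open>ln 2\<close>, so that the maximum changes the
  bound by at most a constant factor.\<close>
definition time_bound :: "nat \<Rightarrow> real mat \<Rightarrow> real \<Rightarrow> real \<Rightarrow> real" where
  "time_bound d K T \<delta> =
     T * opt_outer_cond d K powr 1.5 * max 1 (ln (d * opt_outer_cond d K / \<delta>)) ^ 8"

end

theory Submission
  imports Defs
begin

text \<open>The condition number of \<open>N = S (K + \<mu> diag K) S\<close> is reduced by multiplicative updates of the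
  positive diagonal matrix \<open>S\<close>, while \<open>\<mu>\<close> is halved, starting from \<open>d\<close>, until it no longer matters;
  the output is \<open>w = diag S\<^sup>2\<close>. One update works on the potential \<open>tr N^p * tr N^(-p)\<close>, where \<open>p\<close> is a
  power of two of order \<open>log d\<close>. If the normalised diagonals of \<open>N^p\<close> and \<open>N^(-p)\<close> have a constant
  distance in the sum norm, then multiplying each \<open>s i\<close> by \<open>r\<close> or \<open>1 / r\<close>, according to which of the
  two entries is larger, decreases the potential by a constant factor; this uses the inequality
  \<open>tr (D N D)^p \<le> tr (N^p D^(2p))\<close> of Araki, Lieb and Thirring. If the two diagonals nearly agree, then
  the Cauchy-Schwarz inequality shows that no diagonal scaling has a condition number much smaller
  than that of \<open>N\<close>.

  The diagonals are estimated by applying \<open>N^(p/2)\<close> and, through Richardson iteration, \<open>N^(-p/2)\<close> to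
  random sign vectors. Since the lower bound on the optimum is valid for arbitrary estimates, the
  running time is bounded for all coins; only the quality of the output relies on concentration.\<close>

section \<open>Linear algebra of real symmetric matrices and the trace inequality\<close>

section \<open>Matrices as functions\<close>

text \<open>The term \<open>\<mu> diag K\<close> allows a start without any knowledge of the
  optimum: for \<open>\<mu> = d\<close>, and with \<open>S\<close> chosen so that
  \<open>S K S\<close> has unit diagonal, the condition number of \<open>N\<close> is at most 2, and
  halving \<mu> at most doubles it. The term does not disturb the lower bound, since a scaling that
  sandwiches \<open>K\<close> sandwiches \<open>diag K\<close> with the same constants. So \<mu> is
  halved only when the condition number is certified to be within a constant factor of the optimum,
  and the bound \<open>B\<close> that the program keeps for it never exceeds a fixed multiple of the
  unknown optimum.

  Up to logarithmic factors, the exponent 1.5 is the product of order \<open>B\<close>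
  multiplications for one solve and order \<open>sqrt B\<close> updates for one value of \<mu>. The
  latter is crude, as order \<open>log B\<close> updates would do, but it spares the program a
  logarithm. This cap on the updates is not met for good coins; it is there to bound the time for
  all coins.\<close>

definition ip :: "nat \<Rightarrow> (nat \<Rightarrow> real) \<Rightarrow> (nat \<Rightarrow> real) \<Rightarrow> real" where
  "ip d x y = (\<Sum>i<d. x i * y i)"

definition mv :: "nat \<Rightarrow> (nat \<Rightarrow> nat \<Rightarrow> real) \<Rightarrow> (nat \<Rightarrow> real) \<Rightarrow> nat \<Rightarrow> real" where
  "mv d A x i = (\<Sum>j<d. A i j * x j)"

definition sym_mat :: "nat \<Rightarrow> (nat \<Rightarrow> nat \<Rightarrow> real) \<Rightarrow> bool" where
  "sym_mat d A \<longleftrightarrow> (\<forall>i<d. \<forall>j<d. A i j = A j i)"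

definition orthonormal :: "nat \<Rightarrow> nat \<Rightarrow> (nat \<Rightarrow> nat \<Rightarrow> real) \<Rightarrow> bool" where
  "orthonormal d r V \<longleftrightarrow> (\<forall>a<r. \<forall>b<r. ip d (V a) (V b) = of_bool (a = b))"

lemma ip_commute: "ip d x y = ip d y x"
  by (simp add: ip_def mult.commute)

lemma ip_add_right: "ip d x (\<lambda>i. y i + z i) = ip d x y + ip d x z"
  by (simp add: ip_def algebra_simps sum.distrib)

lemma ip_scale_right: "ip d x (\<lambda>i. c * y i) = c * ip d x y"
  by (simp add: ip_def sum_distrib_left algebra_simps)

lemma ip_add_left: "ip d (\<lambda>i. y i + z i) x = ip d y x + ip d z x"
  by (simp add: ip_def algebra_simps sum.distrib)

lemma ip_scale_left: "ip d (\<lambda>i. c * y i) x = c * ip d y x"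
  by (simp add: ip_def sum_distrib_left algebra_simps)

lemma ip_sum_right: "ip d x (\<lambda>i. \<Sum>a\<in>I. y a i) = (\<Sum>a\<in>I. ip d x (y a))"
  unfolding ip_def sum_distrib_left by (rule sum.swap)

lemma ip_self_nonneg: "0 \<le> ip d x x"
  by (simp add: ip_def sum_nonneg)

lemma ip_self_pos: "i < d \<Longrightarrow> x i \<noteq> 0 \<Longrightarrow> 0 < ip d x x"
  unfolding ip_def by (rule sum_pos2[where i=i]) (auto simp: zero_less_mult_iff)

lemma ip_self_eq_0: "ip d x x = 0 \<Longrightarrow> i < d \<Longrightarrow> x i = 0"
  using ip_self_pos[of i d x] by auto

lemma ip_cong: "(\<And>i. i < d \<Longrightarrow> x i = x' i) \<Longrightarrow> (\<And>i. i < d \<Longrightarrow> y i = y' i) \<Longrightarrow> ip d x y = ip d x' y'"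
  by (simp add: ip_def)

lemma mv_cong: "(\<And>i. i < d \<Longrightarrow> x i = x' i) \<Longrightarrow> mv d A x = mv d A x'"
  by (simp add: mv_def fun_eq_iff)

lemma mv_add: "mv d A (\<lambda>i. x i + y i) = (\<lambda>i. mv d A x i + mv d A y i)"
  by (simp add: mv_def fun_eq_iff algebra_simps sum.distrib)

lemma mv_scale: "mv d A (\<lambda>i. c * x i) = (\<lambda>i. c * mv d A x i)"
  by (simp add: mv_def fun_eq_iff sum_distrib_left algebra_simps)

lemma sym_mat_ip:
  assumes "sym_mat d A"
  shows "ip d x (mv d A y) = ip d (mv d A x) y"
proof -
  have "ip d x (mv d A y) = (\<Sum>i<d. \<Sum>j<d. x i * A i j * y j)"
    by (simp add: ip_def mv_def sum_distrib_left mult.assoc)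
  also have "\<dots> = (\<Sum>j<d. \<Sum>i<d. x i * A i j * y j)" by (rule sum.swap)
  also have "\<dots> = (\<Sum>j<d. \<Sum>i<d. A j i * x i * y j)"
    using assms by (intro sum.cong refl) (simp add: sym_mat_def)
  also have "\<dots> = ip d (mv d A x) y"
    by (simp add: ip_def mv_def sum_distrib_right)
  finally show ?thesis .
qed

lemma orthonormal_residual:
  assumes "orthonormal d r V"
  shows "ip d (\<lambda>i. x i - (\<Sum>a<r. ip d (V a) x * V a i)) (\<lambda>i. x i - (\<Sum>a<r. ip d (V a) x * V a i))
    = ip d x x - (\<Sum>a<r. (ip d (V a) x)\<^sup>2)"
    and "b < r \<Longrightarrow> ip d (V b) (\<lambda>i. x i - (\<Sum>a<r. ip d (V a) x * V a i)) = 0"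
proof -
  define R where "R = (\<lambda>i. \<Sum>a<r. ip d (V a) x * V a i)"
  have proj: "ip d (V b) R = ip d (V b) x" if "b < r" for b
  proof -
    have "ip d (V b) R = (\<Sum>a<r. ip d (V a) x * ip d (V b) (V a))"
      by (simp add: R_def ip_sum_right ip_scale_right)
    also have "\<dots> = (\<Sum>a<r. if a = b then ip d (V b) x else 0)"
      using assms that by (intro sum.cong) (auto simp: orthonormal_def)
    finally show ?thesis using that by simp
  qed
  have minus: "ip d z (\<lambda>i. x i - R i) = ip d z x - ip d z R" for z
    using ip_add_right[of d z x "\<lambda>i. - 1 * R i"] by (simp add: ip_def sum_negf)
  show "b < r \<Longrightarrow> ip d (V b) (\<lambda>i. x i - (\<Sum>a<r. ip d (V a) x * V a i)) = 0"
    using minus[of "V b"] proj[of b] by (simp add: R_def)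
  have RR: "ip d z R = (\<Sum>a<r. ip d (V a) x * ip d z (V a))" for z
    by (simp add: R_def ip_sum_right ip_scale_right)
  have "ip d x R = (\<Sum>a<r. (ip d (V a) x)\<^sup>2)"
    by (simp add: RR power2_eq_square ip_commute[of d x])
  moreover have "ip d R R = (\<Sum>a<r. (ip d (V a) x)\<^sup>2)"
    unfolding RR[of R] using proj by (simp add: power2_eq_square ip_commute[of d R])
  moreover have "ip d (\<lambda>i. x i - R i) (\<lambda>i. x i - R i) = ip d x x - 2 * ip d x R + ip d R R"
    using minus[of "\<lambda>i. x i - R i"] minus[of x] minus[of R]
      ip_commute[of d "\<lambda>i. x i - R i" x] ip_commute[of d "\<lambda>i. x i - R i" R] ip_commute[of d R x]
    by linarith
  ultimately show "ip d (\<lambda>i. x i - (\<Sum>a<r. ip d (V a) x * V a i)) (\<lambda>i. x i - (\<Sum>a<r. ip d (V a) x * V a i))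
    = ip d x x - (\<Sum>a<r. (ip d (V a) x)\<^sup>2)"
    unfolding R_def by linarith
qed

lemma ip_delta: "i < d \<Longrightarrow> ip d x (\<lambda>j. of_bool (j = i)) = x i"
  by (simp add: ip_def)

text \<open>From \<open>V V^T = I\<close> to \<open>V^T V = I\<close> without dimension theory: the
  residuals of the \<open>d\<close> unit vectors have squared norms that add up to
  \<open>d - d = 0\<close>, so every residual vanishes.\<close>

lemma orthonormal_complete:
  assumes "orthonormal d d V" "i < d" "j < d"
  shows "(\<Sum>a<d. V a i * V a j) = of_bool (i = j)"
proof -
  define \<delta> where "\<delta> i = (\<lambda>j. of_bool (j = i) :: real)" for i :: nat
  define \<rho> where "\<rho> k = (\<lambda>i. \<delta> k i - (\<Sum>a<d. ip d (V a) (\<delta> k) * V a i))" for k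
  have c: "ip d (V a) (\<delta> k) = V a k" if "k < d" for a k
    using that by (simp add: \<delta>_def ip_delta)
  have res: "ip d (\<rho> k) (\<rho> k) = 1 - (\<Sum>a<d. (V a k)\<^sup>2)" if "k < d" for k
  proof -
    have "ip d (\<delta> k) (\<delta> k) = 1" using that by (simp add: \<delta>_def ip_delta)
    then show ?thesis
      unfolding \<rho>_def orthonormal_residual(1)[OF assms(1), of "\<delta> k"] by (simp add: c[OF that])
  qed
  have "(\<Sum>k<d. ip d (\<rho> k) (\<rho> k)) = real d - (\<Sum>k<d. \<Sum>a<d. (V a k)\<^sup>2)"
    using res by (simp add: sum_subtractf)
  also have "(\<Sum>k<d. \<Sum>a<d. (V a k)\<^sup>2) = (\<Sum>a<d. ip d (V a) (V a))"
    by (subst sum.swap) (simp add: ip_def power2_eq_square)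
  also have "\<dots> = real d" using assms(1) by (simp add: orthonormal_def)
  finally have "(\<Sum>k<d. ip d (\<rho> k) (\<rho> k)) = 0" by simp
  then have "ip d (\<rho> j) (\<rho> j) = 0"
    using assms(3) by (subst (asm) sum_nonneg_eq_0_iff) (auto simp: ip_self_nonneg)
  from ip_self_eq_0[OF this assms(2)] have "\<delta> j i = (\<Sum>a<d. V a j * V a i)"
    by (simp add: \<rho>_def c[OF assms(3)])
  then show ?thesis by (simp add: \<delta>_def mult.commute)
qed

section \<open>The spectral theorem\<close>

text \<open>Vectors are functions on all naturals. Forcing them to vanish from \<open>d\<close> on
  makes the set a closed subset of a product of compact intervals, to which Tychonoff's theorem
  applies.\<close>

lemma compact_unit_sphere_compl:
  "compact {x :: nat \<Rightarrow> real. (\<forall>i\<ge>d. x i = 0) \<and> ip d x x = 1 \<and> (\<forall>a<r. ip d (V a) x = 0)}"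
  (is "compact ?S")
proof -
  define B where "B i = (if i < d then {-1..1} else {0::real})" for i :: nat
  have "compactin (product_topology (\<lambda>_. euclidean) UNIV) (PiE UNIV B)"
    unfolding compactin_PiE by (auto simp: compactin_euclidean_iff B_def)
  then have cp: "compact (PiE UNIV B)"
    by (simp add: euclidean_product_topology compactin_euclidean_iff)
  have cip: "continuous_on UNIV (\<lambda>x. ip d x x)" "continuous_on UNIV (ip d y)" for y
    unfolding ip_def by (intro continuous_intros continuous_on_product_coordinates)+
  have "closed ((\<Inter>i\<in>{d..}. {x. x i = 0}) \<inter> {x. ip d x x = 1} \<inter> (\<Inter>a\<in>{..<r}. {x. ip d (V a) x = 0}))"
    by (intro closed_Int closed_INT ballI closed_Collect_eq cip
        continuous_on_product_coordinates continuous_on_const)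
  also have "(\<Inter>i\<in>{d..}. {x. x i = 0}) \<inter> {x. ip d x x = 1} \<inter> (\<Inter>a\<in>{..<r}. {x. ip d (V a) x = 0}) = ?S"
    by auto
  finally have cl: "closed ?S" .
  have "?S \<subseteq> PiE UNIV B"
  proof (clarsimp simp: B_def PiE_iff)
    fix x :: "nat \<Rightarrow> real" and i assume *: "ip d x x = 1" "i < d"
    have "(x i)\<^sup>2 \<le> ip d x x"
      unfolding ip_def power2_eq_square using *(2) by (intro member_le_sum) auto
    then have "\<bar>x i\<bar> \<le> 1" using * by (simp add: abs_square_le_1)
    then show "- 1 \<le> x i \<and> x i \<le> 1" by linarith
  qed
  then have "PiE UNIV B \<inter> ?S = ?S" by (rule Int_absorb1)
  then show ?thesis using compact_Int_closed[OF cp cl] by argo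
qed

text \<open>The first-order condition at a maximum, without derivatives: for
  \<open>t = b / (\<bar>c\<bar> + 1)\<close> the linear term would beat the quadratic one.\<close>

lemma quadratic_max_zero:
  fixes b c :: real
  assumes "\<And>t. 2 * t * b \<le> t\<^sup>2 * c"
  shows "b = 0"
proof (rule ccontr)
  assume "b \<noteq> 0"
  define t where "t = b / (\<bar>c\<bar> + 1)"
  have "2 * t * b \<le> t\<^sup>2 * (\<bar>c\<bar> + 1)"
    using assms[of t] mult_left_mono[of c "\<bar>c\<bar> + 1" "t\<^sup>2"] by fastforce
  also have "\<dots> = t * (t * (\<bar>c\<bar> + 1))" by (simp add: power2_eq_square)
  also have "t * (\<bar>c\<bar> + 1) = b" unfolding t_def using abs_ge_zero[of c] by auto
  finally have "t * b \<le> 0" by (simp add: mult.commute)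
  moreover have "t * b > 0" using \<open>b \<noteq> 0\<close>
    by (simp add: t_def zero_less_mult_iff zero_less_divide_iff) linarith
  ultimately show False by simp
qed

text \<open>Maximise the Rayleigh quotient on the unit sphere of the orthogonal complement. At a
  maximiser \<open>x\<close> with value \<open>l\<close>, the residual \<open>y = A x - l x\<close>
  stays in the complement, and moving from \<open>x\<close> in direction \<open>y\<close> would
  increase the quotient at a rate of twice the squared norm of \<open>y\<close>; hence
  \<open>y = 0\<close>.\<close>

lemma eigenvector_in_complement:
  assumes sym: "sym_mat d A" and orth: "orthonormal d r V" and r: "r < d"
    and eig: "\<forall>a<r. \<forall>i<d. mv d A (V a) i = \<mu> a * V a i"
  shows "\<exists>x l. ip d x x = 1 \<and> (\<forall>a<r. ip d (V a) x = 0) \<and> (\<forall>i<d. mv d A x i = l * x i)"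
proof -
  define S where "S = {x :: nat \<Rightarrow> real. (\<forall>i\<ge>d. x i = 0) \<and> ip d x x = 1 \<and> (\<forall>a<r. ip d (V a) x = 0)}"
  have norm: "\<exists>c>0. (\<lambda>i. if i < d then c * y i else 0) \<in> S \<and> c\<^sup>2 * ip d y y = 1"
    if "ip d y y \<noteq> 0" "\<And>a. a < r \<Longrightarrow> ip d (V a) y = 0" for y
  proof -
    define c where "c = 1 / sqrt (ip d y y)"
    have pos: "ip d y y > 0" using that(1) ip_self_nonneg[of d y] by linarith
    have c: "c > 0" "c\<^sup>2 * ip d y y = 1" using pos by (auto simp: c_def power_divide)
    have "ip d z (\<lambda>i. if i < d then c * y i else 0) = ip d z (\<lambda>i. c * y i)" for z
      by (rule ip_cong) auto
    moreover have "ip d (\<lambda>i. if i < d then c * y i else 0) z = ip d (\<lambda>i. c * y i) z" for z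
      by (rule ip_cong) auto
    ultimately have "(\<lambda>i. if i < d then c * y i else 0) \<in> S"
      using c that(2) by (simp add: S_def ip_scale_right ip_scale_left power2_eq_square)
    then show ?thesis using c by blast
  qed
  \<comment> \<open>The squared entries of \<open>r\<close> orthonormal vectors add up to
    \<open>r < d\<close>, so some coordinate carries less than 1, and the residual of its unit
    vector is nonzero. Thus the sphere is not empty.\<close>
  have "\<exists>i<d. (\<Sum>a<r. (V a i)\<^sup>2) < 1"
  proof (rule ccontr)
    assume "\<not> ?thesis"
    then have "(\<Sum>i<d. 1) \<le> (\<Sum>i<d. \<Sum>a<r. (V a i)\<^sup>2)" by (intro sum_mono) force
    also have "\<dots> = (\<Sum>a<r. ip d (V a) (V a))"
      by (subst sum.swap) (simp add: ip_def power2_eq_square)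
    also have "\<dots> = real r" using orth by (simp add: orthonormal_def)
    finally show False using r by simp
  qed
  then obtain i0 where i0: "i0 < d" "(\<Sum>a<r. (V a i0)\<^sup>2) < 1" by blast
  define e where "e = (\<lambda>j. of_bool (j = i0) :: real)"
  have "ip d e e - (\<Sum>a<r. (ip d (V a) e)\<^sup>2) \<noteq> 0"
    using i0 by (simp add: e_def ip_delta) 
  then have "S \<noteq> {}"
    using norm[of "\<lambda>i. e i - (\<Sum>a<r. ip d (V a) e * V a i)"] orthonormal_residual[OF orth, where x=e]
    by auto
  moreover have "compact S" unfolding S_def by (rule compact_unit_sphere_compl)
  moreover have "continuous_on S (\<lambda>x. ip d x (mv d A x))"
    unfolding ip_def mv_def
    by (intro continuous_intros continuous_on_subset[OF continuous_on_product_coordinates]) auto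
  ultimately have "\<exists>x\<in>S. \<forall>y\<in>S. ip d y (mv d A y) \<le> ip d x (mv d A x)"
    by - (rule continuous_attains_sup)
  then obtain x where x: "x \<in> S" and
    mx: "\<forall>y\<in>S. ip d y (mv d A y) \<le> ip d x (mv d A x)"
    by (rule bexE)
  define l where "l = ip d x (mv d A x)"
  have le: "ip d y (mv d A y) \<le> l * ip d y y" if "\<And>a. a < r \<Longrightarrow> ip d (V a) y = 0" for y
  proof (cases "ip d y y = 0")
    case True
    then have "ip d y (mv d A y) = 0"
      using ip_self_eq_0[OF True] unfolding ip_def by (intro sum.neutral) simp
    then show ?thesis using True by simp
  next
    case False
    from norm[OF False that] obtain c where c: "c > 0" "(\<lambda>i. if i < d then c * y i else 0) \<in> S"
      "c\<^sup>2 * ip d y y = 1" by blast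
    have m: "mv d A (\<lambda>i. if i < d then c * y i else 0) = (\<lambda>i. c * mv d A y i)"
      by (subst mv_scale[symmetric]) (rule mv_cong, simp)
    have "ip d (\<lambda>i. if i < d then c * y i else 0) z = c * ip d y z" for z
      by (subst ip_scale_left[symmetric]) (rule ip_cong, simp_all)
    then have "c\<^sup>2 * ip d y (mv d A y) \<le> l"
      using bspec[OF mx c(2)] by (simp add: m ip_scale_right l_def power2_eq_square mult.assoc)
    also have "l = c\<^sup>2 * (l * ip d y y)" using c(3) by (simp add: mult.left_commute)
    finally show ?thesis using c(1) by simp
  qed
  have xS: "ip d x x = 1" "\<And>a. a < r \<Longrightarrow> ip d (V a) x = 0" using x by (auto simp: S_def)
  define y where "y = (\<lambda>i. mv d A x i + (- l) * x i)"
  have yV: "ip d (V a) y = 0" if "a < r" for a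
  proof -
    have "ip d (V a) (mv d A x) = ip d (\<lambda>i. \<mu> a * V a i) x"
      unfolding sym_mat_ip[OF sym] using eig that by (intro ip_cong) auto
    then show ?thesis using xS(2)[OF that]
      unfolding y_def ip_add_right ip_scale_right ip_scale_left by simp
  qed
  have "2 * t * ip d y y \<le> t\<^sup>2 * (l * ip d y y - ip d y (mv d A y))" for t
  proof -
    define z where "z = (\<lambda>i. x i + t * y i)"
    have "ip d z (mv d A z) \<le> l * ip d z z"
      by (rule le) (simp add: z_def ip_add_right ip_scale_right yV xS(2))
    moreover have "ip d z (mv d A z) = l + 2 * t * ip d y (mv d A x) + t\<^sup>2 * ip d y (mv d A y)"
      unfolding z_def mv_add mv_scale ip_add_left ip_add_right ip_scale_left ip_scale_right
      using sym_mat_ip[OF sym, of x y] ip_commute[of d "mv d A x" y] l_def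
      by (simp add: algebra_simps power2_eq_square)
    moreover have "ip d z z = 1 + 2 * t * ip d y x + t\<^sup>2 * ip d y y"
      unfolding z_def ip_add_left ip_add_right ip_scale_left ip_scale_right
      using xS(1) ip_commute[of d x y] by (simp add: algebra_simps power2_eq_square)
    moreover have "mv d A x = (\<lambda>i. y i + l * x i)" by (simp add: y_def)
    then have "ip d y (mv d A x) = ip d y y + l * ip d y x"
      by (simp only: ip_add_right ip_scale_right)
    ultimately show ?thesis by (simp add: algebra_simps)
  qed
  from quadratic_max_zero[OF this] have "ip d y y = 0" .
  then have "\<forall>i<d. mv d A x i = l * x i"
    using ip_self_eq_0[of d y] by (simp add: y_def)
  then show ?thesis using xS by (intro exI[of _ x] exI[of _ l]) simp
qed

theorem spectral_theorem:
  assumes sym: "sym_mat d A"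
  obtains V \<mu> where "orthonormal d d V"
    "\<And>i j. i < d \<Longrightarrow> j < d \<Longrightarrow> A i j = (\<Sum>a<d. \<mu> a * V a i * V a j)"
proof -
  have "\<exists>V \<mu>. orthonormal d r V \<and> (\<forall>a<r. \<forall>i<d. mv d A (V a) i = \<mu> a * V a i)" if "r \<le> d" for r
    using that
  proof (induction r)
    case 0
    then show ?case by (simp add: orthonormal_def)
  next
    case (Suc r)
    then obtain V \<mu> where V: "orthonormal d r V" "\<forall>a<r. \<forall>i<d. mv d A (V a) i = \<mu> a * V a i"
      by auto
    have r: "r < d" using Suc.prems by simp
    from eigenvector_in_complement[OF sym V(1) r V(2)]
    obtain x l where x: "ip d x x = 1" "\<forall>a<r. ip d (V a) x = 0" "\<forall>i<d. mv d A x i = l * x i"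
      by (elim exE conjE)
    have "\<forall>a<r. ip d x (V a) = 0" using x(2) ip_commute[of d x] by metis
    then have "orthonormal d (Suc r) (V(r := x))"
      using V(1) x by (auto simp: orthonormal_def less_Suc_eq)
    moreover have "\<forall>a<Suc r. \<forall>i<d. mv d A ((V(r := x)) a) i = (\<mu>(r := l)) a * (V(r := x)) a i"
      using V(2) x(3) by (auto simp: less_Suc_eq)
    ultimately show ?case by blast
  qed
  from this[of d] obtain V \<mu> where V: "orthonormal d d V"
    "\<And>a i. a < d \<Longrightarrow> i < d \<Longrightarrow> mv d A (V a) i = \<mu> a * V a i" by auto
  have "A i j = (\<Sum>a<d. \<mu> a * V a i * V a j)" if ij: "i < d" "j < d" for i j
  proof -
    have "A i j = (\<Sum>k<d. A i k * of_bool (k = j))" using ij by simp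
    also have "\<dots> = (\<Sum>k<d. \<Sum>a<d. A i k * (V a k * V a j))"
      using orthonormal_complete[OF V(1) _ ij(2)] by (simp add: sum_distrib_left[symmetric])
    also have "\<dots> = (\<Sum>a<d. mv d A (V a) i * V a j)"
      by (subst sum.swap) (simp add: mv_def sum_distrib_right mult.assoc)
    finally show ?thesis using V(2) ij by simp
  qed
  then show thesis using that V(1) by blast
qed

section \<open>A trace inequality of Araki, Lieb and Thirring\<close>

definition mmul :: "nat \<Rightarrow> (nat \<Rightarrow> nat \<Rightarrow> real) \<Rightarrow> (nat \<Rightarrow> nat \<Rightarrow> real) \<Rightarrow> nat \<Rightarrow> nat \<Rightarrow> real" where
  "mmul d X Y i j = (\<Sum>k<d. X i k * Y k j)"

definition mtr :: "nat \<Rightarrow> (nat \<Rightarrow> nat \<Rightarrow> real) \<Rightarrow> real" where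
  "mtr d X = (\<Sum>i<d. X i i)"

definition tp :: "(nat \<Rightarrow> nat \<Rightarrow> real) \<Rightarrow> nat \<Rightarrow> nat \<Rightarrow> real" where
  "tp X i j = X j i"

text \<open>Repeated squaring, since the functions \<open>nat \<Rightarrow> nat \<Rightarrow> real\<close> form a semigroup without unit
  under multiplication.\<close>
definition sqn :: "nat \<Rightarrow> nat \<Rightarrow> (nat \<Rightarrow> nat \<Rightarrow> real) \<Rightarrow> nat \<Rightarrow> nat \<Rightarrow> real" where
  "sqn d l = (\<lambda>X. mmul d X X) ^^ l"

lemma mmul_assoc: "mmul d (mmul d X Y) Z = mmul d X (mmul d Y Z)"
proof (intro ext)
  fix i j
  have "mmul d (mmul d X Y) Z i j = (\<Sum>k<d. \<Sum>l<d. X i l * Y l k * Z k j)"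
    by (simp add: mmul_def sum_distrib_right)
  also have "\<dots> = (\<Sum>l<d. \<Sum>k<d. X i l * Y l k * Z k j)" by (rule sum.swap)
  also have "\<dots> = mmul d X (mmul d Y Z) i j"
    by (simp add: mmul_def sum_distrib_left mult.assoc)
  finally show "mmul d (mmul d X Y) Z i j = mmul d X (mmul d Y Z) i j" .
qed

lemma mtr_mmul_commute: "mtr d (mmul d X Y) = mtr d (mmul d Y X)"
  unfolding mtr_def mmul_def by (subst sum.swap) (simp add: mult.commute)

lemma tp_mmul: "tp (mmul d X Y) = mmul d (tp Y) (tp X)"
  by (simp add: tp_def mmul_def fun_eq_iff mult.commute)

lemma tp_tp: "tp (tp X) = X" by (simp add: tp_def fun_eq_iff)

lemma sqn_0: "sqn d 0 X = X" by (simp add: sqn_def)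

lemma sqn_Suc: "sqn d (Suc l) X = mmul d (sqn d l X) (sqn d l X)"
  by (simp add: sqn_def)

lemma sqn_Suc2: "sqn d (Suc l) X = sqn d l (mmul d X X)"
  by (simp add: sqn_def funpow_Suc_right del: funpow.simps)

lemma tp_sqn: "tp X = X \<Longrightarrow> tp (sqn d l X) = sqn d l X"
  by (induction l) (simp_all add: sqn_0 sqn_Suc tp_mmul)

lemma mtr_sqn_commute: "mtr d (sqn d l (mmul d X Y)) = mtr d (sqn d l (mmul d Y X))"
proof (cases l)
  case 0
  then show ?thesis by (simp add: sqn_0 mtr_mmul_commute)
next
  case (Suc m)
  \<comment> \<open>\<open>R\<close> is \<open>(Y X)^(2^(m+1) - 1)\<close>. The induction starts at
    exponent 2, because at exponent 1 it would have to be a unit matrix.\<close>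
  have "\<exists>R. sqn d (Suc m) (mmul d X Y) = mmul d X (mmul d R Y) \<and>
      sqn d (Suc m) (mmul d Y X) = mmul d R (mmul d Y X)"
  proof (induction m)
    case 0
    show ?case by (intro exI[of _ "mmul d Y X"]) (simp add: sqn_Suc sqn_0 mmul_assoc)
  next
    case (Suc m)
    then obtain R where R: "sqn d (Suc m) (mmul d X Y) = mmul d X (mmul d R Y)"
      "sqn d (Suc m) (mmul d Y X) = mmul d R (mmul d Y X)" by auto
    show ?case
      unfolding sqn_Suc[of d "Suc m"] R
      by (intro exI[of _ "mmul d R (mmul d Y (mmul d X R))"]) (simp add: mmul_assoc)
  qed
  then obtain R where R: "sqn d (Suc m) (mmul d X Y) = mmul d X (mmul d R Y)"
      "sqn d (Suc m) (mmul d Y X) = mmul d R (mmul d Y X)" by auto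
  show ?thesis unfolding Suc R by (subst mtr_mmul_commute) (simp add: mmul_assoc)
qed

text \<open>Expand \<open>0 \<le> tr ((X - Y) (X - Y)^T)\<close>.\<close>

lemma mtr_mmul_le:
  "mtr d (mmul d X (tp Y)) \<le> (mtr d (mmul d X (tp X)) + mtr d (mmul d Y (tp Y))) / 2"
proof -
  have "2 * mtr d (mmul d X (tp Y)) = (\<Sum>i<d. \<Sum>k<d. 2 * (X i k * Y i k))"
    by (simp add: mtr_def mmul_def tp_def sum_distrib_left)
  also have "\<dots> \<le> (\<Sum>i<d. \<Sum>k<d. X i k * X i k + Y i k * Y i k)"
  proof (intro sum_mono)
    fix i k
    show "2 * (X i k * Y i k) \<le> X i k * X i k + Y i k * Y i k"
      using zero_le_power2[of "X i k - Y i k"] by (simp add: power2_eq_square algebra_simps)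
  qed
  also have "\<dots> = mtr d (mmul d X (tp X)) + mtr d (mmul d Y (tp Y))"
    by (simp add: mtr_def mmul_def tp_def sum.distrib)
  finally show ?thesis by simp
qed

lemma mtr_mmul_tp: "mtr d (mmul d (tp X) X) = mtr d (mmul d X (tp X))"
  by (rule mtr_mmul_commute)

text \<open>The two halves feed each other. The second, applied to \<open>X = P Q\<close>, leads to
  powers of \<open>P Q Q P\<close>, whose traces are those of powers of \<open>(Q Q) (P P)\<close>;
  there the first half applies to the squares. Conversely, the second half at the next level follows
  from the first, applied to \<open>X X^T\<close> and \<open>X^T X\<close>.\<close>

theorem trace_inequality_pow2:
  "(tp P = P \<longrightarrow> tp Q = Q \<longrightarrow> mtr d (sqn d l (mmul d P Q)) \<le> mtr d (mmul d (sqn d l P) (sqn d l Q))) \<and>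
   mtr d (sqn d (Suc l) X) \<le> mtr d (sqn d l (mmul d X (tp X)))"
proof (induction l arbitrary: P Q X)
  case 0
  have "mtr d (mmul d X X) \<le> mtr d (mmul d X (tp X))"
    using mtr_mmul_le[of d X "tp X"] by (simp add: tp_tp mtr_mmul_tp)
  then show ?case by (simp add: sqn_0 sqn_Suc)
next
  case (Suc l)
  have A: "mtr d (sqn d l (mmul d P Q)) \<le> mtr d (mmul d (sqn d l P) (sqn d l Q))"
    if "tp P = P" "tp Q = Q" for P Q using Suc that by blast
  have H: "mtr d (sqn d (Suc l) X) \<le> mtr d (sqn d l (mmul d X (tp X)))" for X
    using Suc by blast
  have "mtr d (sqn d (Suc l) (mmul d P Q)) \<le> mtr d (mmul d (sqn d (Suc l) P) (sqn d (Suc l) Q))"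
    if sy: "tp P = P" "tp Q = Q"
  proof -
    have "mtr d (sqn d (Suc l) (mmul d P Q)) \<le> mtr d (sqn d l (mmul d P (mmul d Q (mmul d Q P))))"
      using H[of "mmul d P Q"] by (simp add: tp_mmul sy mmul_assoc)
    also have "\<dots> = mtr d (sqn d l (mmul d (mmul d Q Q) (mmul d P P)))"
      by (subst mtr_sqn_commute) (simp add: mmul_assoc)
    also have "\<dots> \<le> mtr d (mmul d (sqn d l (mmul d Q Q)) (sqn d l (mmul d P P)))"
      by (rule A) (simp_all add: tp_mmul sy)
    also have "\<dots> = mtr d (mmul d (sqn d (Suc l) P) (sqn d (Suc l) Q))"
      unfolding sqn_Suc2 by (rule mtr_mmul_commute)
    finally show ?thesis .
  qed
  moreover have "mtr d (sqn d (Suc (Suc l)) X) \<le> mtr d (sqn d (Suc l) (mmul d X (tp X)))"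
  proof -
    define Q where "Q = mmul d X (tp X)"
    define P where "P = mmul d (tp X) X"
    have sy: "tp Q = Q" "tp P = P" by (simp_all add: Q_def P_def tp_mmul tp_tp)
    have "mtr d (sqn d (Suc (Suc l)) X) = mtr d (sqn d (Suc l) (mmul d X X))"
      by (simp only: sqn_Suc2)
    also have "\<dots> \<le> mtr d (sqn d l (mmul d (mmul d X X) (tp (mmul d X X))))" by (rule H)
    also have "\<dots> = mtr d (sqn d l (mmul d X (mmul d X (mmul d (tp X) (tp X)))))"
      by (simp add: tp_mmul mmul_assoc)
    \<comment> \<open>Moving the first factor \<open>X\<close> to the end gives
      \<open>X X^T X^T X = Q P\<close>. Below, passing to the mean of two traces loses nothing at
      the end, since \<open>Q\<close> and \<open>P\<close> have equal power traces.\<close>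
    also have "\<dots> = mtr d (sqn d l (mmul d Q P))"
      by (subst mtr_sqn_commute) (simp add: mmul_assoc Q_def P_def)
    also have "\<dots> \<le> mtr d (mmul d (sqn d l Q) (sqn d l P))" using A sy by blast
    also have "\<dots> \<le> (mtr d (sqn d (Suc l) Q) + mtr d (sqn d (Suc l) P)) / 2"
      using mtr_mmul_le[of d "sqn d l Q" "sqn d l P"] by (simp add: tp_sqn sy sqn_Suc)
    also have "mtr d (sqn d (Suc l) P) = mtr d (sqn d (Suc l) Q)"
      unfolding P_def Q_def by (rule mtr_sqn_commute)
    finally show ?thesis by (simp add: Q_def)
  qed
  ultimately show ?case by blast
qed

section \<open>Spectral calculus\<close>

locale spectral =
  fixes d :: nat and A :: "nat \<Rightarrow> nat \<Rightarrow> real" and V :: "nat \<Rightarrow> nat \<Rightarrow> real" and \<mu> :: "nat \<Rightarrow> real"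
  assumes orth: "orthonormal d d V"
    and dec: "\<And>i j. i < d \<Longrightarrow> j < d \<Longrightarrow> A i j = (\<Sum>a<d. \<mu> a * V a i * V a j)"
begin

text \<open>The diagonal of the matrix \<open>f(A)\<close>. Values of \<open>f\<close> are indexed
  by eigenvectors, not by eigenvalues, so that \<open>f\<close> may also be an approximation such as
  \<open>q\<close> below.\<close>

definition dg :: "(nat \<Rightarrow> real) \<Rightarrow> nat \<Rightarrow> real" where
  "dg f i = (\<Sum>a<d. f a * (V a i)\<^sup>2)"

text \<open>The matrix \<open>f(A)\<close> itself, read by rows.\<close>

definition rw :: "(nat \<Rightarrow> real) \<Rightarrow> nat \<Rightarrow> nat \<Rightarrow> real" where
  "rw f i j = (\<Sum>a<d. f a * V a i * V a j)"

lemma compl: "i < d \<Longrightarrow> j < d \<Longrightarrow> (\<Sum>a<d. V a i * V a j) = of_bool (i = j)"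
  by (rule orthonormal_complete[OF orth])

lemma orthD: "a < d \<Longrightarrow> b < d \<Longrightarrow> (\<Sum>i<d. V a i * V b i) = of_bool (a = b)"
  using orth by (simp add: orthonormal_def ip_def)

lemma sum_V_sq: "a < d \<Longrightarrow> (\<Sum>i<d. (V a i)\<^sup>2) = 1"
  using orthD[of a a] by (simp add: power2_eq_square)

lemma sum_dg: "(\<Sum>i<d. dg f i) = (\<Sum>a<d. f a)"
  unfolding dg_def by (subst sum.swap) (simp add: sum_distrib_left[symmetric] sum_V_sq)

lemma dg_mono: "(\<And>a. a < d \<Longrightarrow> f a \<le> g a) \<Longrightarrow> dg f i \<le> dg g i"
  unfolding dg_def by (intro sum_mono mult_right_mono) auto

lemma dg_scale: "dg (\<lambda>a. c * f a) i = c * dg f i"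
  by (simp add: dg_def sum_distrib_left mult.assoc)

lemma dg_pos:
  assumes "\<And>a. a < d \<Longrightarrow> 0 < f a" "i < d"
  shows "0 < dg f i"
proof -
  have "(\<Sum>a<d. (V a i)\<^sup>2) = 1" using compl[OF assms(2) assms(2)] by (simp add: power2_eq_square)
  then have "\<exists>a<d. V a i \<noteq> 0" using sum.neutral[of "{..<d}" "\<lambda>a. (V a i)\<^sup>2"] by fastforce
  then obtain a where a: "a < d" "V a i \<noteq> 0" by auto
  then have "0 < f a * (V a i)\<^sup>2" using assms(1) by simp
  then show ?thesis unfolding dg_def
    by (intro sum_pos2[where i=a]) (use a assms(1) in \<open>auto simp: less_imp_le\<close>)
qed

lemma expand:
  assumes "i < d" shows "x i = (\<Sum>a<d. ip d (V a) x * V a i)"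
proof -
  have "(\<Sum>a<d. ip d (V a) x * V a i) = (\<Sum>a<d. \<Sum>j<d. V a j * V a i * x j)"
    by (simp add: ip_def sum_distrib_right sum_distrib_left mult.commute mult.left_commute)
  also have "\<dots> = (\<Sum>j<d. (\<Sum>a<d. V a j * V a i) * x j)"
    by (subst sum.swap) (simp add: sum_distrib_right)
  also have "\<dots> = (\<Sum>j<d. of_bool (j = i) * x j)"
    using compl assms by (intro sum.cong) auto
  also have "\<dots> = x i" using assms by simp
  finally show ?thesis by simp
qed

lemma parseval: "ip d x y = (\<Sum>a<d. ip d (V a) x * ip d (V a) y)"
proof -
  have "ip d x y = (\<Sum>i<d. (\<Sum>a<d. ip d (V a) x * V a i) * y i)"
    unfolding ip_def[of d x y] using expand[of _ x] by (intro sum.cong) auto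
  also have "\<dots> = (\<Sum>a<d. \<Sum>i<d. ip d (V a) x * (V a i * y i))"
    by (subst sum.swap) (simp add: sum_distrib_right mult.assoc)
  finally show ?thesis by (simp add: ip_def[of d _ y] sum_distrib_left)
qed

lemma parseval_self: "ip d x x = (\<Sum>a<d. (ip d (V a) x)\<^sup>2)"
  using parseval[of x x] by (simp add: power2_eq_square)

lemma coeff_combination:
  assumes "a < d" "\<And>i. i < d \<Longrightarrow> x i = (\<Sum>b<d. c b * V b i)"
  shows "ip d (V a) x = c a"
proof -
  have "ip d (V a) x = (\<Sum>i<d. \<Sum>b<d. c b * (V a i * V b i))"
    unfolding ip_def using assms(2) by (intro sum.cong) (simp_all add: sum_distrib_left mult.left_commute)
  also have "\<dots> = (\<Sum>b<d. c b * of_bool (a = b))"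
    by (subst sum.swap) (simp add: sum_distrib_left[symmetric] orthD[OF assms(1)])
  also have "\<dots> = c a" using assms(1) by simp
  finally show ?thesis .
qed

lemma coeff_mv: "a < d \<Longrightarrow> ip d (V a) (mv d A x) = \<mu> a * ip d (V a) x"
proof (rule coeff_combination, assumption)
  fix i assume i: "i < d"
  have "mv d A x i = (\<Sum>j<d. \<Sum>b<d. \<mu> b * V b i * (V b j * x j))"
    unfolding mv_def using dec[OF i] by (intro sum.cong) (simp_all add: sum_distrib_right mult.assoc)
  also have "\<dots> = (\<Sum>b<d. \<mu> b * V b i * ip d (V b) x)"
    by (subst sum.swap) (simp add: ip_def sum_distrib_left)
  finally show "mv d A x i = (\<Sum>b<d. \<mu> b * ip d (V b) x * V b i)"
    by (simp add: mult.commute mult.left_commute)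
qed

lemma coeff_mv_funpow: "a < d \<Longrightarrow> ip d (V a) ((mv d A ^^ n) x) = \<mu> a ^ n * ip d (V a) x"
  by (induction n) (simp_all add: coeff_mv)

lemma quad: "ip d x (mv d A x) = (\<Sum>a<d. \<mu> a * (ip d (V a) x)\<^sup>2)"
  unfolding parseval[of x "mv d A x"] by (intro sum.cong) (simp_all add: coeff_mv power2_eq_square)

text \<open>Identifies an operator by its action on the eigencoordinates alone. Iterated
  multiplication and Richardson iteration are recognised as functions of \<open>A\<close> in this
  way.\<close>

lemma coord_rw:
  assumes "\<And>a. a < d \<Longrightarrow> ip d (V a) y = f a * ip d (V a) x" "i < d"
  shows "y i = ip d (rw f i) x"
proof -
  have "y i = (\<Sum>a<d. f a * ip d (V a) x * V a i)"
    unfolding expand[OF assms(2), of y] using assms(1) by simp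
  also have "\<dots> = (\<Sum>a<d. \<Sum>j<d. f a * V a i * V a j * x j)"
    by (simp add: ip_def sum_distrib_left sum_distrib_right mult.commute mult.left_commute)
  also have "\<dots> = ip d (rw f i) x"
    by (subst sum.swap) (simp add: ip_def rw_def sum_distrib_right)
  finally show ?thesis .
qed

lemma rw_norm:
  assumes "i < d"
  shows "ip d (rw f i) (rw f i) = dg (\<lambda>a. (f a)\<^sup>2) i"
proof -
  have "ip d (V a) (rw f i) = f a * V a i" if "a < d" for a
    by (rule coeff_combination[OF that]) (simp add: rw_def)
  then show ?thesis unfolding parseval_self dg_def by (simp add: power_mult_distrib)
qed

lemma eig_le:
  assumes "\<And>x. ip d x (mv d A x) \<le> h * ip d x x" "a < d"
  shows "\<mu> a \<le> h"
proof -
  have c: "ip d (V b) (V a) = of_bool (b = a)" if "b < d" for b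
    using orthD[OF that assms(2)] by (simp add: ip_def)
  have "ip d (V a) (mv d A (V a)) = (\<Sum>b<d. \<mu> b * of_bool (b = a))"
    unfolding quad by (intro sum.cong) (simp_all add: c)
  then have "ip d (V a) (mv d A (V a)) = \<mu> a" using assms(2) by simp
  then show ?thesis using assms(1)[of "V a"] c[OF assms(2)] by simp
qed

lemma eig_ge:
  assumes "\<And>x. h * ip d x x \<le> ip d x (mv d A x)" "a < d"
  shows "h \<le> \<mu> a"
proof -
  have c: "ip d (V b) (V a) = of_bool (b = a)" if "b < d" for b
    using orthD[OF that assms(2)] by (simp add: ip_def)
  have "ip d (V a) (mv d A (V a)) = (\<Sum>b<d. \<mu> b * of_bool (b = a))"
    unfolding quad by (intro sum.cong) (simp_all add: c)
  then have "ip d (V a) (mv d A (V a)) = \<mu> a" using assms(2) by simp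
  then show ?thesis using assms(1)[of "V a"] c[OF assms(2)] by simp
qed

lemma quad_le: "(\<And>a. a < d \<Longrightarrow> \<mu> a \<le> h) \<Longrightarrow> ip d x (mv d A x) \<le> h * ip d x x"
  unfolding quad parseval_self[of x] sum_distrib_left by (intro sum_mono mult_right_mono) auto

lemma quad_ge: "(\<And>a. a < d \<Longrightarrow> h \<le> \<mu> a) \<Longrightarrow> h * ip d x x \<le> ip d x (mv d A x)"
  unfolding quad parseval_self[of x] sum_distrib_left by (intro sum_mono mult_right_mono) auto

lemma sqn_spectral:
  "i < d \<Longrightarrow> j < d \<Longrightarrow> sqn d l A i j = (\<Sum>a<d. \<mu> a ^ (2 ^ l) * V a i * V a j)"
proof (induction l arbitrary: i j)
  case 0
  then show ?case using dec by (simp add: sqn_0)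
next
  case (Suc l)
  have "sqn d (Suc l) A i j = (\<Sum>k<d. \<Sum>a<d. \<Sum>b<d.
      (\<mu> a ^ (2 ^ l) * \<mu> b ^ (2 ^ l) * V a i * V b j) * (V a k * V b k))"
    unfolding sqn_Suc mmul_def using Suc
    by (intro sum.cong refl) (simp add: sum_product algebra_simps)
  also have "\<dots> = (\<Sum>a<d. \<Sum>k<d. \<Sum>b<d.
      (\<mu> a ^ (2 ^ l) * \<mu> b ^ (2 ^ l) * V a i * V b j) * (V a k * V b k))"
    by (rule sum.swap)
  also have "\<dots> = (\<Sum>a<d. \<Sum>b<d. \<Sum>k<d.
      (\<mu> a ^ (2 ^ l) * \<mu> b ^ (2 ^ l) * V a i * V b j) * (V a k * V b k))"
    by (rule sum.cong, rule refl, rule sum.swap)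
  also have "\<dots> = (\<Sum>a<d. \<Sum>b<d. (\<mu> a ^ (2 ^ l) * \<mu> b ^ (2 ^ l) * V a i * V b j) * of_bool (a = b))"
    using orthD by (intro sum.cong refl) (simp add: sum_distrib_left[symmetric])
  also have "\<dots> = (\<Sum>a<d. \<mu> a ^ (2 ^ l) * \<mu> a ^ (2 ^ l) * V a i * V a j)"
    by (intro sum.cong refl) simp
  finally show ?case by (simp add: power_add[symmetric] mult_2)
qed

lemma mtr_sqn: "mtr d (sqn d l A) = (\<Sum>a<d. \<mu> a ^ (2 ^ l))"
proof -
  have "mtr d (sqn d l A) = (\<Sum>i<d. dg (\<lambda>a. \<mu> a ^ (2 ^ l)) i)"
    unfolding mtr_def dg_def
    by (intro sum.cong refl) (simp add: sqn_spectral power2_eq_square mult.assoc)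
  then show ?thesis by (simp only: sum_dg)
qed

end

lemma mtr_cong: "(\<And>i. i < d \<Longrightarrow> X i i = Y i i) \<Longrightarrow> mtr d X = mtr d Y"
  by (simp add: mtr_def)

lemma mmul_cong:
  "(\<And>i j. i < d \<Longrightarrow> j < d \<Longrightarrow> X i j = X' i j) \<Longrightarrow> (\<And>i j. i < d \<Longrightarrow> j < d \<Longrightarrow> Y i j = Y' i j) \<Longrightarrow>
   i < d \<Longrightarrow> j < d \<Longrightarrow> mmul d X Y i j = mmul d X' Y' i j"
  unfolding mmul_def by (intro sum.cong refl) simp

lemma sqn_cong:
  assumes "\<And>i j. i < d \<Longrightarrow> j < d \<Longrightarrow> X i j = X' i j"
  shows "i < d \<Longrightarrow> j < d \<Longrightarrow> sqn d l X i j = sqn d l X' i j"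
proof (induction l arbitrary: i j)
  case 0
  then show ?case using assms by (simp add: sqn_0)
next
  case (Suc l)
  then show ?case unfolding sqn_Suc by (intro mmul_cong) auto
qed

text \<open>With \<open>C = diag c\<close>, cyclicity turns \<open>tr (C A C)^p\<close> into
  \<open>tr (A C C)^p\<close>, and the trace inequality bounds this by
  \<open>tr (A^p C^(2p))\<close>, which sees only the diagonal of \<open>A^p\<close>. The effect of
  a scaling on the potential is thereby reduced to a weighted sum.\<close>

theorem trace_power_diag_scaling:
  assumes "spectral d A V \<mu>" "spectral d A' V' \<mu>'"
    and sc: "\<And>i j. i < d \<Longrightarrow> j < d \<Longrightarrow> A' i j = c i * A i j * c j"
  shows "(\<Sum>a<d. \<mu>' a ^ (2 ^ l)) \<le> (\<Sum>i<d. spectral.dg d V (\<lambda>a. \<mu> a ^ (2 ^ l)) i * (c i)\<^sup>2 ^ (2 ^ l))"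
proof -
  interpret A: spectral d A V \<mu> by fact
  interpret A': spectral d A' V' \<mu>' by fact
  \<comment> \<open>\<open>A\<close> is specified only below \<open>d\<close>; padding with zeros
    makes symmetry an equation between functions, as the trace inequality demands.\<close>
  define A0 where "A0 i j = (if i < d \<and> j < d then A i j else 0)" for i j
  define C where "C x i j = (if i = j then x i else 0 :: real)" for x :: "nat \<Rightarrow> real" and i j :: nat
  have tpC: "tp (C x) = C x" for x by (simp add: C_def tp_def fun_eq_iff)
  have tpA: "tp A0 = A0"
    by (auto simp: A0_def tp_def fun_eq_iff A.dec mult.commute mult.left_commute intro!: sum.cong)
  have CC: "mmul d (C x) (C y) i j = C (\<lambda>i. x i * y i) i j" if "i < d" "j < d" for x y i j
    using that by (simp add: mmul_def C_def if_distrib[of "\<lambda>u. u * _"] cong: if_cong)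
  have AC: "mmul d A0 (C x) i j = A0 i j * x j" if "i < d" "j < d" for i j x
    using that by (simp add: mmul_def C_def if_distrib[of "\<lambda>u. _ * u"] cong: if_cong)
  have sC: "sqn d l (C x) i j = C (\<lambda>i. x i ^ (2 ^ l)) i j" if "i < d" "j < d" for l x i j
    using that
  proof (induction l arbitrary: i j)
    case 0
    then show ?case by (simp add: sqn_0)
  next
    case (Suc l)
    then have "sqn d (Suc l) (C x) i j = mmul d (C (\<lambda>i. x i ^ (2 ^ l))) (C (\<lambda>i. x i ^ (2 ^ l))) i j"
      unfolding sqn_Suc by (intro mmul_cong) auto
    then show ?case using Suc.prems by (simp add: CC power_add[symmetric] mult_2)
  qed
  have "(\<Sum>a<d. \<mu>' a ^ (2 ^ l)) = mtr d (sqn d l (mmul d (C c) (mmul d A0 (C c))))"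
    unfolding A'.mtr_sqn[symmetric]
  proof (intro mtr_cong sqn_cong)
    fix i j assume ij: "i < d" "j < d"
    have "mmul d (C c) (mmul d A0 (C c)) i j = (\<Sum>k<d. C c i k * (A0 k j * c j))"
      unfolding mmul_def[of d "C c"] using ij AC by simp
    also have "\<dots> = c i * (A0 i j * c j)"
      using ij by (simp add: C_def if_distrib[of "\<lambda>u. u * _"] cong: if_cong)
    finally show "A' i j = mmul d (C c) (mmul d A0 (C c)) i j"
      using ij sc by (simp add: A0_def)
  qed
  also have "\<dots> = mtr d (sqn d l (mmul d A0 (mmul d (C c) (C c))))"
    by (subst mtr_sqn_commute) (simp add: mmul_assoc)
  also have "\<dots> \<le> mtr d (mmul d (sqn d l A0) (sqn d l (mmul d (C c) (C c))))"
    using trace_inequality_pow2[of A0 "mmul d (C c) (C c)"] by (simp add: tpA tp_mmul tpC)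
  also have "\<dots> = mtr d (mmul d (sqn d l A) (C (\<lambda>i. (c i)\<^sup>2 ^ (2 ^ l))))"
  proof (intro mtr_cong mmul_cong)
    fix i j assume "i < d" "j < d"
    then show "sqn d l A0 i j = sqn d l A i j"
      by (intro sqn_cong) (auto simp: A0_def)
    have "sqn d l (mmul d (C c) (C c)) i j = sqn d l (C (\<lambda>i. (c i)\<^sup>2)) i j"
      using \<open>i < d\<close> \<open>j < d\<close> by (intro sqn_cong) (auto simp: CC power2_eq_square)
    then show "sqn d l (mmul d (C c) (C c)) i j = C (\<lambda>i. (c i)\<^sup>2 ^ (2 ^ l)) i j"
      using sC \<open>i < d\<close> \<open>j < d\<close> by simp
  qed auto
  also have "\<dots> = (\<Sum>i<d. A.dg (\<lambda>a. \<mu> a ^ (2 ^ l)) i * (c i)\<^sup>2 ^ (2 ^ l))"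
  proof -
    have "mmul d (sqn d l A) (C (\<lambda>i. (c i)\<^sup>2 ^ (2 ^ l))) i i
        = A.dg (\<lambda>a. \<mu> a ^ (2 ^ l)) i * (c i)\<^sup>2 ^ (2 ^ l)" if "i < d" for i
      using that by (simp add: mmul_def C_def if_distrib[of "\<lambda>u. _ * u"] A.sqn_spectral A.dg_def
          power2_eq_square mult.assoc cong: if_cong)
    then show ?thesis by (simp add: mtr_def)
  qed
  finally show ?thesis .
qed

lemma spectral_exists:
  assumes "sym_mat d A"
  obtains V \<mu> where "spectral d A V \<mu>"
  by (rule spectral_theorem[OF assms]) (rule that[OF spectral.intro])

section \<open>Inequalities behind the eigenvalue estimates, the contraction and the lower
  bound\<close>

section \<open>Scalar inequalities\<close>

text \<open>Log-convexity of moments in the exponent: each term in the middle is the geometric mean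
  of its two neighbours.\<close>

lemma Cauchy_Schwarz_moments:
  fixes l c :: "'a \<Rightarrow> real"
  assumes "\<And>a. a \<in> I \<Longrightarrow> 0 \<le> l a" "\<And>a. a \<in> I \<Longrightarrow> 0 \<le> c a"
  shows "(\<Sum>a\<in>I. l a ^ Suc k * c a)\<^sup>2 \<le> (\<Sum>a\<in>I. l a ^ k * c a) * (\<Sum>a\<in>I. l a ^ Suc (Suc k) * c a)"
proof -
  have "(\<Sum>a\<in>I. l a ^ Suc k * c a) = (\<Sum>a\<in>I. sqrt (l a ^ k * c a) * sqrt (l a ^ Suc (Suc k) * c a))"
  proof (intro sum.cong refl)
    fix a assume "a \<in> I"
    then have nn: "0 \<le> l a" "0 \<le> c a" using assms by auto
    have "sqrt (l a ^ k * c a) * sqrt (l a ^ Suc (Suc k) * c a) = sqrt ((l a ^ Suc k * c a)\<^sup>2)"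
      by (simp add: real_sqrt_mult[symmetric] power2_eq_square algebra_simps)
    then show "l a ^ Suc k * c a = sqrt (l a ^ k * c a) * sqrt (l a ^ Suc (Suc k) * c a)"
      using nn by simp
  qed
  also have "\<dots>\<^sup>2 \<le> (\<Sum>a\<in>I. (sqrt (l a ^ k * c a))\<^sup>2) * (\<Sum>a\<in>I. (sqrt (l a ^ Suc (Suc k) * c a))\<^sup>2)"
    by (rule Cauchy_Schwarz_ineq_sum)
  also have "\<dots> = (\<Sum>a\<in>I. l a ^ k * c a) * (\<Sum>a\<in>I. l a ^ Suc (Suc k) * c a)"
    using assms by (intro arg_cong2[where f="(*)"] sum.cong refl) auto
  finally show ?thesis .
qed

text \<open>By log-convexity the ratios of consecutive moments increase with the exponent, so a
  bound for the last ratio holds for all earlier ones, and their product telescopes. This turns the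
  quotient of two adjacent moments, which the program can measure, into a bound for one high
  moment.\<close>

lemma moment_le_ratio_power:
  fixes l c :: "'a \<Rightarrow> real"
  assumes nn: "\<And>a. a \<in> I \<Longrightarrow> 0 \<le> l a" "\<And>a. a \<in> I \<Longrightarrow> 0 \<le> c a"
    and \<theta>: "0 \<le> \<theta>" "(\<Sum>a\<in>I. l a ^ Suc p * c a) \<le> \<theta> * (\<Sum>a\<in>I. l a ^ p * c a)"
  shows "(\<Sum>a\<in>I. l a ^ Suc p * c a) \<le> \<theta> ^ Suc p * (\<Sum>a\<in>I. c a)"
proof -
  define M where "M k = (\<Sum>a\<in>I. l a ^ k * c a)" for k
  have M0: "0 \<le> M k" for k unfolding M_def using nn by (intro sum_nonneg) simp
  have step: "M (Suc k) \<le> \<theta> * M k" if "M (Suc (Suc k)) \<le> \<theta> * M (Suc k)" for k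
  proof (cases "M (Suc k) = 0")
    case True
    then show ?thesis using M0[of k] \<theta>(1) by simp
  next
    case False
    then have pos: "0 < M (Suc k)" using M0[of "Suc k"] by linarith
    have "M (Suc k) * M (Suc k) \<le> M k * M (Suc (Suc k))"
      using Cauchy_Schwarz_moments[of I l c k] nn by (simp add: M_def power2_eq_square)
    also have "\<dots> \<le> M k * (\<theta> * M (Suc k))" by (intro mult_left_mono that M0)
    finally show ?thesis using pos by (simp add: mult.left_commute)
  qed
  have down: "M (Suc (p - j)) \<le> \<theta> * M (p - j)" if "j \<le> p" for j
    using that
  proof (induction j)
    case 0
    then show ?case using \<theta>(2) by (simp add: M_def)
  next
    case (Suc j)
    then have "Suc (p - Suc j) = p - j" by simp
    then show ?case using step[of "p - Suc j"] Suc by simp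
  qed
  have "M k \<le> \<theta> ^ k * M 0" if "k \<le> Suc p" for k
    using that
  proof (induction k)
    case (Suc k)
    have "M (Suc k) \<le> \<theta> * M k" using down[of "p - k"] Suc.prems by simp
    also have "\<dots> \<le> \<theta> * (\<theta> ^ k * M 0)" using Suc \<theta>(1) by (intro mult_left_mono) auto
    finally show ?case by simp
  qed simp
  from this[of "Suc p"] show ?thesis by (simp add: M_def)
qed

text \<open>The first-order gain \<open>\<gamma> (x - y)\<close> outweighs the second-order loss \<open>\<gamma>\<^sup>2\<close> for \<open>\<gamma> = \<rho> / 2\<close>.\<close>
lemma potential_contraction:
  fixes x y c \<rho> :: real
  assumes x: "0 \<le> x" "x \<le> 1" and y: "0 \<le> y" "y \<le> 1" and "\<rho> \<le> y - x" "0 \<le> \<rho>"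
    and c: "0 < c" "c\<^sup>2 = 1 + \<rho> / 2"
  shows "(x * c + (1 - x) / c) * (y / c + (1 - y) * c) \<le> 1 - \<rho>\<^sup>2 / 4"
proof -
  define \<gamma> where "\<gamma> = \<rho> / 2"
  have g: "0 \<le> \<gamma>" "c\<^sup>2 = 1 + \<gamma>" using assms by (auto simp: \<gamma>_def)
  have "(x * c + (1 - x) / c) * (y / c + (1 - y) * c)
      = x * y + (1 - x) * (1 - y) + x * (1 - y) * c\<^sup>2 + (1 - x) * y * (1 / c\<^sup>2)"
    using c(1) by (simp add: field_simps power2_eq_square)
  also have "\<dots> \<le> x * y + (1 - x) * (1 - y) + x * (1 - y) * (1 + \<gamma>) + (1 - x) * y * (1 - \<gamma> + \<gamma>\<^sup>2)"
  proof -
    have "(1 - \<gamma> + \<gamma>\<^sup>2) * (1 + \<gamma>) = 1 + \<gamma> ^ 3" by (simp add: algebra_simps power2_eq_square power3_eq_cube)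
    then have "1 / c\<^sup>2 \<le> 1 - \<gamma> + \<gamma>\<^sup>2" using g by (simp add: divide_le_eq)
    then have "(1 - x) * y * (1 / c\<^sup>2) \<le> (1 - x) * y * (1 - \<gamma> + \<gamma>\<^sup>2)"
      using x y by (intro mult_left_mono) auto
    then show ?thesis using g by simp
  qed
  also have "\<dots> = 1 + \<gamma> * (x - y) + \<gamma>\<^sup>2 * ((1 - x) * y)" by (simp add: algebra_simps)
  also have "\<dots> \<le> 1 + \<gamma> * (- \<rho>) + \<gamma>\<^sup>2 * 1"
  proof (intro add_mono mult_left_mono)
    show "(1 - x) * y \<le> 1" using x y by (intro mult_le_one) auto
  qed (use assms g in auto)
  also have "\<dots> = 1 - \<rho>\<^sup>2 / 4" by (simp add: \<gamma>_def power2_eq_square)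
  finally show ?thesis .
qed

text \<open>If the normalised \<open>P\<close> and \<open>S\<close> were equal, this would be the
  Cauchy-Schwarz inequality for \<open>sqrt (h P)\<close> and \<open>sqrt (P / h)\<close>. In
  general that inequality is applied to their pointwise minimum, whose total mass is 1 minus half of
  their distance.\<close>

lemma affinity_lower_bound:
  fixes P S h :: "'a \<Rightarrow> real"
  assumes fin: "finite I" and nn: "\<And>i. i \<in> I \<Longrightarrow> 0 \<le> P i" "\<And>i. i \<in> I \<Longrightarrow> 0 \<le> S i" "\<And>i. i \<in> I \<Longrightarrow> 0 < h i"
    and pos: "sum P I > 0" "sum S I > 0"
    and dist: "(\<Sum>i\<in>I. \<bar>P i / sum P I - S i / sum S I\<bar>) \<le> e" "e \<le> 2"
  shows "(1 - e / 2)\<^sup>2 * (sum P I * sum S I) \<le> (\<Sum>i\<in>I. h i * P i) * (\<Sum>i\<in>I. S i / h i)"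
proof -
  define p where "p i = P i / sum P I" for i
  define s where "s i = S i / sum S I" for i
  define m where "m i = min (p i) (s i)" for i
  have m0: "0 \<le> m i" if "i \<in> I" for i using nn that pos by (simp add: m_def p_def s_def less_imp_le)
  have sp: "sum p I = 1" "sum s I = 1" using pos by (simp_all add: p_def s_def sum_divide_distrib[symmetric])
  have "(\<Sum>i\<in>I. m i) = (\<Sum>i\<in>I. (p i + s i - \<bar>p i - s i\<bar>) / 2)"
    by (intro sum.cong) (auto simp: m_def min_def abs_if)
  also have "\<dots> = (sum p I + sum s I - (\<Sum>i\<in>I. \<bar>p i - s i\<bar>)) / 2"
    by (simp add: sum_divide_distrib[symmetric] sum.distrib sum_subtractf)
  finally have "1 - e / 2 \<le> sum m I" using dist(1) sp by (simp add: p_def s_def)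
  then have "(1 - e / 2)\<^sup>2 \<le> (sum m I)\<^sup>2" using dist(2) by (intro power_mono) auto
  also have "sum m I = (\<Sum>i\<in>I. sqrt (h i * m i) * sqrt (m i / h i))"
  proof (intro sum.cong refl)
    fix i assume i: "i \<in> I"
    have "h i * m i * (m i / h i) = (m i)\<^sup>2" using nn(3)[OF i] by (simp add: power2_eq_square)
    then show "m i = sqrt (h i * m i) * sqrt (m i / h i)"
      using m0[OF i] by (simp add: real_sqrt_mult[symmetric])
  qed
  also have "\<dots>\<^sup>2 \<le> (\<Sum>i\<in>I. (sqrt (h i * m i))\<^sup>2) * (\<Sum>i\<in>I. (sqrt (m i / h i))\<^sup>2)"
    by (rule Cauchy_Schwarz_ineq_sum)
  also have "\<dots> = (\<Sum>i\<in>I. h i * m i) * (\<Sum>i\<in>I. m i / h i)"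
    using m0 nn(3) by (intro arg_cong2[where f="(*)"] sum.cong refl) (auto simp: less_imp_le)
  also have "\<dots> \<le> (\<Sum>i\<in>I. h i * p i) * (\<Sum>i\<in>I. s i / h i)"
    using m0 nn(3) by (intro mult_mono sum_mono sum_nonneg mult_left_mono divide_right_mono)
      (auto simp: m_def less_imp_le p_def nn(1) pos zero_le_divide_iff intro!: mult_nonneg_nonneg)
  also have "(\<Sum>i\<in>I. h i * p i) = (\<Sum>i\<in>I. h i * P i) / sum P I"
    by (simp add: p_def sum_divide_distrib)
  also have "(\<Sum>i\<in>I. s i / h i) = (\<Sum>i\<in>I. S i / h i) / sum S I"
    by (simp add: s_def sum_divide_distrib mult.commute)
  finally show ?thesis using pos by (simp add: field_simps)
qed

text \<open>Expand \<open>0 \<le> \<langle>y - t x, N (y - t x)\<rangle>\<close> for \<open>x = h N y\<close> and \<open>t = 1 / H\<close>.\<close>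
lemma weighted_image_bound:
  assumes sym: "sym_mat d N" and psd: "\<And>x. 0 \<le> ip d x (mv d N x)"
    and h: "\<And>i. i < d \<Longrightarrow> 0 < h i" and H: "0 < H"
    and le: "\<And>x. ip d x (mv d N x) \<le> H * (\<Sum>i<d. (x i)\<^sup>2 / h i)"
  shows "(\<Sum>i<d. h i * (mv d N y i)\<^sup>2) \<le> H * ip d y (mv d N y)"
proof -
  define q where "q = (\<Sum>i<d. h i * (mv d N y i)\<^sup>2)"
  define x where "x i = h i * mv d N y i" for i
  define t where "t = - (1 / H)"
  have xq: "(\<Sum>i<d. (x i)\<^sup>2 / h i) = q"
    unfolding q_def x_def using h by (intro sum.cong) (auto simp: power2_eq_square field_simps less_imp_neq[symmetric])
  have xNy: "ip d x (mv d N y) = q" by (simp add: q_def ip_def x_def power2_eq_square mult.assoc)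
  have "0 \<le> ip d (\<lambda>i. y i + t * x i) (mv d N (\<lambda>i. y i + t * x i))" by (rule psd)
  also have "\<dots> = ip d y (mv d N y) + 2 * t * q + t\<^sup>2 * ip d x (mv d N x)"
    unfolding mv_add mv_scale ip_add_left ip_add_right ip_scale_left ip_scale_right
    using sym_mat_ip[OF sym, of y x] ip_commute[of d "mv d N y" x] xNy
    by (simp add: algebra_simps power2_eq_square)
  also have "\<dots> \<le> ip d y (mv d N y) + 2 * t * q + t\<^sup>2 * (H * q)"
    using le[of x] xq by (intro add_left_mono mult_left_mono) auto
  also have "\<dots> = ip d y (mv d N y) - q / H"
    using H by (simp add: t_def power2_eq_square field_simps)
  finally show ?thesis using H by (simp add: q_def field_simps)
qed

text \<open>A quotient of two sums with relative errors \<open>2 t\<close> has a relative error of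
  about \<open>4 t\<close>, which is also an absolute one as the quotient is at most 1. The bound
  \<open>5 t\<close> absorbs the second-order terms as long as
  \<open>t \<le> 1 / 40\<close>.\<close>

lemma normalized_estimate:
  fixes a P :: "'a \<Rightarrow> real"
  assumes fin: "finite I" and a: "\<And>i. i \<in> I \<Longrightarrow> 0 \<le> a i" "0 < sum a I" and k: "0 < k"
    and t: "0 \<le> t" "t \<le> 1 / 40"
    and est: "\<And>i. i \<in> I \<Longrightarrow> (1 - 2 * t) * (k * a i) \<le> P i" "\<And>i. i \<in> I \<Longrightarrow> P i \<le> (1 + 2 * t) * (k * a i)"
    and X: "X \<subseteq> I"
  shows "\<bar>sum P X / sum P I - sum a X / sum a I\<bar> \<le> 5 * t"
proof -
  have lo: "(1 - 2 * t) * (k * sum a J) \<le> sum P J" and hi: "sum P J \<le> (1 + 2 * t) * (k * sum a J)"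
    if "J \<subseteq> I" for J
    unfolding sum_distrib_left using est that by (auto intro!: sum_mono)
  have aX: "0 \<le> sum a X" "sum a X \<le> sum a I"
    using a(1) X fin by (auto intro!: sum_nonneg sum_mono2)
  have PI: "0 < sum P I"
    using lo[of I] t a(2) k by (intro less_le_trans[OF _ lo[of I]]) (auto intro!: mult_pos_pos)
  define r where "r = sum a X / sum a I"
  have r: "0 \<le> r" "r \<le> 1" using aX a(2) by (auto simp: r_def)
  have rX: "sum a X = r * sum a I" using a(2) by (simp add: r_def)
  define A where "A = k * sum a I"
  have A: "0 < A" using k a(2) by (simp add: A_def)
  have b: "(1 - 2 * t) * A \<le> sum P I" "sum P I \<le> (1 + 2 * t) * A"
    "(1 - 2 * t) * (r * A) \<le> sum P X" "sum P X \<le> (1 + 2 * t) * (r * A)"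
    using lo[of I] hi[of I] lo[OF X] hi[OF X] by (simp_all add: A_def rX mult.left_commute mult.assoc)
  have "sum P X \<le> (r + 5 * t) * sum P I"
  proof -
    have "(1 + 2 * t) * r \<le> (r + 5 * t) * (1 - 2 * t)"
    proof -
      have "4 * t * r \<le> 4 * t * 1" using r t by (intro mult_left_mono) auto
      moreover have "10 * t * t \<le> 10 * t * (1 / 40)" using t by (intro mult_left_mono) auto
      ultimately have "4 * t * r + 10 * t * t \<le> 5 * t" using t by simp
      then show ?thesis by (simp add: algebra_simps)
    qed
    then have "(1 + 2 * t) * r * A \<le> (r + 5 * t) * (1 - 2 * t) * A" using A by (intro mult_right_mono) auto
    also have "\<dots> \<le> (r + 5 * t) * sum P I"
      unfolding mult.assoc using r t b(1) by (intro mult_left_mono) auto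
    finally show ?thesis using b(4) by (simp add: mult.assoc)
  qed
  moreover have "(r - 5 * t) * sum P I \<le> sum P X"
  proof (cases "r \<le> 5 * t")
    case True
    then have "(r - 5 * t) * sum P I \<le> 0" using PI by (simp add: mult_nonpos_nonneg)
    also have "0 \<le> (1 - 2 * t) * (r * A)" using t r A by simp
    finally show ?thesis using b(3) by linarith
  next
    case False
    have "(r - 5 * t) * (1 + 2 * t) \<le> (1 - 2 * t) * r"
    proof -
      have "4 * t * r \<le> 4 * t * 1" using r t by (intro mult_left_mono) auto
      moreover have "0 \<le> 10 * t * t" using t by simp
      ultimately have "4 * t * r \<le> 5 * t + 10 * t * t" using t by linarith
      then show ?thesis by (simp add: algebra_simps)
    qed
    then have "(r - 5 * t) * (1 + 2 * t) * A \<le> (1 - 2 * t) * r * A" using A by (intro mult_right_mono) auto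
    moreover have "(r - 5 * t) * sum P I \<le> (r - 5 * t) * ((1 + 2 * t) * A)"
      using False b(2) by (intro mult_left_mono) auto
    ultimately show ?thesis using b(3) by (simp add: mult.assoc)
  qed
  ultimately show ?thesis
    using PI by (simp add: r_def[symmetric] abs_le_iff field_simps)
qed

section \<open>Probability over finitely many coins: independence, stopping times,
  concentration\<close>

section \<open>Averages over coin flips\<close>

text \<open>Expectation over the first \<open>n\<close> coins with all later ones set to
  \<open>False\<close>. Peeling off the first coin makes independence and stopping arguments plain
  inductions; measure theory enters only in \<open>measure_fair_coins\<close>.\<close>

primrec pavg :: "nat \<Rightarrow> ((nat \<Rightarrow> bool) \<Rightarrow> real) \<Rightarrow> real" where
  "pavg 0 h = h (\<lambda>_. False)"
| "pavg (Suc n) h = (pavg n (\<lambda>\<omega>. h (case_nat False \<omega>)) + pavg n (\<lambda>\<omega>. h (case_nat True \<omega>))) / 2"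

definition dep :: "nat \<Rightarrow> ((nat \<Rightarrow> bool) \<Rightarrow> 'a) \<Rightarrow> bool" where
  "dep n h \<longleftrightarrow> (\<forall>\<omega> \<omega>'. (\<forall>i<n. \<omega> i = \<omega>' i) \<longrightarrow> h \<omega> = h \<omega>')"

lemma depD: "dep n h \<Longrightarrow> (\<And>i. i < n \<Longrightarrow> \<omega> i = \<omega>' i) \<Longrightarrow> h \<omega> = h \<omega>'"
  by (simp add: dep_def)

lemma dep_case_nat: "dep (Suc n) h \<Longrightarrow> dep n (\<lambda>\<omega>. h (case_nat b \<omega>))"
  by (auto simp: dep_def split: nat.split)

lemma dep_comp: "dep n f \<Longrightarrow> dep n (\<lambda>\<omega>. g (f \<omega>))"
  unfolding dep_def by (metis (no_types))

lemma pavg_const: "pavg n (\<lambda>_. c) = c"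
  by (induction n) simp_all

lemma pavg_add: "pavg n (\<lambda>\<omega>. f \<omega> + g \<omega>) = pavg n f + pavg n g"
  by (induction n arbitrary: f g) (simp_all add: field_simps)

lemma pavg_scale: "pavg n (\<lambda>\<omega>. c * f \<omega>) = c * pavg n f"
  by (induction n arbitrary: f) (simp_all add: field_simps)

lemma pavg_mono: "(\<And>\<omega>. f \<omega> \<le> g \<omega>) \<Longrightarrow> pavg n f \<le> pavg n g"
  by (induction n arbitrary: f g) (simp_all add: add_mono divide_right_mono)

lemma pavg_dep_const: "dep 0 h \<Longrightarrow> pavg n h = h \<omega>"
proof -
  assume "dep 0 h"
  then have "h = (\<lambda>_. h \<omega>)" by (auto simp: dep_def)
  then have "pavg n h = pavg n (\<lambda>_. h \<omega>)" by (rule arg_cong)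
  then show ?thesis by (simp only: pavg_const)
qed

lemma pavg_dep: "dep n h \<Longrightarrow> pavg (n + m) h = pavg n h"
proof (induction n arbitrary: h)
  case 0
  show ?case using pavg_dep_const[OF 0] by simp
next
  case (Suc n)
  show ?case by (simp add: Suc.IH[OF dep_case_nat[OF Suc.prems]])
qed

lemma pavg_sum_le:
  assumes "finite I"
  shows "pavg n (\<lambda>\<omega>. of_bool (\<exists>i\<in>I. B i \<omega>)) \<le> (\<Sum>i\<in>I. pavg n (\<lambda>\<omega>. of_bool (B i \<omega>)))"
  using assms
proof (induction I)
  case empty
  then show ?case by (simp add: pavg_const)
next
  case (insert i I)
  have "pavg n (\<lambda>\<omega>. of_bool (\<exists>j\<in>insert i I. B j \<omega>))
      \<le> pavg n (\<lambda>\<omega>. of_bool (B i \<omega>) + of_bool (\<exists>j\<in>I. B j \<omega>))"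
    by (intro pavg_mono) auto
  then show ?case using insert by (simp add: pavg_add)
qed

text \<open>Independence of disjoint blocks, by peeling off the coins on which \<open>F\<close>
  depends.\<close>

lemma pavg_block:
  assumes "dep n F"
  shows "pavg (n + m) (\<lambda>\<omega>. F \<omega> * G (\<lambda>i. \<omega> (n + i))) = pavg n F * pavg m G"
  using assms
proof (induction n arbitrary: F)
  case 0
  have "F = (\<lambda>_. F (\<lambda>_. False))" using 0 by (auto simp: dep_def)
  then have e: "F \<omega> = F (\<lambda>_. False)" for \<omega> by (rule fun_cong)
  have "pavg m (\<lambda>\<omega>. F \<omega> * G \<omega>) = pavg m (\<lambda>\<omega>. F (\<lambda>_. False) * G \<omega>)"
    by (rule arg_cong[where f="pavg m"], rule ext) (rule arg_cong2[where f="(*)"], rule e, rule refl)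
  then show ?case by (simp add: pavg_scale)
next
  case (Suc n)
  have "pavg (n + m) (\<lambda>\<omega>. F (case_nat b \<omega>) * G (\<lambda>i. case_nat b \<omega> (Suc n + i)))
      = pavg n (\<lambda>\<omega>. F (case_nat b \<omega>)) * pavg m G" for b
    using Suc.IH[OF dep_case_nat[OF Suc.prems]] by simp
  then show ?case by (simp add: algebra_simps)
qed

text \<open>The assumption \<open>det\<close> says that \<open>f\<close> is a stopping time with past \<open>S\<close>.\<close>
lemma pavg_stopping_time:
  assumes bound: "\<And>\<omega>. f \<omega> \<le> n"
    and det: "\<And>\<omega> \<omega>'. (\<forall>i<f \<omega>. \<omega> i = \<omega>' i) \<Longrightarrow> f \<omega>' = f \<omega> \<and> S \<omega>' = S \<omega>"
    and dep: "\<And>\<omega>. dep m (B (S \<omega>))"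
    and \<beta>: "\<And>\<omega>. pavg m (\<lambda>\<eta>. of_bool (B (S \<omega>) \<eta>)) \<le> \<beta>"
  shows "pavg (n + m) (\<lambda>\<omega>. of_bool (B (S \<omega>) (\<lambda>i. \<omega> (f \<omega> + i)))) \<le> \<beta>"
  using assms
proof (induction n arbitrary: f S)
  case 0
  have f: "f \<omega> = 0" and S: "S \<omega> = S (\<lambda>_. False)" for \<omega>
    using 0(1)[of \<omega>] 0(1)[of "\<lambda>_. False"] 0(2)[of "\<lambda>_. False" \<omega>] by auto
  have e: "of_bool (B (S \<omega>) (\<lambda>i. \<omega> (f \<omega> + i))) = (of_bool (B (S (\<lambda>_. False)) \<omega>) :: real)" for \<omega>
    using f[of \<omega>] S[of \<omega>] by simp
  show ?case unfolding e using 0(4)[of "\<lambda>_. False"] by simp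
next
  case (Suc n)
  \<comment> \<open>If \<open>f\<close> vanishes somewhere, then \<open>det\<close>, with an empty
    condition on the coins, makes \<open>f\<close> zero and \<open>S\<close> constant everywhere.
    Otherwise the first coin is always read and can be peeled off, which lowers \<open>f\<close> by
    one.\<close>
  show ?case
  proof (cases "\<exists>\<omega>0. f \<omega>0 = 0")
    case True
    then obtain \<omega>0 where w0: "f \<omega>0 = 0" by blast
    have f: "f \<omega> = 0" and S: "S \<omega> = S \<omega>0" for \<omega>
      using Suc(3)[of \<omega>0 \<omega>] w0 by auto
    have e: "of_bool (B (S \<omega>) (\<lambda>i. \<omega> (f \<omega> + i))) = (of_bool (B (S \<omega>0) \<omega>) :: real)" for \<omega>
      using f[of \<omega>] S[of \<omega>] by simp
    have "dep m (\<lambda>\<omega>. of_bool (B (S \<omega>0) \<omega>) :: real)"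
      by (rule dep_comp[OF Suc(4)])
    from pavg_dep[OF this, of "Suc n"] show ?thesis
      unfolding e using Suc(5)[of \<omega>0] by (simp only: add.commute)
  next
    case False
    have "pavg (n + m) (\<lambda>\<omega>. of_bool (B (S (case_nat b \<omega>)) (\<lambda>i. \<omega> (f (case_nat b \<omega>) - 1 + i)))) \<le> \<beta>" for b
    proof (rule Suc.IH)
      fix \<omega>
      show "f (case_nat b \<omega>) - 1 \<le> n" using Suc(2)[of "case_nat b \<omega>"] by simp
      show "dep m (B (S (case_nat b \<omega>)))" by (rule Suc(4))
      show "pavg m (\<lambda>\<eta>. of_bool (B (S (case_nat b \<omega>)) \<eta>)) \<le> \<beta>" by (rule Suc(5))
      fix \<omega>' assume "\<forall>i<f (case_nat b \<omega>) - 1. \<omega> i = \<omega>' i"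
      then have "\<forall>i<f (case_nat b \<omega>). case_nat b \<omega> i = case_nat b \<omega>' i"
        by (auto split: nat.split)
      from Suc(3)[OF this]
      show "f (case_nat b \<omega>') - 1 = f (case_nat b \<omega>) - 1 \<and> S (case_nat b \<omega>') = S (case_nat b \<omega>)"
        by simp
    qed
    moreover have "case_nat b \<omega> (f (case_nat b \<omega>) + i) = \<omega> (f (case_nat b \<omega>) - 1 + i)" for b \<omega> i
      using False[simplified, THEN spec, of "case_nat b \<omega>"] by (cases "f (case_nat b \<omega>)") simp_all
    ultimately have "pavg (n + m) (\<lambda>\<omega>. of_bool (B (S (case_nat b \<omega>))
        (\<lambda>i. case_nat b \<omega> (f (case_nat b \<omega>) + i)))) \<le> \<beta>" for b
      by simp
    from this[of True] this[of False] show ?thesis by simp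
  qed
qed

text \<open>The product measure is the law of one coin put in front of an independent sequence
  (\<open>PiM_iter\<close>), so that integrating over this coin reproduces the recursion of
  \<open>pavg\<close>.\<close>

lemma measure_fair_coins:
  assumes "dep n Q"
  shows "{\<omega>. Q \<omega>} \<in> sets fair_coins \<and> measure fair_coins {\<omega>. Q \<omega>} = pavg n (\<lambda>\<omega>. of_bool (Q \<omega>))"
  using assms
proof (induction n arbitrary: Q)
  case 0
  have sp: "space fair_coins = UNIV" by (simp add: fair_coins_def space_PiM)
  interpret product_prob_space "\<lambda>_::nat. measure_pmf (bernoulli_pmf (1/2))" UNIV
    by unfold_locales
  interpret pr: prob_space fair_coins
    unfolding fair_coins_def by (rule P.prob_space_axioms)
  have "Q \<omega> = Q (\<lambda>_. False)" for \<omega> using 0 by (simp add: dep_def)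
  then have "{\<omega>. Q \<omega>} = (if Q (\<lambda>_. False) then UNIV else {})" by auto
  then show ?case using pr.prob_space sets.top[of fair_coins] by (simp add: sp)
next
  case (Suc n)
  define M where "M = measure_pmf (bernoulli_pmf (1/2))"
  interpret sequence_space M
    unfolding sequence_space_def M_def by unfold_locales
  interpret pr: prob_space fair_coins
    unfolding fair_coins_def M_def[symmetric] by (rule P.prob_space_axioms)
  have IH: "{\<omega>. Q (case_nat b \<omega>)} \<in> sets fair_coins"
    "measure fair_coins {\<omega>. Q (case_nat b \<omega>)} = pavg n (\<lambda>\<omega>. of_bool (Q (case_nat b \<omega>)))" for b
    using Suc.IH[OF dep_case_nat[OF Suc.prems]] by auto
  have FC: "fair_coins = S" by (simp add: fair_coins_def M_def)
  have sh: "(\<lambda>\<omega> i. \<omega> (Suc i)) \<in> measurable S S"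
    by (rule measurable_PiM_single') (auto simp: space_PiM)
  have c0: "(\<lambda>\<omega>. \<omega> 0) \<in> measurable S M" by (rule measurable_component_singleton) simp
  have sp: "space S = UNIV" by (simp add: space_PiM M_def)
  have sM: "sets M = UNIV" "space M = UNIV" by (simp_all add: M_def)
  \<comment> \<open>Measurability is needed before the measure can be transported. Splitting by the
    first coin reduces it to the induction hypothesis for the shifted sequence.\<close>
  have dec: "{\<omega>. Q \<omega>} = (\<Union>b. {\<omega>. \<omega> 0 = b} \<inter> {\<omega>. Q (case_nat b (\<lambda>i. \<omega> (Suc i)))})"
  proof -
    have e: "case_nat (\<omega> 0) (\<lambda>i. \<omega> (Suc i)) = \<omega>" for \<omega> :: "nat \<Rightarrow> bool"
      by (auto simp: fun_eq_iff split: nat.split)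
    show ?thesis
    proof (rule Set.set_eqI)
      fix \<omega>
      show "\<omega> \<in> {\<omega>. Q \<omega>} \<longleftrightarrow>
          \<omega> \<in> (\<Union>b. {\<omega>. \<omega> 0 = b} \<inter> {\<omega>. Q (case_nat b (\<lambda>i. \<omega> (Suc i)))})"
        using e[of \<omega>] by simp
    qed
  qed
  have "{\<omega>. \<omega> 0 = b} \<in> sets S" for b
    using measurable_sets[OF c0, of "{b}"] by (simp add: sp vimage_def sM)
  moreover have "{\<omega>. Q (case_nat b (\<lambda>i. \<omega> (Suc i)))} \<in> sets S" for b
    using measurable_sets[OF sh, of "{\<omega>. Q (case_nat b \<omega>)}"] IH(1)[of b] by (simp add: sp vimage_def FC)
  ultimately have meas: "{\<omega>. Q \<omega>} \<in> sets S"
    unfolding dec by (intro sets.countable_UN' sets.Int) auto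
  define E where "E = (\<lambda>(x, \<omega>). case_nat x \<omega>) -` {\<omega>. Q \<omega>} \<inter> space (M \<Otimes>\<^sub>M S)"
  have mc: "(\<lambda>(x, \<omega>). case_nat x \<omega>) \<in> measurable (M \<Otimes>\<^sub>M S) S"
    by measurable
  have E: "E \<in> sets (M \<Otimes>\<^sub>M S)" unfolding E_def by (rule measurable_sets[OF mc meas])
  have "emeasure S {\<omega>. Q \<omega>} = emeasure (distr (M \<Otimes>\<^sub>M S) S (\<lambda>(s, \<omega>). case_nat s \<omega>)) {\<omega>. Q \<omega>}"
    by (simp only: PiM_iter)
  also have "\<dots> = emeasure (M \<Otimes>\<^sub>M S) E"
    unfolding E_def by (rule emeasure_distr[OF mc meas])
  also have "\<dots> = (\<integral>\<^sup>+x. emeasure S (Pair x -` E) \<partial>M)"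
    by (rule P.emeasure_pair_measure_alt[OF E])
  also have "\<dots> = (\<integral>\<^sup>+x. emeasure S {\<omega>. Q (case_nat x \<omega>)} \<partial>M)"
    by (intro nn_integral_cong arg_cong[where f="emeasure S"])
       (auto simp: E_def space_pair_measure sp sM(2))
  also have "\<dots> = (\<integral>\<^sup>+x. ennreal (pavg n (\<lambda>\<omega>. of_bool (Q (case_nat x \<omega>)))) \<partial>M)"
    using IH(2) by (simp add: FC[symmetric] pr.emeasure_eq_measure)
  also have "\<dots> = ennreal (pavg (Suc n) (\<lambda>\<omega>. of_bool (Q \<omega>)))"
  proof -
    have nn: "0 \<le> pavg n (\<lambda>\<omega>. of_bool (Q (case_nat x \<omega>)))" for x
      using pavg_mono[of "\<lambda>_. 0" "\<lambda>\<omega>. of_bool (Q (case_nat x \<omega>))" n] by (simp add: pavg_const)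
    have half: "(\<integral>\<^sup>+x. ennreal (g x) \<partial>M) = ennreal ((g False + g True) / 2)" if "\<And>x. 0 \<le> g x" for g
    proof -
      have "(\<integral>\<^sup>+x. ennreal (g x) \<partial>M) = ennreal (g True) * ennreal (1 / 2) + ennreal (g False) * ennreal (1 / 2)"
        unfolding M_def by (subst nn_integral_bernoulli_pmf) simp_all
      also have "\<dots> = ennreal (g True * (1 / 2) + g False * (1 / 2))"
        using that[of True] that[of False]
        by (simp only: ennreal_mult'[symmetric] ennreal_plus[symmetric] mult_nonneg_nonneg zero_le_divide_1_iff zero_le_numeral)
      also have "g True * (1 / 2) + g False * (1 / 2) = (g False + g True) / 2" by simp
      finally show ?thesis .
    qed
    show ?thesis using half[OF nn] by simp
  qed
  finally have "emeasure fair_coins {\<omega>. Q \<omega>} = ennreal (pavg (Suc n) (\<lambda>\<omega>. of_bool (Q \<omega>)))"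
    by (simp only: FC)
  moreover have "0 \<le> pavg (Suc n) (\<lambda>\<omega>. of_bool (Q \<omega>))"
    using pavg_mono[of "\<lambda>_. 0" "\<lambda>\<omega>. of_bool (Q \<omega>)" "Suc n"] by (simp add: pavg_const del: pavg.simps)
  ultimately show ?case using meas by (simp add: FC measure_def del: pavg.simps)
qed

section \<open>Concentration of Rademacher projections\<close>

definition sgnb :: "bool \<Rightarrow> real" where "sgnb b = (if b then 1 else - 1)"

definition rsum :: "nat \<Rightarrow> (nat \<Rightarrow> real) \<Rightarrow> (nat \<Rightarrow> bool) \<Rightarrow> real" where
  "rsum d a \<omega> = (\<Sum>i<d. sgnb (\<omega> i) * a i)"

lemma rsum_case_nat: "rsum (Suc d) a (case_nat b \<omega>) = sgnb b * a 0 + rsum d (\<lambda>i. a (Suc i)) \<omega>"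
  unfolding rsum_def by (subst sum.lessThan_Suc_shift) simp

lemma dep_rsum: "dep d (rsum d a)"
  unfolding dep_def rsum_def by (auto intro!: sum.cong)

text \<open>The quotient of the two sides has a derivative with the sign of
  \<open>sinh x - x cosh x\<close>, which is not positive for \<open>x \<ge> 0\<close>.\<close>

lemma cosh_le_exp_half_square: "cosh x \<le> exp (x\<^sup>2 / 2)" for x :: real
proof -
  have pos: "cosh x \<le> exp (x\<^sup>2 / 2)" if "0 \<le> x" for x :: real
  proof -
    have sinh_le: "0 \<le> y * cosh y - sinh y" if "0 \<le> y" for y :: real
    proof -
      have "0 * cosh 0 - sinh 0 \<le> y * cosh y - sinh y"
      proof (rule DERIV_nonneg_imp_nondecreasing[OF that])
        fix z :: real assume "0 \<le> z" "z \<le> y"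
        then show "\<exists>D. ((\<lambda>y. y * cosh y - sinh y) has_real_derivative D) (at z) \<and> 0 \<le> D"
          by (intro exI[of _ "z * sinh z"]) (auto intro!: derivative_eq_intros)
      qed
      then show ?thesis by simp
    qed
    have "cosh x * exp (- (x\<^sup>2 / 2)) \<le> cosh 0 * exp (- (0\<^sup>2 / 2))"
    proof (rule DERIV_nonpos_imp_nonincreasing[OF that])
      fix z :: real assume z: "0 \<le> z" "z \<le> x"
      have "((\<lambda>x. cosh x * exp (- (x\<^sup>2 / 2))) has_real_derivative - ((z * cosh z - sinh z) * exp (- (z\<^sup>2 / 2)))) (at z)"
        by (auto intro!: derivative_eq_intros simp: algebra_simps)
      moreover have "- ((z * cosh z - sinh z) * exp (- (z\<^sup>2 / 2))) \<le> 0"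
        using sinh_le[OF z(1)] by simp
      ultimately show "\<exists>D. ((\<lambda>x. cosh x * exp (- (x\<^sup>2 / 2))) has_real_derivative D) (at z) \<and> D \<le> 0"
        by blast
    qed
    then show ?thesis by (simp add: exp_minus field_simps)
  qed
  show ?thesis using pos[of "\<bar>x\<bar>"] by simp
qed

lemma exp_minus_le_quadratic:
  fixes y :: real assumes "0 \<le> y" shows "exp (- y) \<le> 1 - y + y\<^sup>2 / 2"
proof -
  have "1 - 0 + 0\<^sup>2 / 2 - exp (- 0) \<le> 1 - y + y\<^sup>2 / 2 - exp (- y)"
  proof (rule DERIV_nonneg_imp_nondecreasing[OF assms])
    fix z :: real
    have "((\<lambda>y. 1 - y + y\<^sup>2 / 2 - exp (- y)) has_real_derivative (- 1 + z + exp (- z))) (at z)"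
      by (auto intro!: derivative_eq_intros)
    moreover have "0 \<le> - 1 + z + exp (- z)" using exp_ge_add_one_self[of "- z"] by simp
    ultimately show "\<exists>D. ((\<lambda>y. 1 - y + y\<^sup>2 / 2 - exp (- y)) has_real_derivative D) (at z) \<and> 0 \<le> D"
      by blast
  qed
  then show ?thesis by simp
qed

text \<open>The right side is the exact value for a centred Gaussian of variance \<open>a^2\<close>
  in place of the sign. Comparison with Gaussians makes the estimate reproduce its own shape when
  signs are added one at a time.\<close>

lemma square_mgf_step:
  fixes s a b :: real
  assumes "0 \<le> s" "2 * s * a\<^sup>2 < 1"
  shows "(exp (s * (b + a)\<^sup>2) + exp (s * (b - a)\<^sup>2)) / 2
    \<le> exp (s * b\<^sup>2 / (1 - 2 * s * a\<^sup>2)) / sqrt (1 - 2 * s * a\<^sup>2)"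
proof -
  define x where "x = 2 * s * a\<^sup>2"
  have x: "0 \<le> x" "x < 1" using assms by (auto simp: x_def)
  have "(exp (s * (b + a)\<^sup>2) + exp (s * (b - a)\<^sup>2)) / 2 = exp (s * (a\<^sup>2 + b\<^sup>2)) * cosh (2 * s * a * b)"
    by (simp add: cosh_def exp_add[symmetric] algebra_simps power2_eq_square)
  also have "\<dots> \<le> exp (s * (a\<^sup>2 + b\<^sup>2)) * exp ((2 * s * a * b)\<^sup>2 / 2)"
    by (intro mult_left_mono cosh_le_exp_half_square) simp
  also have "\<dots> = exp (s * b\<^sup>2 * (1 + x)) * exp (x / 2)"
    by (simp add: exp_add[symmetric] x_def algebra_simps power2_eq_square)
  also have "\<dots> \<le> exp (s * b\<^sup>2 / (1 - x)) * (1 / sqrt (1 - x))"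
  proof (intro mult_mono)
    have "(1 + x) * (1 - x) \<le> 1" by (simp add: algebra_simps)
    then have "1 + x \<le> 1 / (1 - x)" using x by (simp add: le_divide_eq)
    then have "s * b\<^sup>2 * (1 + x) \<le> s * b\<^sup>2 * (1 / (1 - x))" using assms by (intro mult_left_mono) auto
    then show "exp (s * b\<^sup>2 * (1 + x)) \<le> exp (s * b\<^sup>2 / (1 - x))" by simp
    have "(1 - x) \<le> exp (- x)" using exp_ge_add_one_self[of "- x"] by simp
    then have "sqrt (1 - x) \<le> sqrt (exp (- x))" by simp
    also have "sqrt (exp (- x)) = exp (- x / 2)"
      by (rule real_sqrt_unique) (simp_all add: power2_eq_square exp_add[symmetric])
    finally have "sqrt (1 - x) * exp (x / 2) \<le> exp (- x / 2) * exp (x / 2)" by (intro mult_right_mono) auto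
    then show "exp (x / 2) \<le> 1 / sqrt (1 - x)"
      using x by (simp add: exp_add[symmetric] le_divide_eq mult.commute)
  qed auto
  finally show ?thesis by (simp add: x_def)
qed

lemma square_mgf:
  assumes "0 \<le> s" "2 * s * (\<Sum>i<d. (a i)\<^sup>2) < 1"
  shows "pavg d (\<lambda>\<omega>. exp (s * (b + rsum d a \<omega>)\<^sup>2))
    \<le> exp (s * b\<^sup>2 / (1 - 2 * s * (\<Sum>i<d. (a i)\<^sup>2))) / sqrt (1 - 2 * s * (\<Sum>i<d. (a i)\<^sup>2))"
  using assms
proof (induction d arbitrary: a b)
  case 0
  then show ?case by (simp add: rsum_def)
next
  case (Suc d)
  define A where "A = (\<Sum>i<d. (a (Suc i))\<^sup>2)"
  have A: "(\<Sum>i<Suc d. (a i)\<^sup>2) = (a 0)\<^sup>2 + A"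
    unfolding A_def by (rule sum.lessThan_Suc_shift)
  have A0: "0 \<le> A" by (simp add: A_def sum_nonneg)
  have l: "2 * s * A < 1"
  proof -
    have "2 * s * A \<le> 2 * s * ((a 0)\<^sup>2 + A)" using Suc.prems(1) by (intro mult_left_mono) auto
    then show ?thesis using Suc.prems(2) unfolding A by linarith
  qed
  \<comment> \<open>The exponent that remains after averaging over all signs but the first.\<close>
  define s' where "s' = s / (1 - 2 * s * A)"
  have s': "0 \<le> s'" "2 * s' * (a 0)\<^sup>2 < 1"
    using Suc.prems l unfolding A by (auto simp: s'_def divide_less_eq algebra_simps)
  have e: "(1 - 2 * s * A) * (1 - 2 * s' * (a 0)\<^sup>2) = 1 - 2 * s * ((a 0)\<^sup>2 + A)"
  proof -
    have "s' * (1 - 2 * s * A) = s" using l by (simp add: s'_def)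
    moreover have "(1 - 2 * s * A) * (1 - 2 * s' * (a 0)\<^sup>2)
        = 1 - 2 * s * A - 2 * (s' * (1 - 2 * s * A)) * (a 0)\<^sup>2"
      by (simp add: algebra_simps)
    ultimately have "(1 - 2 * s * A) * (1 - 2 * s' * (a 0)\<^sup>2) = 1 - 2 * s * A - 2 * s * (a 0)\<^sup>2"
      by (simp only:)
    then show ?thesis by (simp add: distrib_left)
  qed
  have IH: "pavg d (\<lambda>\<omega>. exp (s * (c + rsum d (\<lambda>i. a (Suc i)) \<omega>)\<^sup>2)) \<le> exp (s' * c\<^sup>2) / sqrt (1 - 2 * s * A)" for c
    using Suc.IH[of "\<lambda>i. a (Suc i)" c] Suc.prems(1) l by (simp add: A_def s'_def)
  have "pavg (Suc d) (\<lambda>\<omega>. exp (s * (b + rsum (Suc d) a \<omega>)\<^sup>2))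
     = (pavg d (\<lambda>\<omega>. exp (s * ((b - a 0) + rsum d (\<lambda>i. a (Suc i)) \<omega>)\<^sup>2))
      + pavg d (\<lambda>\<omega>. exp (s * ((b + a 0) + rsum d (\<lambda>i. a (Suc i)) \<omega>)\<^sup>2))) / 2"
    by (simp add: rsum_case_nat sgnb_def algebra_simps)
  also have "\<dots> \<le> (exp (s' * (b - a 0)\<^sup>2) / sqrt (1 - 2 * s * A) + exp (s' * (b + a 0)\<^sup>2) / sqrt (1 - 2 * s * A)) / 2"
    by (intro divide_right_mono add_mono IH) simp
  also have "\<dots> = ((exp (s' * (b + a 0)\<^sup>2) + exp (s' * (b - a 0)\<^sup>2)) / 2) / sqrt (1 - 2 * s * A)"
    by (simp add: add_divide_distrib)
  also have "\<dots> \<le> (exp (s' * b\<^sup>2 / (1 - 2 * s' * (a 0)\<^sup>2)) / sqrt (1 - 2 * s' * (a 0)\<^sup>2)) / sqrt (1 - 2 * s * A)"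
    using l by (intro divide_right_mono square_mgf_step s') simp
  also have "\<dots> = exp (s' * b\<^sup>2 / (1 - 2 * s' * (a 0)\<^sup>2)) / sqrt (1 - 2 * s * ((a 0)\<^sup>2 + A))"
    unfolding e[symmetric] real_sqrt_mult divide_divide_eq_left
    by (simp only: mult.commute[of "sqrt (1 - 2 * s * A)"])
  also have "s' * b\<^sup>2 / (1 - 2 * s' * (a 0)\<^sup>2) = s * b\<^sup>2 / (1 - 2 * s * ((a 0)\<^sup>2 + A))"
    unfolding e[symmetric] by (simp add: s'_def)
  finally show ?case unfolding A .
qed

lemma rsum_moment2: "pavg d (\<lambda>\<omega>. (b + rsum d a \<omega>)\<^sup>2) = b\<^sup>2 + (\<Sum>i<d. (a i)\<^sup>2)"
proof (induction d arbitrary: a b)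
  case 0
  then show ?case by (simp add: rsum_def)
next
  case (Suc d)
  have "pavg (Suc d) (\<lambda>\<omega>. (b + rsum (Suc d) a \<omega>)\<^sup>2)
     = (pavg d (\<lambda>\<omega>. ((b - a 0) + rsum d (\<lambda>i. a (Suc i)) \<omega>)\<^sup>2)
      + pavg d (\<lambda>\<omega>. ((b + a 0) + rsum d (\<lambda>i. a (Suc i)) \<omega>)\<^sup>2)) / 2"
    by (simp add: rsum_case_nat sgnb_def algebra_simps)
  also have "\<dots> = b\<^sup>2 + ((a 0)\<^sup>2 + (\<Sum>i<d. (a (Suc i))\<^sup>2))"
    unfolding Suc.IH by (simp add: power2_eq_square algebra_simps)
  finally show ?case by (simp only: sum.lessThan_Suc_shift[of "\<lambda>i. (a i)\<^sup>2"])
qed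

text \<open>Again the Gaussian value, which composes under sums of independent terms; a single sign
  falls short of it by \<open>2 (a 0)^4\<close>.\<close>

lemma rsum_moment4:
  "pavg d (\<lambda>\<omega>. (b + rsum d a \<omega>) ^ 4) \<le> b ^ 4 + 6 * b\<^sup>2 * (\<Sum>i<d. (a i)\<^sup>2) + 3 * (\<Sum>i<d. (a i)\<^sup>2)\<^sup>2"
proof (induction d arbitrary: a b)
  case 0
  then show ?case by (simp add: rsum_def)
next
  case (Suc d)
  define A where "A = (\<Sum>i<d. (a (Suc i))\<^sup>2)"
  have "pavg (Suc d) (\<lambda>\<omega>. (b + rsum (Suc d) a \<omega>) ^ 4)
     = (pavg d (\<lambda>\<omega>. ((b - a 0) + rsum d (\<lambda>i. a (Suc i)) \<omega>) ^ 4)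
      + pavg d (\<lambda>\<omega>. ((b + a 0) + rsum d (\<lambda>i. a (Suc i)) \<omega>) ^ 4)) / 2"
    by (simp add: rsum_case_nat sgnb_def algebra_simps)
  also have "\<dots> \<le> (((b - a 0) ^ 4 + 6 * (b - a 0)\<^sup>2 * A + 3 * A\<^sup>2) + ((b + a 0) ^ 4 + 6 * (b + a 0)\<^sup>2 * A + 3 * A\<^sup>2)) / 2"
    unfolding A_def by (intro divide_right_mono add_mono Suc.IH) simp
  also have "\<dots> = b ^ 4 + 6 * b\<^sup>2 * ((a 0)\<^sup>2 + A) + 3 * ((a 0)\<^sup>2 + A)\<^sup>2 - 2 * (a 0) ^ 4"
    by (simp add: power2_eq_square power4_eq_xxxx algebra_simps)
  also have "\<dots> \<le> b ^ 4 + 6 * b\<^sup>2 * ((a 0)\<^sup>2 + A) + 3 * ((a 0)\<^sup>2 + A)\<^sup>2" by simp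
  finally show ?case by (simp only: sum.lessThan_Suc_shift[of "\<lambda>i. (a i)\<^sup>2"] A_def)
qed

text \<open>Block \<open>j\<close> uses the coins from \<open>j * d\<close> on, which is the order
  in which the program flips them.\<close>

definition qsum :: "nat \<Rightarrow> nat \<Rightarrow> (nat \<Rightarrow> real) \<Rightarrow> (nat \<Rightarrow> bool) \<Rightarrow> real" where
  "qsum d k a \<omega> = (\<Sum>j<k. (rsum d a (\<lambda>i. \<omega> (j * d + i)))\<^sup>2)"

lemma dep_qsum: "dep (k * d) (qsum d k a)"
proof -
  have "j * d + i < k * d" if "j < k" "i < d" for i j
  proof -
    have "j * d + i < Suc j * d" using that by simp
    also have "\<dots> \<le> k * d" using that by (intro mult_right_mono) auto
    finally show ?thesis .
  qed
  then show ?thesis unfolding dep_def qsum_def rsum_def by (auto intro!: sum.cong)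
qed

lemma qsum_Suc: "qsum d (Suc k) a \<omega> = (rsum d a \<omega>)\<^sup>2 + qsum d k a (\<lambda>i. \<omega> (d + i))"
  unfolding qsum_def by (subst sum.lessThan_Suc_shift) (simp add: add.assoc)

lemma pavg_exp_qsum: "pavg (k * d) (\<lambda>\<omega>. exp (s * qsum d k a \<omega>)) = (pavg d (\<lambda>\<omega>. exp (s * (rsum d a \<omega>)\<^sup>2))) ^ k"
proof (induction k)
  case 0
  then show ?case by (simp add: qsum_def)
next
  case (Suc k)
  have "dep d (\<lambda>\<omega>. exp (s * (rsum d a \<omega>)\<^sup>2))"
    by (rule dep_comp[OF dep_rsum])
  from pavg_block[OF this, of "k * d" "\<lambda>\<omega>. exp (s * qsum d k a \<omega>)"]
  show ?case by (simp add: qsum_Suc exp_add[symmetric] distrib_left Suc)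
qed

lemma pavg_exp_markov:
  "pavg n (\<lambda>\<omega>. of_bool (X \<omega> \<ge> c)) \<le> exp (- c) * pavg n (\<lambda>\<omega>. exp (X \<omega>))"
proof -
  have "pavg n (\<lambda>\<omega>. of_bool (X \<omega> \<ge> c)) \<le> pavg n (\<lambda>\<omega>. exp (- c) * exp (X \<omega>))"
    by (intro pavg_mono) (auto simp: exp_add[symmetric])
  then show ?thesis by (simp add: pavg_scale)
qed

text \<open>Since \<open>- ln (1 - 2 s) / 2 = s + s^2 + O(s^3)\<close>, the term
  \<open>2 s^2\<close> covers the remainder for \<open>s\<close> up to \<open>1 / 8\<close>.\<close>

lemma inverse_sqrt_le_exp:
  fixes s :: real
  assumes "0 \<le> s" "s \<le> 1 / 8"
  shows "1 / sqrt (1 - 2 * s) \<le> exp (s + 2 * s\<^sup>2)"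
proof -
  define u where "u = 2 * s + 4 * s\<^sup>2"
  have u: "0 \<le> u" using assms by (simp add: u_def)
  have "1 \<le> (1 - 2 * s) * (1 + 2 * s + 6 * s\<^sup>2)"
  proof -
    have "12 * s * s\<^sup>2 \<le> 2 * s\<^sup>2" using assms by (intro mult_right_mono) auto
    then show ?thesis by (simp add: algebra_simps power2_eq_square)
  qed
  also have "\<dots> \<le> (1 - 2 * s) * (1 + u + u\<^sup>2 / 2)"
  proof (intro mult_left_mono)
    have "(2 * s)\<^sup>2 \<le> u\<^sup>2" using assms by (intro power_mono) (auto simp: u_def)
    then show "1 + 2 * s + 6 * s\<^sup>2 \<le> 1 + u + u\<^sup>2 / 2" by (simp add: u_def power_mult_distrib)
  qed (use assms in auto)
  also have "\<dots> \<le> (1 - 2 * s) * exp u"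
    using assms exp_lower_Taylor_quadratic[OF u] by (intro mult_left_mono) auto
  finally have "1 / (1 - 2 * s) \<le> exp u" using assms by (simp add: divide_le_eq mult.commute)
  then have "sqrt (1 / (1 - 2 * s)) \<le> sqrt (exp u)" by simp
  also have "sqrt (exp u) = exp (u / 2)"
    by (rule real_sqrt_unique) (simp_all add: power2_eq_square exp_add[symmetric])
  also have "u / 2 = s + 2 * s\<^sup>2" by (simp add: u_def)
  finally show ?thesis by (simp add: real_sqrt_divide)
qed

theorem qsum_concentration:
  assumes A: "A = (\<Sum>i<d. (a i)\<^sup>2)" and t: "0 < t" "t \<le> 1 / 2"
  shows "pavg (k * d) (\<lambda>\<omega>. of_bool (\<not> ((1 - t) * (real k * A) \<le> qsum d k a \<omega> \<and> qsum d k a \<omega> \<le> (1 + t) * (real k * A))))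
    \<le> 2 * exp (- real k * t\<^sup>2 / 8)"
proof (cases "A = 0")
  case True
  then have "a i = 0" if "i < d" for i
    using that A by (simp add: sum_nonneg_eq_0_iff)
  then have "qsum d k a \<omega> = 0" for \<omega> by (simp add: qsum_def rsum_def)
  then show ?thesis by (simp add: True pavg_const)
next
  case False
  then have A0: "0 < A" using A by (simp add: sum_nonneg order_less_le)
  have up: "pavg (k * d) (\<lambda>\<omega>. of_bool (t / 4 / A * qsum d k a \<omega> \<ge> t / 4 * (1 + t) * real k)) \<le> exp (- real k * t\<^sup>2 / 8)"
  proof -
    \<comment> \<open>Minimises the Chernoff exponent \<open>- s t + 2 s^2\<close>, with minimum
      \<open>- t^2 / 8\<close>.\<close>
    define s where "s = t / 4"
    have s: "0 \<le> s" "s \<le> 1 / 8" using t by (auto simp: s_def)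
    have "pavg (k * d) (\<lambda>\<omega>. exp (s / A * qsum d k a \<omega>)) \<le> (exp (s + 2 * s\<^sup>2)) ^ k"
      unfolding pavg_exp_qsum
    proof (rule power_mono)
      have "pavg d (\<lambda>\<omega>. exp (s / A * (0 + rsum d a \<omega>)\<^sup>2)) \<le> exp (s / A * 0\<^sup>2 / (1 - 2 * (s / A) * A)) / sqrt (1 - 2 * (s / A) * A)"
        unfolding A by (rule square_mgf) (use A A0 s in auto)
      also have "\<dots> = 1 / sqrt (1 - 2 * s)" using A0 by simp
      also have "\<dots> \<le> exp (s + 2 * s\<^sup>2)" by (rule inverse_sqrt_le_exp[OF s])
      finally show "pavg d (\<lambda>\<omega>. exp (s / A * (rsum d a \<omega>)\<^sup>2)) \<le> exp (s + 2 * s\<^sup>2)" by simp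
      show "0 \<le> pavg d (\<lambda>\<omega>. exp (s / A * (rsum d a \<omega>)\<^sup>2))"
        using pavg_mono[of "\<lambda>_. 0" "\<lambda>\<omega>. exp (s / A * (rsum d a \<omega>)\<^sup>2)" d] by (simp add: pavg_const)
    qed
    then have "exp (- (s * (1 + t) * real k)) * pavg (k * d) (\<lambda>\<omega>. exp (s / A * qsum d k a \<omega>))
        \<le> exp (- (s * (1 + t) * real k)) * exp (real k * (s + 2 * s\<^sup>2))"
      by (intro mult_left_mono) (simp_all add: exp_of_nat_mult[symmetric])
    also have "\<dots> = exp (- real k * t\<^sup>2 / 8)"
      by (simp add: exp_add[symmetric] s_def algebra_simps power2_eq_square)
    finally show ?thesis
      using pavg_exp_markov[of "k * d" "s * (1 + t) * real k" "\<lambda>\<omega>. s / A * qsum d k a \<omega>"]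
      by (simp add: s_def)
  qed
  have lo: "pavg (k * d) (\<lambda>\<omega>. of_bool (- (t / 3) / A * qsum d k a \<omega> \<ge> - (t / 3 * (1 - t) * real k))) \<le> exp (- real k * t\<^sup>2 / 8)"
  proof -
    \<comment> \<open>The squares are bounded below, so for the lower tail a quadratic bound of the
      exponential, and with it the second and fourth moments, suffice. The choice
      \<open>t / 3\<close> minimises \<open>- r t + 3 r^2 / 2\<close>, with minimum
      \<open>- t^2 / 6\<close>.\<close>
    define r where "r = t / 3"
    have r: "0 \<le> r" using t by (simp add: r_def)
    have "pavg (k * d) (\<lambda>\<omega>. exp (- r / A * qsum d k a \<omega>)) \<le> (exp (- r + 3 / 2 * r\<^sup>2)) ^ k"
      unfolding pavg_exp_qsum
    proof (rule power_mono)
      have "pavg d (\<lambda>\<omega>. exp (- r / A * (rsum d a \<omega>)\<^sup>2))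
          \<le> pavg d (\<lambda>\<omega>. (1 + (- r / A) * (0 + rsum d a \<omega>)\<^sup>2) + (r\<^sup>2 / A\<^sup>2 / 2) * (0 + rsum d a \<omega>) ^ 4)"
      proof (rule pavg_mono)
        fix \<omega>
        show "exp (- r / A * (rsum d a \<omega>)\<^sup>2) \<le> 1 + - r / A * (0 + rsum d a \<omega>)\<^sup>2 + r\<^sup>2 / A\<^sup>2 / 2 * (0 + rsum d a \<omega>) ^ 4"
          using exp_minus_le_quadratic[of "r / A * (rsum d a \<omega>)\<^sup>2"] r A0
          by (simp add: power_mult_distrib power_divide)
      qed
      also have "\<dots> = 1 + (- r / A) * (0\<^sup>2 + A) + (r\<^sup>2 / A\<^sup>2 / 2) * pavg d (\<lambda>\<omega>. (0 + rsum d a \<omega>) ^ 4)"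
        unfolding pavg_add pavg_scale pavg_const rsum_moment2 A ..
      also have "\<dots> \<le> 1 + (- r / A) * (0\<^sup>2 + A) + (r\<^sup>2 / A\<^sup>2 / 2) * (0 ^ 4 + 6 * 0\<^sup>2 * A + 3 * A\<^sup>2)"
        unfolding A by (intro add_left_mono mult_left_mono rsum_moment4) auto
      also have "\<dots> = 1 + (- r + 3 / 2 * r\<^sup>2)" using A0 by (simp add: field_simps)
      also have "\<dots> \<le> exp (- r + 3 / 2 * r\<^sup>2)" by (rule exp_ge_add_one_self)
      finally show "pavg d (\<lambda>\<omega>. exp (- r / A * (rsum d a \<omega>)\<^sup>2)) \<le> exp (- r + 3 / 2 * r\<^sup>2)" .
      show "0 \<le> pavg d (\<lambda>\<omega>. exp (- r / A * (rsum d a \<omega>)\<^sup>2))"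
        using pavg_mono[of "\<lambda>_. 0" "\<lambda>\<omega>. exp (- r / A * (rsum d a \<omega>)\<^sup>2)" d] by (simp add: pavg_const)
    qed
    then have "exp (r * (1 - t) * real k) * pavg (k * d) (\<lambda>\<omega>. exp (- r / A * qsum d k a \<omega>))
        \<le> exp (r * (1 - t) * real k) * exp (real k * (- r + 3 / 2 * r\<^sup>2))"
      by (intro mult_left_mono) (simp_all only: exp_of_nat_mult[symmetric] exp_ge_zero)
    also have "\<dots> = exp (- real k * t\<^sup>2 / 6)"
      unfolding exp_add[symmetric] r_def
      by (rule arg_cong[where f=exp]) (simp add: field_simps power2_eq_square)
    also have "\<dots> \<le> exp (- real k * t\<^sup>2 / 8)" by (simp add: frac_le)
    finally show ?thesis
      using pavg_exp_markov[of "k * d" "- (r * (1 - t) * real k)" "\<lambda>\<omega>. - r / A * qsum d k a \<omega>"]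
      by (simp add: r_def)
  qed
  have "pavg (k * d) (\<lambda>\<omega>. of_bool (\<not> ((1 - t) * (real k * A) \<le> qsum d k a \<omega> \<and> qsum d k a \<omega> \<le> (1 + t) * (real k * A))))
    \<le> pavg (k * d) (\<lambda>\<omega>. of_bool (t / 4 / A * qsum d k a \<omega> \<ge> t / 4 * (1 + t) * real k)
        + of_bool (- (t / 3) / A * qsum d k a \<omega> \<ge> - (t / 3 * (1 - t) * real k)))"
  proof (rule pavg_mono)
    fix \<omega>
    have 1: "t / 4 / A * qsum d k a \<omega> \<ge> t / 4 * (1 + t) * real k" if "qsum d k a \<omega> > (1 + t) * (real k * A)"
    proof -
      have "t / 4 / A * ((1 + t) * (real k * A)) \<le> t / 4 / A * qsum d k a \<omega>"
        using that A0 t by (intro mult_left_mono) auto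
      then show ?thesis using A0 by (simp add: mult.assoc)
    qed
    have 2: "- (t / 3) / A * qsum d k a \<omega> \<ge> - (t / 3 * (1 - t) * real k)" if "qsum d k a \<omega> < (1 - t) * (real k * A)"
    proof -
      have "t / 3 / A * qsum d k a \<omega> \<le> t / 3 / A * ((1 - t) * (real k * A))"
        using that A0 t by (intro mult_left_mono) auto
      then show ?thesis using A0 by (simp add: mult.assoc)
    qed
    show "of_bool (\<not> ((1 - t) * (real k * A) \<le> qsum d k a \<omega> \<and> qsum d k a \<omega> \<le> (1 + t) * (real k * A)))
      \<le> (of_bool (t / 4 / A * qsum d k a \<omega> \<ge> t / 4 * (1 + t) * real k)
        + of_bool (- (t / 3) / A * qsum d k a \<omega> \<ge> - (t / 3 * (1 - t) * real k)) :: real)"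
      using 1 2 by (auto simp: not_le)
  qed
  also have "\<dots> \<le> exp (- real k * t\<^sup>2 / 8) + exp (- real k * t\<^sup>2 / 8)"
    unfolding pavg_add by (rule add_mono[OF up lo])
  finally show ?thesis by simp
qed

section \<open>A structured language of scalars and vectors, with semantics, cost and
  compilation\<close>

section \<open>A vector language on top of the real RAM\<close>

text \<open>Scalars live in the real cells below 39 (cell 39 stays 0), vector \<open>c\<close> in the \<open>d\<close> cells from
  \<open>40 + c * d\<close> on. Natural number cells: 0 the dimension, 1 and 2 the constants 1 and 0, 3 the
  running coordinate, 4 scratch, \<open>20 + c\<close> the base address of vector \<open>c\<close>, \<open>30 + c\<close> the address
  of its running coordinate.\<close>

datatype opd = Sc nat | Vc nat

datatype vinstr =
    Arith arith opd opd opd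
  | Root opd opd
  | Const opd nat
  | Dim opd
  | DiagEntry opd
  | Coin opd
  | Copy opd opd
  | Select opd opd opd opd opd

text \<open>Every program of this language halts, because the number of repetitions is read once on
  entry; hence its semantics can be a function. Only the main loop of \<open>mainp\<close>, whose
  length depends on the course of the computation, is left to the machine. \<open>Log2\<close> is a
  primitive because its doubling loop has no count fixed beforehand either.\<close>

datatype vprog =
    Block "vinstr list"
  | ForEach "vinstr list"
  | MulK nat nat
  | Then vprog vprog
  | Repeat nat nat vprog
  | Log2 nat nat nat

record vstate =
  av :: "nat \<Rightarrow> real"
  vv :: "nat \<Rightarrow> nat \<Rightarrow> real"
  fl :: nat

fun get :: "nat \<Rightarrow> vstate \<Rightarrow> opd \<Rightarrow> real" where
  "get i \<sigma> (Sc k) = av \<sigma> k"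
| "get i \<sigma> (Vc c) = vv \<sigma> c i"

fun put :: "nat \<Rightarrow> opd \<Rightarrow> real \<Rightarrow> vstate \<Rightarrow> vstate" where
  "put i (Sc k) x \<sigma> = \<sigma>\<lparr>av := (av \<sigma>)(k := x)\<rparr>"
| "put i (Vc c) x \<sigma> = \<sigma>\<lparr>vv := (vv \<sigma>)(c := (vv \<sigma> c)(i := x))\<rparr>"

fun bsem :: "nat \<Rightarrow> (nat \<Rightarrow> nat \<Rightarrow> real) \<Rightarrow> (nat \<Rightarrow> bool) \<Rightarrow> nat \<Rightarrow> vinstr \<Rightarrow> vstate \<Rightarrow> vstate" where
  "bsem d A \<omega> i (Arith f a b c) \<sigma> = put i a (arith_op f (get i \<sigma> b) (get i \<sigma> c)) \<sigma>"
| "bsem d A \<omega> i (Root a b) \<sigma> = put i a (sqrt (get i \<sigma> b)) \<sigma>"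
| "bsem d A \<omega> i (Const a n) \<sigma> = put i a (real n) \<sigma>"
| "bsem d A \<omega> i (Dim a) \<sigma> = put i a (real d) \<sigma>"
| "bsem d A \<omega> i (DiagEntry a) \<sigma> = put i a (A i i) \<sigma>"
| "bsem d A \<omega> i (Coin a) \<sigma> = (put i a (of_bool (\<omega> (fl \<sigma>))) \<sigma>)\<lparr>fl := Suc (fl \<sigma>)\<rparr>"
| "bsem d A \<omega> i (Copy a b) \<sigma> = put i a (get i \<sigma> b) \<sigma>"
| "bsem d A \<omega> i (Select a b c x y) \<sigma> = put i a (if get i \<sigma> b < get i \<sigma> c then get i \<sigma> x else get i \<sigma> y) \<sigma>"

definition lg :: "real \<Rightarrow> nat" where
  "lg x = (LEAST n. x \<le> 2 ^ n)"

primrec hsem :: "nat \<Rightarrow> (nat \<Rightarrow> nat \<Rightarrow> real) \<Rightarrow> (nat \<Rightarrow> bool) \<Rightarrow> vprog \<Rightarrow> vstate \<Rightarrow> vstate" where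
  "hsem d A \<omega> (Block bs) \<sigma> = fold (bsem d A \<omega> 0) bs \<sigma>"
| "hsem d A \<omega> (ForEach bs) \<sigma> = fold (\<lambda>i. fold (bsem d A \<omega> i) bs) [0..<d] \<sigma>"
| "hsem d A \<omega> (MulK a b) \<sigma> = \<sigma>\<lparr>vv := (vv \<sigma>)(a := mv d A (vv \<sigma> b))\<rparr>"
| "hsem d A \<omega> (Then P Q) \<sigma> = hsem d A \<omega> Q (hsem d A \<omega> P \<sigma>)"
| "hsem d A \<omega> (Repeat k N P) \<sigma> =
    ((\<lambda>\<tau>. fold (bsem d A \<omega> 0) [Const (Sc 38) 1, Arith Plus (Sc k) (Sc k) (Sc 38)] (hsem d A \<omega> P \<tau>))
      ^^ nat \<lceil>av \<sigma> N\<rceil>) (\<sigma>\<lparr>av := (av \<sigma>)(k := 0)\<rparr>)"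
| "hsem d A \<omega> (Log2 y l x) \<sigma> =
    \<sigma>\<lparr>av := (av \<sigma>)(y := 2 ^ lg (av \<sigma> x), l := real (lg (av \<sigma> x)), 38 := 1)\<rparr>"

text \<open>Upper bound for the running time, in units of the cost of a matrix-vector product.\<close>
primrec hcost :: "nat \<Rightarrow> (nat \<Rightarrow> nat \<Rightarrow> real) \<Rightarrow> (nat \<Rightarrow> bool) \<Rightarrow> vprog \<Rightarrow> vstate \<Rightarrow> real" where
  "hcost d A \<omega> (Block bs) \<sigma> = 10 + 2 * real (length bs)"
| "hcost d A \<omega> (ForEach bs) \<sigma> = 22 + 2 * real (length bs)"
| "hcost d A \<omega> (MulK a b) \<sigma> = 1"
| "hcost d A \<omega> (Then P Q) \<sigma> = hcost d A \<omega> P \<sigma> + hcost d A \<omega> Q (hsem d A \<omega> P \<sigma>)"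
| "hcost d A \<omega> (Repeat k N P) \<sigma> = 13 + (\<Sum>j<nat \<lceil>av \<sigma> N\<rceil>. 15 + hcost d A \<omega> P
    (((\<lambda>\<tau>. fold (bsem d A \<omega> 0) [Const (Sc 38) 1, Arith Plus (Sc k) (Sc k) (Sc 38)] (hsem d A \<omega> P \<tau>)) ^^ j)
      (\<sigma>\<lparr>av := (av \<sigma>)(k := 0)\<rparr>)))"
| "hcost d A \<omega> (Log2 y l x) \<sigma> = 17 + 15 * real (lg (av \<sigma> x))"

fun dst :: "vinstr \<Rightarrow> opd" where
  "dst (Arith f a b c) = a" | "dst (Root a b) = a" | "dst (Const a n) = a" | "dst (Dim a) = a"
| "dst (DiagEntry a) = a" | "dst (Coin a) = a" | "dst (Copy a b) = a" | "dst (Select a b c x y) = a"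

primrec ok_opd :: "opd \<Rightarrow> bool" where
  "ok_opd (Sc k) = (k < 39)" | "ok_opd (Vc c) = (c < 9)"

fun ok_vinstr :: "vinstr \<Rightarrow> bool" where
  "ok_vinstr (Arith f a b c) = (ok_opd a \<and> ok_opd b \<and> ok_opd c)"
| "ok_vinstr (Root a b) = (ok_opd a \<and> ok_opd b)"
| "ok_vinstr (Const a n) = ok_opd a"
| "ok_vinstr (Dim a) = ok_opd a"
| "ok_vinstr (DiagEntry a) = ok_opd a"
| "ok_vinstr (Coin a) = ok_opd a"
| "ok_vinstr (Copy a b) = (ok_opd a \<and> ok_opd b)"
| "ok_vinstr (Select a b c x y) = (ok_opd a \<and> ok_opd b \<and> ok_opd c \<and> ok_opd x \<and> ok_opd y)"

primrec writes :: "vprog \<Rightarrow> opd set" where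
  "writes (Block bs) = dst ` set bs"
| "writes (ForEach bs) = dst ` set bs"
| "writes (MulK a b) = {Vc a}"
| "writes (Then P Q) = writes P \<union> writes Q"
| "writes (Repeat k N P) = insert (Sc k) (insert (Sc 38) (writes P))"
| "writes (Log2 y l x) = {Sc y, Sc l, Sc 38}"

text \<open>Cell 38 is the scratch cell for the constant 1 of \<open>Repeat\<close> and
  \<open>Log2\<close>, so counters and bounds lie below it. A loop body must leave its counter and
  its bound alone, as the compiled loop tests them anew in each round.\<close>

primrec ok_vprog :: "vprog \<Rightarrow> bool" where
  "ok_vprog (Block bs) = (\<forall>b\<in>set bs. ok_vinstr b)"
| "ok_vprog (ForEach bs) = (\<forall>b\<in>set bs. ok_vinstr b)"
| "ok_vprog (MulK a b) = (a < 9 \<and> b < 9)"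
| "ok_vprog (Then P Q) = (ok_vprog P \<and> ok_vprog Q)"
| "ok_vprog (Repeat k N P) = (k < 38 \<and> N < 38 \<and> k \<noteq> N \<and> Sc k \<notin> writes P \<and> Sc N \<notin> writes P \<and> ok_vprog P)"
| "ok_vprog (Log2 y l x) = (y < 38 \<and> l < 38 \<and> x < 38 \<and> y \<noteq> l \<and> y \<noteq> x \<and> l \<noteq> x)"

lemma bsem_frame_av: "Sc k \<noteq> dst b \<Longrightarrow> av (bsem d A \<omega> i b \<sigma>) k = av \<sigma> k"
  by (cases "dst b"; cases b) auto

lemma bsem_frame_vv: "Vc c \<noteq> dst b \<Longrightarrow> vv (bsem d A \<omega> i b \<sigma>) c = vv \<sigma> c"
  by (cases "dst b"; cases b) auto

lemma fold_bsem_frame_av: "Sc k \<notin> dst ` set bs \<Longrightarrow> av (fold (bsem d A \<omega> i) bs \<sigma>) k = av \<sigma> k"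
  by (induction bs arbitrary: \<sigma>) (auto simp: bsem_frame_av)

lemma fold_bsem_frame_vv: "Vc c \<notin> dst ` set bs \<Longrightarrow> vv (fold (bsem d A \<omega> i) bs \<sigma>) c = vv \<sigma> c"
  by (induction bs arbitrary: \<sigma>) (auto simp: bsem_frame_vv)

lemma fold_fold_frame:
  assumes "\<And>i \<sigma>. f (g i \<sigma>) = f \<sigma>"
  shows "f (fold g is \<sigma>) = f \<sigma>"
  by (induction "is" arbitrary: \<sigma>) (simp_all add: assms)

lemma funpow_frame:
  assumes "\<And>\<sigma>. f (g \<sigma>) = f \<sigma>"
  shows "f ((g ^^ n) \<sigma>) = f \<sigma>"
  by (induction n) (simp_all add: assms)

lemma hsem_frame_av: "Sc k \<notin> writes P \<Longrightarrow> av (hsem d A \<omega> P \<sigma>) k = av \<sigma> k"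
proof (induction P arbitrary: \<sigma>)
  case (Block bs)
  then show ?case by (simp add: fold_bsem_frame_av)
next
  case (ForEach bs)
  then show ?case
    using fold_fold_frame[where f="\<lambda>\<sigma>. av \<sigma> k" and g="\<lambda>i. fold (bsem d A \<omega> i) bs"] by (simp add: fold_bsem_frame_av)
next
  case (Repeat j N P)
  have "av (((\<lambda>\<tau>. fold (bsem d A \<omega> 0) [Const (Sc 38) 1, Arith Plus (Sc j) (Sc j) (Sc 38)] (hsem d A \<omega> P \<tau>)) ^^ n) \<tau>) k = av \<tau> k" for n \<tau>
    by (rule funpow_frame[where f="\<lambda>\<sigma>. av \<sigma> k"]) (use Repeat in simp)
  then show ?case using Repeat.prems by simp
qed auto

lemma hsem_frame_vv: "Vc c \<notin> writes P \<Longrightarrow> vv (hsem d A \<omega> P \<sigma>) c = vv \<sigma> c"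
proof (induction P arbitrary: \<sigma>)
  case (Block bs)
  then show ?case by (simp add: fold_bsem_frame_vv)
next
  case (ForEach bs)
  then show ?case
    using fold_fold_frame[where f="\<lambda>\<sigma>. vv \<sigma> c" and g="\<lambda>i. fold (bsem d A \<omega> i) bs"] by (simp add: fold_bsem_frame_vv)
next
  case (Repeat j N P)
  have "vv (((\<lambda>\<tau>. fold (bsem d A \<omega> 0) [Const (Sc 38) 1, Arith Plus (Sc j) (Sc j) (Sc 38)] (hsem d A \<omega> P \<tau>)) ^^ n) \<tau>) c = vv \<tau> c" for n \<tau>
    by (rule funpow_frame[where f="\<lambda>\<sigma>. vv \<sigma> c"]) (use Repeat in simp)
  then show ?case using Repeat.prems by simp
qed auto

subsection \<open>Dependence on the coins\<close>

text \<open>As \<open>fl\<close> counts the coins read so far, this is the hypothesis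
  \<open>det\<close> of \<open>pavg_stopping_time\<close> for programs, in a form that is closed
  under composition.\<close>

definition coin_local :: "((nat \<Rightarrow> bool) \<Rightarrow> vstate \<Rightarrow> vstate) \<Rightarrow> bool" where
  "coin_local F \<longleftrightarrow> (\<forall>\<omega> \<omega>' \<sigma>. fl \<sigma> \<le> fl (F \<omega> \<sigma>) \<and>
     ((\<forall>i<fl (F \<omega> \<sigma>). \<omega> i = \<omega>' i) \<longrightarrow> F \<omega>' \<sigma> = F \<omega> \<sigma>))"

lemma coin_localD:
  assumes "coin_local F"
  shows "fl \<sigma> \<le> fl (F \<omega> \<sigma>)" "(\<And>i. i < fl (F \<omega> \<sigma>) \<Longrightarrow> \<omega> i = \<omega>' i) \<Longrightarrow> F \<omega>' \<sigma> = F \<omega> \<sigma>"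
  using assms unfolding coin_local_def by auto

lemma coin_local_id: "coin_local (\<lambda>_ \<sigma>. \<sigma>)"
  by (simp add: coin_local_def)

lemma coin_local_comp:
  assumes F: "coin_local F" and G: "coin_local G"
  shows "coin_local (\<lambda>\<omega> \<sigma>. G \<omega> (F \<omega> \<sigma>))"
  unfolding coin_local_def
proof (intro allI conjI impI)
  fix \<omega> \<omega>' \<sigma>
  have le: "fl (F \<omega> \<sigma>) \<le> fl (G \<omega> (F \<omega> \<sigma>))" by (rule coin_localD(1)[OF G])
  then show "fl \<sigma> \<le> fl (G \<omega> (F \<omega> \<sigma>))" using coin_localD(1)[OF F, of \<sigma> \<omega>] by linarith
  assume *: "\<forall>i<fl (G \<omega> (F \<omega> \<sigma>)). \<omega> i = \<omega>' i"
  have "F \<omega>' \<sigma> = F \<omega> \<sigma>" by (rule coin_localD(2)[OF F]) (use * le in auto)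
  moreover have "G \<omega>' (F \<omega> \<sigma>) = G \<omega> (F \<omega> \<sigma>)" by (rule coin_localD(2)[OF G]) (use * in auto)
  ultimately show "G \<omega>' (F \<omega>' \<sigma>) = G \<omega> (F \<omega> \<sigma>)" by simp
qed

lemma fl_put [simp]: "fl (put i a x \<sigma>) = fl \<sigma>"
  by (cases a) auto

lemma coin_local_bsem: "coin_local (\<lambda>\<omega>. bsem d A \<omega> i b)"
  by (cases b) (auto simp: coin_local_def)

lemma coin_local_fold:
  assumes "\<And>x. coin_local (\<lambda>\<omega>. f \<omega> x)"
  shows "coin_local (\<lambda>\<omega>. fold (f \<omega>) xs)"
proof (induction xs)
  case Nil
  then show ?case using coin_local_id by (simp add: id_def)
next
  case (Cons x xs)
  show ?case using coin_local_comp[OF assms[of x] Cons] by (simp add: o_def)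
qed

lemma coin_local_funpow:
  assumes "coin_local F"
  shows "coin_local (\<lambda>\<omega>. F \<omega> ^^ n)"
proof (induction n)
  case 0
  then show ?case using coin_local_id by (simp add: id_def)
next
  case (Suc n)
  show ?case using coin_local_comp[OF Suc assms] by (simp add: o_def)
qed

lemma coin_local_hsem: "coin_local (\<lambda>\<omega>. hsem d A \<omega> P)"
proof (induction P)
  case (Block bs)
  show ?case unfolding hsem.simps by (intro coin_local_fold coin_local_bsem)
next
  case (ForEach bs)
  show ?case unfolding hsem.simps by (intro coin_local_fold coin_local_bsem)
next
  case (Then P Q)
  then show ?case unfolding hsem.simps by (rule coin_local_comp)
next
  case (Repeat k N P)
  define G where "G \<omega> \<tau> = fold (bsem d A \<omega> 0) [Const (Sc 38) 1, Arith Plus (Sc k) (Sc k) (Sc 38)] (hsem d A \<omega> P \<tau>)" for \<omega> \<tau>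
  have G: "coin_local G"
    unfolding G_def by (intro coin_local_comp[OF Repeat] coin_local_fold coin_local_bsem)
  show ?case unfolding coin_local_def hsem.simps G_def[symmetric]
    using coin_localD[OF coin_local_funpow[OF G]] by (metis (no_types, lifting) vstate.select_convs(3) vstate.surjective vstate.update_convs(1))
qed (auto simp: coin_local_def)

subsection \<open>Compilation\<close>

primrec ad :: "opd \<Rightarrow> addr" where
  "ad (Sc k) = At k" | "ad (Vc c) = Ptr (30 + c)"

text \<open>There is no move instruction for real cells, so copying adds the zero cell 39. Constants
  and coins pass through the natural number cell 4.\<close>

fun bprog :: "vinstr \<Rightarrow> prog" where
  "bprog (Arith f a b c) = Do (RArith f (ad a) (ad b) (ad c))"
| "bprog (Root a b) = Do (RSqrt (ad a) (ad b))"
| "bprog (Const a n) = Seq (Do (NConst (At 4) n)) (Do (ROfNat (ad a) (At 4)))"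
| "bprog (Dim a) = Do (ROfNat (ad a) (At 0))"
| "bprog (DiagEntry a) = Do (Entry (ad a) (At 3) (At 3))"
| "bprog (Coin a) = Seq (Do (Flip (At 4))) (Do (ROfNat (ad a) (At 4)))"
| "bprog (Copy a b) = Do (RArith Plus (ad a) (ad b) (At 39))"
| "bprog (Select a b c x y) = Cond (RLess (ad b) (ad c))
    (Do (RArith Plus (ad a) (ad x) (At 39))) (Do (RArith Plus (ad a) (ad y) (At 39)))"

primrec seqs :: "prog list \<Rightarrow> prog" where
  "seqs [] = Skip" | "seqs (P # Ps) = Seq P (seqs Ps)"

definition setup_ptrs :: prog where
  "setup_ptrs = seqs (Do (NConst (At 3) 0) # map (\<lambda>c. Do (NAdd (At (30 + c)) (At (20 + c)) (At 2))) [0..<9])"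

definition incr_ptrs :: prog where
  "incr_ptrs = seqs (Do (NAdd (At 3) (At 3) (At 1)) # map (\<lambda>c. Do (NAdd (At (30 + c)) (At (30 + c)) (At 1))) [0..<9])"

primrec compile :: "vprog \<Rightarrow> prog" where
  "compile (Block bs) = Seq setup_ptrs (seqs (map bprog bs))"
| "compile (ForEach bs) = Seq setup_ptrs (While (NLess (At 3) (At 0)) (Seq (seqs (map bprog bs)) incr_ptrs))"
| "compile (MulK a b) = Do (MatVec (Ptr (20 + a)) (Ptr (20 + b)))"
| "compile (Then P Q) = Seq (compile P) (compile Q)"
| "compile (Repeat k N P) = Seq (Seq setup_ptrs (seqs [bprog (Const (Sc k) 0)]))
    (While (RLess (At k) (At N)) (Seq (compile P)
      (Seq setup_ptrs (seqs (map bprog [Const (Sc 38) 1, Arith Plus (Sc k) (Sc k) (Sc 38)])))))"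
| "compile (Log2 y l x) = Seq (Seq setup_ptrs (seqs (map bprog [Const (Sc y) 1, Const (Sc l) 0, Const (Sc 38) 1])))
    (While (RLess (At y) (At x))
      (Seq setup_ptrs (seqs (map bprog [Arith Plus (Sc y) (Sc y) (Sc y), Arith Plus (Sc l) (Sc l) (Sc 38)]))))"

definition Rel :: "nat \<Rightarrow> state \<Rightarrow> vstate \<Rightarrow> bool" where
  "Rel d s \<sigma> \<longleftrightarrow> (\<forall>k<39. rmem s k = av \<sigma> k) \<and> rmem s 39 = 0 \<and>
    (\<forall>c<9. \<forall>i<d. rmem s (40 + c * d + i) = vv \<sigma> c i) \<and> flips s = fl \<sigma> \<and>
    nmem s 0 = d \<and> nmem s 1 = 1 \<and> nmem s 2 = 0 \<and> (\<forall>c<9. nmem s (20 + c) = 40 + c * d)"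

definition ptrs :: "nat \<Rightarrow> nat \<Rightarrow> state \<Rightarrow> bool" where
  "ptrs d i s \<longleftrightarrow> nmem s 3 = i \<and> (\<forall>c<9. nmem s (30 + c) = 40 + c * d + i)"

lemma slot_inj:
  assumes "i < d" "j < d"
  shows "40 + c * d + i = 40 + c' * d + j \<longleftrightarrow> c = c' \<and> i = (j::nat)"
proof
  assume "40 + c * d + i = 40 + c' * d + j"
  then have e: "c * d + i = c' * d + j" by simp
  have "(c * d + i) div d = c" "(c' * d + j) div d = c'" using assms by simp_all
  then show "c = c' \<and> i = j" using e by auto
qed simp

lemma Rel_get:
  assumes "Rel d s \<sigma>" "ptrs d i s" "i < d" "ok_opd a"
  shows "rval s (ad a) = get i \<sigma> a"
  using assms by (cases a) (auto simp: Rel_def ptrs_def)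

lemma Rel_rset:
  assumes R: "Rel d s \<sigma>" and p: "ptrs d i s" and i: "i < d" and ok: "ok_opd a"
  shows "Rel d (rset (ad a) x s) (put i a x \<sigma>)" "ptrs d i (rset (ad a) x s)"
proof -
  show "ptrs d i (rset (ad a) x s)" using p by (simp add: ptrs_def rset_def)
  show "Rel d (rset (ad a) x s) (put i a x \<sigma>)"
  proof (cases a)
    case (Sc k)
    then show ?thesis using R ok by (auto simp: Rel_def rset_def)
  next
    case (Vc c)
    then have l: "loc s (ad a) = 40 + c * d + i" "c < 9" using p ok by (auto simp: ptrs_def)
    show ?thesis unfolding Rel_def rset_def l
      using R slot_inj[OF i] slot_inj[OF _ i] i Vc l(2) by (auto simp: Rel_def)
  qed
qed

lemma Rel_nmem4: "Rel d s \<sigma> \<Longrightarrow> Rel d (nset (At 4) n s) \<sigma>"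
  by (simp add: Rel_def nset_def)

lemma ptrs_nmem4: "ptrs d i s \<Longrightarrow> ptrs d i (nset (At 4) n s)"
  by (simp add: ptrs_def nset_def)

lemma lg_upper: "x \<le> 2 ^ lg x"
proof -
  obtain n where "x < 2 ^ n" using real_arch_pow[of 2 x] by auto
  then have "x \<le> 2 ^ n" by simp
  then show ?thesis unfolding lg_def by (rule LeastI[of "\<lambda>n. x \<le> 2 ^ n"])
qed

lemma lg_lower: "j < lg x \<Longrightarrow> 2 ^ j < x"
  unfolding lg_def using not_less_Least[of j "\<lambda>n. x \<le> 2 ^ n"] by (simp add: not_le)

locale ram =
  fixes d :: nat and K :: "real mat" and T :: real and \<omega> :: "nat \<Rightarrow> bool"
  assumes K: "K \<in> carrier_mat d d" and d: "1 \<le> d" and T: "real d \<le> T"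
begin

definition A :: "nat \<Rightarrow> nat \<Rightarrow> real" where "A i j = K $$ (i, j)"

lemma T1: "1 \<le> T" using d T by (metis dual_order.trans of_nat_1 of_nat_le_iff)

lemma le_mult_T: "x \<le> c \<Longrightarrow> 0 \<le> c \<Longrightarrow> x \<le> c * T"
  using mult_left_mono[OF T1, of c] by linarith

lemma bprog_sim:
  assumes R: "Rel d s \<sigma>" and p: "ptrs d i s" and i: "i < d" and ok: "ok_vinstr b"
  shows "\<exists>t s'. exec K T \<omega> (bprog b) s t s' \<and> t \<le> 2 \<and> Rel d s' (bsem d A \<omega> i b \<sigma>) \<and> ptrs d i s'"
proof -
  have i3: "nmem s 3 = i" and d0: "nmem s 0 = d" and z: "rmem s 39 = 0" and f: "flips s = fl \<sigma>"
    using p R by (auto simp: ptrs_def Rel_def)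
  note get = Rel_get[OF R p i]
  note set = Rel_rset[OF R p i]
  show ?thesis
  proof (cases b)
    case (Arith f a b' c)
    then show ?thesis using exec.Do[where K=K and T=T and \<omega>=\<omega> and c="RArith f (ad a) (ad b') (ad c)" and s=s] get set ok
      by (intro exI conjI) (auto simp del: loc.simps)
  next
    case (Root a b')
    then show ?thesis using exec.Do[where K=K and T=T and \<omega>=\<omega> and c="RSqrt (ad a) (ad b')" and s=s] get set ok
      by (intro exI conjI) (auto simp del: loc.simps)
  next
    case (Const a n)
    define s1 where "s1 = nset (At 4) n s"
    have "exec K T \<omega> (bprog b) s (1 + 1) (rset (ad a) (real n) s1)"
      using exec.Seq[OF exec.Do[where K=K and T=T and \<omega>=\<omega> and c="NConst (At 4) n" and s=s] exec.Do[where c="ROfNat (ad a) (At 4)"]]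
      by (simp add: Const s1_def nset_def)
    moreover have "Rel d s1 \<sigma>" "ptrs d i s1"
      unfolding s1_def by (intro Rel_nmem4 ptrs_nmem4 R p)+
    ultimately show ?thesis using Rel_rset[of d s1 \<sigma> i a "real n"] i ok Const
      by (intro exI[of _ "1 + 1"] exI[of _ "rset (ad a) (real n) s1"]) simp
  next
    case (Dim a)
    then show ?thesis using exec.Do[where K=K and T=T and \<omega>=\<omega> and c="ROfNat (ad a) (At 0)" and s=s] set ok d0
      by (intro exI conjI) (auto simp del: loc.simps simp add: loc.simps(1))
  next
    case (DiagEntry a)
    have "effect K \<omega> (Entry (ad a) (At 3) (At 3)) s = rset (ad a) (A i i) s"
      using K i by (simp add: i3 A_def)
    then show ?thesis using exec.Do[where K=K and T=T and \<omega>=\<omega> and c="Entry (ad a) (At 3) (At 3)" and s=s] set ok DiagEntry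
      by (intro exI conjI) auto
  next
    case (Coin a)
    define s1 where "s1 = (nset (At 4) (of_bool (\<omega> (flips s))) s)\<lparr>flips := Suc (flips s)\<rparr>"
    have "exec K T \<omega> (bprog b) s (1 + 1) (rset (ad a) (of_bool (\<omega> (fl \<sigma>))) s1)"
      using exec.Seq[OF exec.Do[where K=K and T=T and \<omega>=\<omega> and c="Flip (At 4)" and s=s] exec.Do[where c="ROfNat (ad a) (At 4)"]]
      by (simp add: Coin s1_def nset_def f)
    moreover have "Rel d s1 (\<sigma>\<lparr>fl := Suc (fl \<sigma>)\<rparr>)" "ptrs d i s1"
      using Rel_nmem4[OF R] ptrs_nmem4[OF p] f unfolding s1_def by (simp_all add: Rel_def ptrs_def)
    moreover have "put i a x (\<sigma>\<lparr>fl := n\<rparr>) = (put i a x \<sigma>)\<lparr>fl := n\<rparr>" for x n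
      by (cases a) auto
    ultimately show ?thesis using Rel_rset[of d s1 "\<sigma>\<lparr>fl := Suc (fl \<sigma>)\<rparr>" i a] i ok Coin
      by (intro exI[of _ "1 + 1"] exI[of _ "rset (ad a) (of_bool (\<omega> (fl \<sigma>))) s1"]) simp
  next
    case (Copy a b')
    then show ?thesis using exec.Do[where K=K and T=T and \<omega>=\<omega> and c="RArith Plus (ad a) (ad b') (At 39)" and s=s] get set ok z
      by (intro exI conjI) (auto simp del: loc.simps simp add: loc.simps(1))
  next
    case (Select a b' c x y)
    show ?thesis
    proof (cases "get i \<sigma> b' < get i \<sigma> c")
      case True
      then have h: "holds (RLess (ad b') (ad c)) s" using get ok Select by (simp del: loc.simps)
      from exec.Cond_True[OF h exec.Do] show ?thesis unfolding Select bprog.simps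
        using get set ok Select z True
        by (intro exI conjI) (assumption | auto simp del: loc.simps simp add: loc.simps(1))+
    next
      case False
      then have h: "\<not> holds (RLess (ad b') (ad c)) s" using get ok Select by (simp del: loc.simps)
      from exec.Cond_False[OF h exec.Do] show ?thesis unfolding Select bprog.simps
        using get set ok Select z False
        by (intro exI conjI) (assumption | auto simp del: loc.simps simp add: loc.simps(1))+
    qed
  qed
qed

lemma bprogs_sim:
  assumes "Rel d s \<sigma>" "ptrs d i s" "i < d" "\<forall>b\<in>set bs. ok_vinstr b"
  shows "\<exists>t s'. exec K T \<omega> (seqs (map bprog bs)) s t s' \<and> t \<le> 2 * real (length bs) \<and>
    Rel d s' (fold (bsem d A \<omega> i) bs \<sigma>) \<and> ptrs d i s'"
  using assms
proof (induction bs arbitrary: s \<sigma>)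
  case Nil
  then show ?case using exec.Skip by fastforce
next
  case (Cons b bs)
  from bprog_sim[OF Cons.prems(1,2,3), of b] Cons.prems(4)
  obtain t s1 where 1: "exec K T \<omega> (bprog b) s t s1" "t \<le> 2" "Rel d s1 (bsem d A \<omega> i b \<sigma>)" "ptrs d i s1"
    by auto
  from Cons.IH[OF 1(3,4)] Cons.prems
  obtain t' s2 where 2: "exec K T \<omega> (seqs (map bprog bs)) s1 t' s2" "t' \<le> 2 * real (length bs)"
    "Rel d s2 (fold (bsem d A \<omega> i) bs (bsem d A \<omega> i b \<sigma>))" "ptrs d i s2" by auto
  from exec.Seq[OF 1(1) 2(1)] show ?case using 1 2 by (intro exI[of _ "t + t'"] exI[of _ s2]) simp
qed

lemma seqs_Do: "exec K T \<omega> (seqs (map Do cs)) s (\<Sum>c\<leftarrow>cs. cost T c) (fold (effect K \<omega>) cs s)"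
proof (induction cs arbitrary: s)
  case Nil
  then show ?case using exec.Skip by simp
next
  case (Cons c cs)
  show ?case using exec.Seq[OF exec.Do[where K=K and T=T and \<omega>=\<omega> and c=c and s=s] Cons] by simp
qed

lemma all_less_9: "(\<forall>c<9::nat. P c) \<longleftrightarrow> P 0 \<and> P 1 \<and> P 2 \<and> P 3 \<and> P 4 \<and> P 5 \<and> P 6 \<and> P 7 \<and> P 8"
proof -
  have "[0..<9] = [0,1,2,3,4,5,6,7,8::nat]" by (simp add: upt_rec)
  then have "(\<forall>c\<in>set [0..<9]. P c) \<longleftrightarrow> P 0 \<and> P 1 \<and> P 2 \<and> P 3 \<and> P 4 \<and> P 5 \<and> P 6 \<and> P 7 \<and> P 8"
    by simp
  then show ?thesis by (simp add: Ball_def)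
qed

lemma setup_sim:
  assumes "Rel d s \<sigma>"
  shows "\<exists>s'. exec K T \<omega> setup_ptrs s 10 s' \<and> Rel d s' \<sigma> \<and> ptrs d 0 s'"
proof -
  define cs where "cs = NConst (At 3) 0 # map (\<lambda>c. NAdd (At (30 + c)) (At (20 + c)) (At 2)) [0..<9]"
  have e: "[0..<9] = [0,1,2,3,4,5,6,7,8::nat]" by (simp add: upt_rec)
  have "setup_ptrs = seqs (map Do cs)" by (simp add: setup_ptrs_def cs_def o_def)
  moreover have "(\<Sum>c\<leftarrow>cs. cost T c) = 10" by (simp add: cs_def e)
  moreover have "Rel d (fold (effect K \<omega>) cs s) \<sigma> \<and> ptrs d 0 (fold (effect K \<omega>) cs s)"
    using assms by (simp add: cs_def e Rel_def ptrs_def nset_def all_less_9)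
  ultimately show ?thesis using seqs_Do[of cs s] by auto
qed

lemma incr_sim:
  assumes "Rel d s \<sigma>" "ptrs d i s"
  shows "\<exists>s'. exec K T \<omega> incr_ptrs s 10 s' \<and> Rel d s' \<sigma> \<and> ptrs d (Suc i) s'"
proof -
  define cs where "cs = NAdd (At 3) (At 3) (At 1) # map (\<lambda>c. NAdd (At (30 + c)) (At (30 + c)) (At 1)) [0..<9]"
  have e: "[0..<9] = [0,1,2,3,4,5,6,7,8::nat]" by (simp add: upt_rec)
  have "incr_ptrs = seqs (map Do cs)" by (simp add: incr_ptrs_def cs_def o_def)
  moreover have "(\<Sum>c\<leftarrow>cs. cost T c) = 10" by (simp add: cs_def e)
  moreover have "Rel d (fold (effect K \<omega>) cs s) \<sigma> \<and> ptrs d (Suc i) (fold (effect K \<omega>) cs s)"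
    using assms by (simp add: cs_def e Rel_def ptrs_def nset_def all_less_9)
  ultimately show ?thesis using seqs_Do[of cs s] by auto
qed

lemma block_sim:
  assumes "Rel d s \<sigma>" "\<forall>b\<in>set bs. ok_vinstr b"
  shows "\<exists>t s'. exec K T \<omega> (Seq setup_ptrs (seqs (map bprog bs))) s t s' \<and> t \<le> 10 + 2 * real (length bs) \<and>
    Rel d s' (fold (bsem d A \<omega> 0) bs \<sigma>)"
proof -
  from setup_sim[OF assms(1)] obtain s1 where 1: "exec K T \<omega> setup_ptrs s 10 s1" "Rel d s1 \<sigma>" "ptrs d 0 s1" by auto
  have "0 < d" using d by simp
  from bprogs_sim[OF 1(2,3) this assms(2)] obtain t s2 where 2: "exec K T \<omega> (seqs (map bprog bs)) s1 t s2"
    "t \<le> 2 * real (length bs)" "Rel d s2 (fold (bsem d A \<omega> 0) bs \<sigma>)" by auto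
  from exec.Seq[OF 1(1) 2(1)] show ?thesis using 2 by (intro exI[of _ "10 + t"] exI[of _ s2]) simp
qed

lemma vloop_sim:
  assumes "Rel d s \<sigma>" "ptrs d i s" "i \<le> d" "\<forall>b\<in>set bs. ok_vinstr b"
  shows "\<exists>t s'. exec K T \<omega> (While (NLess (At 3) (At 0)) (Seq (seqs (map bprog bs)) incr_ptrs)) s t s' \<and>
    t \<le> 1 + real (d - i) * (11 + 2 * real (length bs)) \<and>
    Rel d s' (fold (\<lambda>i. fold (bsem d A \<omega> i) bs) [i..<d] \<sigma>)"
  using assms(1-3)
proof (induction "d - i" arbitrary: i s \<sigma>)
  case 0
  then have "\<not> holds (NLess (At 3) (At 0)) s" by (simp add: Rel_def ptrs_def)
  from exec.While_False[OF this] show ?case using 0 by (intro exI[of _ 1] exI[of _ s]) auto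
next
  case (Suc n)
  then have i: "i < d" by simp
  have h: "holds (NLess (At 3) (At 0)) s" using Suc.prems i by (simp add: Rel_def ptrs_def)
  from bprogs_sim[OF Suc.prems(1,2) i assms(4)] obtain t s1 where 1: "exec K T \<omega> (seqs (map bprog bs)) s t s1"
    "t \<le> 2 * real (length bs)" "Rel d s1 (fold (bsem d A \<omega> i) bs \<sigma>)" "ptrs d i s1" by auto
  from incr_sim[OF 1(3,4)] obtain s2 where 2: "exec K T \<omega> incr_ptrs s1 10 s2"
    "Rel d s2 (fold (bsem d A \<omega> i) bs \<sigma>)" "ptrs d (Suc i) s2" by auto
  have "n = d - Suc i" "Suc i \<le> d" using Suc.hyps(2) i by auto
  from Suc.hyps(1)[OF this(1) 2(2,3) this(2)] obtain t' s3 where 3: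
    "exec K T \<omega> (While (NLess (At 3) (At 0)) (Seq (seqs (map bprog bs)) incr_ptrs)) s2 t' s3"
    "t' \<le> 1 + real (d - Suc i) * (11 + 2 * real (length bs))"
    "Rel d s3 (fold (\<lambda>i. fold (bsem d A \<omega> i) bs) [Suc i..<d] (fold (bsem d A \<omega> i) bs \<sigma>))" by auto
  have "real (d - i) = 1 + real (d - Suc i)" using i by simp
  then have "1 + (t + 10) + t' \<le> 1 + real (d - i) * (11 + 2 * real (length bs))"
    using 1(2) 3(2) by (simp only: distrib_right mult_1)
  then show ?case
    using exec.While_True[OF h exec.Seq[OF 1(1) 2(1)] 3(1)] 3(3) i
    by (intro exI[of _ "1 + (t + 10) + t'"] exI[of _ s3] conjI) (simp_all add: upt_rec[of i])
qed

lemma matvec_sim: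
  assumes R: "Rel d s \<sigma>" and ab: "a < 9" "b < 9"
  shows "Rel d (effect K \<omega> (MatVec (Ptr (20 + a)) (Ptr (20 + b))) s) (\<sigma>\<lparr>vv := (vv \<sigma>)(a := mv d A (vv \<sigma> b))\<rparr>)"
proof -
  define v where "v = K *\<^sub>v read_vec d (40 + b * d) s"
  have v: "dim_vec v = d" "\<And>i. i < d \<Longrightarrow> v $ i = mv d A (vv \<sigma> b) i"
    using K R ab by (auto simp: v_def read_vec_def scalar_prod_def mv_def A_def Rel_def atLeast0LessThan intro!: sum.cong)
  have e: "effect K \<omega> (MatVec (Ptr (20 + a)) (Ptr (20 + b))) s = write_vec (40 + a * d) v s"
    using R ab K by (simp add: Rel_def v_def)
  have in_slot: "40 + a * d \<le> 40 + c * d + i \<and> 40 + c * d + i < 40 + a * d + d \<longleftrightarrow> c = a" if "i < d" for c i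
  proof
    assume *: "40 + a * d \<le> 40 + c * d + i \<and> 40 + c * d + i < 40 + a * d + d"
    then obtain j where "40 + c * d + i = 40 + a * d + j" "j < d"
      by (metis le_Suc_ex nat_add_left_cancel_less)
    then show "c = a" using slot_inj[OF that, of j c a] by simp
  qed (use that in auto)
  show ?thesis unfolding e Rel_def write_vec_def v(1)
    using R in_slot v(2) by (auto simp: Rel_def)
qed

text \<open>Counters are real cells and the loop test compares reals, so a bound that is no integer
  is rounded up, and a negative one gives no iteration.\<close>

lemma less_ceiling_nat: "real j < X \<longleftrightarrow> j < nat \<lceil>X\<rceil>"
  by (simp add: zless_nat_eq_int_zless less_ceiling_iff)

lemma for_sim:
  assumes IH: "\<And>s \<sigma>. Rel d s \<sigma> \<Longrightarrow> \<exists>t s'. exec K T \<omega> P s t s' \<and> t \<le> c \<sigma> * T \<and> Rel d s' (F \<sigma>)"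
    and keep: "\<And>\<sigma>. av (F \<sigma>) k = av \<sigma> k + 1" "\<And>\<sigma>. av (F \<sigma>) N = av \<sigma> N" and kN: "k < 39" "N < 39"
    and R: "Rel d s \<sigma>" and j: "av \<sigma> k = real j" "nat \<lceil>av \<sigma> N\<rceil> = j + n"
  shows "\<exists>t s'. exec K T \<omega> (While (RLess (At k) (At N)) P) s t s' \<and>
    t \<le> 1 + (\<Sum>j<n. 1 + c ((F ^^ j) \<sigma>)) * T \<and> Rel d s' ((F ^^ n) \<sigma>)"
  using R j
proof (induction n arbitrary: s \<sigma> j)
  case 0
  have "\<not> real j < av \<sigma> N" unfolding less_ceiling_nat using 0 by simp
  then have "\<not> holds (RLess (At k) (At N)) s" using 0 kN by (simp add: Rel_def)
  from exec.While_False[OF this] show ?case using 0 by (intro exI[of _ 1] exI[of _ s]) auto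
next
  case (Suc n)
  have "real j < av \<sigma> N" unfolding less_ceiling_nat using Suc.prems by simp
  then have h: "holds (RLess (At k) (At N)) s" using Suc.prems kN by (simp add: Rel_def)
  from IH[OF Suc.prems(1)] obtain t s1 where 1: "exec K T \<omega> P s t s1" "t \<le> c \<sigma> * T" "Rel d s1 (F \<sigma>)" by auto
  have "av (F \<sigma>) k = real (Suc j)" "nat \<lceil>av (F \<sigma>) N\<rceil> = Suc j + n" using keep Suc.prems by simp_all
  from Suc.IH[OF 1(3) this] obtain t' s2 where 2: "exec K T \<omega> (While (RLess (At k) (At N)) P) s1 t' s2"
    "t' \<le> 1 + (\<Sum>j<n. 1 + c ((F ^^ j) (F \<sigma>))) * T" "Rel d s2 ((F ^^ n) (F \<sigma>))" by auto
  have "1 + t + t' \<le> 1 + ((1 + c \<sigma>) * T + (\<Sum>j<n. 1 + c ((F ^^ j) (F \<sigma>))) * T)"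
    using 1(2) 2(2) T1 by (simp add: distrib_right)
  also have "\<dots> = 1 + (\<Sum>j<Suc n. 1 + c ((F ^^ j) \<sigma>)) * T"
    by (subst sum.lessThan_Suc_shift) (simp add: funpow_swap1 distrib_right)
  finally show ?case using exec.While_True[OF h 1(1) 2(1)] 2(3)
    by (intro exI[of _ "1 + t + t'"] exI[of _ s2]) (simp add: funpow_swap1)
qed

lemma lg_sim:
  assumes ok: "y < 38" "l < 38" "x < 38" "y \<noteq> l" "y \<noteq> x" "l \<noteq> x"
    and R: "Rel d s \<sigma>" and j: "av \<sigma> y = 2 ^ j" "av \<sigma> l = real j" "av \<sigma> 38 = 1" "lg (av \<sigma> x) = j + n"
  shows "\<exists>t s'. exec K T \<omega> (While (RLess (At y) (At x))
      (Seq setup_ptrs (seqs (map bprog [Arith Plus (Sc y) (Sc y) (Sc y), Arith Plus (Sc l) (Sc l) (Sc 38)])))) s t s' \<and>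
    t \<le> 1 + real n * 15 \<and>
    Rel d s' (\<sigma>\<lparr>av := (av \<sigma>)(y := 2 ^ lg (av \<sigma> x), l := real (lg (av \<sigma> x)), 38 := 1)\<rparr>)"
  using R j
proof (induction n arbitrary: s \<sigma> j)
  case 0
  have "\<not> holds (RLess (At y) (At x)) s"
    using 0 ok lg_upper[of "av \<sigma> x"] by (simp add: Rel_def)
  moreover have "\<sigma>\<lparr>av := (av \<sigma>)(y := 2 ^ lg (av \<sigma> x), l := real (lg (av \<sigma> x)), 38 := 1)\<rparr> = \<sigma>"
    using 0 by (intro vstate.equality) (auto simp: fun_eq_iff)
  ultimately show ?case using exec.While_False[where b="RLess (At y) (At x)" and s=s] 0(1)
    by (intro exI[of _ 1] exI[of _ s]) (simp only: mult_zero_left of_nat_0 add_0_right order.refl simp_thms)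
next
  case (Suc n)
  let ?bs = "[Arith Plus (Sc y) (Sc y) (Sc y), Arith Plus (Sc l) (Sc l) (Sc 38)]"
  have h: "holds (RLess (At y) (At x)) s"
    using Suc.prems ok lg_lower[of j "av \<sigma> x"] by (simp add: Rel_def)
  have "\<forall>b\<in>set ?bs. ok_vinstr b" using ok by simp
  from block_sim[OF Suc.prems(1) this] obtain t s1 where
    1: "exec K T \<omega> (Seq setup_ptrs (seqs (map bprog ?bs))) s t s1" "t \<le> 14"
      "Rel d s1 (fold (bsem d A \<omega> 0) ?bs \<sigma>)" by auto
  define \<tau> where "\<tau> = fold (bsem d A \<omega> 0) ?bs \<sigma>"
  have \<tau>: "\<tau> = \<sigma>\<lparr>av := (av \<sigma>)(y := 2 ^ Suc j, l := real (Suc j))\<rparr>"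
    using ok Suc.prems by (simp add: \<tau>_def fun_eq_iff)
  have "av \<tau> y = 2 ^ Suc j" "av \<tau> l = real (Suc j)" "av \<tau> 38 = 1" "lg (av \<tau> x) = Suc j + n"
    using ok Suc.prems by (simp_all add: \<tau>)
  from Suc.IH[OF 1(3)[folded \<tau>_def] this] obtain t' s2 where
    2: "exec K T \<omega> (While (RLess (At y) (At x)) (Seq setup_ptrs (seqs (map bprog ?bs)))) s1 t' s2"
      "t' \<le> 1 + real n * 15"
      "Rel d s2 (\<tau>\<lparr>av := (av \<tau>)(y := 2 ^ lg (av \<tau> x), l := real (lg (av \<tau> x)), 38 := 1)\<rparr>)" by blast
  have e: "\<tau>\<lparr>av := (av \<tau>)(y := 2 ^ lg (av \<tau> x), l := real (lg (av \<tau> x)), 38 := 1)\<rparr>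
      = \<sigma>\<lparr>av := (av \<sigma>)(y := 2 ^ lg (av \<sigma> x), l := real (lg (av \<sigma> x)), 38 := 1)\<rparr>"
    using ok by (simp add: \<tau> fun_eq_iff)
  have "1 + t + t' \<le> 1 + real (Suc n) * 15" using 1(2) 2(2) by simp
  with exec.While_True[OF h 1(1) 2(1)] show ?case
    by (rule_tac x="1 + t + t'" in exI, rule_tac x=s2 in exI, intro conjI) (assumption | rule 2(3)[unfolded e])+
qed

theorem comp_sim:
  assumes "ok_vprog P" "Rel d s \<sigma>"
  shows "\<exists>t s'. exec K T \<omega> (compile P) s t s' \<and> t \<le> hcost d A \<omega> P \<sigma> * T \<and> Rel d s' (hsem d A \<omega> P \<sigma>)"
  using assms
proof (induction P arbitrary: s \<sigma>)
  case (Block bs)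
  from block_sim[OF Block.prems(2), of bs] Block.prems(1) obtain t s' where
    *: "exec K T \<omega> (Seq setup_ptrs (seqs (map bprog bs))) s t s'" "t \<le> 10 + 2 * real (length bs)"
    "Rel d s' (fold (bsem d A \<omega> 0) bs \<sigma>)" by auto
  have "t \<le> (10 + 2 * real (length bs)) * T"
    by (rule le_mult_T[OF *(2)]) simp
  then show ?case using *(1,3) by (intro exI[of _ t] exI[of _ s']) simp
next
  case (ForEach bs)
  from setup_sim[OF ForEach.prems(2)] obtain s1 where 1: "exec K T \<omega> setup_ptrs s 10 s1" "Rel d s1 \<sigma>" "ptrs d 0 s1" by auto
  from vloop_sim[OF 1(2,3), of bs] ForEach.prems(1) obtain t s2 where
    2: "exec K T \<omega> (While (NLess (At 3) (At 0)) (Seq (seqs (map bprog bs)) incr_ptrs)) s1 t s2"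
    "t \<le> 1 + real d * (11 + 2 * real (length bs))"
    "Rel d s2 (fold (\<lambda>i. fold (bsem d A \<omega> i) bs) [0..<d] \<sigma>)" by auto
  \<comment> \<open>A pass over all coordinates costs a multiple of \<open>d\<close>, hence at most
    that multiple of one matrix-vector product.\<close>
  have "10 + t \<le> 11 * T + T * (11 + 2 * real (length bs))"
    using 2(2) T1 mult_right_mono[OF T, of "11 + 2 * real (length bs)"] by linarith
  then have "10 + t \<le> (22 + 2 * real (length bs)) * T" by (simp add: algebra_simps)
  then show ?case using exec.Seq[OF 1(1) 2(1)] 2(3) by (intro exI[of _ "10 + t"] exI[of _ s2]) auto
next
  case (MulK a b)
  then show ?case using matvec_sim[of s \<sigma> a b] exec.Do[where K=K and T=T and \<omega>=\<omega> and c="MatVec (Ptr (20 + a)) (Ptr (20 + b))" and s=s]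
    by (intro exI conjI) (auto simp del: effect.simps)
next
  case (Then P Q)
  from Then.IH(1)[of s \<sigma>] Then.prems obtain t s1 where 1: "exec K T \<omega> (compile P) s t s1"
    "t \<le> hcost d A \<omega> P \<sigma> * T" "Rel d s1 (hsem d A \<omega> P \<sigma>)" by auto
  from Then.IH(2)[OF _ 1(3)] Then.prems obtain t' s2 where 2: "exec K T \<omega> (compile Q) s1 t' s2"
    "t' \<le> hcost d A \<omega> Q (hsem d A \<omega> P \<sigma>) * T" "Rel d s2 (hsem d A \<omega> Q (hsem d A \<omega> P \<sigma>))" by auto
  from exec.Seq[OF 1(1) 2(1)] show ?case using 1 2
    by (intro exI[of _ "t + t'"] exI[of _ s2]) (simp add: distrib_right)
next
  case (Repeat k N P)
  let ?bs = "[Const (Sc 38) 1, Arith Plus (Sc k) (Sc k) (Sc 38)]"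
  let ?F = "\<lambda>\<tau>. fold (bsem d A \<omega> 0) ?bs (hsem d A \<omega> P \<tau>)"
  have okb: "\<forall>b\<in>set ?bs. ok_vinstr b" and kN: "k < 39" "N < 39" and wr: "Sc k \<notin> writes P" "Sc N \<notin> writes P"
    and ne: "k \<noteq> N" "k \<noteq> 38" "N \<noteq> 38" using Repeat.prems by auto
  have body: "\<exists>t s'. exec K T \<omega> (Seq (compile P) (Seq setup_ptrs (seqs (map bprog ?bs)))) s t s' \<and>
      t \<le> (14 + hcost d A \<omega> P \<sigma>) * T \<and> Rel d s' (?F \<sigma>)" if "Rel d s \<sigma>" for s \<sigma>
  proof -
    from Repeat.IH[OF _ that] Repeat.prems obtain t s1 where 1: "exec K T \<omega> (compile P) s t s1"
      "t \<le> hcost d A \<omega> P \<sigma> * T" "Rel d s1 (hsem d A \<omega> P \<sigma>)" by auto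
    from block_sim[OF 1(3) okb] obtain t' s2 where 2: "exec K T \<omega> (Seq setup_ptrs (seqs (map bprog ?bs))) s1 t' s2"
      "t' \<le> 14" "Rel d s2 (?F \<sigma>)" by auto
    from exec.Seq[OF 1(1) 2(1)] show ?thesis using 1(2) 2(2,3) T1
      by (intro exI[of _ "t + t'"] exI[of _ s2]) (simp add: distrib_right)
  qed
  have keep: "av (?F \<sigma>) k = av \<sigma> k + 1" "av (?F \<sigma>) N = av \<sigma> N" for \<sigma>
    using hsem_frame_av[OF wr(1)] hsem_frame_av[OF wr(2)] ne by simp_all
  define \<sigma>0 where "\<sigma>0 = \<sigma>\<lparr>av := (av \<sigma>)(k := 0)\<rparr>"
  have "\<forall>b\<in>set [Const (Sc k) 0]. ok_vinstr b" using kN by simp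
  from block_sim[OF Repeat.prems(2) this] obtain t s1 where
    1: "exec K T \<omega> (Seq setup_ptrs (seqs [bprog (Const (Sc k) 0)])) s t s1" "t \<le> 12" "Rel d s1 \<sigma>0"
    by (auto simp: \<sigma>0_def)
  have s0: "av \<sigma>0 k = real 0" "nat \<lceil>av \<sigma>0 N\<rceil> = 0 + nat \<lceil>av \<sigma> N\<rceil>" using ne by (simp_all add: \<sigma>0_def)
  from for_sim[of "Seq (compile P) (Seq setup_ptrs (seqs (map bprog ?bs)))" "\<lambda>\<sigma>. 14 + hcost d A \<omega> P \<sigma>" ?F k N s1 \<sigma>0 0 "nat \<lceil>av \<sigma> N\<rceil>",
      OF body keep kN 1(3) s0]
  obtain t' s2 where 2: "exec K T \<omega> (While (RLess (At k) (At N)) (Seq (compile P) (Seq setup_ptrs (seqs (map bprog ?bs))))) s1 t' s2"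
    "t' \<le> 1 + (\<Sum>j<nat \<lceil>av \<sigma> N\<rceil>. 1 + (14 + hcost d A \<omega> P ((?F ^^ j) \<sigma>0))) * T"
    "Rel d s2 ((?F ^^ nat \<lceil>av \<sigma> N\<rceil>) \<sigma>0)" by blast
  have "t + t' \<le> 13 * T + (\<Sum>j<nat \<lceil>av \<sigma> N\<rceil>. 15 + hcost d A \<omega> P ((?F ^^ j) \<sigma>0)) * T"
    using 1(2) 2(2) T1 by simp
  then have "t + t' \<le> hcost d A \<omega> (Repeat k N P) \<sigma> * T"
    unfolding hcost.simps \<sigma>0_def[symmetric] by (simp only: distrib_right)
  then show ?case using exec.Seq[OF 1(1) 2(1)] 2(3)
    by (intro exI[of _ "t + t'"] exI[of _ s2]) (simp add: \<sigma>0_def)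
next
  case (Log2 y l x)
  let ?bs = "[Const (Sc y) 1, Const (Sc l) 0, Const (Sc 38) 1]"
  have ok: "y < 38" "l < 38" "x < 38" "y \<noteq> l" "y \<noteq> x" "l \<noteq> x" using Log2.prems by auto
  have "\<forall>b\<in>set ?bs. ok_vinstr b" using ok by simp
  define \<tau> where "\<tau> = fold (bsem d A \<omega> 0) ?bs \<sigma>"
  from block_sim[OF Log2.prems(2) \<open>\<forall>b\<in>set ?bs. ok_vinstr b\<close>] obtain t s1 where
    1: "exec K T \<omega> (Seq setup_ptrs (seqs (map bprog ?bs))) s t s1" "t \<le> 16" "Rel d s1 \<tau>"
    unfolding \<tau>_def by auto
  have \<tau>: "av \<tau> y = 2 ^ 0" "av \<tau> l = real 0" "av \<tau> 38 = 1" "lg (av \<tau> x) = 0 + lg (av \<sigma> x)"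
    using ok by (simp_all add: \<tau>_def)
  from lg_sim[OF ok 1(3) \<tau>] obtain t' s2 where
    2: "exec K T \<omega> (While (RLess (At y) (At x))
      (Seq setup_ptrs (seqs (map bprog [Arith Plus (Sc y) (Sc y) (Sc y), Arith Plus (Sc l) (Sc l) (Sc 38)])))) s1 t' s2"
    "t' \<le> 1 + real (lg (av \<sigma> x)) * 15"
    "Rel d s2 (\<tau>\<lparr>av := (av \<tau>)(y := 2 ^ lg (av \<tau> x), l := real (lg (av \<tau> x)), 38 := 1)\<rparr>)" by blast
  have e: "\<tau>\<lparr>av := (av \<tau>)(y := 2 ^ lg (av \<tau> x), l := real (lg (av \<tau> x)), 38 := 1)\<rparr> = hsem d A \<omega> (Log2 y l x) \<sigma>"
    using ok by (simp add: \<tau>_def fun_eq_iff)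
  have "t + t' \<le> hcost d A \<omega> (Log2 y l x) \<sigma> * T"
  proof -
    have "t + t' \<le> 17 + 15 * real (lg (av \<sigma> x))" using 1(2) 2(2) by simp
    then have "t + t' \<le> (17 + 15 * real (lg (av \<sigma> x))) * T" by (rule le_mult_T) simp
    then show ?thesis by simp
  qed
  moreover have "exec K T \<omega> (compile (Log2 y l x)) s (t + t') s2"
    unfolding compile.simps by (rule exec.Seq[OF 1(1) 2(1)])
  ultimately show ?case
    by (rule_tac x="t + t'" in exI, rule_tac x=s2 in exI, intro conjI) (assumption | rule 2(3)[unfolded e])+
qed

end

subsection \<open>Reasoning about vector programs\<close>

declare hsem.simps(2,5) [simp del] hcost.simps(5) [simp del] One_nat_def [simp del]

text \<open>Instructions that neither read coins nor write scalars. For these, the sequential pass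
  over the coordinates acts as a simultaneous update.\<close>

fun pureb :: "vinstr \<Rightarrow> bool" where
  "pureb (Coin a) = False"
| "pureb b = (case dst b of Vc c \<Rightarrow> True | Sc k \<Rightarrow> False)"

lemma pureb_bsem:
  assumes "pureb b"
  shows "av (bsem d A \<omega> i b \<sigma>) = av \<sigma>" "fl (bsem d A \<omega> i b \<sigma>) = fl \<sigma>"
    "j \<noteq> i \<Longrightarrow> vv (bsem d A \<omega> i b \<sigma>) c j = vv \<sigma> c j"
  using assms by (cases b; auto split: opd.splits)+

lemma pureb_fold:
  assumes "\<forall>b\<in>set bs. pureb b"
  shows "av (fold (bsem d A \<omega> i) bs \<sigma>) = av \<sigma>" "fl (fold (bsem d A \<omega> i) bs \<sigma>) = fl \<sigma>"
    "j \<noteq> i \<Longrightarrow> vv (fold (bsem d A \<omega> i) bs \<sigma>) c j = vv \<sigma> c j"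
  using assms by (induction bs arbitrary: \<sigma>) (simp_all add: pureb_bsem)

lemma get_local: "av \<sigma> = av \<sigma>' \<Longrightarrow> (\<And>c. vv \<sigma> c i = vv \<sigma>' c i) \<Longrightarrow> get i \<sigma> a = get i \<sigma>' a"
  by (cases a) simp_all

lemma pureb_bsem_local:
  assumes b: "pureb b" and a: "av \<sigma> = av \<sigma>'" and v: "\<And>c. vv \<sigma> c i = vv \<sigma>' c i"
  shows "vv (bsem d A \<omega> i b \<sigma>) c i = vv (bsem d A \<omega> i b \<sigma>') c i"
proof -
  have g: "get i \<sigma> x = get i \<sigma>' x" for x by (rule get_local[OF a v])
  have "vv (put i x y \<sigma>) c i = vv (put i x y \<sigma>') c i" for x y using v[of c] by (cases x) simp_all
  then show ?thesis using b by (cases b) (simp_all add: g)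
qed

lemma pureb_fold_local:
  assumes "\<forall>b\<in>set bs. pureb b" "av \<sigma> = av \<sigma>'" "\<And>c. vv \<sigma> c i = vv \<sigma>' c i"
  shows "vv (fold (bsem d A \<omega> i) bs \<sigma>) c i = vv (fold (bsem d A \<omega> i) bs \<sigma>') c i"
  using assms
proof (induction bs arbitrary: \<sigma> \<sigma>')
  case (Cons b bs)
  have b: "pureb b" using Cons.prems by simp
  show ?case unfolding fold_simps
  proof (rule Cons.IH)
    show "\<forall>b\<in>set bs. pureb b" using Cons.prems by simp
    show "av (bsem d A \<omega> i b \<sigma>) = av (bsem d A \<omega> i b \<sigma>')" using b Cons.prems by (simp add: pureb_bsem)
    show "vv (bsem d A \<omega> i b \<sigma>) c i = vv (bsem d A \<omega> i b \<sigma>') c i" for c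
      by (rule pureb_bsem_local[OF b]) (use Cons.prems in auto)
  qed
qed simp

text \<open>The pass at coordinate \<open>i\<close> changes only entries at \<open>i\<close>, and
  reads only these and the scalars, which stay constant. So coordinate \<open>j\<close> still has
  its old values when its turn comes.\<close>

lemma pure_loop:
  assumes p: "\<forall>b\<in>set bs. pureb b"
  shows "av (fold (\<lambda>i. fold (bsem d A \<omega> i) bs) [0..<n] \<sigma>) = av \<sigma> \<and>
    fl (fold (\<lambda>i. fold (bsem d A \<omega> i) bs) [0..<n] \<sigma>) = fl \<sigma> \<and>
    (\<forall>c j. vv (fold (\<lambda>i. fold (bsem d A \<omega> i) bs) [0..<n] \<sigma>) c j =
      (if j < n then vv (fold (bsem d A \<omega> j) bs \<sigma>) c j else vv \<sigma> c j))"
proof (induction n)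
  case (Suc n)
  define \<tau> where "\<tau> = fold (\<lambda>i. fold (bsem d A \<omega> i) bs) [0..<n] \<sigma>"
  have e: "fold (\<lambda>i. fold (bsem d A \<omega> i) bs) [0..<Suc n] \<sigma> = fold (bsem d A \<omega> n) bs \<tau>"
    by (simp add: \<tau>_def)
  have t: "av \<tau> = av \<sigma>" "fl \<tau> = fl \<sigma>"
    "\<And>c j. vv \<tau> c j = (if j < n then vv (fold (bsem d A \<omega> j) bs \<sigma>) c j else vv \<sigma> c j)"
    using Suc unfolding \<tau>_def by auto
  have "vv (fold (bsem d A \<omega> n) bs \<tau>) c n = vv (fold (bsem d A \<omega> n) bs \<sigma>) c n" for c
    by (rule pureb_fold_local[OF p]) (simp_all add: t)
  moreover have "vv (fold (bsem d A \<omega> n) bs \<tau>) c j = vv \<tau> c j" if "j \<noteq> n" for c j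
    by (rule pureb_fold(3)[OF p that])
  ultimately have "vv (fold (bsem d A \<omega> n) bs \<tau>) c j =
      (if j < Suc n then vv (fold (bsem d A \<omega> j) bs \<sigma>) c j else vv \<sigma> c j)" for c j
    by (cases "j = n") (auto simp: t(3))
  then show ?case unfolding e using pureb_fold(1,2)[OF p] t(1,2) by simp
qed simp

lemma pure_ForEach:
  assumes "\<forall>b\<in>set bs. pureb b"
  shows "av (hsem d A \<omega> (ForEach bs) \<sigma>) = av \<sigma>" "fl (hsem d A \<omega> (ForEach bs) \<sigma>) = fl \<sigma>"
    "j < d \<Longrightarrow> vv (hsem d A \<omega> (ForEach bs) \<sigma>) c j = vv (fold (bsem d A \<omega> j) bs \<sigma>) c j"
  using pure_loop[OF assms, of d A \<omega> d \<sigma>] by (simp_all add: hsem.simps(2))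

lemma ForEach_sum:
  "hsem d A \<omega> (ForEach [Arith Plus (Sc k) (Sc k) (Vc c)]) \<sigma> = \<sigma>\<lparr>av := (av \<sigma>)(k := av \<sigma> k + (\<Sum>i<d. vv \<sigma> c i))\<rparr>"
proof -
  have "fold (\<lambda>i. fold (bsem d A \<omega> i) [Arith Plus (Sc k) (Sc k) (Vc c)]) [0..<n] \<sigma> =
      \<sigma>\<lparr>av := (av \<sigma>)(k := av \<sigma> k + (\<Sum>i<n. vv \<sigma> c i))\<rparr>" for n
    by (induction n) (simp_all add: add.assoc fun_upd_def cong: if_cong)
  then show ?thesis by (simp add: hsem.simps(2))
qed

lemma ForEach_coins:
  "fl (hsem d A \<omega> (ForEach [Coin (Vc c)]) \<sigma>) = fl \<sigma> + d"
  "av (hsem d A \<omega> (ForEach [Coin (Vc c)]) \<sigma>) = av \<sigma>"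
  "j < d \<Longrightarrow> vv (hsem d A \<omega> (ForEach [Coin (Vc c)]) \<sigma>) c j = of_bool (\<omega> (fl \<sigma> + j))"
proof -
  have *: "fl (fold (\<lambda>i. fold (bsem d A \<omega> i) [Coin (Vc c)]) [0..<n] \<sigma>) = fl \<sigma> + n \<and>
    av (fold (\<lambda>i. fold (bsem d A \<omega> i) [Coin (Vc c)]) [0..<n] \<sigma>) = av \<sigma> \<and>
    (\<forall>j<n. vv (fold (\<lambda>i. fold (bsem d A \<omega> i) [Coin (Vc c)]) [0..<n] \<sigma>) c j = of_bool (\<omega> (fl \<sigma> + j)))" for n
    by (induction n) (auto simp: less_Suc_eq)
  show "fl (hsem d A \<omega> (ForEach [Coin (Vc c)]) \<sigma>) = fl \<sigma> + d"
    "av (hsem d A \<omega> (ForEach [Coin (Vc c)]) \<sigma>) = av \<sigma>"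
    "j < d \<Longrightarrow> vv (hsem d A \<omega> (ForEach [Coin (Vc c)]) \<sigma>) c j = of_bool (\<omega> (fl \<sigma> + j))"
    using *[of d] by (simp_all add: hsem.simps(2))
qed

primrec flipfree :: "vprog \<Rightarrow> bool" where
  "flipfree (Block bs) = (\<forall>b\<in>set bs. \<forall>a. b \<noteq> Coin a)"
| "flipfree (ForEach bs) = (\<forall>b\<in>set bs. \<forall>a. b \<noteq> Coin a)"
| "flipfree (MulK a b) = True"
| "flipfree (Then P Q) = (flipfree P \<and> flipfree Q)"
| "flipfree (Repeat k N P) = flipfree P"
| "flipfree (Log2 y l x) = True"

lemma fl_fold: "\<forall>b\<in>set bs. \<forall>a. b \<noteq> Coin a \<Longrightarrow> fl (fold (bsem d A \<omega> i) bs \<sigma>) = fl \<sigma>"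
proof (induction bs arbitrary: \<sigma>)
  case (Cons b bs)
  then have "fl (bsem d A \<omega> i b \<sigma>) = fl \<sigma>" by (cases b) auto
  then show ?case using Cons by simp
qed simp

lemma fl_hsem: "flipfree P \<Longrightarrow> fl (hsem d A \<omega> P \<sigma>) = fl \<sigma>"
proof (induction P arbitrary: \<sigma>)
  case (Block bs)
  then show ?case by (simp add: fl_fold)
next
  case (ForEach bs)
  show ?case unfolding hsem.simps
    by (rule fold_fold_frame[where f=fl and g="\<lambda>i. fold (bsem d A \<omega> i) bs"]) (use ForEach in \<open>simp add: fl_fold\<close>)
next
  case (Repeat k N P)
  then have "fl (((\<lambda>\<tau>. fold (bsem d A \<omega> 0) [Const (Sc 38) 1, Arith Plus (Sc k) (Sc k) (Sc 38)] (hsem d A \<omega> P \<tau>)) ^^ n) \<tau>) = fl \<tau>" for n \<tau>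
    by (intro funpow_frame[where f=fl]) simp
  then show ?case by (simp add: hsem.simps(5))
qed auto

definition frz :: "opd set \<Rightarrow> vstate \<Rightarrow> vstate \<Rightarrow> bool" where
  "frz W \<sigma> \<tau> \<longleftrightarrow> (\<forall>k. Sc k \<notin> W \<longrightarrow> av \<tau> k = av \<sigma> k) \<and> (\<forall>c. Vc c \<notin> W \<longrightarrow> vv \<tau> c = vv \<sigma> c)"

lemma frz_av: "frz W \<sigma> \<tau> \<Longrightarrow> Sc k \<notin> W \<Longrightarrow> av \<tau> k = av \<sigma> k"
  by (simp add: frz_def)

lemma frz_vv: "frz W \<sigma> \<tau> \<Longrightarrow> Vc c \<notin> W \<Longrightarrow> vv \<tau> c = vv \<sigma> c"
  by (simp add: frz_def)

lemma frz_hsem: "frz (writes P) \<sigma> (hsem d A \<omega> P \<sigma>)"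
  by (simp add: frz_def hsem_frame_av hsem_frame_vv)

definition hinc :: "nat \<Rightarrow> vstate \<Rightarrow> vstate" where
  "hinc k \<tau> = \<tau>\<lparr>av := (av \<tau>)(38 := 1, k := av \<tau> k + 1)\<rparr>"

lemma hinc_simps [simp]:
  "vv (hinc k \<tau>) = vv \<tau>" "fl (hinc k \<tau>) = fl \<tau>" "i \<noteq> 38 \<Longrightarrow> i \<noteq> k \<Longrightarrow> av (hinc k \<tau>) i = av \<tau> i"
  by (simp_all add: hinc_def)

lemma hinc_eq: "k \<noteq> 38 \<Longrightarrow> fold (bsem d A \<omega> 0) [Const (Sc 38) 1, Arith Plus (Sc k) (Sc k) (Sc 38)] \<tau> = hinc k \<tau>"
  by (simp add: hinc_def)

lemma hfor_eq:
  assumes "k \<noteq> 38"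
  shows "hsem d A \<omega> (Repeat k N P) \<sigma> =
  ((\<lambda>\<tau>. hinc k (hsem d A \<omega> P \<tau>)) ^^ nat \<lceil>av \<sigma> N\<rceil>) (\<sigma>\<lparr>av := (av \<sigma>)(k := 0)\<rparr>)"
  unfolding hsem.simps(5) hinc_eq[OF assms] ..

lemma frz_step:
  assumes "frz (insert (Sc k) (insert (Sc 38) (writes P))) \<sigma> \<tau>"
  shows "frz (insert (Sc k) (insert (Sc 38) (writes P))) \<sigma> (hinc k (hsem d A \<omega> P \<tau>))"
  using assms hsem_frame_av[of _ P d A \<omega> \<tau>] hsem_frame_vv[of _ P d A \<omega> \<tau>]
  by (simp add: frz_def)

lemma frz_iterate:
  "frz (insert (Sc k) (insert (Sc 38) (writes P))) \<sigma>
    (((\<lambda>\<tau>. hinc k (hsem d A \<omega> P \<tau>)) ^^ j) (\<sigma>\<lparr>av := (av \<sigma>)(k := 0)\<rparr>))"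
proof (induction j)
  case (Suc j)
  show ?case unfolding funpow.simps o_apply by (rule frz_step[OF Suc])
qed (simp add: frz_def)

text \<open>Each step is given the frame condition relative to the state before the loop, so that an
  invariant \<open>I\<close> need not repeat which cells are constant.\<close>

lemma hfor_rule:
  assumes k: "k \<noteq> 38" and n: "n = nat \<lceil>av \<sigma> N\<rceil>"
    and base: "I 0 (\<sigma>\<lparr>av := (av \<sigma>)(k := 0)\<rparr>)"
    and step: "\<And>j \<tau>. j < n \<Longrightarrow> frz (insert (Sc k) (insert (Sc 38) (writes P))) \<sigma> \<tau> \<Longrightarrow> I j \<tau> \<Longrightarrow>
      I (Suc j) (hinc k (hsem d A \<omega> P \<tau>))"
  shows "I n (hsem d A \<omega> (Repeat k N P) \<sigma>)"
proof -
  let ?F = "\<lambda>\<tau>. hinc k (hsem d A \<omega> P \<tau>)"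
  have "I j ((?F ^^ j) (\<sigma>\<lparr>av := (av \<sigma>)(k := 0)\<rparr>))" if "j \<le> n" for j
    using that
  proof (induction j)
    case 0
    show ?case using base by (simp only: funpow_0)
  next
    case (Suc j)
    have j: "j < n" using Suc.prems by (rule Suc_le_lessD)
    show ?case unfolding funpow.simps o_apply
      by (rule step[OF j frz_iterate Suc.IH[OF less_imp_le[OF j]]])
  qed
  from this[OF order.refl] show ?thesis unfolding hfor_eq[OF k] n .
qed

lemma hfor_cost:
  assumes k: "k \<noteq> 38"
    and step: "\<And>\<tau>. frz (insert (Sc k) (insert (Sc 38) (writes P))) \<sigma> \<tau> \<Longrightarrow> hcost d A \<omega> P \<tau> \<le> C"
  shows "hcost d A \<omega> (Repeat k N P) \<sigma> \<le> 13 + real (nat \<lceil>av \<sigma> N\<rceil>) * (15 + C)"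
proof -
  have "(\<Sum>j<nat \<lceil>av \<sigma> N\<rceil>. 15 + hcost d A \<omega> P
      (((\<lambda>\<tau>. hinc k (hsem d A \<omega> P \<tau>)) ^^ j) (\<sigma>\<lparr>av := (av \<sigma>)(k := 0)\<rparr>)))
    \<le> (\<Sum>j<nat \<lceil>av \<sigma> N\<rceil>. 15 + C)"
    by (intro sum_mono add_left_mono step frz_iterate)
  then show ?thesis unfolding hcost.simps(5) hinc_eq[OF k] by simp
qed

section \<open>Sampling the diagonals: the program for one evaluation and what it computes\<close>

section \<open>The algorithm\<close>

text \<open>Meaning of the cells. Scalars: 0 \<open>\<delta>\<close>; 1 \<open>d\<close>; 2 \<open>p/2 - 1\<close>; 3 \<open>p/2\<close>; 4 the factor \<open>r\<close>; 5 \<open>\<mu>\<close>;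
  6 a bound \<open>B\<close> for the ratio of cell 7 and the smallest eigenvalue of \<open>N\<close>; 7 an upper bound for the
  eigenvalues of \<open>N\<close>; 8 number of samples; 9 number of Richardson steps; 10 updates since \<open>\<mu>\<close> was
  halved; 11 a cap for cell 10; 12 positive until the main loop stops; 13 number of rounds; 14 and 15
  the denominators of the estimates in cells 18 and 19 of the largest eigenvalue of \<open>N\<close> and of
  \<open>N^(-1)\<close>; 16 and 17 the sums of the vectors 2 and 3; 20 the distance of the normalised diagonals;
  21 \<open>1 / n\<close>, the tolerance for cell 20; 32 \<open>p\<close>. Vectors: 0 the diagonal of \<open>K\<close>; 1 the scaling \<open>s\<close>;
  2 and 3 the estimated diagonals of \<open>N^p\<close> and \<open>N^(-p)\<close>.\<close>

definition Nmat :: "(nat \<Rightarrow> nat \<Rightarrow> real) \<Rightarrow> (nat \<Rightarrow> real) \<Rightarrow> (nat \<Rightarrow> real) \<Rightarrow> real \<Rightarrow> nat \<Rightarrow> nat \<Rightarrow> real" where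
  "Nmat A s D \<mu> i j = s i * (A i j + (if i = j then \<mu> * D i else 0)) * s j"

text \<open>\<open>m\<close> Richardson steps of length \<open>1 / h\<close> for
  \<open>N z = b\<close>, started at 0. The result is a polynomial in \<open>N\<close> applied to
  \<open>b\<close>, which is why it multiplies each eigencoordinate by a scalar
  (\<open>coeff_rich\<close>).\<close>

definition rich :: "nat \<Rightarrow> (nat \<Rightarrow> nat \<Rightarrow> real) \<Rightarrow> real \<Rightarrow> nat \<Rightarrow> (nat \<Rightarrow> real) \<Rightarrow> nat \<Rightarrow> real" where
  "rich d N h m b = ((\<lambda>z i. z i + (b i - mv d N z i) / h) ^^ m) (\<lambda>_. 0)"

lemma rich_cong:
  assumes "\<And>i. i < d \<Longrightarrow> b i = b' i" "i < d"
  shows "rich d N h m b i = rich d N h m b' i"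
  using assms(2) unfolding rich_def
proof (induction m arbitrary: i)
  case (Suc m)
  have "mv d N (((\<lambda>z i. z i + (b i - mv d N z i) / h) ^^ m) (\<lambda>_. 0))
      = mv d N (((\<lambda>z i. z i + (b' i - mv d N z i) / h) ^^ m) (\<lambda>_. 0))"
    by (rule mv_cong) (rule Suc.IH)
  then show ?case using Suc assms(1) by simp
qed simp

lemma funpow_cong_on:
  fixes F :: "(nat \<Rightarrow> real) \<Rightarrow> nat \<Rightarrow> real"
  assumes "\<And>b b' i. (\<And>i. i < d \<Longrightarrow> b i = b' i) \<Longrightarrow> i < d \<Longrightarrow> F b i = F b' (i::nat)"
    "\<And>i. i < d \<Longrightarrow> x i = x' i" "i < d"
  shows "(F ^^ n) x i = (F ^^ n) x' i"
  using assms(3)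
proof (induction n arbitrary: i)
  case (Suc n)
  then show ?case using assms(1)[of "(F ^^ n) x" "(F ^^ n) x'"] by simp
qed (use assms(2) in simp)

text \<open>Leaves \<open>N x\<close> in vector 8 at the price of one multiplication by
  \<open>K\<close>; vector 7 is scratch.\<close>

definition appN :: "nat \<Rightarrow> vprog" where
  "appN x = Then (ForEach [Arith Times (Vc 7) (Vc 1) (Vc x)]) (Then (MulK 8 7)
    (ForEach [Arith Times (Vc 7) (Vc 0) (Vc 7), Arith Times (Vc 7) (Sc 5) (Vc 7),
         Arith Plus (Vc 8) (Vc 8) (Vc 7), Arith Times (Vc 8) (Vc 1) (Vc 8)]))"

text \<open>Replaces vector 5 by an approximation of \<open>N^(-1)\<close> applied to it; the
  right-hand side is kept in vector 6.\<close>

definition solveN :: vprog where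
  "solveN = Then (ForEach [Copy (Vc 6) (Vc 5), Const (Vc 5) 0]) (Repeat 28 9 (Then (appN 5)
    (ForEach [Arith Minus (Vc 7) (Vc 6) (Vc 8), Arith Divide (Vc 7) (Vc 7) (Sc 7), Arith Plus (Vc 5) (Vc 5) (Vc 7)])))"

text \<open>One sign vector \<open>g\<close> serves both diagonals. The power loop stops one step
  early, at \<open>y = N^(p/2 - 1) g\<close>: the squares of \<open>N y\<close> estimate the
  diagonal of \<open>N^p\<close>, while the inner product of \<open>y\<close> and \<open>N y\<close>
  is the moment of order \<open>p - 1\<close> needed as a denominator. Likewise \<open>z\<close>
  approximates \<open>N^(-p/2) g\<close>, and the inner product of \<open>z\<close> and
  \<open>N z\<close> the moment of order \<open>p - 1\<close> of the inverse.\<close>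

definition samp :: vprog where
  "samp = Then (ForEach [Coin (Vc 4)])
   (Then (ForEach [Arith Plus (Vc 4) (Vc 4) (Vc 4), Const (Vc 7) 1, Arith Minus (Vc 4) (Vc 4) (Vc 7), Copy (Vc 5) (Vc 4)])
   (Then (Repeat 26 2 (Then (appN 4) (ForEach [Copy (Vc 4) (Vc 8)])))
   (Then (appN 4)
   (Then (ForEach [Arith Times (Vc 7) (Vc 8) (Vc 8), Arith Plus (Vc 2) (Vc 2) (Vc 7), Arith Times (Vc 7) (Vc 4) (Vc 8)])
   (Then (ForEach [Arith Plus (Sc 14) (Sc 14) (Vc 7)])
   (Then (Repeat 27 3 solveN)
   (Then (appN 5)
   (Then (ForEach [Arith Times (Vc 7) (Vc 5) (Vc 5), Arith Plus (Vc 3) (Vc 3) (Vc 7), Arith Times (Vc 7) (Vc 5) (Vc 8)])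
         (ForEach [Arith Plus (Sc 15) (Sc 15) (Vc 7)])))))))))"

text \<open>The absolute values in the distance are computed as roots of squares.\<close>

definition evalp :: vprog where
  "evalp = Then (ForEach [Const (Vc 2) 0, Const (Vc 3) 0])
   (Then (Block [Const (Sc 14) 0, Const (Sc 15) 0, Const (Sc 16) 0, Const (Sc 17) 0, Const (Sc 20) 0])
   (Then (Repeat 25 8 samp)
   (Then (ForEach [Arith Plus (Sc 16) (Sc 16) (Vc 2)])
   (Then (ForEach [Arith Plus (Sc 17) (Sc 17) (Vc 3)])
   (Then (ForEach [Arith Divide (Vc 7) (Vc 2) (Sc 16), Arith Divide (Vc 8) (Vc 3) (Sc 17), Arith Minus (Vc 8) (Vc 7) (Vc 8),
              Arith Times (Vc 8) (Vc 8) (Vc 8), Root (Vc 8) (Vc 8)])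
   (Then (ForEach [Arith Plus (Sc 20) (Sc 20) (Vc 8)])
         (Block [Arith Divide (Sc 18) (Sc 16) (Sc 14), Arith Divide (Sc 19) (Sc 17) (Sc 15)])))))))"

lemma writes_appN: "writes (appN x) = {Vc 7, Vc 8}"
  by (auto simp: appN_def)

lemma writes_solveN: "writes solveN = {Sc 28, Sc 38, Vc 5, Vc 6, Vc 7, Vc 8}"
  by (auto simp: solveN_def writes_appN)

lemma writes_samp: "writes samp = {Sc 14, Sc 15, Sc 26, Sc 27, Sc 28, Sc 38, Vc 2, Vc 3, Vc 4, Vc 5, Vc 6, Vc 7, Vc 8}"
  by (auto simp: samp_def writes_appN writes_solveN)

lemma writes_evalp: "writes evalp = {Sc 14, Sc 15, Sc 16, Sc 17, Sc 18, Sc 19, Sc 20, Sc 25, Sc 26, Sc 27, Sc 28, Sc 38,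
    Vc 2, Vc 3, Vc 4, Vc 5, Vc 6, Vc 7, Vc 8}"
  by (auto simp: evalp_def writes_samp)

lemma flipfree_appN: "flipfree (appN x)" by (simp add: appN_def)

lemma flipfree_solveN: "flipfree solveN" by (simp add: solveN_def flipfree_appN)

context
  fixes d :: nat and A :: "nat \<Rightarrow> nat \<Rightarrow> real" and \<omega> :: "nat \<Rightarrow> bool"
begin

abbreviation "H \<equiv> hsem d A \<omega>"

definition NN :: "vstate \<Rightarrow> nat \<Rightarrow> nat \<Rightarrow> real" where
  "NN \<sigma> = Nmat A (vv \<sigma> 1) (vv \<sigma> 0) (av \<sigma> 5)"

lemma NN_frz: "frz W \<sigma> \<tau> \<Longrightarrow> Vc 0 \<notin> W \<Longrightarrow> Vc 1 \<notin> W \<Longrightarrow> Sc 5 \<notin> W \<Longrightarrow> NN \<tau> = NN \<sigma>"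
  by (simp add: NN_def frz_def)

lemma appN_correct:
  assumes x: "x \<noteq> 7" "x \<noteq> 8" and i: "i < d"
  shows "vv (H (appN x) \<sigma>) 8 i = mv d (NN \<sigma>) (vv \<sigma> x) i"
proof -
  define \<sigma>1 where "\<sigma>1 = H (ForEach [Arith Times (Vc 7) (Vc 1) (Vc x)]) \<sigma>"
  have s1: "av \<sigma>1 = av \<sigma>" "\<And>j. j < d \<Longrightarrow> vv \<sigma>1 7 j = vv \<sigma> 1 j * vv \<sigma> x j" "vv \<sigma>1 0 = vv \<sigma> 0" "vv \<sigma>1 1 = vv \<sigma> 1"
    unfolding \<sigma>1_def by (simp_all add: pure_ForEach hsem_frame_vv)
  have "vv (H (appN x) \<sigma>) 8 i = vv \<sigma> 1 i * (mv d A (vv \<sigma>1 7) i + av \<sigma> 5 * (vv \<sigma> 0 i * (vv \<sigma> 1 i * vv \<sigma> x i)))"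
    using i by (simp add: appN_def \<sigma>1_def[symmetric] pure_ForEach s1)
  also have "mv d A (vv \<sigma>1 7) i = (\<Sum>j<d. A i j * (vv \<sigma> 1 j * vv \<sigma> x j))"
    unfolding mv_def using s1(2) by simp
  also have "vv \<sigma> 1 i * ((\<Sum>j<d. A i j * (vv \<sigma> 1 j * vv \<sigma> x j)) + av \<sigma> 5 * (vv \<sigma> 0 i * (vv \<sigma> 1 i * vv \<sigma> x i)))
      = mv d (NN \<sigma>) (vv \<sigma> x) i"
  proof -
    have "mv d (NN \<sigma>) (vv \<sigma> x) i = (\<Sum>j<d. vv \<sigma> 1 i * (A i j * (vv \<sigma> 1 j * vv \<sigma> x j))
        + (if j = i then vv \<sigma> 1 i * (av \<sigma> 5 * (vv \<sigma> 0 i * (vv \<sigma> 1 i * vv \<sigma> x i))) else 0))"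
      unfolding mv_def NN_def Nmat_def by (intro sum.cong refl) (auto simp: algebra_simps)
    also have "\<dots> = (\<Sum>j<d. vv \<sigma> 1 i * (A i j * (vv \<sigma> 1 j * vv \<sigma> x j)))
        + vv \<sigma> 1 i * (av \<sigma> 5 * (vv \<sigma> 0 i * (vv \<sigma> 1 i * vv \<sigma> x i)))"
      using i by (simp add: sum.distrib)
    finally show ?thesis by (simp add: sum_distrib_left distrib_left)
  qed
  finally show ?thesis .
qed

lemma solveN_correct:
  assumes i: "i < d"
  shows "vv (H solveN \<sigma>) 5 i = rich d (NN \<sigma>) (av \<sigma> 7) (nat \<lceil>av \<sigma> 9\<rceil>) (vv \<sigma> 5) i"
proof -
  define \<sigma>1 where "\<sigma>1 = H (ForEach [Copy (Vc 6) (Vc 5), Const (Vc 5) 0]) \<sigma>"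
  have f1: "frz {Vc 5, Vc 6} \<sigma> \<sigma>1"
    unfolding \<sigma>1_def using frz_hsem[of "ForEach [Copy (Vc 6) (Vc 5), Const (Vc 5) 0]" \<sigma> d A \<omega>] by (simp add: insert_commute)
  have s1: "\<And>j. j < d \<Longrightarrow> vv \<sigma>1 5 j = 0" "\<And>j. j < d \<Longrightarrow> vv \<sigma>1 6 j = vv \<sigma> 5 j"
    unfolding \<sigma>1_def by (simp_all add: pure_ForEach)
  have N1: "NN \<sigma>1 = NN \<sigma>" by (rule NN_frz[OF f1]) auto
  define P where "P = Then (appN 5)
    (ForEach [Arith Minus (Vc 7) (Vc 6) (Vc 8), Arith Divide (Vc 7) (Vc 7) (Sc 7), Arith Plus (Vc 5) (Vc 5) (Vc 7)])"
  have wP: "writes P = {Vc 5, Vc 7, Vc 8}" by (auto simp: P_def writes_appN)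
  define I where "I m \<tau> \<longleftrightarrow> (\<forall>i<d. vv \<tau> 5 i = rich d (NN \<sigma>) (av \<sigma> 7) m (vv \<sigma> 5) i)" for m and \<tau> :: vstate
  have "I (nat \<lceil>av \<sigma>1 9\<rceil>) (H (Repeat 28 9 P) \<sigma>1)"
  proof (rule hfor_rule)
    show "I 0 (\<sigma>1\<lparr>av := (av \<sigma>1)(28 := 0)\<rparr>)" using s1 by (simp add: I_def rich_def)
  next
    fix j \<tau> assume f: "frz (insert (Sc 28) (insert (Sc 38) (writes P))) \<sigma>1 \<tau>" and I: "I j \<tau>"
    have N: "NN \<tau> = NN \<sigma>" using NN_frz[OF f] N1 wP by simp
    have a7: "av \<tau> 7 = av \<sigma> 7" using frz_av[OF f, of 7] frz_av[OF f1, of 7] wP by simp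
    have v6: "vv \<tau> 6 = vv \<sigma>1 6" using frz_vv[OF f, of 6] wP by simp
    show "I (Suc j) (hinc 28 (H P \<tau>))"
      unfolding I_def
    proof (intro allI impI)
      fix i assume i: "i < d"
      define \<tau>1 where "\<tau>1 = H (appN 5) \<tau>"
      have t1: "vv \<tau>1 8 i = mv d (NN \<sigma>) (vv \<tau> 5) i" "vv \<tau>1 6 = vv \<tau> 6" "vv \<tau>1 5 = vv \<tau> 5" "av \<tau>1 7 = av \<tau> 7"
        using appN_correct[of 5 i \<tau>] i N unfolding \<tau>1_def
        by (simp_all add: hsem_frame_vv hsem_frame_av writes_appN)
      have m: "mv d (NN \<sigma>) (vv \<tau> 5) i = mv d (NN \<sigma>) (rich d (NN \<sigma>) (av \<sigma> 7) j (vv \<sigma> 5)) i"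
        using I unfolding I_def by (intro fun_cong[OF mv_cong]) simp
      have "vv (H P \<tau>) 5 i = vv \<tau> 5 i + (vv \<tau> 6 i - mv d (NN \<sigma>) (vv \<tau> 5) i) / av \<tau> 7"
        using i by (simp add: P_def \<tau>1_def[symmetric] pure_ForEach t1)
      then show "vv (hinc 28 (H P \<tau>)) 5 i = rich d (NN \<sigma>) (av \<sigma> 7) (Suc j) (vv \<sigma> 5) i"
        using I i m s1(2)[OF i] unfolding I_def by (simp add: v6 a7 rich_def)
    qed
  qed auto
  moreover have "av \<sigma>1 9 = av \<sigma> 9" using frz_av[OF f1, of 9] by simp
  moreover have "H solveN \<sigma> = H (Repeat 28 9 P) \<sigma>1" by (simp add: solveN_def \<sigma>1_def P_def)
  ultimately show ?thesis using i by (simp add: I_def)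
qed

text \<open>The sign vector read off the coins from position \<open>f\<close> on; \<open>yv\<close>
  and \<open>zv\<close> below are the vectors \<open>y\<close> and \<open>z\<close> of the sample
  that starts there.\<close>

definition sg :: "nat \<Rightarrow> nat \<Rightarrow> real" where
  "sg f i = sgnb (\<omega> (f + i))"

definition yv :: "vstate \<Rightarrow> nat \<Rightarrow> nat \<Rightarrow> real" where
  "yv \<sigma> f = (mv d (NN \<sigma>) ^^ nat \<lceil>av \<sigma> 2\<rceil>) (sg f)"

definition zv :: "vstate \<Rightarrow> nat \<Rightarrow> nat \<Rightarrow> real" where
  "zv \<sigma> f = (rich d (NN \<sigma>) (av \<sigma> 7) (nat \<lceil>av \<sigma> 9\<rceil>) ^^ nat \<lceil>av \<sigma> 3\<rceil>) (sg f)"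

lemma yv_frz: "frz W \<sigma> \<tau> \<Longrightarrow> Vc 0 \<notin> W \<Longrightarrow> Vc 1 \<notin> W \<Longrightarrow> Sc 5 \<notin> W \<Longrightarrow> Sc 2 \<notin> W \<Longrightarrow> yv \<tau> = yv \<sigma>"
  using NN_frz[of W \<sigma> \<tau>] frz_av[of W \<sigma> \<tau> 2] by (intro ext) (simp add: yv_def)

lemma zv_frz: "frz W \<sigma> \<tau> \<Longrightarrow> Vc 0 \<notin> W \<Longrightarrow> Vc 1 \<notin> W \<Longrightarrow> Sc 5 \<notin> W \<Longrightarrow> Sc 3 \<notin> W \<Longrightarrow> Sc 7 \<notin> W \<Longrightarrow> Sc 9 \<notin> W \<Longrightarrow>
    zv \<tau> = zv \<sigma>"
  using NN_frz[of W \<sigma> \<tau>] frz_av[of W \<sigma> \<tau> 3] frz_av[of W \<sigma> \<tau> 7] frz_av[of W \<sigma> \<tau> 9]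
  by (intro ext) (simp add: zv_def)

lemma power_loop_correct:
  assumes i: "i < d"
  shows "vv (H (Repeat 26 2 (Then (appN 4) (ForEach [Copy (Vc 4) (Vc 8)]))) \<sigma>) 4 i
    = (mv d (NN \<sigma>) ^^ nat \<lceil>av \<sigma> 2\<rceil>) (vv \<sigma> 4) i"
proof -
  define P where "P = Then (appN 4) (ForEach [Copy (Vc 4) (Vc 8)])"
  have wP: "writes P = {Vc 4, Vc 7, Vc 8}" by (auto simp: P_def writes_appN)
  define I where "I m \<tau> \<longleftrightarrow> (\<forall>i<d. vv \<tau> 4 i = (mv d (NN \<sigma>) ^^ m) (vv \<sigma> 4) i)" for m and \<tau> :: vstate
  have "I (nat \<lceil>av \<sigma> 2\<rceil>) (H (Repeat 26 2 P) \<sigma>)"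
  proof (rule hfor_rule)
    fix j \<tau> assume f: "frz (insert (Sc 26) (insert (Sc 38) (writes P))) \<sigma> \<tau>" and I: "I j \<tau>"
    have N: "NN \<tau> = NN \<sigma>" using NN_frz[OF f] wP by simp
    have "mv d (NN \<sigma>) (vv \<tau> 4) = mv d (NN \<sigma>) ((mv d (NN \<sigma>) ^^ j) (vv \<sigma> 4))"
      using I unfolding I_def by (intro mv_cong) simp
    then show "I (Suc j) (hinc 26 (H P \<tau>))"
      by (simp add: I_def P_def pure_ForEach appN_correct N)
  qed (auto simp: I_def)
  then show ?thesis using i by (simp add: I_def P_def)
qed

lemma solve_loop_correct:
  assumes i: "i < d"
  shows "vv (H (Repeat 27 3 solveN) \<sigma>) 5 i
    = (rich d (NN \<sigma>) (av \<sigma> 7) (nat \<lceil>av \<sigma> 9\<rceil>) ^^ nat \<lceil>av \<sigma> 3\<rceil>) (vv \<sigma> 5) i"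
proof -
  let ?R = "rich d (NN \<sigma>) (av \<sigma> 7) (nat \<lceil>av \<sigma> 9\<rceil>)"
  define I where "I m \<tau> \<longleftrightarrow> (\<forall>i<d. vv \<tau> 5 i = (?R ^^ m) (vv \<sigma> 5) i)" for m and \<tau> :: vstate
  have "I (nat \<lceil>av \<sigma> 3\<rceil>) (H (Repeat 27 3 solveN) \<sigma>)"
  proof (rule hfor_rule)
    fix j \<tau> assume f: "frz (insert (Sc 27) (insert (Sc 38) (writes solveN))) \<sigma> \<tau>" and I: "I j \<tau>"
    have N: "NN \<tau> = NN \<sigma>" "av \<tau> 7 = av \<sigma> 7" "av \<tau> 9 = av \<sigma> 9"
      using NN_frz[OF f] frz_av[OF f, of 7] frz_av[OF f, of 9] by (simp_all add: writes_solveN)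
    have "?R (vv \<tau> 5) i = ?R ((?R ^^ j) (vv \<sigma> 5)) i" if "i < d" for i
      using I that unfolding I_def by (intro rich_cong) simp_all
    then show "I (Suc j) (hinc 27 (H solveN \<tau>))"
      by (simp add: I_def solveN_correct N)
  qed (auto simp: I_def)
  then show ?thesis using i by (simp add: I_def)
qed

lemma samp_correct:
  fixes \<sigma> :: vstate
  defines "y \<equiv> yv \<sigma> (fl \<sigma>)" and "z \<equiv> zv \<sigma> (fl \<sigma>)"
  shows "i < d \<Longrightarrow> vv (H samp \<sigma>) 2 i = vv \<sigma> 2 i + (mv d (NN \<sigma>) y i)\<^sup>2"
    "i < d \<Longrightarrow> vv (H samp \<sigma>) 3 i = vv \<sigma> 3 i + (z i)\<^sup>2"
    "av (H samp \<sigma>) 14 = av \<sigma> 14 + ip d y (mv d (NN \<sigma>) y)"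
    "av (H samp \<sigma>) 15 = av \<sigma> 15 + ip d z (mv d (NN \<sigma>) z)"
    "fl (H samp \<sigma>) = fl \<sigma> + d"
proof -
  define \<sigma>1 where "\<sigma>1 = H (ForEach [Coin (Vc 4)]) \<sigma>"
  define \<sigma>2 where "\<sigma>2 = H (ForEach [Arith Plus (Vc 4) (Vc 4) (Vc 4), Const (Vc 7) 1, Arith Minus (Vc 4) (Vc 4) (Vc 7), Copy (Vc 5) (Vc 4)]) \<sigma>1"
  define \<sigma>3 where "\<sigma>3 = H (Repeat 26 2 (Then (appN 4) (ForEach [Copy (Vc 4) (Vc 8)]))) \<sigma>2"
  define \<sigma>4 where "\<sigma>4 = H (appN 4) \<sigma>3"
  define \<sigma>5 where "\<sigma>5 = H (ForEach [Arith Times (Vc 7) (Vc 8) (Vc 8), Arith Plus (Vc 2) (Vc 2) (Vc 7), Arith Times (Vc 7) (Vc 4) (Vc 8)]) \<sigma>4"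
  define \<sigma>6 where "\<sigma>6 = H (ForEach [Arith Plus (Sc 14) (Sc 14) (Vc 7)]) \<sigma>5"
  define \<sigma>7 where "\<sigma>7 = H (Repeat 27 3 solveN) \<sigma>6"
  define \<sigma>8 where "\<sigma>8 = H (appN 5) \<sigma>7"
  define \<sigma>9 where "\<sigma>9 = H (ForEach [Arith Times (Vc 7) (Vc 5) (Vc 5), Arith Plus (Vc 3) (Vc 3) (Vc 7), Arith Times (Vc 7) (Vc 5) (Vc 8)]) \<sigma>8"
  have fin: "H samp \<sigma> = H (ForEach [Arith Plus (Sc 15) (Sc 15) (Vc 7)]) \<sigma>9"
    by (simp add: samp_def \<sigma>1_def \<sigma>2_def \<sigma>3_def \<sigma>4_def \<sigma>5_def \<sigma>6_def \<sigma>7_def \<sigma>8_def \<sigma>9_def)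
  note frame = hsem_frame_vv hsem_frame_av writes_appN writes_solveN
  have fl1: "fl \<sigma>1 = fl \<sigma> + d" by (simp add: \<sigma>1_def ForEach_coins)
  have g1: "vv \<sigma>1 4 i = of_bool (\<omega> (fl \<sigma> + i))" if "i < d" for i using that by (simp add: \<sigma>1_def ForEach_coins)
  have c1: "av \<sigma>1 = av \<sigma>" by (simp add: \<sigma>1_def ForEach_coins)
  have v1: "vv \<sigma>1 c = vv \<sigma> c" if "c \<noteq> 4" for c using that by (simp add: \<sigma>1_def frame)
  have fl2: "fl \<sigma>2 = fl \<sigma> + d" using fl1 by (simp add: \<sigma>2_def pure_ForEach)
  have c2: "av \<sigma>2 = av \<sigma>" using c1 by (simp add: \<sigma>2_def pure_ForEach)
  have v2: "vv \<sigma>2 c = vv \<sigma> c" if "c \<notin> {4, 5, 7}" for c using that v1 by (simp add: \<sigma>2_def frame)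
  have g2: "vv \<sigma>2 4 i = sg (fl \<sigma>) i" "vv \<sigma>2 5 i = sg (fl \<sigma>) i" if "i < d" for i
    using that by (simp_all add: \<sigma>2_def pure_ForEach g1 sg_def sgnb_def)
  have N2: "NN \<sigma>2 = NN \<sigma>" using v2 c2 by (simp add: NN_def)
  have y3: "vv \<sigma>3 4 i = y i" if "i < d" for i
  proof -
    have "vv \<sigma>3 4 i = (mv d (NN \<sigma>) ^^ nat \<lceil>av \<sigma> 2\<rceil>) (vv \<sigma>2 4) i"
      unfolding \<sigma>3_def by (subst power_loop_correct[OF that]) (simp add: N2 c2)
    also have "\<dots> = y i" unfolding y_def yv_def
      by (rule funpow_cong_on[OF _ _ that]) (auto simp: g2 intro: fun_cong[OF mv_cong])
    finally show ?thesis .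
  qed
  have fl3: "fl \<sigma>3 = fl \<sigma> + d" unfolding \<sigma>3_def by (subst fl_hsem) (simp_all add: flipfree_appN fl2)
  have c3: "av \<sigma>3 k = av \<sigma> k" if "k \<notin> {26, 38}" for k using that c2 by (simp add: \<sigma>3_def frame)
  have v3: "vv \<sigma>3 c = vv \<sigma>2 c" if "c \<notin> {4, 7, 8}" for c using that by (simp add: \<sigma>3_def frame)
  have N3: "NN \<sigma>3 = NN \<sigma>" using v2 v3 c3 by (simp add: NN_def)
  have mvy: "mv d (NN \<sigma>) (vv \<sigma>3 4) = mv d (NN \<sigma>) y" by (rule mv_cong) (rule y3)
  have u4: "vv \<sigma>4 8 i = mv d (NN \<sigma>) y i" if "i < d" for i
    unfolding \<sigma>4_def using appN_correct[of 4 i \<sigma>3] that by (simp add: N3 mvy)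
  have c4: "av \<sigma>4 = av \<sigma>3" by (rule ext) (simp add: \<sigma>4_def frame)
  have v4: "vv \<sigma>4 c = vv \<sigma>3 c" if "c \<notin> {7, 8}" for c using that by (simp add: \<sigma>4_def frame)
  have fl4: "fl \<sigma>4 = fl \<sigma> + d" using fl3 by (simp add: \<sigma>4_def fl_hsem flipfree_appN)
  have P5: "vv \<sigma>5 2 i = vv \<sigma> 2 i + (mv d (NN \<sigma>) y i)\<^sup>2" "vv \<sigma>5 7 i = y i * mv d (NN \<sigma>) y i" if "i < d" for i
    using that by (simp_all add: \<sigma>5_def pure_ForEach u4 v4 v3 v2 y3 power2_eq_square)
  have c5: "av \<sigma>5 = av \<sigma>3" by (simp add: \<sigma>5_def pure_ForEach c4)
  have v5: "vv \<sigma>5 c = vv \<sigma>4 c" if "c \<notin> {2, 7}" for c using that by (simp add: \<sigma>5_def frame)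
  have fl5: "fl \<sigma>5 = fl \<sigma> + d" by (simp add: \<sigma>5_def pure_ForEach fl4)
  have c6: "av \<sigma>6 = (av \<sigma>3)(14 := av \<sigma> 14 + ip d y (mv d (NN \<sigma>) y))" and v6: "vv \<sigma>6 = vv \<sigma>5" and fl6: "fl \<sigma>6 = fl \<sigma> + d"
    by (simp_all add: \<sigma>6_def ForEach_sum c5 c3 fl5 P5 ip_def)
  have N6: "NN \<sigma>6 = NN \<sigma>" by (simp add: NN_def c6 v6 v5 v4 v3 v2 c3)
  have z7: "vv \<sigma>7 5 i = z i" if "i < d" for i
  proof -
    have "vv \<sigma>7 5 i = (rich d (NN \<sigma>) (av \<sigma> 7) (nat \<lceil>av \<sigma> 9\<rceil>) ^^ nat \<lceil>av \<sigma> 3\<rceil>) (vv \<sigma>6 5) i"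
      unfolding \<sigma>7_def by (subst solve_loop_correct[OF that]) (simp add: N6 c6 c3)
    also have "\<dots> = z i" unfolding z_def zv_def
      by (rule funpow_cong_on[OF _ _ that]) (auto simp: v6 v5 v4 v3 g2 intro: rich_cong)
    finally show ?thesis .
  qed
  have c7: "av \<sigma>7 k = av \<sigma>6 k" if "k \<notin> {27, 28, 38}" for k using that by (simp add: \<sigma>7_def frame)
  have v7: "vv \<sigma>7 c = vv \<sigma>6 c" if "c \<notin> {5, 6, 7, 8}" for c using that by (simp add: \<sigma>7_def frame)
  have fl7: "fl \<sigma>7 = fl \<sigma> + d" unfolding \<sigma>7_def by (subst fl_hsem) (simp_all add: flipfree_solveN fl6)
  have N7: "NN \<sigma>7 = NN \<sigma>" using N6 by (simp add: NN_def v7 c7)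
  have mvz: "mv d (NN \<sigma>) (vv \<sigma>7 5) = mv d (NN \<sigma>) z" by (rule mv_cong) (rule z7)
  have u8: "vv \<sigma>8 8 i = mv d (NN \<sigma>) z i" if "i < d" for i
    unfolding \<sigma>8_def using appN_correct[of 5 i \<sigma>7] that by (simp add: N7 mvz)
  have c8: "av \<sigma>8 = av \<sigma>7" by (rule ext) (simp add: \<sigma>8_def frame)
  have v8: "vv \<sigma>8 c = vv \<sigma>7 c" if "c \<notin> {7, 8}" for c using that by (simp add: \<sigma>8_def frame)
  have fl8: "fl \<sigma>8 = fl \<sigma> + d" using fl7 by (simp add: \<sigma>8_def fl_hsem flipfree_appN)
  have S9: "vv \<sigma>9 3 i = vv \<sigma> 3 i + (z i)\<^sup>2" "vv \<sigma>9 7 i = z i * mv d (NN \<sigma>) z i" if "i < d" for i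
    using that by (simp_all add: \<sigma>9_def pure_ForEach u8 v8 v7 v6 v5 v4 v3 v2 z7 power2_eq_square)
  have c9: "av \<sigma>9 = av \<sigma>7" by (simp add: \<sigma>9_def pure_ForEach c8)
  have v9: "vv \<sigma>9 2 = vv \<sigma>5 2" by (simp add: \<sigma>9_def frame v8 v7 v6)
  have fl9: "fl \<sigma>9 = fl \<sigma> + d" by (simp add: \<sigma>9_def pure_ForEach fl8)
  show "i < d \<Longrightarrow> vv (H samp \<sigma>) 2 i = vv \<sigma> 2 i + (mv d (NN \<sigma>) y i)\<^sup>2"
    by (simp add: fin ForEach_sum v9 P5)
  show "i < d \<Longrightarrow> vv (H samp \<sigma>) 3 i = vv \<sigma> 3 i + (z i)\<^sup>2"
    by (simp add: fin ForEach_sum S9)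
  show "av (H samp \<sigma>) 14 = av \<sigma> 14 + ip d y (mv d (NN \<sigma>) y)"
    by (simp add: fin ForEach_sum c9 c7 c6)
  show "av (H samp \<sigma>) 15 = av \<sigma> 15 + ip d z (mv d (NN \<sigma>) z)"
    by (simp add: fin ForEach_sum c9 c7 c6 c3 S9 ip_def)
  show "fl (H samp \<sigma>) = fl \<sigma> + d" by (simp add: fin ForEach_sum fl9)
qed

definition Pv :: "vstate \<Rightarrow> nat \<Rightarrow> real" where
  "Pv \<sigma> i = (\<Sum>j<nat \<lceil>av \<sigma> 8\<rceil>. (mv d (NN \<sigma>) (yv \<sigma> (fl \<sigma> + j * d)) i)\<^sup>2)"

definition Sv :: "vstate \<Rightarrow> nat \<Rightarrow> real" where
  "Sv \<sigma> i = (\<Sum>j<nat \<lceil>av \<sigma> 8\<rceil>. (zv \<sigma> (fl \<sigma> + j * d) i)\<^sup>2)"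

definition E1 :: "vstate \<Rightarrow> real" where
  "E1 \<sigma> = (\<Sum>j<nat \<lceil>av \<sigma> 8\<rceil>. ip d (yv \<sigma> (fl \<sigma> + j * d)) (mv d (NN \<sigma>) (yv \<sigma> (fl \<sigma> + j * d))))"

definition E2 :: "vstate \<Rightarrow> real" where
  "E2 \<sigma> = (\<Sum>j<nat \<lceil>av \<sigma> 8\<rceil>. ip d (zv \<sigma> (fl \<sigma> + j * d)) (mv d (NN \<sigma>) (zv \<sigma> (fl \<sigma> + j * d))))"

definition dist_PS :: "vstate \<Rightarrow> real" where
  "dist_PS \<sigma> = (\<Sum>i<d. \<bar>Pv \<sigma> i / sum (Pv \<sigma>) {..<d} - Sv \<sigma> i / sum (Sv \<sigma>) {..<d}\<bar>)"

lemma evalp_correct: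
  shows "i < d \<Longrightarrow> vv (H evalp \<sigma>) 2 i = Pv \<sigma> i" "i < d \<Longrightarrow> vv (H evalp \<sigma>) 3 i = Sv \<sigma> i"
    "av (H evalp \<sigma>) 16 = sum (Pv \<sigma>) {..<d}" "av (H evalp \<sigma>) 17 = sum (Sv \<sigma>) {..<d}"
    "av (H evalp \<sigma>) 18 = sum (Pv \<sigma>) {..<d} / E1 \<sigma>" "av (H evalp \<sigma>) 19 = sum (Sv \<sigma>) {..<d} / E2 \<sigma>"
    "av (H evalp \<sigma>) 20 = dist_PS \<sigma>" "fl (H evalp \<sigma>) = fl \<sigma> + nat \<lceil>av \<sigma> 8\<rceil> * d"
proof -
  define \<sigma>1 where "\<sigma>1 = H (Block [Const (Sc 14) 0, Const (Sc 15) 0, Const (Sc 16) 0, Const (Sc 17) 0, Const (Sc 20) 0]) (H (ForEach [Const (Vc 2) 0, Const (Vc 3) 0]) \<sigma>)"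
  have f1: "frz {Sc 14, Sc 15, Sc 16, Sc 17, Sc 20, Vc 2, Vc 3} \<sigma> \<sigma>1"
    unfolding \<sigma>1_def frz_def by (auto simp: pure_ForEach hsem_frame_vv)
  have s1: "av \<sigma>1 14 = 0" "av \<sigma>1 15 = 0" "av \<sigma>1 16 = 0" "av \<sigma>1 17 = 0" "av \<sigma>1 20 = 0" "fl \<sigma>1 = fl \<sigma>"
    "\<And>i. i < d \<Longrightarrow> vv \<sigma>1 2 i = 0" "\<And>i. i < d \<Longrightarrow> vv \<sigma>1 3 i = 0"
    unfolding \<sigma>1_def by (simp_all add: pure_ForEach)
  have N1: "NN \<sigma>1 = NN \<sigma>" "yv \<sigma>1 = yv \<sigma>" "zv \<sigma>1 = zv \<sigma>" "av \<sigma>1 8 = av \<sigma> 8"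
    using NN_frz[OF f1] yv_frz[OF f1] zv_frz[OF f1] frz_av[OF f1, of 8] by simp_all
  define I where "I n \<tau> \<longleftrightarrow> fl \<tau> = fl \<sigma> + n * d \<and>
    (\<forall>i<d. vv \<tau> 2 i = (\<Sum>j<n. (mv d (NN \<sigma>) (yv \<sigma> (fl \<sigma> + j * d)) i)\<^sup>2)) \<and>
    (\<forall>i<d. vv \<tau> 3 i = (\<Sum>j<n. (zv \<sigma> (fl \<sigma> + j * d) i)\<^sup>2)) \<and>
    av \<tau> 14 = (\<Sum>j<n. ip d (yv \<sigma> (fl \<sigma> + j * d)) (mv d (NN \<sigma>) (yv \<sigma> (fl \<sigma> + j * d)))) \<and>
    av \<tau> 15 = (\<Sum>j<n. ip d (zv \<sigma> (fl \<sigma> + j * d)) (mv d (NN \<sigma>) (zv \<sigma> (fl \<sigma> + j * d))))" for n and \<tau> :: vstate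
  define \<sigma>2 where "\<sigma>2 = H (Repeat 25 8 samp) \<sigma>1"
  have "I (nat \<lceil>av \<sigma>1 8\<rceil>) \<sigma>2"
    unfolding \<sigma>2_def
  proof (rule hfor_rule)
    show "I 0 (\<sigma>1\<lparr>av := (av \<sigma>1)(25 := 0)\<rparr>)" using s1 by (simp add: I_def)
  next
    fix j \<tau> assume f: "frz (insert (Sc 25) (insert (Sc 38) (writes samp))) \<sigma>1 \<tau>" and I: "I j \<tau>"
    have N: "NN \<tau> = NN \<sigma>" "yv \<tau> = yv \<sigma>" "zv \<tau> = zv \<sigma>"
      using NN_frz[OF f] yv_frz[OF f] zv_frz[OF f] N1 by (simp_all add: writes_samp)
    show "I (Suc j) (hinc 25 (H samp \<tau>))"
      using I unfolding I_def by (simp add: samp_correct N add.assoc add.commute)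
  qed auto
  then have I2: "I (nat \<lceil>av \<sigma> 8\<rceil>) \<sigma>2" by (simp add: N1)
  have s2: "\<And>i. i < d \<Longrightarrow> vv \<sigma>2 2 i = Pv \<sigma> i" "\<And>i. i < d \<Longrightarrow> vv \<sigma>2 3 i = Sv \<sigma> i"
    "av \<sigma>2 14 = E1 \<sigma>" "av \<sigma>2 15 = E2 \<sigma>" "fl \<sigma>2 = fl \<sigma> + nat \<lceil>av \<sigma> 8\<rceil> * d"
    using I2 unfolding I_def by (simp_all add: Pv_def Sv_def E1_def E2_def)
  have s2': "av \<sigma>2 16 = 0" "av \<sigma>2 17 = 0" "av \<sigma>2 20 = 0"
    using s1 by (simp_all add: \<sigma>2_def hsem_frame_av writes_samp)
  define \<sigma>3 where "\<sigma>3 = H (ForEach [Arith Plus (Sc 17) (Sc 17) (Vc 3)]) (H (ForEach [Arith Plus (Sc 16) (Sc 16) (Vc 2)]) \<sigma>2)"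
  have s3: "\<sigma>3 = \<sigma>2\<lparr>av := (av \<sigma>2)(16 := sum (Pv \<sigma>) {..<d}, 17 := sum (Sv \<sigma>) {..<d})\<rparr>"
    unfolding \<sigma>3_def ForEach_sum by (simp add: s2 s2')
  define bs where "bs = [Arith Divide (Vc 7) (Vc 2) (Sc 16), Arith Divide (Vc 8) (Vc 3) (Sc 17), Arith Minus (Vc 8) (Vc 7) (Vc 8),
              Arith Times (Vc 8) (Vc 8) (Vc 8), Root (Vc 8) (Vc 8)]"
  have pb: "\<forall>b\<in>set bs. pureb b" by (simp add: bs_def)
  define \<sigma>4 where "\<sigma>4 = H (ForEach bs) \<sigma>3"
  have s4: "av \<sigma>4 = av \<sigma>3" "fl \<sigma>4 = fl \<sigma>3" "vv \<sigma>4 2 = vv \<sigma>2 2" "vv \<sigma>4 3 = vv \<sigma>2 3"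
    unfolding \<sigma>4_def pure_ForEach(1,2)[OF pb] by (simp_all add: hsem_frame_vv bs_def s3)
  have v4: "vv \<sigma>4 8 i = \<bar>Pv \<sigma> i / sum (Pv \<sigma>) {..<d} - Sv \<sigma> i / sum (Sv \<sigma>) {..<d}\<bar>" if "i < d" for i
    unfolding \<sigma>4_def pure_ForEach(3)[OF pb that] using that
    by (simp add: bs_def s3 s2 real_sqrt_abs2)
  have fin: "H evalp \<sigma> = H (Block [Arith Divide (Sc 18) (Sc 16) (Sc 14), Arith Divide (Sc 19) (Sc 17) (Sc 15)])
      (H (ForEach [Arith Plus (Sc 20) (Sc 20) (Vc 8)]) \<sigma>4)"
    by (simp add: evalp_def \<sigma>1_def \<sigma>2_def \<sigma>3_def \<sigma>4_def bs_def)
  show "i < d \<Longrightarrow> vv (H evalp \<sigma>) 2 i = Pv \<sigma> i" "i < d \<Longrightarrow> vv (H evalp \<sigma>) 3 i = Sv \<sigma> i"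
    "av (H evalp \<sigma>) 16 = sum (Pv \<sigma>) {..<d}" "av (H evalp \<sigma>) 17 = sum (Sv \<sigma>) {..<d}"
    "av (H evalp \<sigma>) 18 = sum (Pv \<sigma>) {..<d} / E1 \<sigma>" "av (H evalp \<sigma>) 19 = sum (Sv \<sigma>) {..<d} / E2 \<sigma>"
    "av (H evalp \<sigma>) 20 = dist_PS \<sigma>" "fl (H evalp \<sigma>) = fl \<sigma> + nat \<lceil>av \<sigma> 8\<rceil> * d"
    unfolding fin ForEach_sum by (simp_all add: s4 s2 s3 s2' v4 dist_PS_def)
qed

end

section \<open>Quadratic forms, the lower bound for the optimum, and the potential\<close>

section \<open>Condition numbers and quadratic forms\<close>

definition fm :: "real mat \<Rightarrow> nat \<Rightarrow> nat \<Rightarrow> real" where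
  "fm M i j = M $$ (i, j)"

definition fv :: "real vec \<Rightarrow> nat \<Rightarrow> real" where
  "fv v i = v $ i"

lemma mult_mat_vec_fm: "M \<in> carrier_mat d d \<Longrightarrow> v \<in> carrier_vec d \<Longrightarrow> i < d \<Longrightarrow> (M *\<^sub>v v) $ i = mv d (fm M) (fv v) i"
  by (auto simp: scalar_prod_def mv_def fm_def fv_def atLeast0LessThan intro!: sum.cong)

lemma scalar_prod_fv: "v \<in> carrier_vec d \<Longrightarrow> M \<in> carrier_mat d d \<Longrightarrow>
    scalar_prod v (M *\<^sub>v v) = ip d (fv v) (mv d (fm M) (fv v))"
  unfolding scalar_prod_def ip_def using mult_mat_vec_fm[of M d v]
  by (auto simp: fv_def atLeast0LessThan simp del: index_mult_mat_vec intro!: sum.cong)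

lemma positive_definite_iff:
  "positive_definite d M \<longleftrightarrow> M \<in> carrier_mat d d \<and> sym_mat d (fm M) \<and>
    (\<forall>x. (\<exists>i<d. x i \<noteq> 0) \<longrightarrow> 0 < ip d x (mv d (fm M) x))"
proof (cases "M \<in> carrier_mat d d")
  case M: True
  have "transpose_mat M = M \<longleftrightarrow> sym_mat d (fm M)"
    using M by (auto simp: sym_mat_def fm_def mat_eq_iff)
  moreover have "(\<forall>x\<in>carrier_vec d. x \<noteq> 0\<^sub>v d \<longrightarrow> scalar_prod x (M *\<^sub>v x) > 0) \<longleftrightarrow>
    (\<forall>x. (\<exists>i<d. x i \<noteq> 0) \<longrightarrow> 0 < ip d x (mv d (fm M) x))" (is "?L \<longleftrightarrow> ?R")
  proof
    assume L: ?L
    show ?R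
    proof (intro allI impI)
      fix x assume x: "\<exists>i<d. x i \<noteq> (0::real)"
      define v where "v = Matrix.vec d x"
      have v: "v \<in> carrier_vec d" "v \<noteq> 0\<^sub>v d" using x by (auto simp: v_def vec_eq_iff)
      have e: "fv v i = x i" if "i < d" for i using that by (simp add: fv_def v_def)
      have "mv d (fm M) (fv v) = mv d (fm M) x" by (rule mv_cong) (rule e)
      then have "ip d (fv v) (mv d (fm M) (fv v)) = ip d x (mv d (fm M) x)"
        by (intro ip_cong) (simp_all add: e)
      then show "0 < ip d x (mv d (fm M) x)" using L v scalar_prod_fv[OF v(1) M] by auto
    qed
  next
    assume R: ?R
    show ?L
    proof (intro ballI impI)
      fix v :: "real vec" assume v: "v \<in> carrier_vec d" "v \<noteq> 0\<^sub>v d"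
      then have "\<exists>i<d. fv v i \<noteq> 0" by (auto simp: fv_def vec_eq_iff)
      then show "scalar_prod v (M *\<^sub>v v) > 0" using R scalar_prod_fv[OF v(1) M] by auto
    qed
  qed
  ultimately show ?thesis using M by (simp add: positive_definite_def)
qed (simp add: positive_definite_def)

text \<open>An eigenvector has some nonzero coefficient with respect to \<open>V\<close>; comparing
  this coefficient on both sides of the eigenvalue equation gives
  \<open>\<mu> a = k\<close>.\<close>

lemma spectrum_eq_image:
  assumes M: "M \<in> carrier_mat d d" and "spectral d (fm M) V \<mu>"
  shows "spectrum M = \<mu> ` {..<d}"
proof -
  interpret spectral d "fm M" V \<mu> by fact
  show ?thesis
  proof (rule Set.set_eqI, rule iffI)
    fix k assume "k \<in> spectrum M"
    then obtain v where v: "v \<in> carrier_vec d" "v \<noteq> 0\<^sub>v d" "M *\<^sub>v v = k \<cdot>\<^sub>v v"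
      using M by (auto simp: spectrum_def eigenvalue_def eigenvector_def)
    have mk: "mv d (fm M) (fv v) i = k * fv v i" if "i < d" for i
      using mult_mat_vec_fm[OF M v(1) that] v that by (simp add: fv_def del: index_mult_mat_vec)
    have "\<exists>a<d. ip d (V a) (fv v) \<noteq> 0"
    proof (rule ccontr)
      assume "\<not> ?thesis"
      then have "fv v i = 0" if "i < d" for i using expand[OF that, of "fv v"] by simp
      then show False using v(1,2) by (auto simp: fv_def vec_eq_iff)
    qed
    then obtain a where a: "a < d" "ip d (V a) (fv v) \<noteq> 0" by blast
    have "\<mu> a * ip d (V a) (fv v) = ip d (V a) (\<lambda>i. k * fv v i)"
      unfolding coeff_mv[OF a(1), symmetric] by (rule ip_cong) (simp_all add: mk)
    then have "\<mu> a = k" using a(2) by (simp add: ip_scale_right)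
    then show "k \<in> \<mu> ` {..<d}" using a(1) by blast
  next
    fix k assume "k \<in> \<mu> ` {..<d}"
    then obtain a where a: "a < d" "k = \<mu> a" by blast
    define v where "v = Matrix.vec d (V a)"
    have vc: "v \<in> carrier_vec d" by (simp add: v_def)
    have e: "fv v i = V a i" if "i < d" for i using that by (simp add: fv_def v_def)
    have "v \<noteq> 0\<^sub>v d"
    proof
      assume "v = 0\<^sub>v d"
      then have "V a i = 0" if "i < d" for i using that e[OF that] by (simp add: fv_def)
      then show False using sum_V_sq[OF a(1)] by simp
    qed
    moreover have "M *\<^sub>v v = k \<cdot>\<^sub>v v"
    proof (rule eq_vecI)
      fix i assume "i < dim_vec (k \<cdot>\<^sub>v v)"
      then have i: "i < d" by (simp add: v_def)
      have "mv d (fm M) (fv v) i = (\<Sum>b<d. ip d (V b) (mv d (fm M) (fv v)) * V b i)" by (rule expand[OF i])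
      also have "\<dots> = (\<Sum>b<d. \<mu> b * ip d (V b) (fv v) * V b i)" by (simp add: coeff_mv)
      also have "\<dots> = (\<Sum>b<d. if b = a then \<mu> a * V a i else 0)"
      proof (intro sum.cong refl)
        fix b assume "b \<in> {..<d}"
        then have "ip d (V b) (fv v) = of_bool (b = a)"
          using orthD[of b a] a(1) e by (simp add: ip_def)
        then show "\<mu> b * ip d (V b) (fv v) * V b i = (if b = a then \<mu> a * V a i else 0)" by simp
      qed
      also have "\<dots> = k * V a i" using a by simp
      finally show "(M *\<^sub>v v) $ i = (k \<cdot>\<^sub>v v) $ i"
        using mult_mat_vec_fm[OF M vc i] e[OF i] i by (simp add: v_def del: index_mult_mat_vec)
    qed (use M in \<open>simp add: v_def\<close>)
    ultimately show "k \<in> spectrum M"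
      using M vc by (auto simp: spectrum_def eigenvalue_def eigenvector_def)
  qed
qed

lemma cond_number_bounds:
  assumes pd: "positive_definite d M" and d: "1 \<le> d"
  shows "\<exists>lo hi. 0 < lo \<and> cond_number M = hi / lo \<and> lo \<le> hi \<and>
    (\<forall>x. lo * ip d x x \<le> ip d x (mv d (fm M) x)) \<and> (\<forall>x. ip d x (mv d (fm M) x) \<le> hi * ip d x x)"
proof -
  from pd have M: "M \<in> carrier_mat d d" "sym_mat d (fm M)"
    and pos: "\<And>x. (\<exists>i<d. x i \<noteq> 0) \<Longrightarrow> 0 < ip d x (mv d (fm M) x)"
    by (auto simp: positive_definite_iff)
  obtain V \<mu> where sp: "spectral d (fm M) V \<mu>" by (rule spectral_exists[OF M(2)])
  interpret spectral d "fm M" V \<mu> by (rule sp)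
  have s: "spectrum M = \<mu> ` {..<d}" by (rule spectrum_eq_image[OF M(1) sp])
  have "0 \<in> {..<d}" using d by simp
  then have fin: "finite (\<mu> ` {..<d})" "\<mu> ` {..<d} \<noteq> {}" by blast+
  define lo where "lo = Min (\<mu> ` {..<d})"
  define hi where "hi = Max (\<mu> ` {..<d})"
  have b: "lo \<le> \<mu> a" "\<mu> a \<le> hi" if "a < d" for a using fin that by (auto simp: lo_def hi_def)
  obtain a where a: "a < d" "lo = \<mu> a" using Min_in[OF fin] by (auto simp: lo_def)
  have "\<exists>i<d. V a i \<noteq> 0"
  proof (rule ccontr)
    assume "\<not> ?thesis"
    then show False using sum_V_sq[OF a(1)] by simp
  qed
  from pos[OF this] have "0 < \<mu> a"
  proof -
    have c: "ip d (V b) (V a) = of_bool (b = a)" if "b < d" for b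
      using orthD[OF that a(1)] by (simp add: ip_def)
    have "ip d (V a) (mv d (fm M) (V a)) = (\<Sum>b<d. \<mu> b * of_bool (b = a))"
      unfolding quad by (intro sum.cong) (simp_all add: c)
    also have "\<dots> = \<mu> a" using a(1) by simp
    finally show ?thesis using pos[OF \<open>\<exists>i<d. V a i \<noteq> 0\<close>] by simp
  qed
  show ?thesis
  proof (intro exI conjI allI)
    show "0 < lo" using \<open>0 < \<mu> a\<close> a by simp
    show "cond_number M = hi / lo" by (simp add: cond_number_def s lo_def hi_def)
    show "lo \<le> hi" using b[OF a(1)] by linarith
    show "lo * ip d x x \<le> ip d x (mv d (fm M) x)" for x by (rule quad_ge) (rule b)
    show "ip d x (mv d (fm M) x) \<le> hi * ip d x x" for x by (rule quad_le) (rule b)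
  qed
qed

lemma cond_number_le:
  assumes M: "M \<in> carrier_mat d d" "sym_mat d (fm M)" and d: "1 \<le> d" and lo: "0 < lo"
    and b: "\<And>x. lo * ip d x x \<le> ip d x (mv d (fm M) x)" "\<And>x. ip d x (mv d (fm M) x) \<le> hi * ip d x x"
  shows "positive_definite d M" "cond_number M \<le> hi / lo"
proof -
  have "0 < ip d x (mv d (fm M) x)" if "\<exists>i<d. x i \<noteq> 0" for x
  proof -
    have "0 < ip d x x" using that ip_self_pos by blast
    then have "0 < lo * ip d x x" using lo by simp
    then show ?thesis using b(1)[of x] by linarith
  qed
  then show "positive_definite d M" using M by (simp add: positive_definite_iff)
  obtain V \<mu> where sp: "spectral d (fm M) V \<mu>" by (rule spectral_exists[OF M(2)])
  interpret spectral d "fm M" V \<mu> by (rule sp)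
  have s: "spectrum M = \<mu> ` {..<d}" by (rule spectrum_eq_image[OF M(1) sp])
  have "0 \<in> {..<d}" using d by simp
  then have fin: "finite (\<mu> ` {..<d})" "\<mu> ` {..<d} \<noteq> {}" by blast+
  have mu: "lo \<le> \<mu> a" "\<mu> a \<le> hi" if "a < d" for a
    using eig_ge[OF b(1) that] eig_le[OF b(2) that] by auto
  have "Max (\<mu> ` {..<d}) \<le> hi" using fin mu by simp
  moreover have lm: "lo \<le> Min (\<mu> ` {..<d})" using fin mu by simp
  moreover have "0 \<le> hi" using mu[of 0] d lo by simp
  ultimately show "cond_number M \<le> hi / lo"
    unfolding cond_number_def s using lo by (intro frac_le) auto
qed

lemma outer_scale_fm:
  assumes "K \<in> carrier_mat d d" "i < d" "j < d"
  shows "fm (outer_scale d K w) i j = sqrt (w $ i) * fm K i j * sqrt (w $ j)"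
proof -
  define f where "f i = sqrt (w $ i)" for i
  have 1: "mat_diag d f * K = Matrix.mat d d (\<lambda>(i, j). f i * K $$ (i, j))"
    by (rule mat_diag_mult_left[OF assms(1)])
  have "mat_diag d f * K * mat_diag d f = Matrix.mat d d (\<lambda>(i, j). f i * K $$ (i, j) * f j)"
    unfolding 1 by (subst mat_diag_mult_right[of _ d]) auto
  then show ?thesis using assms by (simp add: outer_scale_def fm_def f_def[abs_def])
qed

lemma outer_scale_carrier: "K \<in> carrier_mat d d \<Longrightarrow> outer_scale d K w \<in> carrier_mat d d"
  unfolding outer_scale_def by (intro mult_carrier_mat) (auto simp: mat_diag_def)

lemma ip_scaled:
  assumes "\<And>i j. i < d \<Longrightarrow> j < d \<Longrightarrow> N i j = c i * A i j * c j"
  shows "ip d x (mv d N x) = ip d (\<lambda>i. c i * x i) (mv d A (\<lambda>i. c i * x i))"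
  unfolding ip_def mv_def using assms
  by (intro sum.cong refl) (simp add: sum_distrib_left mult.assoc mult.left_commute)

text \<open>The substitution of \<open>x i / sqrt (w i)\<close> for \<open>x i\<close> turns
  eigenvalue bounds of the scaled matrix into a sandwich of \<open>K\<close> between multiples of
  \<open>diag (1 / w)\<close>. A zero weight is impossible, since its unit vector would have
  quadratic form 0.\<close>

lemma feasible_scaling:
  fixes w :: "real vec"
  assumes d: "1 \<le> d" and K: "K \<in> carrier_mat d d" and w: "nonneg_vec d w"
    and pd: "positive_definite d (outer_scale d K w)"
  shows "\<exists>lo hi. 0 < lo \<and> cond_number (outer_scale d K w) = hi / lo \<and> lo \<le> hi \<and>
    (\<forall>i<d. 0 < w $ i) \<and>
    (\<forall>x. lo * (\<Sum>i<d. (x i)\<^sup>2 / w $ i) \<le> ip d x (mv d (fm K) x)) \<and>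
    (\<forall>x. ip d x (mv d (fm K) x) \<le> hi * (\<Sum>i<d. (x i)\<^sup>2 / w $ i))"
proof -
  let ?M = "outer_scale d K w"
  from cond_number_bounds[OF pd d]
  obtain lo hi where b: "0 < lo" "cond_number ?M = hi / lo" "lo \<le> hi"
    "\<forall>x. lo * ip d x x \<le> ip d x (mv d (fm ?M) x)" "\<forall>x. ip d x (mv d (fm ?M) x) \<le> hi * ip d x x"
    by (elim exE conjE)
  have M: "fm ?M i j = sqrt (w $ i) * fm K i j * sqrt (w $ j)" if "i < d" "j < d" for i j
    by (rule outer_scale_fm[OF K that])
  have wpos: "0 < w $ i" if i: "i < d" for i
  proof (rule ccontr)
    assume "\<not> 0 < w $ i"
    then have w0: "w $ i = 0" using w i by (auto simp: nonneg_vec_def)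
    define x where "x = (\<lambda>j. of_bool (j = i) :: real)"
    have "ip d x (mv d (fm ?M) x) = ip d (\<lambda>i. sqrt (w $ i) * x i) (mv d (fm K) (\<lambda>i. sqrt (w $ i) * x i))"
      by (rule ip_scaled) (rule M)
    also have "\<dots> = 0" unfolding ip_def using w0 by (intro sum.neutral) (simp add: x_def)
    finally have "lo * ip d x x \<le> 0" using spec[OF b(4), of x] by simp
    moreover have "ip d x x = 1" using i by (simp add: ip_def x_def)
    ultimately show False using b(1) by simp
  qed
  have q: "ip d x (mv d (fm K) x) = ip d (\<lambda>i. x i / sqrt (w $ i)) (mv d (fm ?M) (\<lambda>i. x i / sqrt (w $ i)))" for x
  proof -
    have "ip d (\<lambda>i. x i / sqrt (w $ i)) (mv d (fm ?M) (\<lambda>i. x i / sqrt (w $ i)))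
      = ip d (\<lambda>i. sqrt (w $ i) * (x i / sqrt (w $ i))) (mv d (fm K) (\<lambda>i. sqrt (w $ i) * (x i / sqrt (w $ i))))"
      by (rule ip_scaled) (rule M)
    also have "mv d (fm K) (\<lambda>i. sqrt (w $ i) * (x i / sqrt (w $ i))) = mv d (fm K) x"
      by (rule mv_cong) (use wpos in \<open>simp add: less_imp_neq[symmetric]\<close>)
    also have "ip d (\<lambda>i. sqrt (w $ i) * (x i / sqrt (w $ i))) (mv d (fm K) x) = ip d x (mv d (fm K) x)"
      by (rule ip_cong) (use wpos in \<open>auto simp: less_imp_neq[symmetric]\<close>)
    finally show ?thesis by simp
  qed
  have n: "ip d (\<lambda>i. x i / sqrt (w $ i)) (\<lambda>i. x i / sqrt (w $ i)) = (\<Sum>i<d. (x i)\<^sup>2 / w $ i)" for x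
    unfolding ip_def using wpos
    by (intro sum.cong refl) (simp add: power2_eq_square[symmetric] power_divide less_imp_le)
  show ?thesis
  proof (rule exI[of _ lo], rule exI[of _ hi], intro conjI allI impI)
    show "0 < lo" "cond_number ?M = hi / lo" "lo \<le> hi" by (rule b)+
    show "0 < w $ i" if "i < d" for i using that by (rule wpos)
    fix x
    show "lo * (\<Sum>i<d. (x i)\<^sup>2 / w $ i) \<le> ip d x (mv d (fm K) x)" unfolding q n[symmetric] by (rule spec[OF b(4)])
    show "ip d x (mv d (fm K) x) \<le> hi * (\<Sum>i<d. (x i)\<^sup>2 / w $ i)" unfolding q n[symmetric] by (rule spec[OF b(5)])
  qed
qed

section \<open>The lower bound certificate\<close>

lemma Nmat_quad:
  "ip d x (mv d (Nmat A s D \<mu>) x) = ip d (\<lambda>i. s i * x i) (mv d A (\<lambda>i. s i * x i)) + \<mu> * (\<Sum>i<d. D i * (s i * x i)\<^sup>2)"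
proof -
  define B where "B i j = A i j + (if i = j then \<mu> * D i else 0)" for i j
  have "ip d x (mv d (Nmat A s D \<mu>) x) = ip d (\<lambda>i. s i * x i) (mv d B (\<lambda>i. s i * x i))"
    by (rule ip_scaled) (simp add: Nmat_def B_def)
  also have "mv d B y i = mv d A y i + \<mu> * D i * y i" if "i < d" for y i
    using that by (simp add: mv_def B_def distrib_right sum.distrib if_distrib[of "\<lambda>u. u * _"] cong: if_cong)
  then have "ip d (\<lambda>i. s i * x i) (mv d B (\<lambda>i. s i * x i))
    = ip d (\<lambda>i. s i * x i) (\<lambda>i. mv d A (\<lambda>i. s i * x i) i + \<mu> * D i * (s i * x i))"
    by (intro ip_cong) simp_all
  also have "\<dots> = ip d (\<lambda>i. s i * x i) (mv d A (\<lambda>i. s i * x i)) + \<mu> * (\<Sum>i<d. D i * (s i * x i)\<^sup>2)"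
    unfolding ip_add_right by (simp add: ip_def sum_distrib_left power2_eq_square mult.assoc mult.left_commute)
  finally show ?thesis .
qed

lemma Nmat_sym: "sym_mat d A \<Longrightarrow> sym_mat d (Nmat A s D \<mu>)"
  by (auto simp: sym_mat_def Nmat_def)

lemma diag_quad: "i < d \<Longrightarrow> ip d (\<lambda>j. of_bool (j = i)) (mv d A (\<lambda>j. of_bool (j = i))) = A i i"
  by (simp add: ip_def mv_def)

text \<open>Tested on unit vectors, the sandwich of \<open>A\<close> gives the same one for its
  diagonal, so adding \<open>\<mu> diag A\<close> multiplies both ends by \<open>1 + \<mu>\<close>
  and leaves their ratio alone. Hence bounds obtained from the regularised matrix speak about the
  original one.\<close>

lemma Nmat_sandwich:
  assumes mu: "0 \<le> \<mu>" and s: "\<forall>i<d. 0 < s i" and w: "\<forall>i<d. 0 < w i"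
    and lo: "\<forall>x. lo * (\<Sum>i<d. (x i)\<^sup>2 / w i) \<le> ip d x (mv d A x)"
    and hi: "\<forall>x. ip d x (mv d A x) \<le> hi * (\<Sum>i<d. (x i)\<^sup>2 / w i)"
  defines "N \<equiv> Nmat A s (\<lambda>i. A i i) \<mu>" and "h \<equiv> \<lambda>i. w i / (s i)\<^sup>2"
  shows "lo * (1 + \<mu>) * (\<Sum>i<d. (x i)\<^sup>2 / h i) \<le> ip d x (mv d N x)"
    "ip d x (mv d N x) \<le> hi * (1 + \<mu>) * (\<Sum>i<d. (x i)\<^sup>2 / h i)"
proof -
  have D: "lo / w i \<le> A i i" "A i i \<le> hi / w i" if "i < d" for i
  proof -
    have "(\<Sum>j<d. (of_bool (j = i))\<^sup>2 / w j) = (\<Sum>j<d. if j = i then 1 / w i else 0)"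
      by (intro sum.cong refl) auto
    also have "\<dots> = 1 / w i" using that by simp
    finally show "lo / w i \<le> A i i" "A i i \<le> hi / w i"
      using spec[OF lo, of "\<lambda>j. of_bool (j = i)"] spec[OF hi, of "\<lambda>j. of_bool (j = i)"] diag_quad[OF that, of A] by simp_all
  qed
  define X where "X = (\<Sum>i<d. (s i * x i)\<^sup>2 / w i)"
  have X: "(\<Sum>i<d. (x i)\<^sup>2 / h i) = X"
    unfolding X_def h_def by (intro sum.cong refl) (simp add: power_mult_distrib mult.commute)
  have "lo * X \<le> (\<Sum>i<d. A i i * (s i * x i)\<^sup>2)"
    unfolding X_def sum_distrib_left
  proof (rule sum_mono)
    fix i assume "i \<in> {..<d}"
    then have "lo / w i * (s i * x i)\<^sup>2 \<le> A i i * (s i * x i)\<^sup>2" using D by (intro mult_right_mono) auto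
    then show "lo * ((s i * x i)\<^sup>2 / w i) \<le> A i i * (s i * x i)\<^sup>2" by simp
  qed
  moreover have "(\<Sum>i<d. A i i * (s i * x i)\<^sup>2) \<le> hi * X"
    unfolding X_def sum_distrib_left
  proof (rule sum_mono)
    fix i assume "i \<in> {..<d}"
    then have "A i i * (s i * x i)\<^sup>2 \<le> hi / w i * (s i * x i)\<^sup>2" using D by (intro mult_right_mono) auto
    then show "A i i * (s i * x i)\<^sup>2 \<le> hi * ((s i * x i)\<^sup>2 / w i)" by simp
  qed
  moreover have "lo * X \<le> ip d (\<lambda>i. s i * x i) (mv d A (\<lambda>i. s i * x i))"
    "ip d (\<lambda>i. s i * x i) (mv d A (\<lambda>i. s i * x i)) \<le> hi * X"
    unfolding X_def by (rule spec[OF lo], rule spec[OF hi])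
  ultimately show "lo * (1 + \<mu>) * (\<Sum>i<d. (x i)\<^sup>2 / h i) \<le> ip d x (mv d N x)"
    "ip d x (mv d N x) \<le> hi * (1 + \<mu>) * (\<Sum>i<d. (x i)\<^sup>2 / h i)"
    unfolding N_def Nmat_quad X
    using mult_left_mono[OF _ mu, of "lo * X" "\<Sum>i<d. A i i * (s i * x i)\<^sup>2"]
      mult_left_mono[OF _ mu, of "\<Sum>i<d. A i i * (s i * x i)\<^sup>2" "hi * X"]
    by (simp_all add: algebra_simps)
qed

text \<open>For a feasible \<open>w\<close>, the vectors enter through two inequalities:
  \<open>weighted_image_bound\<close> bounds the weighted sum of \<open>P\<close> by a multiple of
  \<open>E\<close>, and the lower half of the sandwich bounds the inversely weighted sum of
  \<open>S\<close> by one of \<open>1 / lo\<close> times \<open>F\<close>. The affinity bound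
  multiplies the two sums, and the weights cancel. As \<open>y\<close> and \<open>z\<close> are
  arbitrary, inaccurate samples cannot spoil the bound.\<close>

theorem certificate:
  fixes y z A :: "nat \<Rightarrow> nat \<Rightarrow> real" and d k :: nat and s :: "nat \<Rightarrow> real" and \<mu> :: real
  assumes sym: "sym_mat d A" and mu: "0 \<le> \<mu>" and s: "\<forall>i<d. 0 < s i"
    and w: "\<forall>i<d. 0 < w i" and lh: "0 < lo" "lo \<le> hi"
    and lo: "\<forall>x. lo * (\<Sum>i<d. (x i)\<^sup>2 / w i) \<le> ip d x (mv d A x)"
    and hi: "\<forall>x. ip d x (mv d A x) \<le> hi * (\<Sum>i<d. (x i)\<^sup>2 / w i)"
  defines "N \<equiv> Nmat A s (\<lambda>i. A i i) \<mu>"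
  defines "P \<equiv> \<lambda>i. \<Sum>j<k. (mv d N (y j) i)\<^sup>2" and "S \<equiv> \<lambda>i. \<Sum>j<k. (z j i)\<^sup>2"
    and "E \<equiv> \<Sum>j<k. ip d (y j) (mv d N (y j))" and "F \<equiv> \<Sum>j<k. ip d (z j) (mv d N (z j))"
  assumes dist: "(\<Sum>i<d. \<bar>P i / sum P {..<d} - S i / sum S {..<d}\<bar>) \<le> e" "e \<le> 2"
  shows "(1 - e / 2)\<^sup>2 * (sum P {..<d} / E * (sum S {..<d} / F)) \<le> hi / lo"
proof -
  define h where "h i = w i / (s i)\<^sup>2" for i
  have h: "0 < h i" if "i < d" for i using w[rule_format, OF that] s[rule_format, OF that] by (simp add: h_def)
  have sw: "lo * (1 + \<mu>) * (\<Sum>i<d. (x i)\<^sup>2 / h i) \<le> ip d x (mv d N x)"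
    "ip d x (mv d N x) \<le> hi * (1 + \<mu>) * (\<Sum>i<d. (x i)\<^sup>2 / h i)" for x
    using Nmat_sandwich[OF mu s w lo hi, where x=x] unfolding N_def h_def by blast+
  have psd: "0 \<le> ip d x (mv d N x)" for x
  proof -
    have "0 \<le> lo * (1 + \<mu>) * (\<Sum>i<d. (x i)\<^sup>2 / h i)"
      using lh mu h by (intro mult_nonneg_nonneg sum_nonneg) (auto simp: less_imp_le)
    then show ?thesis using sw(1)[of x] by linarith
  qed
  have Ns: "sym_mat d N" unfolding N_def by (rule Nmat_sym[OF sym])
  have vprog: "0 < hi * (1 + \<mu>)" "0 < lo * (1 + \<mu>)" using lh mu by auto
  have P0: "0 \<le> P i" "0 \<le> S i" for i by (simp_all add: P_def S_def sum_nonneg)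
  have E0: "0 \<le> E" "0 \<le> F" by (simp_all add: E_def F_def sum_nonneg psd)
  have "(\<Sum>i<d. h i * P i) = (\<Sum>j<k. \<Sum>i<d. h i * (mv d N (y j) i)\<^sup>2)"
    unfolding P_def sum_distrib_left by (rule sum.swap)
  also have "\<dots> \<le> (\<Sum>j<k. hi * (1 + \<mu>) * ip d (y j) (mv d N (y j)))"
    by (intro sum_mono weighted_image_bound[OF Ns psd h vprog(1) sw(2)])
  finally have 1: "(\<Sum>i<d. h i * P i) \<le> hi * (1 + \<mu>) * E" by (simp add: E_def sum_distrib_left)
  have "(\<Sum>i<d. S i / h i) = (\<Sum>j<k. \<Sum>i<d. (z j i)\<^sup>2 / h i)"
    unfolding S_def sum_divide_distrib by (rule sum.swap)
  then have "lo * (1 + \<mu>) * (\<Sum>i<d. S i / h i) = (\<Sum>j<k. lo * (1 + \<mu>) * (\<Sum>i<d. (z j i)\<^sup>2 / h i))"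
    by (simp add: sum_distrib_left)
  also have "\<dots> \<le> F" unfolding F_def by (intro sum_mono sw(1))
  finally have 2: "lo * (1 + \<mu>) * (\<Sum>i<d. S i / h i) \<le> F" .
  show ?thesis
  proof (cases "sum P {..<d} = 0 \<or> sum S {..<d} = 0")
    case True
    then have "sum P {..<d} / E * (sum S {..<d} / F) = 0" by auto
    then have "(1 - e / 2)\<^sup>2 * (sum P {..<d} / E * (sum S {..<d} / F)) = 0" by (simp only: mult_zero_right)
    also have "0 \<le> hi / lo" using lh by simp
    finally show ?thesis .
  next
    case False
    then have pos: "0 < sum P {..<d}" "0 < sum S {..<d}"
      using P0 by (auto simp: less_le sum_nonneg)
    have aff: "(1 - e / 2)\<^sup>2 * (sum P {..<d} * sum S {..<d}) \<le> (\<Sum>i<d. h i * P i) * (\<Sum>i<d. S i / h i)"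
      by (rule affinity_lower_bound) (use P0 h pos dist in auto)
    have hP: "0 \<le> (\<Sum>i<d. h i * P i)" "0 \<le> (\<Sum>i<d. S i / h i)"
      using P0 h by (auto intro!: sum_nonneg simp: less_imp_le)
    \<comment> \<open>Division by 0 gives 0, so positive denominators have to be secured before the
      final rearrangement; up to positive factors they dominate weighted sums that are positive
      here.\<close>
    have EF: "E \<noteq> 0" "F \<noteq> 0"
    proof -
      have ex: "\<exists>i<d. 0 < G i" if "0 < sum G {..<d}" for G :: "nat \<Rightarrow> real"
      proof (rule ccontr)
        assume "\<not> ?thesis"
        then have "sum G {..<d} \<le> 0" by (intro sum_nonpos) (meson lessThan_iff not_less)
        then show False using that by simp
      qed
      obtain i where i: "i < d" "0 < P i" using ex[OF pos(1)] by blast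
      then have "0 < (\<Sum>i<d. h i * P i)"
        by (intro sum_pos2[of _ i]) (use h P0 in \<open>auto simp: less_imp_le\<close>)
      then show "E \<noteq> 0" using 1 by auto
      obtain i where i: "i < d" "0 < S i" using ex[OF pos(2)] by blast
      then have "0 < (\<Sum>i<d. S i / h i)"
        by (intro sum_pos2[of _ i]) (use h P0 in \<open>auto simp: less_imp_le\<close>)
      then have "0 < lo * (1 + \<mu>) * (\<Sum>i<d. S i / h i)" using vprog(2) by simp
      then show "F \<noteq> 0" using 2 by auto
    qed
    then have EFp: "0 < E" "0 < F" using E0 by auto
    have "lo * (1 + \<mu>) * ((1 - e / 2)\<^sup>2 * (sum P {..<d} * sum S {..<d}))
        \<le> lo * (1 + \<mu>) * ((\<Sum>i<d. h i * P i) * (\<Sum>i<d. S i / h i))"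
      using aff vprog(2) by (intro mult_left_mono) auto
    also have "\<dots> = (\<Sum>i<d. h i * P i) * (lo * (1 + \<mu>) * (\<Sum>i<d. S i / h i))" by (simp add: mult.left_commute)
    also have "\<dots> \<le> (hi * (1 + \<mu>) * E) * F"
      using 1 2 hP vprog EFp by (intro mult_mono) auto
    finally have "(1 + \<mu>) * (lo * ((1 - e / 2)\<^sup>2 * (sum P {..<d} * sum S {..<d}))) \<le> (1 + \<mu>) * (hi * (E * F))"
      by (simp add: algebra_simps)
    then have "lo * ((1 - e / 2)\<^sup>2 * (sum P {..<d} * sum S {..<d})) \<le> hi * (E * F)"
      using mu by simp
    then show ?thesis using EFp lh by (simp add: field_simps)
  qed
qed

section \<open>The potential\<close>

context spectral begin

lemma inverse_spectral: "spectral d (rw (\<lambda>a. 1 / \<mu> a)) V (\<lambda>a. 1 / \<mu> a)"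
  by unfold_locales (simp_all add: orth rw_def)

lemma rw_mult:
  assumes "i < d" "j < d"
  shows "(\<Sum>k<d. rw f i k * rw g k j) = rw (\<lambda>a. f a * g a) i j"
proof -
  have "(\<Sum>k<d. rw f i k * rw g k j) = (\<Sum>k<d. \<Sum>a<d. \<Sum>b<d. (f a * V a i * (g b * V b j)) * (V a k * V b k))"
    unfolding rw_def by (intro sum.cong refl) (simp add: sum_product algebra_simps)
  also have "\<dots> = (\<Sum>a<d. \<Sum>k<d. \<Sum>b<d. (f a * V a i * (g b * V b j)) * (V a k * V b k))" by (rule sum.swap)
  also have "\<dots> = (\<Sum>a<d. \<Sum>b<d. \<Sum>k<d. (f a * V a i * (g b * V b j)) * (V a k * V b k))"
    by (rule sum.cong, rule refl, rule sum.swap)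
  also have "\<dots> = (\<Sum>a<d. \<Sum>b<d. (f a * V a i * (g b * V b j)) * of_bool (a = b))"
    using orthD by (intro sum.cong refl) (simp add: sum_distrib_left[symmetric])
  also have "\<dots> = rw (\<lambda>a. f a * g a) i j"
    unfolding rw_def by (intro sum.cong refl) simp
  finally show ?thesis .
qed

lemma rw_id: "i < d \<Longrightarrow> j < d \<Longrightarrow> rw \<mu> i j = A i j"
  by (simp add: rw_def dec)

lemma rw_one: "i < d \<Longrightarrow> j < d \<Longrightarrow> (\<And>a. a < d \<Longrightarrow> f a = 1) \<Longrightarrow> rw f i j = of_bool (i = j)"
  using compl[of i j] by (simp add: rw_def)

end

text \<open>\<open>G\<close> is a right inverse of \<open>N'\<close>, and the spectral formula gives
  a left inverse; evaluating the product of left inverse, \<open>N'\<close> and \<open>G\<close> in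
  two ways shows that they agree.\<close>

lemma inverse_scaling:
  assumes "spectral d N V \<mu>" "spectral d N' V' \<mu>'"
    and sc: "\<And>i j. i < d \<Longrightarrow> j < d \<Longrightarrow> N' i j = c i * N i j * c j"
    and c: "\<And>i. i < d \<Longrightarrow> c i \<noteq> 0" and nz: "\<And>a. a < d \<Longrightarrow> \<mu> a \<noteq> 0" "\<And>a. a < d \<Longrightarrow> \<mu>' a \<noteq> 0"
    and ij: "i < d" "j < d"
  shows "spectral.rw d V' (\<lambda>a. 1 / \<mu>' a) i j = (1 / c i) * spectral.rw d V (\<lambda>a. 1 / \<mu> a) i j * (1 / c j)"
proof -
  interpret N: spectral d N V \<mu> by fact
  interpret N': spectral d N' V' \<mu>' by fact
  define G where "G i j = (1 / c i) * N.rw (\<lambda>a. 1 / \<mu> a) i j * (1 / c j)" for i j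
  have NG: "(\<Sum>k<d. N' x k * G k j) = of_bool (x = j)" if x: "x < d" for x
  proof -
    have "(\<Sum>k<d. N' x k * G k j) = (\<Sum>k<d. c x * (N.rw \<mu> x k * N.rw (\<lambda>a. 1 / \<mu> a) k j) / c j)"
      using x c by (intro sum.cong refl) (simp add: sc G_def N.rw_id)
    also have "\<dots> = c x * (\<Sum>k<d. N.rw \<mu> x k * N.rw (\<lambda>a. 1 / \<mu> a) k j) / c j"
      by (simp add: sum_distrib_left sum_divide_distrib)
    also have "(\<Sum>k<d. N.rw \<mu> x k * N.rw (\<lambda>a. 1 / \<mu> a) k j) = of_bool (x = j)"
      unfolding N.rw_mult[OF x ij(2)] using x ij nz by (intro N.rw_one) auto
    finally show ?thesis using c[OF ij(2)] by (cases "x = j") auto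
  qed
  have IN: "(\<Sum>x<d. N'.rw (\<lambda>a. 1 / \<mu>' a) i x * N' x k) = of_bool (i = k)" if k: "k < d" for k
  proof -
    have "(\<Sum>x<d. N'.rw (\<lambda>a. 1 / \<mu>' a) i x * N' x k) = (\<Sum>x<d. N'.rw (\<lambda>a. 1 / \<mu>' a) i x * N'.rw \<mu>' x k)"
      using k by (intro sum.cong refl) (simp add: N'.rw_id)
    also have "\<dots> = of_bool (i = k)"
      unfolding N'.rw_mult[OF ij(1) k] using k ij nz by (intro N'.rw_one) auto
    finally show ?thesis .
  qed
  have "N'.rw (\<lambda>a. 1 / \<mu>' a) i j = (\<Sum>x<d. N'.rw (\<lambda>a. 1 / \<mu>' a) i x * of_bool (x = j))"
    using ij by simp
  also have "\<dots> = (\<Sum>x<d. \<Sum>k<d. N'.rw (\<lambda>a. 1 / \<mu>' a) i x * N' x k * G k j)"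
    by (intro sum.cong refl) (simp add: NG[symmetric] sum_distrib_left mult.assoc)
  also have "\<dots> = (\<Sum>k<d. (\<Sum>x<d. N'.rw (\<lambda>a. 1 / \<mu>' a) i x * N' x k) * G k j)"
    by (subst sum.swap) (simp add: sum_distrib_right)
  also have "\<dots> = (\<Sum>k<d. of_bool (i = k) * G k j)"
    by (intro sum.cong refl) (simp add: IN)
  also have "\<dots> = G i j" using ij by simp
  finally show ?thesis by (simp add: G_def)
qed

text \<open>A smooth stand-in for the \<open>p\<close>-th power of the condition number, which it
  exceeds by a factor of at most \<open>d^2\<close> (\<open>pot_ge_ratio\<close>,
  \<open>pot_le\<close>).\<close>

definition pot :: "nat \<Rightarrow> nat \<Rightarrow> (nat \<Rightarrow> real) \<Rightarrow> real" where
  "pot d p \<mu> = (\<Sum>a<d. \<mu> a ^ p) * (\<Sum>a<d. (1 / \<mu> a) ^ p)"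

lemma pot_ge_ratio:
  assumes "\<And>a. a < d \<Longrightarrow> 0 < \<mu> a" "a < d" "b < d"
  shows "(\<mu> a / \<mu> b) ^ p \<le> pot d p \<mu>"
proof -
  have "\<mu> a ^ p \<le> (\<Sum>a<d. \<mu> a ^ p)" using assms by (intro member_le_sum) (auto simp: less_imp_le)
  moreover have "(1 / \<mu> b) ^ p \<le> (\<Sum>a<d. (1 / \<mu> a) ^ p)"
    using assms by (intro member_le_sum) (auto simp: less_imp_le)
  ultimately have "\<mu> a ^ p * (1 / \<mu> b) ^ p \<le> pot d p \<mu>"
    unfolding pot_def using assms by (intro mult_mono sum_nonneg) (auto simp: less_imp_le)
  then show ?thesis by (simp add: power_divide)
qed

lemma pot_le:
  assumes pos: "\<And>a. a < d \<Longrightarrow> 0 < \<mu> a" and r: "\<And>a b. a < d \<Longrightarrow> b < d \<Longrightarrow> \<mu> a \<le> \<kappa> * \<mu> b"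
  shows "pot d p \<mu> \<le> (real d)\<^sup>2 * \<kappa> ^ p"
proof -
  have "pot d p \<mu> = (\<Sum>a<d. \<Sum>b<d. (\<mu> a / \<mu> b) ^ p)"
    unfolding pot_def sum_product by (simp add: power_divide)
  also have "\<dots> \<le> (\<Sum>a<d. \<Sum>b<d. \<kappa> ^ p)"
  proof (intro sum_mono power_mono)
    fix a b assume "a \<in> {..<d}" "b \<in> {..<d}"
    then show "\<mu> a / \<mu> b \<le> \<kappa>" "0 \<le> \<mu> a / \<mu> b"
      using pos[of a] pos[of b] r[of a b] by (auto simp: divide_le_eq)
  qed
  finally show ?thesis by (simp add: power2_eq_square mult.assoc)
qed

text \<open>Since \<open>r^(2 p) = c\<close> for \<open>p = 2^l\<close>, the bound of
  \<open>trace_power_diag_scaling\<close> weights the diagonal of \<open>N^p\<close> by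
  \<open>c\<close> on \<open>X\<close> and by \<open>1 / c\<close> elsewhere, and the diagonal of
  \<open>N^(-p)\<close> the other way round. What remains is \<open>potential_contraction\<close>
  for the shares \<open>x\<close> and \<open>y\<close> of \<open>X\<close> in the two
  traces.\<close>

theorem pot_contraction:
  assumes N: "spectral d N V \<mu>" and N': "spectral d N' V' \<mu>'" and d: "1 \<le> d"
    and pos: "\<And>a. a < d \<Longrightarrow> 0 < \<mu> a" and pos': "\<And>a. a < d \<Longrightarrow> 0 < \<mu>' a"
    and c: "0 < c" "c\<^sup>2 = 1 + \<rho> / 2" and r: "0 < r" "r ^ (2 * 2 ^ l) = c" and rho: "0 \<le> \<rho>"
    and sc: "\<And>i j. i < d \<Longrightarrow> j < d \<Longrightarrow> N' i j = f i * N i j * f j"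
    and f: "\<And>i. i < d \<Longrightarrow> f i = (if i \<in> X then r else 1 / r)" and X: "X \<subseteq> {..<d}"
  defines "a \<equiv> spectral.dg d V (\<lambda>a. \<mu> a ^ 2 ^ l)" and "b \<equiv> spectral.dg d V (\<lambda>a. (1 / \<mu> a) ^ 2 ^ l)"
  assumes gap: "\<rho> \<le> sum b X / sum b {..<d} - sum a X / sum a {..<d}"
  shows "pot d (2 ^ l) \<mu>' \<le> (1 - \<rho>\<^sup>2 / 4) * pot d (2 ^ l) \<mu>"
proof -
  interpret N: spectral d N V \<mu> by fact
  interpret N': spectral d N' V' \<mu>' by fact
  have a0: "0 < a i" "0 < b i" if "i < d" for i
    unfolding a_def b_def using that pos by (auto intro!: N.dg_pos)
  have ab: "sum a {..<d} = (\<Sum>a<d. \<mu> a ^ 2 ^ l)" "sum b {..<d} = (\<Sum>a<d. (1 / \<mu> a) ^ 2 ^ l)"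
    unfolding a_def b_def by (rule N.sum_dg)+
  have ne: "{..<d} \<noteq> {}" using d by (metis lessThan_empty_iff not_one_le_zero)
  have sp: "0 < sum a {..<d}" "0 < sum b {..<d}" using a0 ne by (auto intro!: sum_pos)
  define x where "x = sum a X / sum a {..<d}"
  define y where "y = sum b X / sum b {..<d}"
  have xy: "0 \<le> x" "x \<le> 1" "0 \<le> y" "y \<le> 1"
    using a0 X sp by (auto simp: x_def y_def less_imp_le intro!: sum_nonneg divide_nonneg_pos sum_mono2)
  have aX: "sum a X = x * sum a {..<d}" and bX: "sum b X = y * sum b {..<d}"
    using sp by (simp_all add: x_def y_def)
  have fp: "(f i)\<^sup>2 ^ 2 ^ l = (if i \<in> X then c else 1 / c)" if "i < d" for i
    using f[OF that] r by (auto simp: power_mult[symmetric] power_divide)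
  have fn: "f i \<noteq> 0" if "i < d" for i using f[OF that] r by auto
  have split: "(\<Sum>i<d. g i * (if i \<in> X then u else v)) = sum g X * u + (sum g {..<d} - sum g X) * v"
    for g :: "nat \<Rightarrow> real" and u v
  proof -
    have "(\<Sum>i<d. g i * (if i \<in> X then u else v)) = (\<Sum>i<d. (if i \<in> X then g i * u else 0) + (g i * v - (if i \<in> X then g i * v else 0)))"
      by (intro sum.cong refl) auto
    also have "\<dots> = (\<Sum>i\<in>X. g i * u) + ((\<Sum>i<d. g i * v) - (\<Sum>i\<in>X. g i * v))"
      using Int_absorb2[OF X] by (simp add: sum.distrib sum_subtractf sum.inter_restrict[symmetric] Int_commute)
    finally show ?thesis by (simp add: sum_distrib_right left_diff_distrib)
  qed
  have "(\<Sum>a<d. \<mu>' a ^ 2 ^ l) \<le> (\<Sum>i<d. a i * (f i)\<^sup>2 ^ 2 ^ l)"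
    unfolding a_def by (rule trace_power_diag_scaling[OF N N' sc])
  also have "\<dots> = (\<Sum>i<d. a i * (if i \<in> X then c else 1 / c))" by (intro sum.cong refl) (simp add: fp)
  also have "\<dots> = sum a {..<d} * (x * c + (1 - x) / c)"
    unfolding split aX by (simp add: algebra_simps diff_divide_distrib)
  finally have 1: "(\<Sum>a<d. \<mu>' a ^ 2 ^ l) \<le> sum a {..<d} * (x * c + (1 - x) / c)" .
  have "(\<Sum>a<d. (1 / \<mu>' a) ^ 2 ^ l) \<le> (\<Sum>i<d. b i * (1 / f i)\<^sup>2 ^ 2 ^ l)"
    unfolding b_def
  proof (rule trace_power_diag_scaling[OF N.inverse_spectral N'.inverse_spectral])
    show "N'.rw (\<lambda>a. 1 / \<mu>' a) i j = 1 / f i * N.rw (\<lambda>a. 1 / \<mu> a) i j * (1 / f j)" if "i < d" "j < d" for i j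
      by (rule inverse_scaling[OF N N' sc]) (use fn pos pos' that in \<open>auto simp: less_imp_neq[symmetric]\<close>)
  qed
  also have "\<dots> = (\<Sum>i<d. b i * (if i \<in> X then 1 / c else c))"
    using fp by (intro sum.cong refl) (auto simp: power_divide)
  also have "\<dots> = sum b {..<d} * (y / c + (1 - y) * c)"
    unfolding split bX by (simp add: algebra_simps diff_divide_distrib)
  finally have 2: "(\<Sum>a<d. (1 / \<mu>' a) ^ 2 ^ l) \<le> sum b {..<d} * (y / c + (1 - y) * c)" .
  have "pot d (2 ^ l) \<mu>' \<le> (sum a {..<d} * (x * c + (1 - x) / c)) * (sum b {..<d} * (y / c + (1 - y) * c))"
    unfolding pot_def using 1 2 pos' sp xy c
    by (intro mult_mono) (auto intro!: sum_nonneg mult_nonneg_nonneg add_nonneg_nonneg simp: less_imp_le)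
  also have "\<dots> = (sum a {..<d} * sum b {..<d}) * ((x * c + (1 - x) / c) * (y / c + (1 - y) * c))"
    by (simp add: mult_ac)
  also have "\<dots> \<le> (sum a {..<d} * sum b {..<d}) * (1 - \<rho>\<^sup>2 / 4)"
    using sp xy gap c rho by (intro mult_left_mono potential_contraction) (auto simp: x_def y_def)
  finally show ?thesis unfolding pot_def ab by (simp add: mult.commute)
qed

section \<open>Accuracy of the sampled diagonals and of the eigenvalue estimates\<close>

section \<open>Quality of the estimates\<close>

text \<open>Richardson iteration for a single eigenvalue \<open>x\<close> and right-hand side 1,
  hence an approximation of \<open>1 / x\<close>.\<close>

definition qr :: "real \<Rightarrow> nat \<Rightarrow> real \<Rightarrow> real" where
  "qr h m x = ((\<lambda>c. c + (1 - x * c) / h) ^^ m) 0"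

lemma qr_closed: "h \<noteq> 0 \<Longrightarrow> x * qr h m x = 1 - (1 - x / h) ^ m"
proof (induction m)
  case (Suc m)
  have "x * qr h (Suc m) x = x * qr h m x + x / h * (1 - x * qr h m x)"
    using Suc.prems by (simp add: qr_def field_simps)
  then show ?case using Suc by (simp add: field_simps)
qed (simp add: qr_def)

context spectral begin

lemma coeff_rich:
  assumes a: "a < d"
  shows "ip d (V a) (rich d A h m b) = qr h m (\<mu> a) * ip d (V a) b"
  unfolding rich_def qr_def
proof (induction m)
  case 0
  then show ?case by (simp add: ip_def)
next
  case (Suc m)
  let ?z = "((\<lambda>z i. z i + (b i - mv d A z i) / h) ^^ m) (\<lambda>_. 0)"
  have "ip d (V a) (\<lambda>i. ?z i + (b i - mv d A ?z i) / h)
      = ip d (V a) ?z + (ip d (V a) b - ip d (V a) (mv d A ?z)) / h"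
    unfolding ip_def by (simp add: sum.distrib sum_subtractf algebra_simps sum_divide_distrib diff_divide_distrib)
  then show ?case using Suc by (simp add: coeff_mv[OF a] algebra_simps diff_divide_distrib)
qed

lemma coeff_rich_funpow:
  "a < d \<Longrightarrow> ip d (V a) ((rich d A h m ^^ k) b) = qr h m (\<mu> a) ^ k * ip d (V a) b"
  by (induction k) (simp_all add: coeff_rich)

text \<open>Coordinate \<open>i\<close> of \<open>f(A) g\<close> is a random projection of row
  \<open>i\<close> of \<open>f(A)\<close>, and the squared norm of that row is the diagonal entry of
  \<open>f(A)^2\<close>. This is why squared coordinates of \<open>N^(p/2) g\<close> estimate the
  diagonal of \<open>N^p\<close>.\<close>

lemma row_of_operator:
  assumes F: "\<And>a x. a < d \<Longrightarrow> ip d (V a) (F x) = f a * ip d (V a) x" and i: "i < d"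
  shows "F x i = (\<Sum>j<d. F (\<lambda>k. of_bool (k = j)) i * x j)"
    "(\<Sum>j<d. (F (\<lambda>k. of_bool (k = j)) i)\<^sup>2) = dg (\<lambda>a. (f a)\<^sup>2) i"
proof -
  have r: "F (\<lambda>k. of_bool (k = j)) i = rw f i j" if "j < d" for j
    using coord_rw[OF F i, of "\<lambda>k. of_bool (k = j)"] ip_delta[OF that] by simp
  have "F x i = ip d (rw f i) x" by (rule coord_rw[OF F i])
  then show "F x i = (\<Sum>j<d. F (\<lambda>k. of_bool (k = j)) i * x j)"
    unfolding ip_def by (simp add: r)
  show "(\<Sum>j<d. (F (\<lambda>k. of_bool (k = j)) i)\<^sup>2) = dg (\<lambda>a. (f a)\<^sup>2) i"
    unfolding rw_norm[OF i, symmetric] ip_def by (intro sum.cong refl) (simp add: r power2_eq_square)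
qed

end

text \<open>One evaluation with all randomness fixed: \<open>h\<close> and \<open>B\<close> stand
  for cells 7 and 6, \<open>m\<close> for the number of Richardson steps, \<open>k\<close> for the
  number of samples, \<open>g\<close> for the sign vectors.\<close>

locale eval_ctx = spectral d N V \<mu> for d N V \<mu> +
  fixes h B :: real and n l m k :: nat and g :: "nat \<Rightarrow> nat \<Rightarrow> real"
  assumes d1: "1 \<le> d" and k1: "0 < k" and n1: "1 \<le> n" and l1: "1 \<le> l"
    and pos: "\<And>a. a < d \<Longrightarrow> 0 < \<mu> a" and le_h: "\<And>a. a < d \<Longrightarrow> \<mu> a \<le> h"
    and le_B: "\<And>a. a < d \<Longrightarrow> h \<le> B * \<mu> a" and m_ge: "B * (80 * real n * 2 ^ l) \<le> real m"
    and g1: "\<And>j i. (g j i)\<^sup>2 = 1"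
begin

definition "y j = (mv d N ^^ (2 ^ (l - 1) - 1)) (g j)"
definition "z j = (rich d N h m ^^ (2 ^ (l - 1))) (g j)"
definition "P i = (\<Sum>j<k. (mv d N (y j) i)\<^sup>2)"
definition "S i = (\<Sum>j<k. (z j i)\<^sup>2)"
definition "E = (\<Sum>j<k. ip d (y j) (mv d N (y j)))"
definition "F = (\<Sum>j<k. ip d (z j) (mv d N (z j)))"
definition "q a = qr h m (\<mu> a)"
definition "\<tau> = 1 / (40 * real n)"
text \<open>The energy of the samples in eigendirection \<open>a\<close>. The sums of
  \<open>P\<close> and \<open>S\<close> as well as \<open>E\<close> and \<open>F\<close> are
  weighted by these energies, whose total \<open>k d\<close> is known exactly.\<close>

definition "cc a = (\<Sum>j<k. (ip d (V a) (g j))\<^sup>2)"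
definition "aw = dg (\<lambda>a. \<mu> a ^ 2 ^ l)"
definition "bw = dg (\<lambda>a. (1 / \<mu> a) ^ 2 ^ l)"
text \<open>A quotient of adjacent moments, hence a weighted mean of the eigenvalues that leans
  towards the largest one; \<open>\<theta>'\<close> is the analogue for the inverse.\<close>

definition "\<theta> = sum P {..<d} / E"
definition "\<theta>' = sum S {..<d} / F"

lemma l2: "(2::nat) ^ l = 2 * 2 ^ (l - 1)"
  using l1 by (cases l) auto

lemma d0: "0 < d" using d1 by simp

lemma h_pos: "0 < h" using pos[OF d0] le_h[OF d0] by linarith

lemma B_pos: "1 \<le> B"
proof (rule ccontr)
  assume "\<not> 1 \<le> B"
  then have "B * \<mu> 0 < 1 * \<mu> 0" using pos[OF d0] by (intro mult_strict_right_mono) auto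
  then show False using le_B[OF d0] le_h[OF d0] by simp
qed

lemma tau: "0 < \<tau>" "\<tau> \<le> 1 / 40"
  using n1 by (auto simp: \<tau>_def field_simps)

lemma sum_cc: "(\<Sum>a<d. cc a) = real k * real d"
proof -
  have "(\<Sum>a<d. cc a) = (\<Sum>j<k. ip d (g j) (g j))"
    unfolding cc_def by (subst sum.swap) (simp add: parseval_self)
  also have "\<dots> = (\<Sum>j<k. real d)"
    using g1 by (intro sum.cong refl) (simp add: ip_def power2_eq_square[symmetric])
  finally show ?thesis by simp
qed

lemma Ny: "mv d N (y j) = (mv d N ^^ (2 ^ (l - 1))) (g j)"
proof -
  have "(2::nat) ^ (l - 1) = Suc (2 ^ (l - 1) - 1)" by simp
  then show ?thesis unfolding y_def by (metis funpow.simps(2) o_apply)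
qed

lemma sum_P: "sum P {..<d} = (\<Sum>a<d. \<mu> a ^ 2 ^ l * cc a)"
proof -
  have "sum P {..<d} = (\<Sum>j<k. ip d (mv d N (y j)) (mv d N (y j)))"
    unfolding P_def by (subst sum.swap) (simp add: ip_def power2_eq_square)
  also have "\<dots> = (\<Sum>j<k. \<Sum>a<d. \<mu> a ^ 2 ^ l * (ip d (V a) (g j))\<^sup>2)"
    unfolding parseval_self Ny
    by (intro sum.cong refl) (simp add: coeff_mv_funpow power_mult_distrib power_mult[symmetric] l2 mult.commute)
  also have "\<dots> = (\<Sum>a<d. \<mu> a ^ 2 ^ l * cc a)"
    by (subst sum.swap) (simp add: cc_def sum_distrib_left)
  finally show ?thesis .
qed

lemma E_eq: "E = (\<Sum>a<d. \<mu> a ^ (2 ^ l - 1) * cc a)"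
proof -
  have e: "Suc (2 * (2 ^ (l - 1) - 1)) = 2 ^ l - (1::nat)"
  proof -
    have "(1::nat) \<le> 2 ^ (l - 1)" by simp
    then show ?thesis unfolding l2 by linarith
  qed
  have "E = (\<Sum>j<k. \<Sum>a<d. \<mu> a ^ (2 ^ l - 1) * (ip d (V a) (g j))\<^sup>2)"
    unfolding E_def quad y_def
    by (intro sum.cong refl)
       (simp add: coeff_mv_funpow power_mult_distrib power_mult[symmetric] e[symmetric] mult.commute mult.left_commute)
  also have "\<dots> = (\<Sum>a<d. \<mu> a ^ (2 ^ l - 1) * cc a)"
    by (subst sum.swap) (simp add: cc_def sum_distrib_left)
  finally show ?thesis .
qed

lemma sum_S: "sum S {..<d} = (\<Sum>a<d. q a ^ 2 ^ l * cc a)"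
proof -
  have "sum S {..<d} = (\<Sum>j<k. ip d (z j) (z j))"
    unfolding S_def by (subst sum.swap) (simp add: ip_def power2_eq_square)
  also have "\<dots> = (\<Sum>j<k. \<Sum>a<d. q a ^ 2 ^ l * (ip d (V a) (g j))\<^sup>2)"
    unfolding parseval_self z_def
    by (intro sum.cong refl) (simp add: coeff_rich_funpow q_def power_mult_distrib power_mult[symmetric] l2 mult.commute)
  also have "\<dots> = (\<Sum>a<d. q a ^ 2 ^ l * cc a)"
    by (subst sum.swap) (simp add: cc_def sum_distrib_left)
  finally show ?thesis .
qed

lemma F_eq: "F = (\<Sum>a<d. \<mu> a * (q a ^ 2 ^ l * cc a))"
proof -
  have "F = (\<Sum>j<k. \<Sum>a<d. \<mu> a * (q a ^ 2 ^ l * (ip d (V a) (g j))\<^sup>2))"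
    unfolding F_def quad z_def
    by (intro sum.cong refl) (simp add: coeff_rich_funpow q_def power_mult_distrib power_mult[symmetric] l2 mult.commute)
  also have "\<dots> = (\<Sum>a<d. \<mu> a * (q a ^ 2 ^ l * cc a))"
    by (subst sum.swap) (simp add: cc_def sum_distrib_left)
  finally show ?thesis .
qed

lemma cc0: "0 \<le> cc a" by (simp add: cc_def sum_nonneg)

text \<open>Richardson iteration leaves the relative error
  \<open>\<zeta> = (1 - \<mu> a / h)^m\<close>. As \<open>h \<le> B * \<mu> a\<close>, it is at most
  \<open>exp (- W) \<le> 1 / W\<close> with \<open>W = 80 n p\<close>, and by Bernoulli's inequality
  the \<open>p\<close>-th power amplifies it at most \<open>p\<close>-fold. The error is one-sided:
  \<open>q a\<close> never exceeds \<open>1 / \<mu> a\<close>.\<close>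

lemma q_bounds:
  assumes a: "a < d"
  shows "0 < q a" "q a * \<mu> a \<le> 1" "(1 - \<tau>) * (1 / \<mu> a) ^ 2 ^ l \<le> q a ^ 2 ^ l" "q a ^ 2 ^ l \<le> (1 / \<mu> a) ^ 2 ^ l"
proof -
  define x where "x = \<mu> a / h"
  define \<zeta> where "\<zeta> = (1 - x) ^ m"
  have x: "0 < x" "x \<le> 1" using pos[OF a] le_h[OF a] h_pos by (auto simp: x_def)
  have qm: "\<mu> a * q a = 1 - \<zeta>" unfolding q_def x_def \<zeta>_def using h_pos by (intro qr_closed) simp
  have z0: "0 \<le> \<zeta>" using x by (simp add: \<zeta>_def)
  define W where "W = 80 * real n * 2 ^ l"
  have W: "1 \<le> W" unfolding W_def using n1 by (intro mult_ge1_I) auto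
  have "\<zeta> \<le> exp (- x) ^ m"
    unfolding \<zeta>_def using x exp_ge_add_one_self[of "- x"] by (intro power_mono) auto
  also have "\<dots> = exp (- (real m * x))" by (simp add: exp_of_nat_mult[symmetric])
  also have "\<dots> \<le> exp (- W)"
  proof -
    have "1 \<le> B * x" using le_B[OF a] h_pos by (simp add: x_def)
    then have "W * 1 \<le> W * (B * x)" using W by (intro mult_left_mono) auto
    also have "\<dots> = (B * W) * x" by simp
    also have "\<dots> \<le> real m * x" using m_ge x by (intro mult_right_mono) (auto simp: W_def)
    finally show ?thesis by simp
  qed
  also have "\<dots> \<le> 1 / W"
  proof -
    have "W \<le> exp W" using exp_ge_add_one_self[of W] by linarith
    then show ?thesis using W by (simp add: exp_minus field_simps)
  qed
  finally have zW: "\<zeta> \<le> 1 / W" .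
  have z1: "\<zeta> < 1"
  proof -
    have "2 \<le> W"
    proof -
      have "80 * (1 * 1) \<le> 80 * (real n * 2 ^ l)" using n1 by (intro mult_left_mono mult_mono) auto
      then show ?thesis by (simp add: W_def mult.assoc)
    qed
    then have "1 / W \<le> 1 / 2" by (intro divide_left_mono) auto
    then show ?thesis using zW by linarith
  qed
  have qe: "q a = (1 - \<zeta>) * (1 / \<mu> a)" using qm pos[OF a] by (simp add: field_simps)
  show "0 < q a" unfolding qe using z1 pos[OF a] by simp
  show "q a * \<mu> a \<le> 1" using qm z0 by (simp add: mult.commute)
  have qp: "q a ^ 2 ^ l = (1 - \<zeta>) ^ 2 ^ l * (1 / \<mu> a) ^ 2 ^ l" unfolding qe by (rule power_mult_distrib)
  have mp: "0 \<le> (1 / \<mu> a) ^ 2 ^ l" using pos[OF a] by simp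
  have "1 - \<tau> \<le> 1 + real (2 ^ l) * (- \<zeta>)"
  proof -
    have "real (2 ^ l) * \<zeta> \<le> real (2 ^ l) * (1 / W)" using zW by (intro mult_left_mono) auto
    also have "\<dots> = 1 / (80 * real n)" by (simp add: W_def)
    also have "\<dots> \<le> \<tau>" unfolding \<tau>_def using n1 by (intro divide_left_mono) auto
    finally show ?thesis by simp
  qed
  also have "\<dots> \<le> (1 + (- \<zeta>)) ^ 2 ^ l" using z1 by (intro Bernoulli_inequality) auto
  finally show "(1 - \<tau>) * (1 / \<mu> a) ^ 2 ^ l \<le> q a ^ 2 ^ l"
    unfolding qp using mp by (intro mult_right_mono) auto
  have "(1 - \<zeta>) ^ 2 ^ l \<le> 1" using z0 z1 by (intro power_le_one) auto
  then show "q a ^ 2 ^ l \<le> (1 / \<mu> a) ^ 2 ^ l"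
    unfolding qp using mp mult_right_mono[of "(1 - \<zeta>) ^ 2 ^ l" 1 "(1 / \<mu> a) ^ 2 ^ l"] by simp
qed

lemma rowsP: "i < d \<Longrightarrow> (\<Sum>j<d. ((mv d N ^^ (2 ^ (l - 1))) (\<lambda>x. of_bool (x = j)) i)\<^sup>2) = aw i"
  using row_of_operator(2)[of "mv d N ^^ (2 ^ (l - 1))" "\<lambda>a. \<mu> a ^ 2 ^ (l - 1)" i]
  by (simp add: coeff_mv_funpow aw_def power_mult[symmetric] l2 mult.commute)

lemma rowsS: "i < d \<Longrightarrow> (\<Sum>j<d. ((rich d N h m ^^ (2 ^ (l - 1))) (\<lambda>x. of_bool (x = j)) i)\<^sup>2) = dg (\<lambda>a. q a ^ 2 ^ l) i"
  using row_of_operator(2)[of "rich d N h m ^^ (2 ^ (l - 1))" "\<lambda>a. q a ^ 2 ^ (l - 1)" i]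
  by (simp add: coeff_rich_funpow q_def power_mult[symmetric] l2 mult.commute)

lemma aw_pos: "i < d \<Longrightarrow> 0 < aw i" "i < d \<Longrightarrow> 0 < bw i"
  unfolding aw_def bw_def using pos by (auto intro!: dg_pos)

lemma sum_aw: "sum aw {..<d} = (\<Sum>a<d. \<mu> a ^ 2 ^ l)" "sum bw {..<d} = (\<Sum>a<d. (1 / \<mu> a) ^ 2 ^ l)"
  unfolding aw_def bw_def by (rule sum_dg)+

end

text \<open>The favourable event of one evaluation, as a property of fixed vectors; in
  \<open>evaluation\<close> it is derived from \<open>\<not> Bad\<close>.\<close>

locale good_eval = eval_ctx +
  assumes goodP: "\<forall>i<d. (1 - \<tau>) * (real k * (\<Sum>j<d. ((mv d N ^^ (2 ^ (l - 1))) (\<lambda>x. of_bool (x = j)) i)\<^sup>2)) \<le> P i \<and>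
      P i \<le> (1 + \<tau>) * (real k * (\<Sum>j<d. ((mv d N ^^ (2 ^ (l - 1))) (\<lambda>x. of_bool (x = j)) i)\<^sup>2))"
    and goodS: "\<forall>i<d. (1 - \<tau>) * (real k * (\<Sum>j<d. ((rich d N h m ^^ (2 ^ (l - 1))) (\<lambda>x. of_bool (x = j)) i)\<^sup>2)) \<le> S i \<and>
      S i \<le> (1 + \<tau>) * (real k * (\<Sum>j<d. ((rich d N h m ^^ (2 ^ (l - 1))) (\<lambda>x. of_bool (x = j)) i)\<^sup>2))"
begin

lemma P_bounds:
  assumes i: "i < d"
  shows "(1 - 2 * \<tau>) * (real k * aw i) \<le> P i" "P i \<le> (1 + 2 * \<tau>) * (real k * aw i)"
proof -
  have b: "(1 - \<tau>) * (real k * aw i) \<le> P i" "P i \<le> (1 + \<tau>) * (real k * aw i)"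
    using goodP i by (simp_all add: rowsP)
  have nn: "0 \<le> real k * aw i" using aw_pos(1)[OF i] by simp
  show "(1 - 2 * \<tau>) * (real k * aw i) \<le> P i"
    by (rule order.trans[OF mult_right_mono[OF _ nn] b(1)]) (use tau in simp)
  show "P i \<le> (1 + 2 * \<tau>) * (real k * aw i)"
    by (rule order.trans[OF b(2) mult_right_mono[OF _ nn]]) (use tau in simp)
qed

text \<open>Two errors meet here, that of sampling and that of Richardson iteration;
  \<open>(1 - \<tau>)^2 \<ge> 1 - 2 \<tau>\<close> covers both.\<close>

lemma S_bounds:
  assumes i: "i < d"
  shows "(1 - 2 * \<tau>) * (real k * bw i) \<le> S i" "S i \<le> (1 + 2 * \<tau>) * (real k * bw i)"
proof -
  have b: "(1 - \<tau>) * (real k * dg (\<lambda>a. q a ^ 2 ^ l) i) \<le> S i" "S i \<le> (1 + \<tau>) * (real k * dg (\<lambda>a. q a ^ 2 ^ l) i)"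
    using goodS i by (simp_all add: rowsS)
  have lo: "(1 - \<tau>) * bw i \<le> dg (\<lambda>a. q a ^ 2 ^ l) i"
    unfolding bw_def dg_scale[symmetric] by (rule dg_mono) (rule q_bounds)
  have up: "dg (\<lambda>a. q a ^ 2 ^ l) i \<le> bw i"
    unfolding bw_def by (rule dg_mono) (rule q_bounds)
  have nn: "0 \<le> real k * bw i" using aw_pos(2)[OF i] by simp
  have "(1 - 2 * \<tau>) * (real k * bw i) \<le> (1 - \<tau>) * (1 - \<tau>) * (real k * bw i)"
    by (rule mult_right_mono[OF _ nn]) (simp add: algebra_simps)
  also have "\<dots> = (1 - \<tau>) * (real k * ((1 - \<tau>) * bw i))" by simp
  also have "\<dots> \<le> (1 - \<tau>) * (real k * dg (\<lambda>a. q a ^ 2 ^ l) i)"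
    using lo tau by (intro mult_left_mono) auto
  finally show "(1 - 2 * \<tau>) * (real k * bw i) \<le> S i" using b(1) by linarith
  have "S i \<le> (1 + \<tau>) * (real k * bw i)"
    by (rule order.trans[OF b(2)]) (use up tau in \<open>intro mult_left_mono; simp\<close>)
  also have "\<dots> \<le> (1 + 2 * \<tau>) * (real k * bw i)" by (rule mult_right_mono[OF _ nn]) (use tau in simp)
  finally show "S i \<le> (1 + 2 * \<tau>) * (real k * bw i)" .
qed

lemma sum_lower:
  assumes a: "a < d"
  shows "real k * \<mu> a ^ 2 ^ l / 2 \<le> sum P {..<d}" "real k * (1 / \<mu> a) ^ 2 ^ l / 2 \<le> sum S {..<d}"
proof -
  have t: "1 / 2 \<le> 1 - 2 * \<tau>" using tau by simp
  have "\<mu> a ^ 2 ^ l \<le> sum aw {..<d}"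
    unfolding sum_aw using a pos by (intro member_le_sum) (auto simp: less_imp_le)
  then have "1 / 2 * (real k * \<mu> a ^ 2 ^ l) \<le> (1 - 2 * \<tau>) * (real k * sum aw {..<d})"
    using t pos[OF a] by (intro mult_mono mult_left_mono) (auto simp: less_imp_le)
  also have "\<dots> = (\<Sum>i<d. (1 - 2 * \<tau>) * (real k * aw i))" by (simp add: sum_distrib_left)
  also have "\<dots> \<le> sum P {..<d}" by (intro sum_mono P_bounds) auto
  finally show "real k * \<mu> a ^ 2 ^ l / 2 \<le> sum P {..<d}" by simp
  have "(1 / \<mu> a) ^ 2 ^ l \<le> sum bw {..<d}"
    unfolding sum_aw using a pos by (intro member_le_sum) (auto simp: less_imp_le)
  then have "1 / 2 * (real k * (1 / \<mu> a) ^ 2 ^ l) \<le> (1 - 2 * \<tau>) * (real k * sum bw {..<d})"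
    using t pos[OF a] by (intro mult_mono mult_left_mono) (auto simp: less_imp_le)
  also have "\<dots> = (\<Sum>i<d. (1 - 2 * \<tau>) * (real k * bw i))" by (simp add: sum_distrib_left)
  also have "\<dots> \<le> sum S {..<d}" by (intro sum_mono S_bounds) auto
  finally show "real k * (1 / \<mu> a) ^ 2 ^ l / 2 \<le> sum S {..<d}" by simp
qed

lemma sums_pos: "0 < sum P {..<d}" "0 < sum S {..<d}"
proof -
  have "0 < real k * \<mu> 0 ^ 2 ^ l / 2" "0 < real k * (1 / \<mu> 0) ^ 2 ^ l / 2" using k1 pos[OF d0] by auto
  then show "0 < sum P {..<d}" "0 < sum S {..<d}" using sum_lower[OF d0] by linarith+
qed

lemma pw: "(2::nat) ^ l = Suc (2 ^ l - 1)" by simp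

text \<open>The moment inequality bounds the sum of \<open>P\<close> by \<open>\<theta>^p\<close>
  times the total energy \<open>k d\<close>, and accuracy bounds it below by half of
  \<open>k (\<mu> a)^p\<close>. The factor \<open>2 d\<close> shrinks to \<open>1 + 1 / n\<close>
  when \<open>p\<close>-th roots are taken later.\<close>

theorem theta_bounds:
  assumes a: "a < d"
  shows "0 < \<theta>" "0 < \<theta>'" "\<mu> a ^ 2 ^ l \<le> 2 * real d * \<theta> ^ 2 ^ l" "(1 / \<mu> a) ^ 2 ^ l \<le> 2 * real d * \<theta>' ^ 2 ^ l"
proof -
  have PE: "sum P {..<d} \<le> h * E"
    unfolding sum_P E_eq sum_distrib_left
  proof (rule sum_mono)
    fix a assume "a \<in> {..<d}"
    then have "\<mu> a * (\<mu> a ^ (2 ^ l - 1) * cc a) \<le> h * (\<mu> a ^ (2 ^ l - 1) * cc a)"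
      using le_h[of a] pos[of a] cc0[of a] by (intro mult_right_mono) auto
    then show "\<mu> a ^ 2 ^ l * cc a \<le> h * (\<mu> a ^ (2 ^ l - 1) * cc a)"
      by (subst pw) (simp only: power_Suc mult.assoc)
  qed
  have E0: "0 < E"
  proof (rule ccontr)
    assume "\<not> 0 < E"
    then have "h * E \<le> 0" using h_pos by (simp add: mult_nonneg_nonpos)
    then show False using PE sums_pos by linarith
  qed
  have SF: "sum S {..<d} \<le> B / h * F"
    unfolding sum_S F_eq sum_distrib_left
  proof (rule sum_mono)
    fix a assume a: "a \<in> {..<d}"
    have "1 \<le> B / h * \<mu> a" using a le_B[of a] h_pos by (simp add: field_simps)
    moreover have "0 \<le> q a ^ 2 ^ l * cc a" using a q_bounds(1)[of a] cc0[of a] by simp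
    ultimately have "1 * (q a ^ 2 ^ l * cc a) \<le> B / h * \<mu> a * (q a ^ 2 ^ l * cc a)" by (rule mult_right_mono)
    then show "q a ^ 2 ^ l * cc a \<le> B / h * (\<mu> a * (q a ^ 2 ^ l * cc a))" by (simp only: mult.assoc mult_1)
  qed
  have F0: "0 < F"
  proof (rule ccontr)
    assume "\<not> 0 < F"
    then have "B / h * F \<le> 0" using h_pos B_pos by (intro mult_nonneg_nonpos) auto
    then show False using SF sums_pos by linarith
  qed
  show t: "0 < \<theta>" "0 < \<theta>'" unfolding \<theta>_def \<theta>'_def using sums_pos E0 F0 by auto
  have "(\<Sum>a<d. \<mu> a ^ Suc (2 ^ l - 1) * cc a) \<le> \<theta> ^ Suc (2 ^ l - 1) * (\<Sum>a<d. cc a)"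
  proof (rule moment_le_ratio_power)
    show "(\<Sum>a<d. \<mu> a ^ Suc (2 ^ l - 1) * cc a) \<le> \<theta> * (\<Sum>a<d. \<mu> a ^ (2 ^ l - 1) * cc a)"
      unfolding pw[symmetric] sum_P[symmetric] E_eq[symmetric] \<theta>_def using E0 by simp
  qed (use pos cc0 t in \<open>auto simp: less_imp_le\<close>)
  then have 1: "sum P {..<d} \<le> \<theta> ^ 2 ^ l * (real k * real d)"
    unfolding pw[symmetric] sum_P[symmetric] sum_cc .
  have "real k * (\<mu> a ^ 2 ^ l) \<le> real k * (2 * real d * \<theta> ^ 2 ^ l)"
    using sum_lower(1)[OF a] 1 by (simp add: algebra_simps)
  then show "\<mu> a ^ 2 ^ l \<le> 2 * real d * \<theta> ^ 2 ^ l" using k1 by simp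
  have "(\<Sum>a<d. q a ^ Suc (2 ^ l - 1) * cc a) \<le> \<theta>' ^ Suc (2 ^ l - 1) * (\<Sum>a<d. cc a)"
  proof (rule moment_le_ratio_power)
    \<comment> \<open>\<open>q a * \<mu> a \<le> 1\<close> trades the factor \<open>\<mu> a\<close>
      in \<open>F\<close> for one power of \<open>q a\<close>, so that \<open>F\<close> is dominated
      by the moment adjacent to the sum of \<open>S\<close>.\<close>
    have "F \<le> (\<Sum>a<d. q a ^ (2 ^ l - 1) * cc a)"
      unfolding F_eq
    proof (rule sum_mono)
      fix a assume a: "a \<in> {..<d}"
      then have "(q a * \<mu> a) * (q a ^ (2 ^ l - 1) * cc a) \<le> 1 * (q a ^ (2 ^ l - 1) * cc a)"
        using q_bounds(1,2)[of a] cc0[of a] by (intro mult_right_mono) auto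
      then show "\<mu> a * (q a ^ 2 ^ l * cc a) \<le> q a ^ (2 ^ l - 1) * cc a"
        by (subst pw) (simp only: power_Suc mult_ac mult_1)
    qed
    then have "\<theta>' * F \<le> \<theta>' * (\<Sum>a<d. q a ^ (2 ^ l - 1) * cc a)" using t by (intro mult_left_mono) auto
    then show "(\<Sum>a<d. q a ^ Suc (2 ^ l - 1) * cc a) \<le> \<theta>' * (\<Sum>a<d. q a ^ (2 ^ l - 1) * cc a)"
      unfolding pw[symmetric] sum_S[symmetric] using F0 by (simp add: \<theta>'_def)
  qed (use q_bounds(1) cc0 t in \<open>auto simp: less_imp_le\<close>)
  then have 2: "sum S {..<d} \<le> \<theta>' ^ 2 ^ l * (real k * real d)"
    unfolding pw[symmetric] sum_S[symmetric] sum_cc .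
  have "real k * ((1 / \<mu> a) ^ 2 ^ l) \<le> real k * (2 * real d * \<theta>' ^ 2 ^ l)"
    using sum_lower(2)[OF a] 2 by (simp add: algebra_simps)
  then show "(1 / \<mu> a) ^ 2 ^ l \<le> 2 * real d * \<theta>' ^ 2 ^ l" using k1 by simp
qed

text \<open>\<open>\<theta>\<close> is a weighted mean of the eigenvalues. The bound is used in
  \<open>far_step\<close>, with \<open>U\<close> obtained from the matrix after the update.\<close>

lemma theta_le:
  assumes U: "\<And>x. ip d x (mv d N x) \<le> U * ip d x x"
  shows "\<theta> \<le> U"
proof -
  have le: "\<mu> a \<le> U" if "a < d" for a by (rule eig_le[OF U that])
  have "sum P {..<d} \<le> U * E"
    unfolding sum_P E_eq sum_distrib_left
  proof (rule sum_mono)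
    fix a assume "a \<in> {..<d}"
    then have "\<mu> a * (\<mu> a ^ (2 ^ l - 1) * cc a) \<le> U * (\<mu> a ^ (2 ^ l - 1) * cc a)"
      using le[of a] pos[of a] cc0[of a] by (intro mult_right_mono) auto
    then show "\<mu> a ^ 2 ^ l * cc a \<le> U * (\<mu> a ^ (2 ^ l - 1) * cc a)"
      by (subst pw) (simp only: power_Suc mult.assoc)
  qed
  moreover have "0 < E"
    using theta_bounds(1)[OF d0] sums_pos(1) unfolding \<theta>_def by (simp add: zero_less_divide_iff)
  ultimately show ?thesis unfolding \<theta>_def by (simp add: divide_le_eq)
qed

text \<open>On the set \<open>X\<close>, where the second share is larger, the excess is half of the
  distance, hence at least \<open>1 / (2 n)\<close>. Replacing the estimated shares by the true ones
  costs \<open>5 \<tau>\<close> for each diagonal, together \<open>1 / (4 n)\<close>, and the same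
  amount remains.\<close>

theorem gap:
  assumes dist: "1 / real n \<le> (\<Sum>i<d. \<bar>P i / sum P {..<d} - S i / sum S {..<d}\<bar>)"
  defines "X \<equiv> {i\<in>{..<d}. P i / sum P {..<d} < S i / sum S {..<d}}"
  shows "1 / (4 * real n) \<le> sum bw X / sum bw {..<d} - sum aw X / sum aw {..<d}"
proof -
  define u where "u i = S i / sum S {..<d} - P i / sum P {..<d}" for i
  have su: "(\<Sum>i<d. u i) = 0"
    using sums_pos by (simp add: u_def sum_subtractf sum_divide_distrib[symmetric])
  have XX: "X \<subseteq> {..<d}" by (auto simp: X_def)
  have "(\<Sum>i<d. \<bar>u i\<bar>) = (\<Sum>i<d. 2 * (if i \<in> X then u i else 0) - u i)"
    by (intro sum.cong refl) (auto simp: X_def u_def)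
  also have "\<dots> = 2 * sum u X"
    using Int_absorb2[OF XX] su
    by (simp add: sum_subtractf sum_distrib_left[symmetric] sum.inter_restrict[symmetric] Int_commute)
  finally have "1 / real n \<le> 2 * sum u X"
    using dist by (simp add: u_def abs_minus_commute)
  moreover have "sum u X = sum S X / sum S {..<d} - sum P X / sum P {..<d}"
    by (simp add: u_def sum_subtractf sum_divide_distrib)
  moreover have "\<bar>sum P X / sum P {..<d} - sum aw X / sum aw {..<d}\<bar> \<le> 5 * \<tau>"
  proof (rule normalized_estimate[where k="real k"])
    show "0 < sum aw {..<d}" using aw_pos d0 by (intro sum_pos) auto
  qed (use aw_pos P_bounds tau XX k1 in \<open>auto simp: less_imp_le\<close>)
  moreover have "\<bar>sum S X / sum S {..<d} - sum bw X / sum bw {..<d}\<bar> \<le> 5 * \<tau>"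
  proof (rule normalized_estimate[where k="real k"])
    show "0 < sum bw {..<d}" using aw_pos d0 by (intro sum_pos) auto
  qed (use aw_pos S_bounds tau XX k1 in \<open>auto simp: less_imp_le\<close>)
  moreover have "10 * \<tau> = 1 / (4 * real n)" "1 / real n = 4 * (1 / (4 * real n))" by (simp_all add: \<tau>_def)
  ultimately show ?thesis by linarith
qed

end

section \<open>The full program, its effect on the state, and its cost\<close>

section \<open>The complete program\<close>

text \<open>The number of samples grows with the logarithm of the round number \<open>t\<close>. The
  failure probabilities, of order \<open>\<delta> / t^2\<close>, are then summable although the
  number of rounds is not known beforehand.\<close>

definition prep :: "nat \<Rightarrow> vprog" where
  "prep n = Then (Block [Const (Sc 23) 1, Arith Plus (Sc 13) (Sc 13) (Sc 23), Const (Sc 23) 8, Arith Times (Sc 23) (Sc 23) (Sc 1),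
      Arith Times (Sc 23) (Sc 23) (Sc 13), Arith Times (Sc 23) (Sc 23) (Sc 13), Arith Divide (Sc 23) (Sc 23) (Sc 0)])
    (Then (Log2 24 29 23)
    (Block [Const (Sc 8) (12800 * n\<^sup>2), Arith Times (Sc 8) (Sc 8) (Sc 29),
      Const (Sc 9) (80 * n), Arith Times (Sc 9) (Sc 9) (Sc 32), Arith Times (Sc 9) (Sc 9) (Sc 6),
      Root (Sc 11) (Sc 6), Arith Times (Sc 11) (Sc 11) (Sc 32), Const (Sc 23) (128 * n\<^sup>2), Arith Times (Sc 11) (Sc 11) (Sc 23),
      Const (Sc 23) 1, Arith Plus (Sc 11) (Sc 11) (Sc 23)]))"

text \<open>Free of branches: both alternatives are computed and \<open>Select\<close> chooses. If
  the diagonals nearly agree, then \<open>B\<close> becomes \<open>10 \<theta> \<theta>'\<close>,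
  \<mu> is halved, and the scaling factors in cells 22 and 33 are 1; otherwise these are
  \<open>r\<close> and \<open>1 / r\<close>. The stopping test combines the new \<open>B\<close>
  with the old \<mu>, for which the estimates were made.\<close>

definition postp :: vprog where
  "postp = Then (Block [Const (Sc 31) 1, Const (Sc 30) 0, Select (Sc 22) (Sc 20) (Sc 21) (Sc 31) (Sc 4), Arith Divide (Sc 33) (Sc 31) (Sc 22),
      Arith Times (Sc 23) (Sc 18) (Sc 19), Const (Sc 24) 10, Arith Times (Sc 23) (Sc 24) (Sc 23),
      Select (Sc 6) (Sc 20) (Sc 21) (Sc 23) (Sc 6), Arith Plus (Sc 7) (Sc 18) (Sc 18),
      Arith Times (Sc 23) (Sc 5) (Sc 6), Select (Sc 23) (Sc 23) (Sc 21) (Sc 30) (Sc 31),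
      Select (Sc 24) (Sc 10) (Sc 11) (Sc 31) (Sc 30), Select (Sc 12) (Sc 20) (Sc 21) (Sc 23) (Sc 24),
      Const (Sc 23) 2, Arith Divide (Sc 23) (Sc 5) (Sc 23), Select (Sc 5) (Sc 20) (Sc 21) (Sc 23) (Sc 5),
      Arith Plus (Sc 23) (Sc 10) (Sc 31), Select (Sc 10) (Sc 20) (Sc 21) (Sc 30) (Sc 23)])
    (ForEach [Arith Divide (Vc 7) (Vc 2) (Sc 16), Arith Divide (Vc 8) (Vc 3) (Sc 17),
      Select (Vc 7) (Vc 7) (Vc 8) (Sc 22) (Sc 33), Arith Times (Vc 1) (Vc 1) (Vc 7)])"

definition bodyp :: "nat \<Rightarrow> vprog" where
  "bodyp n = Then (prep n) (Then evalp postp)"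

text \<open>The initial scaling \<open>1 / sqrt (K i i)\<close> gives unit diagonal. Taking
  \<open>l + 2\<close> square roots makes \<open>r^(4 p) = 1 + 1 / (8 n)\<close>; this is
  \<open>c^2 = 1 + \<rho> / 2\<close> of \<open>pot_contraction\<close> for
  \<open>\<rho> = 1 / (4 n)\<close>, the margin left by \<open>gap\<close>.\<close>

definition initp :: "nat \<Rightarrow> vprog" where
  "initp n = Then (ForEach [DiagEntry (Vc 0), Root (Vc 7) (Vc 0), Const (Vc 8) 1, Arith Divide (Vc 1) (Vc 8) (Vc 7)])
    (Then (Block [Dim (Sc 1), Const (Sc 23) n, Const (Sc 21) 1, Arith Divide (Sc 21) (Sc 21) (Sc 23), Copy (Sc 5) (Sc 1), Const (Sc 6) 10,
      Arith Plus (Sc 7) (Sc 1) (Sc 1), Const (Sc 10) 0, Const (Sc 13) 0, Const (Sc 12) 1,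
      Const (Sc 23) 8, Arith Times (Sc 23) (Sc 23) (Sc 1), Arith Times (Sc 23) (Sc 23) (Sc 1)])
    (Then (Log2 24 29 23)
    (Then (Block [Const (Sc 23) n, Arith Times (Sc 23) (Sc 23) (Sc 29)])
    (Then (Log2 32 22 23)
    (Then (Block [Const (Sc 23) 2, Arith Divide (Sc 3) (Sc 32) (Sc 23), Const (Sc 31) 1, Arith Minus (Sc 2) (Sc 3) (Sc 31),
      Const (Sc 4) (8 * n), Arith Divide (Sc 4) (Sc 31) (Sc 4), Arith Plus (Sc 4) (Sc 31) (Sc 4), Arith Plus (Sc 23) (Sc 22) (Sc 23)])
    (Repeat 25 23 (Block [Root (Sc 4) (Sc 4)])))))))"

lemma writes_prep: "writes (prep n) = {Sc 8, Sc 9, Sc 11, Sc 13, Sc 23, Sc 24, Sc 29, Sc 38}"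
  by (auto simp: prep_def)

lemma flipfree_prep: "flipfree (prep n)" by (auto simp: prep_def)

lemma flipfree_postp: "flipfree postp" by (auto simp: postp_def)

lemma ok_bodyp: "ok_vprog (bodyp n)"
  by (simp add: bodyp_def prep_def postp_def evalp_def samp_def writes_samp writes_appN writes_solveN appN_def solveN_def)

lemma ok_initp: "ok_vprog (initp n)"
  by (simp add: initp_def)

lemma av_bsem:
  "av (bsem d A \<omega> i (Arith f (Sc k) b c) \<sigma>) j = (if j = k then arith_op f (get i \<sigma> b) (get i \<sigma> c) else av \<sigma> j)"
  "av (bsem d A \<omega> i (Const (Sc k) n) \<sigma>) j = (if j = k then real n else av \<sigma> j)"
  "av (bsem d A \<omega> i (Dim (Sc k)) \<sigma>) j = (if j = k then real d else av \<sigma> j)"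
  "av (bsem d A \<omega> i (Copy (Sc k) b) \<sigma>) j = (if j = k then get i \<sigma> b else av \<sigma> j)"
  "av (bsem d A \<omega> i (Root (Sc k) b) \<sigma>) j = (if j = k then sqrt (get i \<sigma> b) else av \<sigma> j)"
  "av (bsem d A \<omega> i (Select (Sc k) a b c e) \<sigma>) j =
    (if j = k then (if get i \<sigma> a < get i \<sigma> b then get i \<sigma> c else get i \<sigma> e) else av \<sigma> j)"
  by simp_all

context
  fixes d :: nat and A :: "nat \<Rightarrow> nat \<Rightarrow> real" and \<omega> :: "nat \<Rightarrow> bool"
begin

abbreviation (input) "HH \<equiv> hsem d A \<omega>"

definition tval :: "vstate \<Rightarrow> real" where "tval \<sigma> = av \<sigma> 13 + 1"

text \<open>\<open>12800 = 8 * 40\<^sup>2\<close>: the relative error of the estimates is to be \<open>1 / (40 n)\<close>.\<close>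
definition kval :: "nat \<Rightarrow> vstate \<Rightarrow> nat" where
  "kval n \<sigma> = 12800 * n\<^sup>2 * lg (8 * av \<sigma> 1 * tval \<sigma> * tval \<sigma> / av \<sigma> 0)"

lemma prep_correct:
  "av (HH (prep n) \<sigma>) 13 = tval \<sigma>" "av (HH (prep n) \<sigma>) 8 = real (kval n \<sigma>)"
  "av (HH (prep n) \<sigma>) 9 = 80 * real n * av \<sigma> 32 * av \<sigma> 6"
  "av (HH (prep n) \<sigma>) 11 = sqrt (av \<sigma> 6) * av \<sigma> 32 * (128 * (real n)\<^sup>2) + 1"
  "fl (HH (prep n) \<sigma>) = fl \<sigma>" "k \<notin> {8, 9, 11, 13, 23, 24, 29, 38} \<Longrightarrow> av (HH (prep n) \<sigma>) k = av \<sigma> k"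
  "vv (HH (prep n) \<sigma>) = vv \<sigma>"
proof -
  show "k \<notin> {8, 9, 11, 13, 23, 24, 29, 38} \<Longrightarrow> av (HH (prep n) \<sigma>) k = av \<sigma> k"
    by (rule hsem_frame_av) (simp add: writes_prep)
  show "vv (HH (prep n) \<sigma>) = vv \<sigma>"
    by (rule ext) (rule hsem_frame_vv, simp add: writes_prep)
  show "fl (HH (prep n) \<sigma>) = fl \<sigma>" by (rule fl_hsem[OF flipfree_prep])
qed (simp_all add: prep_def kval_def tval_def)

definition near :: "nat \<Rightarrow> vstate \<Rightarrow> bool" where
  "near n \<sigma> \<longleftrightarrow> dist_PS d A \<omega> (HH (prep n) \<sigma>) < av \<sigma> 21"

definition th :: "nat \<Rightarrow> vstate \<Rightarrow> real" where
  "th n \<sigma> = sum (Pv d A \<omega> (HH (prep n) \<sigma>)) {..<d} / E1 d A \<omega> (HH (prep n) \<sigma>)"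

definition th' :: "nat \<Rightarrow> vstate \<Rightarrow> real" where
  "th' n \<sigma> = sum (Sv d A \<omega> (HH (prep n) \<sigma>)) {..<d} / E2 d A \<omega> (HH (prep n) \<sigma>)"

definition capv :: "nat \<Rightarrow> vstate \<Rightarrow> real" where
  "capv n \<sigma> = sqrt (av \<sigma> 6) * av \<sigma> 32 * (128 * (real n)\<^sup>2) + 1"

definition Bnew :: "nat \<Rightarrow> vstate \<Rightarrow> real" where
  "Bnew n \<sigma> = 10 * (th n \<sigma> * th' n \<sigma>)"

definition up :: "nat \<Rightarrow> vstate \<Rightarrow> nat \<Rightarrow> bool" where
  "up n \<sigma> i \<longleftrightarrow> Pv d A \<omega> (HH (prep n) \<sigma>) i / sum (Pv d A \<omega> (HH (prep n) \<sigma>)) {..<d}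
    < Sv d A \<omega> (HH (prep n) \<sigma>) i / sum (Sv d A \<omega> (HH (prep n) \<sigma>)) {..<d}"

lemma body_correct:
  "av (HH (bodyp n) \<sigma>) 13 = tval \<sigma>"
  "av (HH (bodyp n) \<sigma>) 6 = (if near n \<sigma> then Bnew n \<sigma> else av \<sigma> 6)"
  "av (HH (bodyp n) \<sigma>) 7 = 2 * th n \<sigma>"
  "av (HH (bodyp n) \<sigma>) 12 = (if near n \<sigma> then (if av \<sigma> 5 * Bnew n \<sigma> < av \<sigma> 21 then 0 else 1)
      else (if av \<sigma> 10 < capv n \<sigma> then 1 else 0))"
  "av (HH (bodyp n) \<sigma>) 5 = (if near n \<sigma> then av \<sigma> 5 / 2 else av \<sigma> 5)"
  "av (HH (bodyp n) \<sigma>) 10 = (if near n \<sigma> then 0 else av \<sigma> 10 + 1)"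
  "k \<in> {0, 1, 2, 3, 4, 21, 32} \<Longrightarrow> av (HH (bodyp n) \<sigma>) k = av \<sigma> k"
  "vv (HH (bodyp n) \<sigma>) 0 = vv \<sigma> 0"
  "i < d \<Longrightarrow> vv (HH (bodyp n) \<sigma>) 1 i = vv \<sigma> 1 i *
      (if near n \<sigma> then 1 else if up n \<sigma> i then av \<sigma> 4 else 1 / av \<sigma> 4)"
  "fl (HH (bodyp n) \<sigma>) = fl \<sigma> + kval n \<sigma> * d"
proof -
  define \<sigma>1 where "\<sigma>1 = HH (prep n) \<sigma>"
  define \<sigma>2 where "\<sigma>2 = HH evalp \<sigma>1"
  have fin: "HH (bodyp n) \<sigma> = HH postp \<sigma>2" by (simp add: bodyp_def \<sigma>1_def \<sigma>2_def)
  have s1: "av \<sigma>1 13 = tval \<sigma>" "av \<sigma>1 8 = real (kval n \<sigma>)" "av \<sigma>1 11 = capv n \<sigma>" "fl \<sigma>1 = fl \<sigma>" "vv \<sigma>1 = vv \<sigma>"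
    unfolding \<sigma>1_def prep_correct capv_def by simp_all
  have s1': "av \<sigma>1 k = av \<sigma> k" if "k \<notin> {8, 9, 11, 13, 23, 24, 29, 38}" for k
    unfolding \<sigma>1_def by (rule prep_correct(6)[OF that])
  have s2: "av \<sigma>2 k = av \<sigma>1 k" if "Sc k \<notin> writes evalp" for k
    unfolding \<sigma>2_def by (rule hsem_frame_av[OF that])
  have v2: "vv \<sigma>2 c = vv \<sigma>1 c" if "Vc c \<notin> writes evalp" for c
    unfolding \<sigma>2_def by (rule hsem_frame_vv[OF that])
  note ev = evalp_correct[where d=d and A=A and \<omega>=\<omega> and \<sigma>=\<sigma>1, folded \<sigma>2_def]
  have e: "av \<sigma>2 18 = th n \<sigma>" "av \<sigma>2 19 = th' n \<sigma>" "av \<sigma>2 20 < av \<sigma> 21 \<longleftrightarrow> near n \<sigma>"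
    using ev by (simp_all add: th_def th'_def near_def \<sigma>1_def)
  have c: "av \<sigma>2 k = av \<sigma> k" if "k \<in> {0, 1, 2, 3, 4, 5, 6, 10, 21, 32}" for k
    using that s2[of k] s1'[of k] by (auto simp: writes_evalp)
  have c': "av \<sigma>2 11 = capv n \<sigma>" "av \<sigma>2 13 = tval \<sigma>"
    using s2[of 11] s2[of 13] s1 by (simp_all add: writes_evalp)
  define bs where "bs = [Arith Divide (Vc 7) (Vc 2) (Sc 16), Arith Divide (Vc 8) (Vc 3) (Sc 17),
      Select (Vc 7) (Vc 7) (Vc 8) (Sc 22) (Sc 33), Arith Times (Vc 1) (Vc 1) (Vc 7)]"
  have pb: "\<forall>b\<in>set bs. pureb b" by (simp add: bs_def)
  define cs where "cs = [Const (Sc 31) 1, Const (Sc 30) 0, Select (Sc 22) (Sc 20) (Sc 21) (Sc 31) (Sc 4), Arith Divide (Sc 33) (Sc 31) (Sc 22),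
      Arith Times (Sc 23) (Sc 18) (Sc 19), Const (Sc 24) 10, Arith Times (Sc 23) (Sc 24) (Sc 23),
      Select (Sc 6) (Sc 20) (Sc 21) (Sc 23) (Sc 6), Arith Plus (Sc 7) (Sc 18) (Sc 18),
      Arith Times (Sc 23) (Sc 5) (Sc 6), Select (Sc 23) (Sc 23) (Sc 21) (Sc 30) (Sc 31),
      Select (Sc 24) (Sc 10) (Sc 11) (Sc 31) (Sc 30), Select (Sc 12) (Sc 20) (Sc 21) (Sc 23) (Sc 24),
      Const (Sc 23) 2, Arith Divide (Sc 23) (Sc 5) (Sc 23), Select (Sc 5) (Sc 20) (Sc 21) (Sc 23) (Sc 5),
      Arith Plus (Sc 23) (Sc 10) (Sc 31), Select (Sc 10) (Sc 20) (Sc 21) (Sc 30) (Sc 23)]"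
  define \<sigma>3 where "\<sigma>3 = fold (bsem d A \<omega> 0) cs \<sigma>2"
  have fin2: "HH postp \<sigma>2 = HH (ForEach bs) \<sigma>3" 
    unfolding postp_def bs_def cs_def \<sigma>3_def by (simp only: hsem.simps(1,4))
  have avf: "av (HH (bodyp n) \<sigma>) = av \<sigma>3" unfolding fin fin2 by (rule pure_ForEach(1)[OF pb])
  have vs3: "vv \<sigma>3 = vv \<sigma>2"
    unfolding \<sigma>3_def by (intro ext fun_cong[OF fold_bsem_frame_vv]) (simp add: cs_def)
  have a3: "av \<sigma>3 k = av \<sigma>2 k" if "Sc k \<notin> dst ` set cs" for k
    unfolding \<sigma>3_def by (rule fold_bsem_frame_av[OF that])
  show "av (HH (bodyp n) \<sigma>) 13 = tval \<sigma>" unfolding avf using a3[of 13] c' by (simp add: cs_def)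
  show "k \<in> {0, 1, 2, 3, 4, 21, 32} \<Longrightarrow> av (HH (bodyp n) \<sigma>) k = av \<sigma> k"
    unfolding avf using a3[of k] c[of k] by (auto simp: cs_def)
  have vals: "av \<sigma>3 6 = (if near n \<sigma> then Bnew n \<sigma> else av \<sigma> 6) \<and> av \<sigma>3 7 = 2 * th n \<sigma> \<and>
    av \<sigma>3 12 = (if near n \<sigma> then (if av \<sigma> 5 * Bnew n \<sigma> < av \<sigma> 21 then 0 else 1)
      else (if av \<sigma> 10 < capv n \<sigma> then 1 else 0)) \<and>
    av \<sigma>3 5 = (if near n \<sigma> then av \<sigma> 5 / 2 else av \<sigma> 5) \<and>
    av \<sigma>3 10 = (if near n \<sigma> then 0 else av \<sigma> 10 + 1) \<and>
    av \<sigma>3 22 = (if near n \<sigma> then 1 else av \<sigma> 4) \<and> av \<sigma>3 33 = (if near n \<sigma> then 1 else 1 / av \<sigma> 4)"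
    unfolding \<sigma>3_def cs_def Bnew_def
    by (cases "near n \<sigma>"; cases "av \<sigma> 5 * (10 * (th n \<sigma> * th' n \<sigma>)) < av \<sigma> 21"; cases "av \<sigma> 10 < capv n \<sigma>")
       (simp_all add: av_bsem e c c' del: bsem.simps)
  then show "av (HH (bodyp n) \<sigma>) 6 = (if near n \<sigma> then Bnew n \<sigma> else av \<sigma> 6)"
    "av (HH (bodyp n) \<sigma>) 7 = 2 * th n \<sigma>"
    "av (HH (bodyp n) \<sigma>) 12 = (if near n \<sigma> then (if av \<sigma> 5 * Bnew n \<sigma> < av \<sigma> 21 then 0 else 1)
      else (if av \<sigma> 10 < capv n \<sigma> then 1 else 0))"
    "av (HH (bodyp n) \<sigma>) 5 = (if near n \<sigma> then av \<sigma> 5 / 2 else av \<sigma> 5)"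
    "av (HH (bodyp n) \<sigma>) 10 = (if near n \<sigma> then 0 else av \<sigma> 10 + 1)"
    unfolding avf by blast+
  show "vv (HH (bodyp n) \<sigma>) 0 = vv \<sigma> 0"
    unfolding fin fin2 using v2[of 0] s1(5) vs3
    by (subst hsem_frame_vv) (simp_all add: bs_def writes_evalp)
  show "vv (HH (bodyp n) \<sigma>) 1 i = vv \<sigma> 1 i *
      (if near n \<sigma> then 1 else if up n \<sigma> i then av \<sigma> 4 else 1 / av \<sigma> 4)" if i: "i < d"
  proof -
    have a: "av \<sigma>3 16 = sum (Pv d A \<omega> \<sigma>1) {..<d}" "av \<sigma>3 17 = sum (Sv d A \<omega> \<sigma>1) {..<d}"
      using a3[of 16] a3[of 17] ev by (simp_all add: cs_def)
    have v: "vv \<sigma>3 2 i = Pv d A \<omega> \<sigma>1 i" "vv \<sigma>3 3 i = Sv d A \<omega> \<sigma>1 i" "vv \<sigma>3 1 i = vv \<sigma> 1 i"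
      using ev(1,2)[OF i] v2[of 1] s1(5) by (simp_all add: vs3 writes_evalp)
    have "vv (HH (ForEach bs) \<sigma>3) 1 i = vv \<sigma>3 1 i * (if vv \<sigma>3 2 i / av \<sigma>3 16 < vv \<sigma>3 3 i / av \<sigma>3 17 then av \<sigma>3 22 else av \<sigma>3 33)"
      unfolding pure_ForEach(3)[OF pb i] by (simp add: bs_def)
    then show ?thesis unfolding fin fin2 using vals by (simp add: a v up_def \<sigma>1_def[symmetric])
  qed
  have "fl (HH postp \<sigma>2) = fl \<sigma>2" by (rule fl_hsem[OF flipfree_postp])
  then show "fl (HH (bodyp n) \<sigma>) = fl \<sigma> + kval n \<sigma> * d" unfolding fin using ev(8) s1 by simp
qed

definition vstate0 :: "real \<Rightarrow> vstate" where
  "vstate0 \<delta> = \<lparr>av = (\<lambda>_. 0)(0 := \<delta>), vv = (\<lambda>_ _. 0), fl = 0\<rparr>"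

text \<open>The choice \<open>2^l \<ge> n lg (8 d^2)\<close> ensures that \<open>p\<close>-th roots
  of factors up to \<open>8 d^2\<close> are at most \<open>1 + 1 / n\<close>
  (\<open>power_bound\<close>).\<close>

definition lp :: "nat \<Rightarrow> nat" where
  "lp n = lg (real n * real (lg (8 * real d * real d)))"

lemma init_correct:
  fixes \<delta> :: real
  assumes d: "1 \<le> d" and n: "1 \<le> n"
  defines "\<sigma> \<equiv> HH (initp n) (vstate0 \<delta>)"
  shows "av \<sigma> 0 = \<delta>" "av \<sigma> 1 = real d" "av \<sigma> 21 = 1 / real n" "av \<sigma> 5 = real d" "av \<sigma> 6 = 10" "av \<sigma> 7 = 2 * real d"
    "av \<sigma> 10 = 0" "av \<sigma> 13 = 0" "av \<sigma> 12 = 1" "av \<sigma> 32 = 2 ^ lp n" "av \<sigma> 3 = 2 ^ lp n / 2" "av \<sigma> 2 = 2 ^ lp n / 2 - 1"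
    "av \<sigma> 4 = (sqrt ^^ (lp n + 2)) (1 + 1 / (8 * real n))"
    "i < d \<Longrightarrow> vv \<sigma> 0 i = A i i" "i < d \<Longrightarrow> vv \<sigma> 1 i = 1 / sqrt (A i i)" "fl \<sigma> = 0"
    "hcost d A \<omega> (initp n) (vstate0 \<delta>) \<le> 300 + 15 * real (lg (8 * real d * real d)) + 42 * real (lp n)"
proof -
  define bs where "bs = [DiagEntry (Vc 0), Root (Vc 7) (Vc 0), Const (Vc 8) 1, Arith Divide (Vc 1) (Vc 8) (Vc 7)]"
  have pb: "\<forall>b\<in>set bs. pureb b" by (simp add: bs_def)
  define \<sigma>1 where "\<sigma>1 = HH (ForEach bs) (vstate0 \<delta>)"
  have sv: "vv \<sigma>1 c i = vv (fold (bsem d A \<omega> i) bs (vstate0 \<delta>)) c i" if "i < d" for c i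
    unfolding \<sigma>1_def by (rule pure_ForEach(3)[OF pb that])
  have s1: "av \<sigma>1 = (\<lambda>_. 0)(0 := \<delta>)" "fl \<sigma>1 = 0" "\<And>i. i < d \<Longrightarrow> vv \<sigma>1 0 i = A i i" "\<And>i. i < d \<Longrightarrow> vv \<sigma>1 1 i = 1 / sqrt (A i i)"
    using sv pure_ForEach(1,2)[OF pb, of d A \<omega> "vstate0 \<delta>", folded \<sigma>1_def] by (simp_all add: bs_def vstate0_def)
  define Q where "Q = Then (Block [Dim (Sc 1), Const (Sc 23) n, Const (Sc 21) 1, Arith Divide (Sc 21) (Sc 21) (Sc 23), Copy (Sc 5) (Sc 1), Const (Sc 6) 10,
      Arith Plus (Sc 7) (Sc 1) (Sc 1), Const (Sc 10) 0, Const (Sc 13) 0, Const (Sc 12) 1,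
      Const (Sc 23) 8, Arith Times (Sc 23) (Sc 23) (Sc 1), Arith Times (Sc 23) (Sc 23) (Sc 1)])
    (Then (Log2 24 29 23)
    (Then (Block [Const (Sc 23) n, Arith Times (Sc 23) (Sc 23) (Sc 29)])
    (Then (Log2 32 22 23)
    (Block [Const (Sc 23) 2, Arith Divide (Sc 3) (Sc 32) (Sc 23), Const (Sc 31) 1, Arith Minus (Sc 2) (Sc 3) (Sc 31),
      Const (Sc 4) (8 * n), Arith Divide (Sc 4) (Sc 31) (Sc 4), Arith Plus (Sc 4) (Sc 31) (Sc 4), Arith Plus (Sc 23) (Sc 22) (Sc 23)]))))"
  define \<sigma>2 where "\<sigma>2 = HH Q \<sigma>1"
  have fQ: "flipfree Q" "\<And>c. Vc c \<notin> writes Q" by (auto simp: Q_def)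
  have s2: "av \<sigma>2 0 = \<delta>" "av \<sigma>2 1 = real d" "av \<sigma>2 21 = 1 / real n" "av \<sigma>2 5 = real d" "av \<sigma>2 6 = 10" "av \<sigma>2 7 = 2 * real d"
    "av \<sigma>2 10 = 0" "av \<sigma>2 13 = 0" "av \<sigma>2 12 = 1" "av \<sigma>2 32 = 2 ^ lp n" "av \<sigma>2 3 = 2 ^ lp n / 2" "av \<sigma>2 2 = 2 ^ lp n / 2 - 1"
    "av \<sigma>2 4 = 1 + 1 / (8 * real n)" "av \<sigma>2 23 = real (lp n + 2)"
    unfolding \<sigma>2_def Q_def by (simp_all add: av_bsem s1 lp_def del: bsem.simps)
  have s2v: "vv \<sigma>2 = vv \<sigma>1" unfolding \<sigma>2_def by (rule ext) (rule hsem_frame_vv[OF fQ(2)])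
  have s2f: "fl \<sigma>2 = 0" unfolding \<sigma>2_def by (simp add: fl_hsem[OF fQ(1)] s1)
  define P where "P = Block [Root (Sc 4) (Sc 4)]"
  have fin: "\<sigma> = HH (Repeat 25 23 P) \<sigma>2" by (simp add: \<sigma>_def initp_def bs_def \<sigma>1_def \<sigma>2_def Q_def P_def)
  have wP: "writes P = {Sc 4}" by (simp add: P_def)
  have keep: "av \<sigma> k = av \<sigma>2 k" if "k \<notin> {25, 38, 4}" for k
    unfolding fin using that by (intro hsem_frame_av) (simp add: wP)
  have v: "vv \<sigma> = vv \<sigma>2" unfolding fin by (rule ext) (rule hsem_frame_vv, simp add: wP)
  show "av \<sigma> 0 = \<delta>" "av \<sigma> 1 = real d" "av \<sigma> 21 = 1 / real n" "av \<sigma> 5 = real d" "av \<sigma> 6 = 10" "av \<sigma> 7 = 2 * real d"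
    "av \<sigma> 10 = 0" "av \<sigma> 13 = 0" "av \<sigma> 12 = 1" "av \<sigma> 32 = 2 ^ lp n" "av \<sigma> 3 = 2 ^ lp n / 2" "av \<sigma> 2 = 2 ^ lp n / 2 - 1"
    by (simp_all add: keep s2)
  show "i < d \<Longrightarrow> vv \<sigma> 0 i = A i i" "i < d \<Longrightarrow> vv \<sigma> 1 i = 1 / sqrt (A i i)"
    by (simp_all add: v s2v s1)
  show "fl \<sigma> = 0" unfolding fin by (subst fl_hsem) (simp_all add: P_def s2f)
  define I where "I j \<tau> \<longleftrightarrow> av \<tau> 4 = (sqrt ^^ j) (1 + 1 / (8 * real n))" for j and \<tau> :: vstate
  have ceil: "nat \<lceil>av \<sigma>2 23\<rceil> = lp n + 2" unfolding s2 by (simp only: ceiling_of_nat nat_int)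
  have "I (lp n + 2) (HH (Repeat 25 23 P) \<sigma>2)"
    by (rule hfor_rule[OF _ ceil[symmetric]]) (simp_all add: I_def s2(13) P_def)
  then show "av \<sigma> 4 = (sqrt ^^ (lp n + 2)) (1 + 1 / (8 * real n))" by (simp add: I_def fin)
  have "hcost d A \<omega> (Repeat 25 23 P) \<sigma>2 \<le> 13 + real (nat \<lceil>av \<sigma>2 23\<rceil>) * (15 + 12)"
    by (rule hfor_cost) (simp_all add: P_def)
  then have c2: "hcost d A \<omega> (Repeat 25 23 P) \<sigma>2 \<le> 67 + 27 * real (lp n)"
    unfolding ceil by simp
  have "hcost d A \<omega> (initp n) (vstate0 \<delta>) = 30 + (hcost d A \<omega> Q \<sigma>1 + hcost d A \<omega> (Repeat 25 23 P) \<sigma>2)"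
    by (simp add: initp_def Q_def bs_def \<sigma>1_def \<sigma>2_def P_def)
  also have "hcost d A \<omega> Q \<sigma>1 = 110 + 15 * real (lg (8 * real d * real d)) + 15 * real (lp n)"
    by (simp add: Q_def s1 lp_def)
  finally show "hcost d A \<omega> (initp n) (vstate0 \<delta>) \<le> 300 + 15 * real (lg (8 * real d * real d)) + 42 * real (lp n)"
    using c2 by simp
qed

lemma evalp_cost:
  "hcost d A \<omega> evalp \<sigma> \<le> 177 + real (nat \<lceil>av \<sigma> 8\<rceil>) * (309 + 94 * real (nat \<lceil>av \<sigma> 2\<rceil>)
    + real (nat \<lceil>av \<sigma> 3\<rceil>) * (54 + 98 * real (nat \<lceil>av \<sigma> 9\<rceil>)))"
proof -
  have app: "hcost d A \<omega> (appN x) \<tau> = 55" for x \<tau> by (simp add: appN_def)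
  have solve: "hcost d A \<omega> solveN \<tau> \<le> 39 + 98 * real (nat \<lceil>av \<tau> 9\<rceil>)" for \<tau>
  proof -
    define \<tau>1 where "\<tau>1 = HH (ForEach [Copy (Vc 6) (Vc 5), Const (Vc 5) 0]) \<tau>"
    define P where "P = Then (appN 5) (ForEach [Arith Minus (Vc 7) (Vc 6) (Vc 8), Arith Divide (Vc 7) (Vc 7) (Sc 7), Arith Plus (Vc 5) (Vc 5) (Vc 7)])"
    have "hcost d A \<omega> (Repeat 28 9 P) \<tau>1 \<le> 13 + real (nat \<lceil>av \<tau>1 9\<rceil>) * (15 + 83)"
      by (rule hfor_cost) (simp_all add: P_def app)
    moreover have "av \<tau>1 9 = av \<tau> 9" unfolding \<tau>1_def by (simp add: hsem_frame_av)
    moreover have "hcost d A \<omega> solveN \<tau> = 26 + hcost d A \<omega> (Repeat 28 9 P) \<tau>1"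
      by (simp add: solveN_def P_def \<tau>1_def)
    ultimately show ?thesis by simp
  qed
  have samp: "hcost d A \<omega> samp \<tau> \<le> 294 + 94 * real (nat \<lceil>av \<tau> 2\<rceil>)
    + real (nat \<lceil>av \<tau> 3\<rceil>) * (54 + 98 * real (nat \<lceil>av \<tau> 9\<rceil>))" for \<tau>
  proof -
    define P where "P = Then (appN 4) (ForEach [Copy (Vc 4) (Vc 8)])"
    have pl: "hcost d A \<omega> (Repeat 26 2 P) \<tau>' \<le> 13 + real (nat \<lceil>av \<tau>' 2\<rceil>) * (15 + 79)" for \<tau>'
      by (rule hfor_cost) (simp_all add: P_def app)
    have sl: "hcost d A \<omega> (Repeat 27 3 solveN) \<tau>' \<le> 13 + real (nat \<lceil>av \<tau>' 3\<rceil>) * (15 + (39 + 98 * real (nat \<lceil>av \<tau>' 9\<rceil>)))" for \<tau>'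
    proof (rule hfor_cost)
      fix \<tau>'' assume "frz (insert (Sc 27) (insert (Sc 38) (writes solveN))) \<tau>' \<tau>''"
      then have "av \<tau>'' 9 = av \<tau>' 9" by (rule frz_av) (simp add: writes_solveN)
      then show "hcost d A \<omega> solveN \<tau>'' \<le> 39 + 98 * real (nat \<lceil>av \<tau>' 9\<rceil>)" using solve[of \<tau>''] by simp
    qed simp
    define Q where "Q = Then (ForEach [Coin (Vc 4)])
      (ForEach [Arith Plus (Vc 4) (Vc 4) (Vc 4), Const (Vc 7) 1, Arith Minus (Vc 4) (Vc 4) (Vc 7), Copy (Vc 5) (Vc 4)])"
    define R where "R = Then (Repeat 26 2 P) (Then (appN 4)
       (Then (ForEach [Arith Times (Vc 7) (Vc 8) (Vc 8), Arith Plus (Vc 2) (Vc 2) (Vc 7), Arith Times (Vc 7) (Vc 4) (Vc 8)])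
         (ForEach [Arith Plus (Sc 14) (Sc 14) (Vc 7)])))"
    have wQ: "writes Q = {Vc 4, Vc 5, Vc 7}" and wR: "writes R = {Sc 26, Sc 38, Sc 14, Vc 2, Vc 4, Vc 7, Vc 8}"
      by (auto simp: Q_def R_def P_def writes_appN)
    define \<tau>1 where "\<tau>1 = HH Q \<tau>"
    define \<tau>2 where "\<tau>2 = HH R \<tau>1"
    have "av \<tau>1 k = av \<tau> k" for k unfolding \<tau>1_def by (rule hsem_frame_av) (simp add: wQ)
    moreover have "av \<tau>2 k = av \<tau>1 k" if "k \<notin> {26, 38, 14}" for k
      unfolding \<tau>2_def using that by (intro hsem_frame_av) (simp add: wR)
    ultimately have a: "av \<tau>1 2 = av \<tau> 2" "av \<tau>2 3 = av \<tau> 3" "av \<tau>2 9 = av \<tau> 9" by simp_all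
    have "hcost d A \<omega> samp \<tau> = 54 + hcost d A \<omega> (Repeat 26 2 P) \<tau>1 + 107 + hcost d A \<omega> (Repeat 27 3 solveN) \<tau>2 + 107"
      by (simp add: samp_def P_def Q_def R_def \<tau>1_def \<tau>2_def app)
    then show ?thesis using pl[of \<tau>1] sl[of \<tau>2] a by simp
  qed
  define Q where "Q = Then (ForEach [Const (Vc 2) 0, Const (Vc 3) 0])
   (Block [Const (Sc 14) 0, Const (Sc 15) 0, Const (Sc 16) 0, Const (Sc 17) 0, Const (Sc 20) 0])"
  define \<tau> where "\<tau> = HH Q \<sigma>"
  have a: "av \<tau> k = av \<sigma> k" if "k \<in> {2, 3, 8, 9}" for k
    unfolding \<tau>_def using that by (intro hsem_frame_av) (auto simp: Q_def)
  have "hcost d A \<omega> (Repeat 25 8 samp) \<tau> \<le> 13 + real (nat \<lceil>av \<tau> 8\<rceil>) * (15 + (294 + 94 * real (nat \<lceil>av \<sigma> 2\<rceil>)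
    + real (nat \<lceil>av \<sigma> 3\<rceil>) * (54 + 98 * real (nat \<lceil>av \<sigma> 9\<rceil>))))"
  proof (rule hfor_cost)
    fix \<tau>'' assume f: "frz (insert (Sc 25) (insert (Sc 38) (writes samp))) \<tau> \<tau>''"
    have "av \<tau>'' k = av \<sigma> k" if "k \<in> {2, 3, 9}" for k
      using frz_av[OF f, of k] a[of k] that by (auto simp: writes_samp)
    then show "hcost d A \<omega> samp \<tau>'' \<le> 294 + 94 * real (nat \<lceil>av \<sigma> 2\<rceil>)
      + real (nat \<lceil>av \<sigma> 3\<rceil>) * (54 + 98 * real (nat \<lceil>av \<sigma> 9\<rceil>))" using samp[of \<tau>''] by simp
  qed simp
  moreover have "hcost d A \<omega> evalp \<sigma> = 46 + hcost d A \<omega> (Repeat 25 8 samp) \<tau> + 118"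
    by (simp add: evalp_def Q_def \<tau>_def)
  ultimately show ?thesis using a[of 8] by (simp add: add.assoc)
qed

lemma body_cost:
  "hcost d A \<omega> (bodyp n) \<sigma> \<le> 400 + 15 * real (lg (8 * av \<sigma> 1 * tval \<sigma> * tval \<sigma> / av \<sigma> 0)) +
    real (kval n \<sigma>) * (309 + 94 * real (nat \<lceil>av \<sigma> 2\<rceil>)
    + real (nat \<lceil>av \<sigma> 3\<rceil>) * (54 + 98 * real (nat \<lceil>80 * real n * av \<sigma> 32 * av \<sigma> 6\<rceil>)))"
proof -
  define \<sigma>1 where "\<sigma>1 = HH (prep n) \<sigma>"
  have s1: "nat \<lceil>av \<sigma>1 8\<rceil> = kval n \<sigma>" "av \<sigma>1 9 = 80 * real n * av \<sigma> 32 * av \<sigma> 6"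
    unfolding \<sigma>1_def prep_correct by simp_all
  have s1': "av \<sigma>1 2 = av \<sigma> 2" "av \<sigma>1 3 = av \<sigma> 3" unfolding \<sigma>1_def by (simp_all add: prep_correct(6))
  have "hcost d A \<omega> (bodyp n) \<sigma> = hcost d A \<omega> (prep n) \<sigma> + (hcost d A \<omega> evalp \<sigma>1 + hcost d A \<omega> postp (HH evalp \<sigma>1))"
    by (simp add: bodyp_def \<sigma>1_def)
  moreover have "hcost d A \<omega> (prep n) \<sigma> = 73 + 15 * real (lg (8 * av \<sigma> 1 * tval \<sigma> * tval \<sigma> / av \<sigma> 0))"
    by (simp add: prep_def tval_def)
  moreover have "hcost d A \<omega> postp (HH evalp \<sigma>1) \<le> 100"
    by (simp add: postp_def del: hsem.simps bsem.simps)
  ultimately show ?thesis using evalp_cost[of \<sigma>1] unfolding s1 s1' by linarith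
qed

end

subsection \<open>Running the program\<close>

text \<open>Natural number cells cannot be multiplied, so the nine base addresses
  \<open>40 + c d\<close> are built up by repeated addition.\<close>

definition rawinit :: prog where
  "rawinit = seqs (map Do [NConst (At 1) 1, NConst (At 20) 40, NAdd (At 21) (At 20) (At 0), NAdd (At 22) (At 21) (At 0),
     NAdd (At 23) (At 22) (At 0), NAdd (At 24) (At 23) (At 0), NAdd (At 25) (At 24) (At 0), NAdd (At 26) (At 25) (At 0),
     NAdd (At 27) (At 26) (At 0), NAdd (At 28) (At 27) (At 0)])"

text \<open>Squaring turns the scaling \<open>s\<close> into the weights \<open>w\<close>. The
  output overwrites scalars and, for large \<open>d\<close>, part of vector 0, but no entry of
  vector 1, which starts at cell \<open>40 + d\<close>.\<close>

definition outloop :: prog where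
  "outloop = While (NLess (At 3) (At 0)) (seqs (map Do
    [RArith Times (Ptr 3) (Ptr 4) (Ptr 4), NAdd (At 3) (At 3) (At 1), NAdd (At 4) (At 4) (At 1)]))"

definition mainp :: "nat \<Rightarrow> prog" where
  "mainp n = Seq rawinit (Seq (compile (initp n)) (Seq (While (RLess (At 39) (At 12)) (compile (bodyp n)))
    (Seq (seqs (map Do [NConst (At 3) 0, NAdd (At 4) (At 21) (At 2)])) outloop)))"

text \<open>The state is frozen once cell 12 is no longer positive, so that any sufficiently large
  \<open>t\<close> describes the final state.\<close>

definition iterate :: "nat \<Rightarrow> (nat \<Rightarrow> nat \<Rightarrow> real) \<Rightarrow> (nat \<Rightarrow> bool) \<Rightarrow> vprog \<Rightarrow> nat \<Rightarrow> vstate \<Rightarrow> vstate" where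
  "iterate d A \<omega> P t = (\<lambda>\<sigma>. if 0 < av \<sigma> 12 then hsem d A \<omega> P \<sigma> else \<sigma>) ^^ t"

lemma iterate_0: "iterate d A \<omega> P 0 \<sigma> = \<sigma>" by (simp add: iterate_def)

lemma iterate_Suc: "iterate d A \<omega> P (Suc t) \<sigma> =
    (if 0 < av (iterate d A \<omega> P t \<sigma>) 12 then hsem d A \<omega> P (iterate d A \<omega> P t \<sigma>) else iterate d A \<omega> P t \<sigma>)"
  by (simp add: iterate_def)

lemma iterate_Suc2: "0 < av \<sigma> 12 \<Longrightarrow> iterate d A \<omega> P (Suc t) \<sigma> = iterate d A \<omega> P t (hsem d A \<omega> P \<sigma>)"
  unfolding iterate_def funpow_Suc_right o_apply by simp

lemma iterate_stop: "\<not> 0 < av \<sigma> 12 \<Longrightarrow> iterate d A \<omega> P t \<sigma> = \<sigma>"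
  by (induction t) (simp_all add: iterate_0 iterate_Suc)

context ram begin

lemma while_sim:
  assumes ok: "ok_vprog P" and C: "0 \<le> C"
    and R: "Rel d s \<sigma>"
    and cost: "\<And>j. j < G \<Longrightarrow> 0 < av (iterate d A \<omega> P j \<sigma>) 12 \<Longrightarrow> hcost d A \<omega> P (iterate d A \<omega> P j \<sigma>) \<le> C"
    and stop: "\<not> 0 < av (iterate d A \<omega> P G \<sigma>) 12"
  shows "\<exists>t s'. exec K T \<omega> (While (RLess (At 39) (At 12)) (compile P)) s t s' \<and>
    t \<le> (1 + real G * (1 + C)) * T \<and> Rel d s' (iterate d A \<omega> P G \<sigma>)"
  using R cost stop
proof (induction G arbitrary: s \<sigma>)
  case 0
  then have "\<not> holds (RLess (At 39) (At 12)) s" by (simp add: Rel_def iterate_0)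
  from exec.While_False[OF this] show ?case using 0 T1 by (intro exI[of _ 1] exI[of _ s]) (simp add: iterate_0)
next
  case (Suc G)
  show ?case
  proof (cases "0 < av \<sigma> 12")
    case False
    then have "\<not> holds (RLess (At 39) (At 12)) s" using Suc.prems(1) by (simp add: Rel_def)
    note e = exec.While_False[OF this]
    have "1 \<le> (1 + real (Suc G) * (1 + C)) * T"
      by (rule le_mult_T) (use C in simp_all)
    then show ?thesis using e Suc.prems(1) iterate_stop[OF False] by (intro exI[of _ 1] exI[of _ s]) simp
  next
    case True
    then have h: "holds (RLess (At 39) (At 12)) s" using Suc.prems(1) by (simp add: Rel_def)
    from comp_sim[OF ok Suc.prems(1)] obtain t s1 where 1: "exec K T \<omega> (compile P) s t s1"
      "t \<le> hcost d A \<omega> P \<sigma> * T" "Rel d s1 (hsem d A \<omega> P \<sigma>)" by auto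
    have sh: "iterate d A \<omega> P j (hsem d A \<omega> P \<sigma>) = iterate d A \<omega> P (Suc j) \<sigma>" for j
      by (rule iterate_Suc2[OF True, symmetric])
    have "\<exists>t s'. exec K T \<omega> (While (RLess (At 39) (At 12)) (compile P)) s1 t s' \<and>
        t \<le> (1 + real G * (1 + C)) * T \<and> Rel d s' (iterate d A \<omega> P G (hsem d A \<omega> P \<sigma>))"
    proof (rule Suc.IH[OF 1(3)])
      fix j assume "j < G" "0 < av (iterate d A \<omega> P j (hsem d A \<omega> P \<sigma>)) 12"
      then show "hcost d A \<omega> P (iterate d A \<omega> P j (hsem d A \<omega> P \<sigma>)) \<le> C"
        unfolding sh by (intro Suc.prems(2)) auto
    next
      show "\<not> 0 < av (iterate d A \<omega> P G (hsem d A \<omega> P \<sigma>)) 12" unfolding sh by (rule Suc.prems(3))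
    qed
    then obtain t' s2 where 2: "exec K T \<omega> (While (RLess (At 39) (At 12)) (compile P)) s1 t' s2"
      "t' \<le> (1 + real G * (1 + C)) * T" "Rel d s2 (iterate d A \<omega> P G (hsem d A \<omega> P \<sigma>))" by auto
    have "hcost d A \<omega> P \<sigma> \<le> C" using Suc.prems(2)[of 0] True by (simp add: iterate_0)
    then have "hcost d A \<omega> P \<sigma> * T \<le> C * T" using T1 by (intro mult_right_mono) auto
    then have "t \<le> C * T" using 1(2) by linarith
    moreover have "(1 + real (Suc G) * (1 + C)) * T = (1 + real G * (1 + C)) * T + T + C * T"
      by (simp add: algebra_simps)
    ultimately have "1 + t + t' \<le> (1 + real (Suc G) * (1 + C)) * T"
      using 2(2) T1 by linarith
    then show ?thesis using exec.While_True[OF h 1(1) 2(1)] 2(3) unfolding sh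
      by (intro exI[of _ "1 + t + t'"] exI[of _ s2]) simp
  qed
qed

lemma rawinit_sim:
  "\<exists>s. exec K T \<omega> rawinit (init_state d \<delta>) 10 s \<and> Rel d s (vstate0 \<delta>)"
proof -
  define cs where "cs = [NConst (At 1) 1, NConst (At 20) 40, NAdd (At 21) (At 20) (At 0), NAdd (At 22) (At 21) (At 0),
     NAdd (At 23) (At 22) (At 0), NAdd (At 24) (At 23) (At 0), NAdd (At 25) (At 24) (At 0), NAdd (At 26) (At 25) (At 0),
     NAdd (At 27) (At 26) (At 0), NAdd (At 28) (At 27) (At 0)]"
  have c: "(\<Sum>c\<leftarrow>cs. cost T c) = 10" by (simp add: cs_def)
  have "Rel d (fold (effect K \<omega>) cs (init_state d \<delta>)) (vstate0 \<delta>)"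
    by (simp add: cs_def Rel_def nset_def all_less_9 init_state_def vstate0_def)
  then show ?thesis using seqs_Do[of cs "init_state d \<delta>"] unfolding c rawinit_def cs_def[symmetric] by blast
qed

lemma outloop_sim:
  assumes "nmem s 3 = i" "nmem s 4 = 40 + d + i" "nmem s 0 = d" "nmem s 1 = 1" "i \<le> d"
    "\<And>j. j < i \<Longrightarrow> rmem s j = (x j)\<^sup>2" "\<And>j. i \<le> j \<Longrightarrow> j < d \<Longrightarrow> rmem s (40 + d + j) = x j"
  shows "\<exists>s'. exec K T \<omega> outloop s (1 + 4 * real (d - i)) s' \<and> (\<forall>j<d. rmem s' j = (x j)\<^sup>2)"
  using assms
proof (induction "d - i" arbitrary: i s)
  case 0
  then have "\<not> holds (NLess (At 3) (At 0)) s" by simp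
  from exec.While_False[OF this] show ?case using 0 unfolding outloop_def by (intro exI[of _ s]) auto
next
  case (Suc m)
  then have i: "i < d" by simp
  then have h: "holds (NLess (At 3) (At 0)) s" using Suc.prems by simp
  define cs where "cs = [RArith Times (Ptr 3) (Ptr 4) (Ptr 4), NAdd (At 3) (At 3) (At 1), NAdd (At 4) (At 4) (At 1)]"
  define s1 where "s1 = fold (effect K \<omega>) cs s"
  have e: "exec K T \<omega> (seqs (map Do cs)) s 3 s1"
    using seqs_Do[of cs s] by (simp add: s1_def cs_def)
  have s1: "nmem s1 3 = Suc i" "nmem s1 4 = 40 + d + Suc i" "nmem s1 0 = d" "nmem s1 1 = 1"
    "rmem s1 = (rmem s)(i := x i * x i)"
    using Suc.prems i by (simp_all add: s1_def cs_def nset_def rset_def)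
  have "\<exists>s'. exec K T \<omega> outloop s1 (1 + 4 * real (d - Suc i)) s' \<and> (\<forall>j<d. rmem s' j = (x j)\<^sup>2)"
  proof (rule Suc.hyps(1))
    show "m = d - Suc i" using Suc.hyps(2) by simp
    show "nmem s1 3 = Suc i" "nmem s1 4 = 40 + d + Suc i" "nmem s1 0 = d" "nmem s1 1 = 1" by (rule s1)+
    show "Suc i \<le> d" using i by simp
    show "rmem s1 j = (x j)\<^sup>2" if "j < Suc i" for j
      using that Suc.prems(6)[of j] by (auto simp: s1(5) power2_eq_square less_Suc_eq)
    show "rmem s1 (40 + d + j) = x j" if "Suc i \<le> j" "j < d" for j
      using that Suc.prems(7)[of j] by (simp add: s1(5))
  qed
  then obtain s2 where 2: "exec K T \<omega> outloop s1 (1 + 4 * real (d - Suc i)) s2" "\<forall>j<d. rmem s2 j = (x j)\<^sup>2" by blast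
  have "1 + 3 + (1 + 4 * real (d - Suc i)) = 1 + 4 * real (d - i)" using i by simp
  then show ?case using exec.While_True[OF h e[unfolded cs_def] 2(1)[unfolded outloop_def]] 2(2)
    unfolding outloop_def by metis
qed

theorem mainp_sim:
  fixes n :: nat and \<delta> :: real
  assumes C: "0 \<le> C"
  defines "\<sigma> \<equiv> hsem d A \<omega> (initp n) (vstate0 \<delta>)"
  assumes cost: "\<And>j. j < G \<Longrightarrow> 0 < av (iterate d A \<omega> (bodyp n) j \<sigma>) 12 \<Longrightarrow>
      hcost d A \<omega> (bodyp n) (iterate d A \<omega> (bodyp n) j \<sigma>) \<le> C"
    and stop: "\<not> 0 < av (iterate d A \<omega> (bodyp n) G \<sigma>) 12"
  shows "\<exists>t s. exec K T \<omega> (mainp n) (init_state d \<delta>) t s \<and>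
    t \<le> (18 + hcost d A \<omega> (initp n) (vstate0 \<delta>) + real G * (1 + C)) * T \<and>
    (\<forall>i<d. rmem s i = (vv (iterate d A \<omega> (bodyp n) G \<sigma>) 1 i)\<^sup>2)"
proof -
  let ?c = "hcost d A \<omega> (initp n) (vstate0 \<delta>)"
  obtain s1 where 1: "exec K T \<omega> rawinit (init_state d \<delta>) 10 s1" "Rel d s1 (vstate0 \<delta>)" using rawinit_sim by blast
  from comp_sim[OF ok_initp 1(2), of n] obtain t2 s2 where 2: "exec K T \<omega> (compile (initp n)) s1 t2 s2"
    "t2 \<le> ?c * T" "Rel d s2 \<sigma>" unfolding \<sigma>_def by blast
  from while_sim[OF ok_bodyp C 2(3) cost stop] obtain t3 s3 where
    3: "exec K T \<omega> (While (RLess (At 39) (At 12)) (compile (bodyp n))) s2 t3 s3"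
      "t3 \<le> (1 + real G * (1 + C)) * T" "Rel d s3 (iterate d A \<omega> (bodyp n) G \<sigma>)" by blast
  define cs where "cs = [NConst (At 3) 0, NAdd (At 4) (At 21) (At 2)]"
  define s4 where "s4 = fold (effect K \<omega>) cs s3"
  have 4: "exec K T \<omega> (seqs (map Do cs)) s3 2 s4"
    using seqs_Do[of cs s3] by (simp add: s4_def cs_def)
  have n21: "nmem s3 21 = 40 + d"
  proof -
    have "\<forall>c<9. nmem s3 (20 + c) = 40 + c * d" using 3(3) by (simp add: Rel_def)
    from this[rule_format, of 1] show ?thesis by simp
  qed
  have v: "rmem s3 (40 + d + j) = vv (iterate d A \<omega> (bodyp n) G \<sigma>) 1 j" if "j < d" for j
  proof -
    have "\<forall>c<9. \<forall>i<d. rmem s3 (40 + c * d + i) = vv (iterate d A \<omega> (bodyp n) G \<sigma>) c i" using 3(3) by (simp add: Rel_def)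
    from this[rule_format, of 1 j] show ?thesis using that by simp
  qed
  have s4: "nmem s4 3 = 0" "nmem s4 4 = 40 + d + 0" "nmem s4 0 = d" "nmem s4 1 = 1" "rmem s4 = rmem s3"
    using 3(3) n21 by (simp_all add: s4_def cs_def nset_def Rel_def)
  have "\<exists>s'. exec K T \<omega> outloop s4 (1 + 4 * real (d - 0)) s' \<and> (\<forall>j<d. rmem s' j = (vv (iterate d A \<omega> (bodyp n) G \<sigma>) 1 j)\<^sup>2)"
    by (rule outloop_sim) (simp_all add: s4 v)
  then obtain s5 where 5: "exec K T \<omega> outloop s4 (1 + 4 * real d) s5"
    "\<forall>j<d. rmem s5 j = (vv (iterate d A \<omega> (bodyp n) G \<sigma>) 1 j)\<^sup>2" by auto
  have "exec K T \<omega> (mainp n) (init_state d \<delta>) (10 + (t2 + (t3 + (2 + (1 + 4 * real d))))) s5"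
    unfolding mainp_def cs_def[symmetric]
    by (intro exec.Seq[OF 1(1)] exec.Seq[OF 2(1)] exec.Seq[OF 3(1)] exec.Seq[OF 4] 5(1))
  moreover have "10 + (t2 + (t3 + (2 + (1 + 4 * real d)))) \<le> (18 + ?c + real G * (1 + C)) * T"
    using 2(2) 3(2) T T1 by (simp add: distrib_right)
  ultimately show ?thesis using 5(2) by blast
qed

end

section \<open>Statements for all coins: the lower bound, termination and running time\<close>

section \<open>Soundness of the certificate\<close>

lemma mv_Nmat_cong:
  assumes "\<And>i. i < d \<Longrightarrow> D i = D' i" "i < d"
  shows "mv d (Nmat A s D \<mu>) x i = mv d (Nmat A s D' \<mu>) x i"
  unfolding mv_def Nmat_def using assms by (intro sum.cong refl) auto

lemma one_le_cond:
  assumes "1 \<le> d" "K \<in> carrier_mat d d" "nonneg_vec d w" "positive_definite d (outer_scale d K w)"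
  shows "1 \<le> cond_number (outer_scale d K w)"
  using feasible_scaling[OF assms] by (auto simp: le_divide_eq)

lemma opt_ge:
  assumes d: "1 \<le> d" and K: "positive_definite d K"
    and le: "\<And>w. nonneg_vec d w \<Longrightarrow> positive_definite d (outer_scale d K w) \<Longrightarrow> x \<le> cond_number (outer_scale d K w)"
  shows "x \<le> opt_outer_cond d K"
  unfolding opt_outer_cond_def
proof (rule cInf_greatest)
  \<comment> \<open>The weights 1 show that the set is not empty; otherwise its infimum would be
    meaningless.\<close>
  define w where "w = Matrix.vec d (\<lambda>_. 1 :: real)"
  have Kc: "K \<in> carrier_mat d d" using K by (simp add: positive_definite_iff)
  have "outer_scale d K w = K"
  proof (rule eq_matI)
    fix i j assume ij: "i < dim_row K" "j < dim_col K"
    then have "i < d" "j < d" using Kc by auto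
    then show "outer_scale d K w $$ (i, j) = K $$ (i, j)"
      using outer_scale_fm[OF Kc, of i j w] by (simp add: fm_def w_def)
  qed (use Kc outer_scale_carrier[OF Kc, of w] in auto)
  moreover have "nonneg_vec d w" by (simp add: nonneg_vec_def w_def)
  ultimately show "{cond_number (outer_scale d K w) | w. nonneg_vec d w \<and> positive_definite d (outer_scale d K w)} \<noteq> {}"
    using K by fastforce
qed (use le in auto)

lemma opt_ge_1: "1 \<le> d \<Longrightarrow> positive_definite d K \<Longrightarrow> 1 \<le> opt_outer_cond d K"
  by (rule opt_ge) (auto intro: one_le_cond simp: positive_definite_iff)

text \<open>Holds for all coins: \<open>certificate\<close> is applied to whatever vectors the
  program has computed, for each feasible \<open>w\<close> separately.\<close>

theorem certificate_sound:
  assumes d: "1 \<le> d" and K: "positive_definite d K" and mu: "0 \<le> av \<sigma> 5"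
    and s: "\<forall>i<d. 0 < vv \<sigma> 1 i" and D: "\<And>i. i < d \<Longrightarrow> vv \<sigma> 0 i = fm K i i"
    and near: "near d (fm K) \<omega> n \<sigma>" and e: "av \<sigma> 21 = e" "e \<le> 2"
  shows "(1 - e / 2)\<^sup>2 * (th d (fm K) \<omega> n \<sigma> * th' d (fm K) \<omega> n \<sigma>) \<le> opt_outer_cond d K"
proof (rule opt_ge[OF d K])
  fix w assume w: "nonneg_vec d w" "positive_definite d (outer_scale d K w)"
  have Kc: "K \<in> carrier_mat d d" "sym_mat d (fm K)" using K by (auto simp: positive_definite_iff)
  from feasible_scaling[OF d Kc(1) w] obtain lo hi where lh: "0 < lo" "cond_number (outer_scale d K w) = hi / lo" "lo \<le> hi"
    "\<forall>i<d. 0 < vec_index w i"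
    "\<forall>x. lo * (\<Sum>i<d. (x i)\<^sup>2 / vec_index w i) \<le> ip d x (mv d (fm K) x)"
    "\<forall>x. ip d x (mv d (fm K) x) \<le> hi * (\<Sum>i<d. (x i)\<^sup>2 / vec_index w i)" by blast
  define \<sigma>1 where "\<sigma>1 = hsem d (fm K) \<omega> (prep n) \<sigma>"
  have s1: "av \<sigma>1 5 = av \<sigma> 5" "vv \<sigma>1 = vv \<sigma>" by (simp_all add: \<sigma>1_def prep_correct)
  define N where "N = Nmat (fm K) (vv \<sigma> 1) (\<lambda>i. fm K i i) (av \<sigma> 5)"
  have NN: "mv d (NN (fm K) \<sigma>1) x i = mv d N x i" if "i < d" for x i
    unfolding NN_def N_def s1 by (rule mv_Nmat_cong) (use D that in auto)
  have ipN: "ip d x (mv d (NN (fm K) \<sigma>1) y) = ip d x (mv d N y)" for x y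
    by (rule ip_cong) (simp_all add: NN)
  define k where "k = nat \<lceil>av \<sigma>1 8\<rceil>"
  define y where "y j = yv d (fm K) \<omega> \<sigma>1 (fl \<sigma>1 + j * d)" for j
  define z where "z j = zv d (fm K) \<omega> \<sigma>1 (fl \<sigma>1 + j * d)" for j
  have P: "Pv d (fm K) \<omega> \<sigma>1 i = (\<Sum>j<k. (mv d N (y j) i)\<^sup>2)" if "i < d" for i
    unfolding Pv_def k_def y_def using NN[OF that] by simp
  have S: "Sv d (fm K) \<omega> \<sigma>1 i = (\<Sum>j<k. (z j i)\<^sup>2)" for i
    unfolding Sv_def k_def z_def ..
  have E: "E1 d (fm K) \<omega> \<sigma>1 = (\<Sum>j<k. ip d (y j) (mv d N (y j)))"
    unfolding E1_def k_def y_def ipN ..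
  have F: "E2 d (fm K) \<omega> \<sigma>1 = (\<Sum>j<k. ip d (z j) (mv d N (z j)))"
    unfolding E2_def k_def z_def ipN ..
  have sP: "sum (Pv d (fm K) \<omega> \<sigma>1) {..<d} = (\<Sum>i<d. \<Sum>j<k. (mv d N (y j) i)\<^sup>2)"
    by (intro sum.cong refl) (simp add: P)
  have sS: "sum (Sv d (fm K) \<omega> \<sigma>1) {..<d} = (\<Sum>i<d. \<Sum>j<k. (z j i)\<^sup>2)"
    by (intro sum.cong refl) (simp add: S)
  have dist: "dist_PS d (fm K) \<omega> \<sigma>1 = (\<Sum>i<d. \<bar>(\<Sum>j<k. (mv d N (y j) i)\<^sup>2) / (\<Sum>i<d. \<Sum>j<k. (mv d N (y j) i)\<^sup>2)
      - (\<Sum>j<k. (z j i)\<^sup>2) / (\<Sum>i<d. \<Sum>j<k. (z j i)\<^sup>2)\<bar>)"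
    unfolding dist_PS_def sP sS by (intro sum.cong refl) (simp add: P S)
  have de: "dist_PS d (fm K) \<omega> \<sigma>1 \<le> e" using near e(1) by (simp add: near_def \<sigma>1_def)
  show "(1 - e / 2)\<^sup>2 * (th d (fm K) \<omega> n \<sigma> * th' d (fm K) \<omega> n \<sigma>) \<le> cond_number (outer_scale d K w)"
    unfolding th_def th'_def \<sigma>1_def[symmetric] lh(2) sP sS E F unfolding N_def
    by (rule certificate[OF Kc(2) mu s lh(4) lh(1,3,5,6) de[unfolded dist N_def] e(2)])
qed

section \<open>Invariants that hold for all coins\<close>

lemma two_power_lg_le: "1 \<le> x \<Longrightarrow> 2 ^ lg x \<le> 2 * x"
proof (cases "lg x")
  case (Suc j)
  then show ?thesis using lg_lower[of j x] by simp
qed simp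

lemma le_lg: "2 ^ j \<le> x \<Longrightarrow> j \<le> lg x"
  using lg_upper[of x] by (metis le_trans not_le power_increasing_iff order.trans one_less_numeral_iff semiring_norm(76))

locale algorithm =
  fixes d :: nat and K :: "real mat" and n :: nat and \<delta> :: real
  assumes d: "1 \<le> d" and K: "positive_definite d K" and n: "10 \<le> n" and \<delta>: "0 < \<delta>" "\<delta> < 1"
begin

abbreviation "A \<equiv> fm K"
abbreviation "\<kappa> \<equiv> opt_outer_cond d K"
abbreviation "l \<equiv> lp d n"

definition rr :: real where "rr = (sqrt ^^ (l + 2)) (1 + 1 / (8 * real n))"

definition st :: "(nat \<Rightarrow> bool) \<Rightarrow> nat \<Rightarrow> vstate" where
  "st \<omega> t = iterate d A \<omega> (bodyp n) t (hsem d A \<omega> (initp n) (vstate0 \<delta>))"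

lemma st_0: "st \<omega> 0 = hsem d A \<omega> (initp n) (vstate0 \<delta>)" by (simp add: st_def iterate_0)

lemma st_Suc: "st \<omega> (Suc t) = (if 0 < av (st \<omega> t) 12 then hsem d A \<omega> (bodyp n) (st \<omega> t) else st \<omega> t)"
  by (simp add: st_def iterate_Suc)

lemma n1: "1 \<le> n" using n by simp

lemma funpow_sqrt_ge_1: "1 \<le> x \<Longrightarrow> 1 \<le> (sqrt ^^ j) x"
  by (induction j) simp_all

lemma funpow_sqrt_power: "0 \<le> x \<Longrightarrow> ((sqrt ^^ j) x) ^ (2 ^ j) = x"
proof (induction j)
  case (Suc j)
  have nn: "0 \<le> (sqrt ^^ j) x" using Suc.prems by (induction j) simp_all
  have "((sqrt ^^ Suc j) x) ^ (2 ^ Suc j) = ((sqrt ((sqrt ^^ j) x))\<^sup>2) ^ (2 ^ j)"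
    by (simp add: power_mult[symmetric])
  then show ?case using Suc nn by simp
qed simp

lemma rr: "1 \<le> rr" "rr ^ (2 ^ (l + 2)) = 1 + 1 / (8 * real n)"
  unfolding rr_def by (intro funpow_sqrt_ge_1 funpow_sqrt_power; simp)+

lemma A_props: "K \<in> carrier_mat d d" "sym_mat d A" "\<And>x. (\<exists>i<d. x i \<noteq> 0) \<Longrightarrow> 0 < ip d x (mv d A x)"
  using K by (auto simp: positive_definite_iff)

lemma A_diag: "i < d \<Longrightarrow> 0 < A i i"
  using A_props(3)[of "\<lambda>j. of_bool (j = i)"] diag_quad[of i d A] by fastforce

lemma kappa: "1 \<le> \<kappa>" by (rule opt_ge_1[OF d K])

definition Static :: "vstate \<Rightarrow> bool" where
  "Static \<sigma> \<longleftrightarrow> av \<sigma> 0 = \<delta> \<and> av \<sigma> 1 = real d \<and> av \<sigma> 2 = 2 ^ l / 2 - 1 \<and> av \<sigma> 3 = 2 ^ l / 2 \<and> av \<sigma> 4 = rr \<and>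
    av \<sigma> 21 = 1 / real n \<and> av \<sigma> 32 = 2 ^ l \<and> (\<forall>i<d. vv \<sigma> 0 i = A i i) \<and> (\<forall>i<d. 0 < vv \<sigma> 1 i)"

lemma Static_init: "Static (st \<omega> 0)"
  unfolding st_0 Static_def rr_def using init_correct[OF d n1, where A=A and \<omega>=\<omega> and \<delta>=\<delta>] A_diag
  by (auto simp: lp_def)

lemma Static_step:
  assumes "Static \<sigma>" shows "Static (hsem d A \<omega> (bodyp n) \<sigma>)"
proof -
  have "0 < rr" using rr by simp
  then show ?thesis using assms unfolding Static_def by (simp add: body_correct)
qed

text \<open>\<open>Jm\<close> controls the number of halvings, as going on after one means
  \<open>\<mu> B \<ge> 1 / n\<close> with \<open>B \<le> 20 \<kappa>\<close>; \<open>Qm\<close> is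
  the cap on updates for the largest possible \<open>B\<close>, rounded up. Both refer to the
  unknown optimum and occur only in the analysis.\<close>

definition "Jm = lg (20 * real n * real d * \<kappa>)"
definition "Qm = nat \<lceil>128 * (real n)\<^sup>2 * 2 ^ l * sqrt (20 * \<kappa>) + 1\<rceil>"
definition "Gm = (Jm + 2) * (Qm + 1)"

text \<open>\<open>j\<close> counts the halvings of \<open>\<mu>\<close> and \<open>c\<close> the updates since the last one.\<close>
definition Inv :: "nat \<Rightarrow> vstate \<Rightarrow> nat \<Rightarrow> nat \<Rightarrow> bool" where
  "Inv t \<sigma> j c \<longleftrightarrow> Static \<sigma> \<and> av \<sigma> 13 = real t \<and> av \<sigma> 5 = real d / 2 ^ j \<and> av \<sigma> 10 = real c \<and>
    0 \<le> av \<sigma> 6 \<and> av \<sigma> 6 \<le> 20 * \<kappa> \<and> t \<le> j * (Qm + 1) + c \<and> c \<le> Qm \<and> j \<le> Jm + 1"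

lemma A_psd: "0 \<le> ip d x (mv d A x)"
proof (cases "\<exists>i<d. x i \<noteq> 0")
  case True
  then show ?thesis using A_props(3)[of x] by simp
next
  case False
  then show ?thesis unfolding ip_def by (intro sum_nonneg) auto
qed

lemma psd_NN:
  assumes "Static \<sigma>" "0 \<le> av \<sigma> 5"
  shows "0 \<le> ip d x (mv d (NN A \<sigma>) x)"
proof -
  have "ip d x (mv d (NN A \<sigma>) x) = ip d (\<lambda>i. vv \<sigma> 1 i * x i) (mv d A (\<lambda>i. vv \<sigma> 1 i * x i))
      + av \<sigma> 5 * (\<Sum>i<d. vv \<sigma> 0 i * (vv \<sigma> 1 i * x i)\<^sup>2)"
    unfolding NN_def by (rule Nmat_quad)
  moreover have "0 \<le> (\<Sum>i<d. vv \<sigma> 0 i * (vv \<sigma> 1 i * x i)\<^sup>2)"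
    using assms A_diag by (intro sum_nonneg) (auto simp: Static_def less_imp_le)
  ultimately show ?thesis using assms(2) A_psd[of "\<lambda>i. vv \<sigma> 1 i * x i"] by simp
qed

lemma th_nonneg:
  assumes "Static \<sigma>" "0 \<le> av \<sigma> 5"
  shows "0 \<le> th d A \<omega> n \<sigma>" "0 \<le> th' d A \<omega> n \<sigma>"
proof -
  define \<sigma>1 where "\<sigma>1 = hsem d A \<omega> (prep n) \<sigma>"
  have N: "NN A \<sigma>1 = NN A \<sigma>" by (simp add: NN_def \<sigma>1_def prep_correct)
  have nn: "0 \<le> ip d x (mv d (NN A \<sigma>1) x)" for x unfolding N by (rule psd_NN[OF assms])
  show "0 \<le> th d A \<omega> n \<sigma>" "0 \<le> th' d A \<omega> n \<sigma>"
    unfolding th_def th'_def \<sigma>1_def[symmetric] E1_def E2_def Pv_def Sv_def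
    by (intro divide_nonneg_nonneg sum_nonneg nn zero_le_power2)+
qed

text \<open>Soundness gives \<open>(1 - e / 2)^2 \<theta> \<theta>' \<le> \<kappa>\<close>, and for
  \<open>e \<le> 1 / 10\<close> the square is at least 1/2; the factor 10 in \<open>Bnew\<close>
  then becomes 20.\<close>

lemma Bnew_bound:
  assumes "Static \<sigma>" "0 \<le> av \<sigma> 5" "near d A \<omega> n \<sigma>"
  shows "(1 - 1 / real n) * (th d A \<omega> n \<sigma> * th' d A \<omega> n \<sigma>) \<le> \<kappa>" "0 \<le> Bnew d A \<omega> n \<sigma>" "Bnew d A \<omega> n \<sigma> \<le> 20 * \<kappa>"
proof -
  define e where "e = 1 / real n"
  have e: "0 \<le> e" "e \<le> 1 / 10" using n by (auto simp: e_def field_simps)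
  define x where "x = th d A \<omega> n \<sigma> * th' d A \<omega> n \<sigma>"
  have x: "0 \<le> x" unfolding x_def using th_nonneg[OF assms(1,2)] by simp
  have "(1 - e / 2)\<^sup>2 * x \<le> \<kappa>"
    unfolding x_def by (rule certificate_sound[OF d K assms(2) _ _ assms(3)])
      (use assms(1) e in \<open>auto simp: Static_def e_def\<close>)
  moreover have "1 - e \<le> (1 - e / 2)\<^sup>2" by (simp add: power2_eq_square algebra_simps)
  then have "(1 - e) * x \<le> (1 - e / 2)\<^sup>2 * x" using x by (rule mult_right_mono)
  ultimately have c: "(1 - e) * x \<le> \<kappa>" by linarith
  show "(1 - 1 / real n) * (th d A \<omega> n \<sigma> * th' d A \<omega> n \<sigma>) \<le> \<kappa>" using c by (simp add: e_def x_def)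
  have "1 / 2 * x \<le> (1 - e) * x" using x e by (intro mult_right_mono) auto
  then have "x \<le> 2 * \<kappa>" using c by linarith
  then show "0 \<le> Bnew d A \<omega> n \<sigma>" "Bnew d A \<omega> n \<sigma> \<le> 20 * \<kappa>" using x by (auto simp: Bnew_def x_def)
qed

lemma capv_le:
  assumes "Static \<sigma>" "0 \<le> av \<sigma> 6" "av \<sigma> 6 \<le> 20 * \<kappa>" "real c < capv n \<sigma>"
  shows "Suc c \<le> Qm"
proof -
  have "capv n \<sigma> \<le> 128 * (real n)\<^sup>2 * 2 ^ l * sqrt (20 * \<kappa>) + 1"
  proof -
    have "sqrt (av \<sigma> 6) * (2 ^ l * (128 * (real n)\<^sup>2)) \<le> sqrt (20 * \<kappa>) * (2 ^ l * (128 * (real n)\<^sup>2))"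
      using assms by (intro mult_right_mono) auto
    then show ?thesis using assms(1) by (simp add: capv_def Static_def mult_ac)
  qed
  then have "real c < 128 * (real n)\<^sup>2 * 2 ^ l * sqrt (20 * \<kappa>) + 1" using assms(4) by linarith
  then have "int c < \<lceil>128 * (real n)\<^sup>2 * 2 ^ l * sqrt (20 * \<kappa>) + 1\<rceil>"
    by (subst less_ceiling_iff) simp
  then have "c < Qm" unfolding Qm_def by (simp only: zless_nat_eq_int_zless)
  then show ?thesis by simp
qed

lemma Inv_init: "Inv 0 (st \<omega> 0) 0 0"
  using Static_init[of \<omega>] init_correct[OF d n1, where A=A and \<omega>=\<omega> and \<delta>=\<delta>] kappa unfolding Inv_def st_0 by simp

text \<open>The mere fact that the loop goes on yields the counter bounds: with a halving, the
  stopping test has failed; with an update, the cap was not yet reached.\<close>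

lemma Inv_step:
  assumes I: "Inv t \<sigma> j c" and go: "0 < av (hsem d A \<omega> (bodyp n) \<sigma>) 12"
  defines "\<sigma>' \<equiv> hsem d A \<omega> (bodyp n) \<sigma>"
  shows "if near d A \<omega> n \<sigma> then Inv (Suc t) \<sigma>' (Suc j) 0 else Inv (Suc t) \<sigma>' j (Suc c)"
proof -
  have S: "Static \<sigma>" "Static \<sigma>'" using I Static_step by (auto simp: Inv_def \<sigma>'_def)
  have mu: "0 \<le> av \<sigma> 5" using I by (simp add: Inv_def)
  have a13: "av \<sigma>' 13 = real (Suc t)" using I by (simp add: \<sigma>'_def body_correct tval_def Inv_def)
  show ?thesis
  proof (cases "near d A \<omega> n \<sigma>")
    case True
    note B = Bnew_bound[OF S(1) mu True]
    have "\<not> av \<sigma> 5 * Bnew d A \<omega> n \<sigma> < 1 / real n"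
      using go True S(1) by (auto simp: body_correct Static_def split: if_splits)
    then have "1 / real n \<le> real d / 2 ^ j * (20 * \<kappa>)"
      using I mult_left_mono[OF B(3) mu] by (simp add: Inv_def)
    then have "2 ^ j \<le> 20 * real n * real d * \<kappa>"
      using n1 by (simp add: field_simps)
    then have "j \<le> Jm" unfolding Jm_def by (rule le_lg)
    then show ?thesis using True I S(2) a13 B unfolding Inv_def
      by (simp add: \<sigma>'_def body_correct)
  next
    case False
    have "real c < capv n \<sigma>"
      using go False I by (auto simp: body_correct Inv_def split: if_splits)
    then have "Suc c \<le> Qm" using capv_le[of \<sigma> c] I S(1) by (simp add: Inv_def)
    then show ?thesis using False I S(2) a13 unfolding Inv_def
      by (simp add: \<sigma>'_def body_correct)
  qed
qed

lemma go_Suc: "0 < av (st \<omega> (Suc t)) 12 \<Longrightarrow> 0 < av (st \<omega> t) 12 \<and> st \<omega> (Suc t) = hsem d A \<omega> (bodyp n) (st \<omega> t)"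
  by (auto simp: st_Suc split: if_splits)

theorem Inv_reachable: "0 < av (st \<omega> t) 12 \<Longrightarrow> \<exists>j c. Inv t (st \<omega> t) j c"
proof (induction t)
  case 0
  then show ?case using Inv_init by blast
next
  case (Suc t)
  from go_Suc[OF Suc.prems] have g: "0 < av (st \<omega> t) 12" "st \<omega> (Suc t) = hsem d A \<omega> (bodyp n) (st \<omega> t)" by auto
  from Suc.IH[OF g(1)] obtain j c where "Inv t (st \<omega> t) j c" by blast
  from Inv_step[OF this, of \<omega>] Suc.prems g(2) show ?case by (auto split: if_splits)
qed

lemma stops: "\<not> 0 < av (st \<omega> Gm) 12"
proof
  assume "0 < av (st \<omega> Gm) 12"
  from Inv_reachable[OF this] obtain j c where "Inv Gm (st \<omega> Gm) j c" by blast
  then have i: "Gm \<le> j * (Qm + 1) + c" "c \<le> Qm" "j \<le> Jm + 1" by (auto simp: Inv_def)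
  then have "j * (Qm + 1) \<le> (Jm + 1) * (Qm + 1)" by (intro mult_right_mono) auto
  then have "Gm < (Jm + 1) * (Qm + 1) + (Qm + 1)" using i by linarith
  then show False by (simp add: Gm_def algebra_simps)
qed

text \<open>Depends on the round number only, so the number of coins read in an executed round does
  not depend on the coins.\<close>

definition "kk t = 12800 * n\<^sup>2 * lg (8 * real d * real (Suc t) * real (Suc t) / \<delta>)"

lemma kval_eq: "Inv t \<sigma> j c \<Longrightarrow> kval n \<sigma> = kk t"
  by (simp add: kval_def kk_def tval_def Inv_def Static_def add.commute)

lemma l5: "5 \<le> l"
proof -
  have "3 \<le> lg (8 * real d * real d)"
  proof (rule le_lg)
    have "1 * 1 \<le> real d * real d" using d by (intro mult_mono) auto
    then show "2 ^ 3 \<le> 8 * real d * real d" by (simp add: mult.assoc)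
  qed
  then have "10 * 3 \<le> real n * real (lg (8 * real d * real d))" using n by (intro mult_mono) auto
  then have "30 \<le> (2::real) ^ l" unfolding lp_def using lg_upper[of "real n * real (lg (8 * real d * real d))"] by linarith
  then have "(2::real) ^ 4 < 2 ^ l" by simp
  then have "4 < l" by (rule power_less_imp_less_exp[rotated]) simp
  then show ?thesis by simp
qed

lemma p_half: "(2::real) ^ l / 2 = real (2 ^ (l - 1))"
  using l5 by (cases l) auto

definition "lamG = lg (8 * real d * real Gm * real Gm / \<delta>)"

definition "Cb = 400 + 15 * real lamG + real (12800 * n\<^sup>2 * lamG) *
  (309 + 94 * 2 ^ l + 2 ^ l * (54 + 98 * (80 * real n * 2 ^ l * (20 * \<kappa>) + 1)))"

lemma lg_mono: "x \<le> y \<Longrightarrow> lg x \<le> lg y"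
  unfolding lg_def[of x] using lg_upper[of y] by (intro Least_le) simp

theorem cost_bound:
  assumes "t < Gm" and go: "0 < av (st \<omega> t) 12"
  shows "hcost d A \<omega> (bodyp n) (st \<omega> t) \<le> Cb"
proof -
  define \<sigma> where "\<sigma> = st \<omega> t"
  from Inv_reachable[OF go] obtain j c where I: "Inv t \<sigma> j c" by (auto simp: \<sigma>_def)
  have S: "av \<sigma> 0 = \<delta>" "av \<sigma> 1 = real d" "av \<sigma> 2 = 2 ^ l / 2 - 1" "av \<sigma> 3 = 2 ^ l / 2" "av \<sigma> 32 = 2 ^ l"
    "tval \<sigma> = real (Suc t)" "0 \<le> av \<sigma> 6" "av \<sigma> 6 \<le> 20 * \<kappa>"
    using I by (auto simp: Inv_def Static_def tval_def)
  have L: "lg (8 * av \<sigma> 1 * tval \<sigma> * tval \<sigma> / av \<sigma> 0) \<le> lamG"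
    unfolding lamG_def S
  proof (intro lg_mono divide_right_mono mult_mono)
    show "real (Suc t) \<le> real Gm" "real (Suc t) \<le> real Gm" using assms(1) by simp_all
  qed (use \<delta> in auto)
  have kv: "real (kval n \<sigma>) \<le> real (12800 * n\<^sup>2 * lamG)"
    unfolding kval_def using L by (simp only: of_nat_le_iff mult_le_mono2)
  have 2: "real (nat \<lceil>av \<sigma> 2\<rceil>) \<le> 2 ^ l" "real (nat \<lceil>av \<sigma> 3\<rceil>) \<le> 2 ^ l"
  proof -
    have "real (nat \<lceil>av \<sigma> 3\<rceil>) = 2 ^ l / 2" unfolding S p_half by simp
    moreover have "real (nat \<lceil>av \<sigma> 2\<rceil>) \<le> real (nat \<lceil>av \<sigma> 3\<rceil>)"
      by (simp only: of_nat_le_iff) (intro nat_mono ceiling_mono, simp add: S)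
    moreover have "(2::real) ^ l / 2 \<le> 2 ^ l" by simp
    ultimately show "real (nat \<lceil>av \<sigma> 2\<rceil>) \<le> 2 ^ l" "real (nat \<lceil>av \<sigma> 3\<rceil>) \<le> 2 ^ l" by linarith+
  qed
  have 9: "real (nat \<lceil>80 * real n * av \<sigma> 32 * av \<sigma> 6\<rceil>) \<le> 80 * real n * 2 ^ l * (20 * \<kappa>) + 1"
  proof -
    have "0 \<le> 80 * real n * av \<sigma> 32 * av \<sigma> 6" using S by simp
    then have "real (nat \<lceil>80 * real n * av \<sigma> 32 * av \<sigma> 6\<rceil>) \<le> 80 * real n * av \<sigma> 32 * av \<sigma> 6 + 1"
      by linarith
    also have "80 * real n * av \<sigma> 32 * av \<sigma> 6 \<le> 80 * real n * 2 ^ l * (20 * \<kappa>)"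
      unfolding S(5) using S by (intro mult_left_mono) auto
    finally show ?thesis by simp
  qed
  have "hcost d A \<omega> (bodyp n) \<sigma> \<le> 400 + 15 * real (lg (8 * av \<sigma> 1 * tval \<sigma> * tval \<sigma> / av \<sigma> 0)) +
    real (kval n \<sigma>) * (309 + 94 * real (nat \<lceil>av \<sigma> 2\<rceil>)
    + real (nat \<lceil>av \<sigma> 3\<rceil>) * (54 + 98 * real (nat \<lceil>80 * real n * av \<sigma> 32 * av \<sigma> 6\<rceil>)))"
    by (rule body_cost)
  also have "\<dots> \<le> Cb"
    unfolding Cb_def using L
    by (intro add_mono mult_mono kv 2 9 mult_left_mono) (auto intro!: add_nonneg_nonneg mult_nonneg_nonneg)
  finally show ?thesis by (simp add: \<sigma>_def)
qed

end

section \<open>The running time\<close>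

definition LL :: "nat \<Rightarrow> real \<Rightarrow> real \<Rightarrow> real" where
  "LL d \<kappa> \<delta> = max 1 (ln (real d * \<kappa> / \<delta>))"

lemma lg_le_ln: "1 \<le> x \<Longrightarrow> real (lg x) \<le> 2 * ln x + 1"
proof -
  assume x: "1 \<le> x"
  have ln2: "1 / 2 \<le> ln (2::real)"
  proof -
    have "(exp (1 / 2 :: real))\<^sup>2 \<le> 2\<^sup>2"
      using exp_le by (simp add: power2_eq_square exp_add[symmetric])
    then have "exp (1 / 2 :: real) \<le> 2" by (rule power2_le_imp_le) simp
    then show ?thesis by (subst ln_ge_iff) simp_all
  qed
  have "2 ^ lg x \<le> 2 * x" by (rule two_power_lg_le[OF x])
  then have "ln (2 ^ lg x) \<le> ln (2 * x)" using x by (subst ln_le_cancel_iff) auto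
  then have "real (lg x) * ln 2 \<le> ln 2 + ln x" using x by (simp add: ln_realpow ln_mult)
  then have "(real (lg x) - 1) * ln 2 \<le> ln x" by (simp add: algebra_simps)
  moreover have "(real (lg x) - 1) * (1 / 2) \<le> (real (lg x) - 1) * ln 2" if "lg x \<noteq> 0"
    using that by (intro mult_left_mono ln2) auto
  moreover have "0 \<le> ln x" using x by simp
  ultimately show ?thesis by (cases "lg x = 0") auto
qed

context algorithm begin

abbreviation "L \<equiv> LL d \<kappa> \<delta>"

lemma L1: "1 \<le> L" by (simp add: LL_def)

lemma ln_bounds: "0 \<le> ln (real d)" "0 \<le> ln \<kappa>" "0 \<le> ln (1 / \<delta>)"
    "ln (real d) + ln \<kappa> + ln (1 / \<delta>) \<le> L"
proof -
  show p: "0 \<le> ln (real d)" "0 \<le> ln \<kappa>" "0 \<le> ln (1 / \<delta>)" using d kappa \<delta> by simp_all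
  have "ln (real d * \<kappa> / \<delta>) = ln (real d * \<kappa> * (1 / \<delta>))" by simp
  also have "\<dots> = ln (real d) + ln \<kappa> + ln (1 / \<delta>)"
    using d kappa \<delta> by (subst ln_mult_pos, (simp add: ln_mult_pos)+)
  finally show "ln (real d) + ln \<kappa> + ln (1 / \<delta>) \<le> L" by (simp add: LL_def)
qed

lemma ln_le_L: "ln (real d) \<le> L" "ln \<kappa> \<le> L" "ln (1 / \<delta>) \<le> L"
  using ln_bounds by linarith+

lemma ln8: "ln (8::real) \<le> 7" using ln_le_minus_one[of 8] by simp

lemma lg8dd: "real (lg (8 * real d * real d)) \<le> 19 * L"
proof -
  have "1 * 1 \<le> real d * real d" using d by (intro mult_mono) auto
  then have "1 \<le> 8 * real d * real d" by (simp add: mult.assoc)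
  from lg_le_ln[OF this] have "real (lg (8 * real d * real d)) \<le> 2 * (ln 8 + ln (real d) + ln (real d)) + 1"
    using d by (simp add: ln_mult_pos)
  moreover have "\<lbrakk>x \<le> 2 * (u + v + v) + 1; u \<le> 7; v \<le> y; 1 \<le> y\<rbrakk> \<Longrightarrow> x \<le> 19 * y" for x u v y :: real by simp
  ultimately show ?thesis using ln8 ln_le_L(1) L1 by blast
qed

definition "q0 = 38 * real n"

lemma p_bound: "(2::real) ^ l \<le> q0 * L"
proof -
  have "1 \<le> real n * real (lg (8 * real d * real d))"
  proof (rule ccontr)
    assume "\<not> ?thesis"
    then have "real n * real (lg (8 * real d * real d)) = 0"
      by (simp only: of_nat_mult[symmetric] not_le of_nat_less_1_iff)
    then have "real n * real (lg (8 * real d * real d)) \<le> 2 ^ 0" by (rule order_trans[OF eq_refl]) simp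
    then have "l \<le> 0" unfolding lp_def lg_def[of "real n * _"] by (intro Least_le)
    then have "l = 0" by simp
    then show False using l5 by simp
  qed
  from two_power_lg_le[OF this] have "(2::real) ^ l \<le> 2 * (real n * real (lg (8 * real d * real d)))"
    by (simp add: lp_def)
  also have "\<dots> \<le> 2 * (real n * (19 * L))" by (intro mult_left_mono lg8dd) auto
  finally show ?thesis by (simp add: q0_def)
qed

lemma l_bound: "real l \<le> q0 * L"
proof -
  have "real l \<le> 2 ^ l" using of_nat_less_two_power[of l, where 'a=real] by simp
  then show ?thesis using p_bound by linarith
qed

lemma sq_kappa: "1 \<le> sqrt \<kappa>" using kappa by simp

lemma J_bound: "real Jm \<le> (40 * real n + 3) * L"
proof -
  have "1 * 1 * 1 * 1 \<le> 20 * real n * real d * \<kappa>" using d n kappa by (intro mult_mono) auto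
  then have 1: "real Jm \<le> 2 * ln (20 * real n * real d * \<kappa>) + 1" unfolding Jm_def by (intro lg_le_ln) simp
  have 2: "ln (20 * real n * real d * \<kappa>) = ln (20 * real n) + ln (real d) + ln \<kappa>"
    using d n kappa by (simp add: ln_mult_pos)
  have 3: "ln (20 * real n) \<le> 20 * real n" using ln_le_minus_one[of "20 * real n"] n by simp
  have "real Jm \<le> 40 * real n + 2 * L + 1" using 1 2 3 ln_bounds(3,4) by linarith
  moreover have "40 * real n * 1 \<le> 40 * real n * L" using L1 by (intro mult_left_mono) auto
  ultimately show ?thesis using L1 by (simp add: distrib_right)
qed

lemma Q_bound: "real Qm \<le> (640 * (real n)\<^sup>2 * q0 + 2) * (L * sqrt \<kappa>)"
proof -
  have "sqrt (20 * \<kappa>) \<le> sqrt (25 * \<kappa>)" using kappa by simp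
  also have "\<dots> = 5 * sqrt \<kappa>" by (simp add: real_sqrt_mult)
  finally have s: "sqrt (20 * \<kappa>) \<le> 5 * sqrt \<kappa>" .
  have "0 \<le> 128 * (real n)\<^sup>2 * 2 ^ l * sqrt (20 * \<kappa>)" using kappa by simp
  then have 1: "real Qm \<le> 128 * (real n)\<^sup>2 * 2 ^ l * sqrt (20 * \<kappa>) + 2" unfolding Qm_def by linarith
  have 2: "128 * (real n)\<^sup>2 * 2 ^ l * sqrt (20 * \<kappa>) \<le> 128 * (real n)\<^sup>2 * (q0 * L) * (5 * sqrt \<kappa>)"
    using kappa L1 by (intro mult_mono s p_bound mult_left_mono) (auto simp: q0_def)
  have 3: "1 \<le> L * sqrt \<kappa>" using mult_mono[OF L1 sq_kappa] L1 by simp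
  have "real Qm \<le> 128 * (real n)\<^sup>2 * (q0 * L) * (5 * sqrt \<kappa>) + 2 * (L * sqrt \<kappa>)"
    using 1 2 3 by linarith
  then show ?thesis by (simp add: algebra_simps)
qed

definition "g0 = (40 * real n + 5) * (640 * (real n)\<^sup>2 * q0 + 3)"

text \<open>One factor \<open>L\<close> counts the halvings; the other one comes from
  \<open>p\<close> in the cap, together with \<open>sqrt \<kappa>\<close>.\<close>

lemma G_bound: "real Gm \<le> g0 * (L\<^sup>2 * sqrt \<kappa>)"
proof -
  have 1: "1 \<le> L * sqrt \<kappa>" using mult_mono[OF L1 sq_kappa] L1 by simp
  have "real Gm = (real Jm + 2) * (real Qm + 1)" by (simp add: Gm_def algebra_simps)
  also have "\<dots> \<le> ((40 * real n + 5) * L) * ((640 * (real n)\<^sup>2 * q0 + 3) * (L * sqrt \<kappa>))"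
  proof (intro mult_mono)
    show "real Jm + 2 \<le> (40 * real n + 5) * L" using J_bound L1 by (simp add: distrib_right)
    show "real Qm + 1 \<le> (640 * (real n)\<^sup>2 * q0 + 3) * (L * sqrt \<kappa>)"
      using Q_bound 1 by (simp add: distrib_right)
  qed (use L1 in \<open>auto simp: q0_def\<close>)
  also have "\<dots> = g0 * (L\<^sup>2 * sqrt \<kappa>)" by (simp add: g0_def power2_eq_square mult_ac)
  finally show ?thesis .
qed

lemma g0: "1 \<le> g0"
proof -
  have "1 * 1 \<le> (40 * real n + 5) * (640 * (real n)\<^sup>2 * q0 + 3)" by (intro mult_mono) (auto simp: q0_def)
  then show ?thesis by (simp add: g0_def)
qed

lemma lamG_bound: "real lamG \<le> (27 + 4 * g0) * L"
proof -
  define G where "G = g0 * (L\<^sup>2 * sqrt \<kappa>)"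
  have G1: "1 \<le> G"
  proof -
    have "1 * (1 * 1) \<le> G" unfolding G_def using g0 L1 sq_kappa by (intro mult_mono) auto
    then show ?thesis by simp
  qed
  have "lamG \<le> lg (8 * real d * G * G / \<delta>)"
    unfolding lamG_def using G_bound \<delta> by (intro lg_mono divide_right_mono mult_mono) (auto simp: G_def[symmetric])
  then have "real lamG \<le> real (lg (8 * real d * G * G / \<delta>))" by simp
  also have "\<dots> \<le> 2 * ln (8 * real d * G * G / \<delta>) + 1"
  proof (rule lg_le_ln)
    have "1 * 1 * 1 * 1 * 1 \<le> 8 * real d * G * G * (1 / \<delta>)" using d G1 \<delta> by (intro mult_mono) auto
    then show "1 \<le> 8 * real d * G * G / \<delta>" by simp
  qed
  finally have 1: "real lamG \<le> 2 * ln (8 * real d * G * G / \<delta>) + 1" .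
  have 2: "ln (8 * real d * G * G / \<delta>) = ln 8 + ln (real d) + ln G + ln G + ln (1 / \<delta>)"
    using d G1 \<delta> by (simp add: ln_mult_pos ln_div)
  have 3: "ln G = ln g0 + (2 * ln L + ln \<kappa> / 2)"
    unfolding G_def using g0 L1 kappa by (simp add: ln_mult_pos ln_realpow ln_sqrt)
  have 4: "ln g0 \<le> g0" using ln_le_minus_one[of g0] g0 by simp
  have 5: "ln L \<le> L" using ln_le_minus_one[of L] L1 by simp
  have "real lamG \<le> 15 + 4 * g0 + 12 * L" using 1 2 3 4 5 ln8 ln_le_L(1,2,3) ln_bounds(4) by linarith
  moreover have "4 * g0 * 1 \<le> 4 * g0 * L" using L1 g0 by (intro mult_left_mono) auto
  ultimately show ?thesis using L1 by (simp add: distrib_right)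
qed

definition "lam0 = 27 + 4 * g0"
definition "b0 = 309 + 246 * q0 + 156800 * real n * q0\<^sup>2"
definition "c0 = 400 + 15 * lam0 + 12800 * (real n)\<^sup>2 * lam0 * b0"
definition "C0 = 318 + 285 + 42 * q0 + g0 * (1 + c0)"

text \<open>The bound is made up of \<open>L\<close> for the number of samples, \<open>L\<close> for
  the \<open>p / 2\<close> solves in each of them, and \<open>L \<kappa>\<close> for the steps of
  one solve, whose number is proportional to \<open>p B\<close>.\<close>

lemma Cb_bound: "Cb \<le> c0 * (L ^ 3 * \<kappa>)"
proof -
  have q: "1 \<le> q0" using n by (simp add: q0_def)
  have L2k: "1 \<le> L\<^sup>2 * \<kappa>" "L \<le> L\<^sup>2 * \<kappa>"
  proof -
    have "1 * 1 \<le> L\<^sup>2 * \<kappa>" using L1 kappa by (intro mult_mono) auto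
    then show "1 \<le> L\<^sup>2 * \<kappa>" by simp
    have "L * 1 * 1 \<le> L * L * \<kappa>" using L1 kappa by (intro mult_mono) auto
    then show "L \<le> L\<^sup>2 * \<kappa>" by (simp add: power2_eq_square)
  qed
  define X where "X = 309 + 94 * 2 ^ l + 2 ^ l * (54 + 98 * (80 * real n * 2 ^ l * (20 * \<kappa>) + 1))"
  have "X = 309 + 246 * 2 ^ l + 156800 * real n * ((2 ^ l)\<^sup>2 * \<kappa>)"
    by (simp add: X_def power2_eq_square algebra_simps)
  also have "\<dots> \<le> 309 * (L\<^sup>2 * \<kappa>) + 246 * (q0 * (L\<^sup>2 * \<kappa>)) + 156800 * real n * ((q0 * L)\<^sup>2 * \<kappa>)"
  proof (intro add_mono mult_left_mono mult_right_mono power_mono p_bound)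
    show "2 ^ l \<le> q0 * (L\<^sup>2 * \<kappa>)"
      using p_bound mult_left_mono[OF L2k(2), of q0] q by linarith
  qed (use L2k kappa in auto)
  also have "\<dots> = b0 * (L\<^sup>2 * \<kappa>)" by (simp add: b0_def algebra_simps power2_eq_square)
  finally have X: "X \<le> b0 * (L\<^sup>2 * \<kappa>)" .
  have X0: "0 \<le> X" unfolding X_def using kappa by (intro add_nonneg_nonneg mult_nonneg_nonneg) auto
  have lm: "real lamG \<le> lam0 * L" using lamG_bound by (simp add: lam0_def)
  have lam0: "0 \<le> lam0" using g0 by (simp add: lam0_def)
  have b0: "0 \<le> b0" using q by (simp add: b0_def)
  have L3: "1 \<le> L ^ 3 * \<kappa>" "L \<le> L ^ 3 * \<kappa>"
  proof -
    have "1 * 1 \<le> L ^ 3 * \<kappa>" using L1 kappa by (intro mult_mono) auto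
    then show "1 \<le> L ^ 3 * \<kappa>" by simp
    have "L * 1 \<le> L * (L\<^sup>2 * \<kappa>)" using L2k L1 by (intro mult_left_mono) auto
    then show "L \<le> L ^ 3 * \<kappa>" by (simp add: power3_eq_cube power2_eq_square mult.assoc)
  qed
  have "real (12800 * n\<^sup>2 * lamG) * X \<le> (12800 * (real n)\<^sup>2 * (lam0 * L)) * (b0 * (L\<^sup>2 * \<kappa>))"
    using lm X X0 lam0 L1 by (intro mult_mono) (auto intro: mult_left_mono)
  also have "\<dots> = 12800 * (real n)\<^sup>2 * lam0 * b0 * (L ^ 3 * \<kappa>)"
    by (simp add: power3_eq_cube power2_eq_square mult_ac)
  finally have 1: "real (12800 * n\<^sup>2 * lamG) * X \<le> 12800 * (real n)\<^sup>2 * lam0 * b0 * (L ^ 3 * \<kappa>)" .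
  have "15 * real lamG \<le> 15 * (lam0 * (L ^ 3 * \<kappa>))"
    using lm mult_left_mono[OF L3(2) lam0] by linarith
  then show ?thesis unfolding Cb_def X_def[symmetric] c0_def using 1 L3(1) by (simp add: algebra_simps)
qed

text \<open>Rounds times cost per round is of order \<open>L^2 sqrt \<kappa>\<close> times
  \<open>L^3 \<kappa>\<close>, and \<open>L^5 \<le> L^8\<close> because
  \<open>L \<ge> 1\<close>.\<close>

theorem total_time:
  "18 + (300 + 15 * real (lg (8 * real d * real d)) + 42 * real l) + real Gm * (1 + Cb)
    \<le> C0 * (\<kappa> powr 1.5 * L ^ 8)"
proof -
  define Y where "Y = \<kappa> * sqrt \<kappa> * L ^ 5"
  have k15: "\<kappa> powr 1.5 = \<kappa> * sqrt \<kappa>"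
  proof -
    have "\<kappa> powr 1.5 = \<kappa> powr (1 + 1 / 2)" by simp
    also have "\<dots> = \<kappa> * sqrt \<kappa>" using kappa by (subst powr_add) (simp add: powr_half_sqrt)
    finally show ?thesis .
  qed
  have kk: "1 \<le> \<kappa> * sqrt \<kappa>" using mult_mono[OF kappa sq_kappa] kappa by simp
  have Lp: "L ^ 1 \<le> L ^ 5" "L ^ 5 \<le> L ^ 8" "1 \<le> L ^ 5" using L1 by (auto intro: power_increasing simp del: power_one_right)
  have Y1: "1 \<le> Y" "L \<le> Y"
    unfolding Y_def using mult_mono[OF kk Lp(3)] mult_mono[OF kk Lp(1)] kk L1 by simp_all
  have Y8: "Y \<le> \<kappa> powr 1.5 * L ^ 8"
    unfolding Y_def k15 using Lp kk by (intro mult_left_mono) auto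
  have q: "1 \<le> q0" using n by (simp add: q0_def)
  have c0: "0 \<le> c0" using g0 q unfolding c0_def lam0_def b0_def by (intro add_nonneg_nonneg mult_nonneg_nonneg) auto
  have L3: "1 \<le> L ^ 3 * \<kappa>"
  proof -
    have "1 * 1 \<le> L ^ 3 * \<kappa>" using L1 kappa by (intro mult_mono) auto
    then show ?thesis by simp
  qed
  have "real Gm * (1 + Cb) \<le> (g0 * (L\<^sup>2 * sqrt \<kappa>)) * ((1 + c0) * (L ^ 3 * \<kappa>))"
  proof (rule mult_mono[OF G_bound])
    show "1 + Cb \<le> (1 + c0) * (L ^ 3 * \<kappa>)" using Cb_bound L3 by (simp add: distrib_right)
    show "0 \<le> 1 + Cb"
      unfolding Cb_def using kappa by (intro add_nonneg_nonneg mult_nonneg_nonneg) auto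
  qed (use g0 kappa in auto)
  also have "\<dots> = g0 * (1 + c0) * Y"
  proof -
    have "L ^ 5 = L\<^sup>2 * L ^ 3" by (simp flip: power_add)
    then show ?thesis unfolding Y_def by (simp only: mult_ac)
  qed
  finally have 1: "real Gm * (1 + Cb) \<le> g0 * (1 + c0) * Y" .
  have 2: "15 * real (lg (8 * real d * real d)) \<le> 285 * Y" using lg8dd Y1 by linarith
  have 3: "42 * real l \<le> 42 * q0 * Y" using l_bound mult_left_mono[OF Y1(2), of q0] q by linarith
  have "18 + (300 + 15 * real (lg (8 * real d * real d)) + 42 * real l) + real Gm * (1 + Cb) \<le> C0 * Y"
    using 1 2 3 Y1(1) by (simp add: C0_def algebra_simps)
  also have "\<dots> \<le> C0 * (\<kappa> powr 1.5 * L ^ 8)"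
    using Y8 g0 c0 q by (intro mult_left_mono) (auto simp: C0_def intro!: add_nonneg_nonneg)
  finally show ?thesis .
qed

end

section \<open>Union bound over the rounds and the rows to be estimated\<close>

section \<open>The failure probability\<close>

context algorithm begin

definition "rowP \<sigma> i j = (mv d (NN A \<sigma>) ^^ (2 ^ (l - 1))) (\<lambda>x. of_bool (x = j)) i"
definition "mm \<sigma> = nat \<lceil>80 * real n * av \<sigma> 32 * av \<sigma> 6\<rceil>"
definition "rowS \<sigma> i j = (rich d (NN A \<sigma>) (av \<sigma> 7) (mm \<sigma>) ^^ (2 ^ (l - 1))) (\<lambda>x. of_bool (x = j)) i"

definition accurate :: "nat \<Rightarrow> (nat \<Rightarrow> real) \<Rightarrow> real \<Rightarrow> bool" where
  "accurate k a x \<longleftrightarrow> (1 - 1 / (40 * real n)) * (real k * (\<Sum>j<d. (a j)\<^sup>2)) \<le> x \<and>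
    x \<le> (1 + 1 / (40 * real n)) * (real k * (\<Sum>j<d. (a j)\<^sup>2))"

text \<open>The coins \<open>\<eta>\<close> of a round estimate some row badly. The first conjunct
  makes the event empty after the loop has ended, when no coins are read.\<close>

definition Bad :: "nat \<Rightarrow> vstate \<Rightarrow> (nat \<Rightarrow> bool) \<Rightarrow> bool" where
  "Bad k \<sigma> \<eta> \<longleftrightarrow> 0 < av \<sigma> 12 \<and> (\<exists>i\<in>{..<d}. \<exists>a\<in>{rowP \<sigma> i, rowS \<sigma> i}. \<not> accurate k a (qsum d k a \<eta>))"

definition BadT :: "nat \<Rightarrow> (nat \<Rightarrow> bool) \<Rightarrow> bool" where
  "BadT t \<omega> = Bad (kk t) (st \<omega> t) (\<lambda>i. \<omega> (fl (st \<omega> t) + i))"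

definition "nt t = (\<Sum>s<t. kk s * d)"

lemma dep_Bad: "dep (k * d) (Bad k \<sigma>)"
proof -
  have "qsum d k a \<eta> = qsum d k a \<eta>'" if "\<forall>i<k * d. \<eta> i = \<eta>' i" for a \<eta> \<eta>'
    using dep_qsum[of k d a] that unfolding dep_def by blast
  then show ?thesis unfolding dep_def Bad_def by metis
qed

lemma accurate_prob:
  "pavg (kk t * d) (\<lambda>\<eta>. of_bool (\<not> accurate (kk t) a (qsum d (kk t) a \<eta>))) \<le> \<delta> / (4 * real d * (real (Suc t))\<^sup>2)"
proof -
  define X where "X = 8 * real d * real (Suc t) * real (Suc t) / \<delta>"
  have X: "0 < X" using d \<delta> by (simp add: X_def)
  have "pavg (kk t * d) (\<lambda>\<eta>. of_bool (\<not> accurate (kk t) a (qsum d (kk t) a \<eta>))) \<le> 2 * exp (- real (kk t) * (1 / (40 * real n))\<^sup>2 / 8)"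
    unfolding accurate_def by (rule qsum_concentration[OF refl]) (use n in auto)
  also have "- real (kk t) * (1 / (40 * real n))\<^sup>2 / 8 = - real (lg X)"
  proof -
    have "kk t = 12800 * n\<^sup>2 * lg X" by (simp only: kk_def X_def)
    then show ?thesis using n by (simp add: power_divide power_mult_distrib)
  qed
  \<comment> \<open>\<open>lg\<close> is a logarithm to base 2, and
    \<open>2 \<le> exp 1\<close>.\<close>
  also have "exp (- real (lg X)) \<le> 1 / X"
  proof -
    have "X \<le> 2 ^ lg X" by (rule lg_upper)
    also have "\<dots> \<le> exp 1 ^ lg X" using exp_ge_add_one_self[of 1] by (intro power_mono) auto
    also have "\<dots> = exp (real (lg X))" by (simp add: exp_of_nat_mult[symmetric])
    finally show ?thesis using X by (simp add: exp_minus field_simps)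
  qed
  finally have "pavg (kk t * d) (\<lambda>\<eta>. of_bool (\<not> accurate (kk t) a (qsum d (kk t) a \<eta>))) \<le> 2 * (1 / X)" by simp
  also have "\<dots> = \<delta> / (4 * real d * (real (Suc t))\<^sup>2)" by (simp add: X_def power2_eq_square)
  finally show ?thesis .
qed

lemma Bad_prob: "pavg (kk t * d) (\<lambda>\<eta>. of_bool (Bad (kk t) \<sigma> \<eta>)) \<le> \<delta> / (2 * (real (Suc t))\<^sup>2)"
proof -
  define W where "W a \<eta> \<longleftrightarrow> \<not> accurate (kk t) a (qsum d (kk t) a \<eta>)" for a \<eta>
  have W: "pavg (kk t * d) (\<lambda>\<eta>. of_bool (W a \<eta>)) \<le> \<delta> / (4 * real d * (real (Suc t))\<^sup>2)" for a
    unfolding W_def by (rule accurate_prob)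
  have "pavg (kk t * d) (\<lambda>\<eta>. of_bool (Bad (kk t) \<sigma> \<eta>))
      \<le> pavg (kk t * d) (\<lambda>\<eta>. of_bool (\<exists>i\<in>{..<d}. W (rowP \<sigma> i) \<eta>) + of_bool (\<exists>i\<in>{..<d}. W (rowS \<sigma> i) \<eta>))"
    by (rule pavg_mono) (auto simp: Bad_def W_def)
  also have "\<dots> \<le> (\<Sum>i<d. \<delta> / (4 * real d * (real (Suc t))\<^sup>2)) + (\<Sum>i<d. \<delta> / (4 * real d * (real (Suc t))\<^sup>2))"
    unfolding pavg_add by (intro add_mono order.trans[OF pavg_sum_le] sum_mono W) auto
  also have "\<dots> = \<delta> / (2 * (real (Suc t))\<^sup>2)" using d by (simp add: field_simps)
  finally show ?thesis .
qed

lemma fl_init: "fl (st \<omega> 0) = 0"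
  unfolding st_0 using init_correct(16)[OF d n1] by simp

lemma fl_step: "0 < av (st \<omega> t) 12 \<Longrightarrow> fl (st \<omega> (Suc t)) = fl (st \<omega> t) + kk t * d"
proof -
  assume go: "0 < av (st \<omega> t) 12"
  from Inv_reachable[OF go] obtain j c where "Inv t (st \<omega> t) j c" by blast
  from kval_eq[OF this] show ?thesis using go by (simp add: st_Suc body_correct)
qed

text \<open>Equality fails in general, since nothing is read after the loop has ended; the position
  of a round's coins is therefore random.\<close>

lemma fl_le: "fl (st \<omega> t) \<le> nt t"
proof (induction t)
  case 0
  then show ?case by (simp add: fl_init)
next
  case (Suc t)
  then show ?case using fl_step[of \<omega> t] by (cases "0 < av (st \<omega> t) 12") (auto simp: nt_def st_Suc)
qed

lemma st_det: "\<forall>i<fl (st \<omega> t). \<omega> i = \<omega>' i \<Longrightarrow> st \<omega>' t = st \<omega> t"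
proof (induction t)
  case 0
  show ?case unfolding st_0 by (rule coin_localD(2)[OF coin_local_hsem]) (use 0 in \<open>simp add: st_0\<close>)
next
  case (Suc t)
  have "fl (st \<omega> t) \<le> fl (st \<omega> (Suc t))"
    using coin_localD(1)[OF coin_local_hsem] by (simp add: st_Suc)
  then have e: "st \<omega>' t = st \<omega> t" using Suc by simp
  show ?case
  proof (cases "0 < av (st \<omega> t) 12")
    case True
    then have s: "st \<omega> (Suc t) = hsem d A \<omega> (bodyp n) (st \<omega> t)" by (simp add: st_Suc)
    have "hsem d A \<omega>' (bodyp n) (st \<omega> t) = hsem d A \<omega> (bodyp n) (st \<omega> t)"
      by (rule coin_localD(2)[OF coin_local_hsem]) (use Suc.prems s in simp)
    then show ?thesis using True by (simp add: st_Suc e)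
  qed (simp add: st_Suc e)
qed

lemma dep_st: "dep (nt t) (\<lambda>\<omega>. st \<omega> t)"
  unfolding dep_def
proof (intro allI impI)
  fix \<omega> \<omega>' :: "nat \<Rightarrow> bool" assume "\<forall>i<nt t. \<omega> i = \<omega>' i"
  then show "st \<omega> t = st \<omega>' t" using st_det[of \<omega> t \<omega>'] fl_le[of \<omega> t] by simp
qed

lemma dep_BadT: "dep (nt (Suc t)) (BadT t)"
  unfolding dep_def
proof (intro allI impI)
  fix \<omega> \<omega>' :: "nat \<Rightarrow> bool" assume *: "\<forall>i<nt (Suc t). \<omega> i = \<omega>' i"
  then have "\<forall>i<nt t. \<omega> i = \<omega>' i" by (simp add: nt_def)
  then have s: "st \<omega>' t = st \<omega> t" using dep_st[of t] unfolding dep_def by metis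
  have "Bad (kk t) (st \<omega> t) (\<lambda>i. \<omega> (fl (st \<omega> t) + i)) = Bad (kk t) (st \<omega> t) (\<lambda>i. \<omega>' (fl (st \<omega> t) + i))"
  proof (rule depD[OF dep_Bad])
    fix i assume "i < kk t * d"
    then have "fl (st \<omega> t) + i < nt (Suc t)" using fl_le[of \<omega> t] by (simp add: nt_def)
    then show "\<omega> (fl (st \<omega> t) + i) = \<omega>' (fl (st \<omega> t) + i)" using * by simp
  qed
  then show "BadT t \<omega> = BadT t \<omega>'" by (simp add: BadT_def s)
qed

lemma nt_mono: "s \<le> t \<Longrightarrow> nt s \<le> nt t"
  unfolding nt_def by (rule sum_mono2) auto

text \<open>The rows to be estimated depend on earlier coins. Given these, the coins of the round
  are fresh, which is what the stopping time lemma expresses.\<close>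

lemma BadT_prob: "pavg (nt (Suc t)) (\<lambda>\<omega>. of_bool (BadT t \<omega>)) \<le> \<delta> / (2 * (real (Suc t))\<^sup>2)"
proof -
  have "pavg (nt t + kk t * d) (\<lambda>\<omega>. of_bool (Bad (kk t) (st \<omega> t) (\<lambda>i. \<omega> (fl (st \<omega> t) + i)))) \<le> \<delta> / (2 * (real (Suc t))\<^sup>2)"
  proof (rule pavg_stopping_time[where S="\<lambda>\<omega>. st \<omega> t" and f="\<lambda>\<omega>. fl (st \<omega> t)" and B="Bad (kk t)"])
    show "fl (st \<omega>' t) = fl (st \<omega> t) \<and> st \<omega>' t = st \<omega> t" if "\<forall>i<fl (st \<omega> t). \<omega> i = \<omega>' i" for \<omega> \<omega>'
      using st_det[OF that] by simp
  qed (rule fl_le dep_Bad Bad_prob)+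
  then show ?thesis by (simp add: nt_def BadT_def)
qed

text \<open>Telescoping, by comparison with \<open>1 / (t (t + 1))\<close>.\<close>

lemma sum_inverse_squares: "(\<Sum>t<G. 1 / (real (Suc t))\<^sup>2) \<le> 2"
proof -
  have "(\<Sum>t<Suc G. 1 / (real (Suc t))\<^sup>2) \<le> 2 - 1 / real (Suc G)" for G
  proof (induction G)
    case (Suc G)
    have "1 / (real (Suc (Suc G)))\<^sup>2 \<le> 1 / (real (Suc G) * real (Suc (Suc G)))"
      unfolding power2_eq_square by (intro divide_left_mono mult_right_mono) auto
    also have "\<dots> = 1 / real (Suc G) - 1 / real (Suc (Suc G))" by (simp add: field_simps)
    finally show ?case using Suc by simp
  qed simp
  from this[of "G - 1"] show ?thesis by (cases G) (auto intro: order.trans)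
qed

theorem failure_prob: "pavg (nt Gm) (\<lambda>\<omega>. of_bool (\<exists>t\<in>{..<Gm}. BadT t \<omega>)) \<le> \<delta>"
proof -
  have "pavg (nt Gm) (\<lambda>\<omega>. of_bool (BadT t \<omega>)) \<le> \<delta> / 2 * (1 / (real (Suc t))\<^sup>2)" if "t < Gm" for t
  proof -
    have "nt Gm = nt (Suc t) + (nt Gm - nt (Suc t))" using nt_mono[of "Suc t" Gm] that by simp
    then have "pavg (nt Gm) (\<lambda>\<omega>. of_bool (BadT t \<omega>) :: real) = pavg (nt (Suc t)) (\<lambda>\<omega>. of_bool (BadT t \<omega>))"
      using pavg_dep[OF dep_comp[OF dep_BadT]] by metis
    then show ?thesis using BadT_prob[of t] by (simp add: mult.commute)
  qed
  then have "(\<Sum>t<Gm. pavg (nt Gm) (\<lambda>\<omega>. of_bool (BadT t \<omega>))) \<le> (\<Sum>t<Gm. \<delta> / 2 * (1 / (real (Suc t))\<^sup>2))"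
    by (intro sum_mono) auto
  also have "\<dots> = \<delta> / 2 * (\<Sum>t<Gm. 1 / (real (Suc t))\<^sup>2)" by (simp only: sum_distrib_left)
  also have "\<dots> \<le> \<delta> / 2 * 2" using \<delta> by (intro mult_left_mono sum_inverse_squares) auto
  finally show ?thesis by (intro order.trans[OF pavg_sum_le]) auto
qed

end

section \<open>Spectral bounds, decrease of the potential, and quality of the output\<close>

section \<open>The invariant for good coins\<close>

lemma quad_cong: "(\<And>i. i < d \<Longrightarrow> x i = y i) \<Longrightarrow> ip d x (mv d A x) = ip d y (mv d A y)"
  unfolding ip_def mv_def by (intro sum.cong refl) simp

context algorithm begin

abbreviation "p \<equiv> (2::nat) ^ l"

text \<open>The inequalities are the hypotheses \<open>le_h\<close> and \<open>le_B\<close> of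
  \<open>eval_ctx\<close>: cell 7 admits Richardson steps of length \<open>1 / h\<close>, and cell 6
  governs their convergence.\<close>

definition Spec :: "vstate \<Rightarrow> (nat \<Rightarrow> nat \<Rightarrow> real) \<Rightarrow> (nat \<Rightarrow> real) \<Rightarrow> bool" where
  "Spec \<sigma> V \<mu> \<longleftrightarrow> spectral d (NN A \<sigma>) V \<mu> \<and>
    (\<forall>a<d. 0 < \<mu> a \<and> \<mu> a \<le> av \<sigma> 7 \<and> av \<sigma> 7 \<le> av \<sigma> 6 * \<mu> a)"

text \<open>The factor depending on \<open>c\<close> bounds the number of updates below the cap: the potential is at least 1.\<close>
definition Good :: "vstate \<Rightarrow> nat \<Rightarrow> bool" where
  "Good \<sigma> c \<longleftrightarrow> (\<exists>V \<mu>. Spec \<sigma> V \<mu> \<and>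
    pot d p \<mu> \<le> (real d)\<^sup>2 * (av \<sigma> 6 / 4) ^ p * (1 - 1 / (64 * (real n)\<^sup>2)) ^ c)"

lemma kk_pos: "0 < kk t"
proof -
  have "3 \<le> lg (8 * real d * real (Suc t) * real (Suc t) / \<delta>)"
  proof (rule le_lg)
    have "1 * 1 * 1 * 1 \<le> real d * real (Suc t) * real (Suc t) * (1 / \<delta>)"
      using d \<delta> by (intro mult_mono) auto
    then show "2 ^ 3 \<le> 8 * real d * real (Suc t) * real (Suc t) / \<delta>" by (simp add: mult.assoc)
  qed
  then show ?thesis using n by (simp add: kk_def)
qed

text \<open>Connects the program with the analysis: the sampled values are sums \<open>qsum\<close>
  for the rows \<open>rowP\<close> and \<open>rowS\<close>, so that \<open>\<not> Bad\<close>
  supplies the hypotheses of \<open>good_eval\<close>.\<close>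

lemma evaluation:
  assumes I: "Inv t \<sigma> j c" and sp: "Spec \<sigma> V \<mu>" and go: "0 < av \<sigma> 12"
    and nb: "\<not> Bad (kk t) \<sigma> (\<lambda>i. \<omega> (fl \<sigma> + i))"
  shows "0 < th d A \<omega> n \<sigma>" "0 < th' d A \<omega> n \<sigma>"
    "\<forall>a<d. \<mu> a ^ p \<le> 2 * real d * th d A \<omega> n \<sigma> ^ p" "\<forall>a<d. (1 / \<mu> a) ^ p \<le> 2 * real d * th' d A \<omega> n \<sigma> ^ p"
    "\<forall>U. (\<forall>x. ip d x (mv d (NN A \<sigma>) x) \<le> U * ip d x x) \<longrightarrow> th d A \<omega> n \<sigma> \<le> U"
    "\<not> near d A \<omega> n \<sigma> \<Longrightarrow> 1 / (4 * real n) \<le>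
      sum (spectral.dg d V (\<lambda>a. (1 / \<mu> a) ^ p)) {i\<in>{..<d}. up d A \<omega> n \<sigma> i} / sum (spectral.dg d V (\<lambda>a. (1 / \<mu> a) ^ p)) {..<d} -
      sum (spectral.dg d V (\<lambda>a. \<mu> a ^ p)) {i\<in>{..<d}. up d A \<omega> n \<sigma> i} / sum (spectral.dg d V (\<lambda>a. \<mu> a ^ p)) {..<d}"
proof -
  define g where "g j i = sgnb (\<omega> (fl \<sigma> + j * d + i))" for j i
  have S: "av \<sigma> 2 = 2 ^ l / 2 - 1" "av \<sigma> 3 = 2 ^ l / 2" "av \<sigma> 32 = 2 ^ l" "av \<sigma> 21 = 1 / real n"
    using I by (auto simp: Inv_def Static_def)
  interpret N: spectral d "NN A \<sigma>" V \<mu> using sp by (simp add: Spec_def)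
  interpret N: eval_ctx d "NN A \<sigma>" V \<mu> "av \<sigma> 7" "av \<sigma> 6" n l "mm \<sigma>" "kk t" g
  proof unfold_locales
    show "av \<sigma> 6 * (80 * real n * 2 ^ l) \<le> real (mm \<sigma>)"
    proof -
      have "80 * real n * av \<sigma> 32 * av \<sigma> 6 \<le> real (mm \<sigma>)" unfolding mm_def by linarith
      then show ?thesis unfolding S by (simp add: mult_ac)
    qed
  qed (use sp d n l5 kk_pos in \<open>auto simp: Spec_def g_def sgnb_def\<close>)
  have rP: "N.P i = qsum d (kk t) (rowP \<sigma> i) (\<lambda>i. \<omega> (fl \<sigma> + i))" if i: "i < d" for i
    unfolding N.P_def N.Ny qsum_def rsum_def rowP_def
    by (subst N.row_of_operator(1)[OF N.coeff_mv_funpow i])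
       (simp_all add: g_def add.assoc mult.commute)
  have rS: "N.S i = qsum d (kk t) (rowS \<sigma> i) (\<lambda>i. \<omega> (fl \<sigma> + i))" if i: "i < d" for i
    unfolding N.S_def N.z_def qsum_def rsum_def rowS_def
    by (subst N.row_of_operator(1)[OF N.coeff_rich_funpow i])
       (simp_all add: g_def add.assoc mult.commute)
  have acc: "accurate (kk t) a (qsum d (kk t) a (\<lambda>i. \<omega> (fl \<sigma> + i)))" if "i < d" "a = rowP \<sigma> i \<or> a = rowS \<sigma> i" for i a
    using nb go that unfolding Bad_def by auto
  interpret N: good_eval d "NN A \<sigma>" V \<mu> "av \<sigma> 7" "av \<sigma> 6" n l "mm \<sigma>" "kk t" g
  proof unfold_locales
    show "\<forall>i<d. (1 - N.\<tau>) * (real (kk t) * (\<Sum>j<d. ((mv d (NN A \<sigma>) ^^ (2 ^ (l - 1))) (\<lambda>x. of_bool (x = j)) i)\<^sup>2)) \<le> N.P i \<and>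
      N.P i \<le> (1 + N.\<tau>) * (real (kk t) * (\<Sum>j<d. ((mv d (NN A \<sigma>) ^^ (2 ^ (l - 1))) (\<lambda>x. of_bool (x = j)) i)\<^sup>2))"
      using acc unfolding N.\<tau>_def rowP_def[symmetric] accurate_def by (simp add: rP)
    show "\<forall>i<d. (1 - N.\<tau>) * (real (kk t) * (\<Sum>j<d. ((rich d (NN A \<sigma>) (av \<sigma> 7) (mm \<sigma>) ^^ (2 ^ (l - 1))) (\<lambda>x. of_bool (x = j)) i)\<^sup>2)) \<le> N.S i \<and>
      N.S i \<le> (1 + N.\<tau>) * (real (kk t) * (\<Sum>j<d. ((rich d (NN A \<sigma>) (av \<sigma> 7) (mm \<sigma>) ^^ (2 ^ (l - 1))) (\<lambda>x. of_bool (x = j)) i)\<^sup>2))"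
      using acc unfolding N.\<tau>_def rowS_def[symmetric] accurate_def by (simp add: rS)
  qed
  define \<sigma>1 where "\<sigma>1 = hsem d A \<omega> (prep n) \<sigma>"
  have s1: "NN A \<sigma>1 = NN A \<sigma>" "nat \<lceil>av \<sigma>1 8\<rceil> = kk t" "nat \<lceil>av \<sigma>1 9\<rceil> = mm \<sigma>" "av \<sigma>1 7 = av \<sigma> 7" "fl \<sigma>1 = fl \<sigma>"
    "nat \<lceil>av \<sigma>1 2\<rceil> = 2 ^ (l - 1) - 1" "nat \<lceil>av \<sigma>1 3\<rceil> = 2 ^ (l - 1)"
  proof -
    show "NN A \<sigma>1 = NN A \<sigma>" by (simp add: NN_def \<sigma>1_def prep_correct)
    show "nat \<lceil>av \<sigma>1 8\<rceil> = kk t" unfolding \<sigma>1_def prep_correct using kval_eq[OF I] by simp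
    show "nat \<lceil>av \<sigma>1 9\<rceil> = mm \<sigma>" unfolding \<sigma>1_def prep_correct mm_def ..
    show "av \<sigma>1 7 = av \<sigma> 7" "fl \<sigma>1 = fl \<sigma>" by (simp_all add: \<sigma>1_def prep_correct)
    have "av \<sigma>1 3 = real (2 ^ (l - 1))" "av \<sigma>1 2 = real (2 ^ (l - 1)) - 1"
      by (simp_all add: \<sigma>1_def prep_correct S p_half)
    then have "av \<sigma>1 3 = real (2 ^ (l - 1))" "av \<sigma>1 2 = real (2 ^ (l - 1) - 1)" by (simp_all add: of_nat_diff)
    then show "nat \<lceil>av \<sigma>1 2\<rceil> = 2 ^ (l - 1) - 1" "nat \<lceil>av \<sigma>1 3\<rceil> = 2 ^ (l - 1)"
      by (simp_all only: ceiling_of_nat nat_int)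
  qed
  have yz: "yv d A \<omega> \<sigma>1 (fl \<sigma> + j * d) = N.y j" "zv d A \<omega> \<sigma>1 (fl \<sigma> + j * d) = N.z j" for j
    unfolding yv_def zv_def N.y_def N.z_def s1 by (simp_all add: sg_def[abs_def] g_def[abs_def])
  have PS: "Pv d A \<omega> \<sigma>1 = N.P" "Sv d A \<omega> \<sigma>1 = N.S" "E1 d A \<omega> \<sigma>1 = N.E" "E2 d A \<omega> \<sigma>1 = N.F"
    unfolding Pv_def[abs_def] Sv_def[abs_def] E1_def E2_def N.P_def[abs_def] N.S_def[abs_def] N.E_def N.F_def s1 yz by (rule refl)+
  have th: "th d A \<omega> n \<sigma> = N.\<theta>" "th' d A \<omega> n \<sigma> = N.\<theta>'"
    unfolding th_def th'_def \<sigma>1_def[symmetric] PS N.\<theta>_def N.\<theta>'_def by (rule refl)+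
  show "0 < th d A \<omega> n \<sigma>" "0 < th' d A \<omega> n \<sigma>"
    unfolding th using N.theta_bounds(1,2)[OF N.d0] by auto
  show "\<forall>a<d. \<mu> a ^ p \<le> 2 * real d * th d A \<omega> n \<sigma> ^ p" "\<forall>a<d. (1 / \<mu> a) ^ p \<le> 2 * real d * th' d A \<omega> n \<sigma> ^ p"
    unfolding th using N.theta_bounds(3,4) by auto
  show "\<forall>U. (\<forall>x. ip d x (mv d (NN A \<sigma>) x) \<le> U * ip d x x) \<longrightarrow> th d A \<omega> n \<sigma> \<le> U"
    unfolding th using N.theta_le by blast
  show "1 / (4 * real n) \<le>
      sum (spectral.dg d V (\<lambda>a. (1 / \<mu> a) ^ p)) {i\<in>{..<d}. up d A \<omega> n \<sigma> i} / sum (spectral.dg d V (\<lambda>a. (1 / \<mu> a) ^ p)) {..<d} -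
      sum (spectral.dg d V (\<lambda>a. \<mu> a ^ p)) {i\<in>{..<d}. up d A \<omega> n \<sigma> i} / sum (spectral.dg d V (\<lambda>a. \<mu> a ^ p)) {..<d}"
    if "\<not> near d A \<omega> n \<sigma>"
  proof -
    have "1 / real n \<le> (\<Sum>i<d. \<bar>N.P i / sum N.P {..<d} - N.S i / sum N.S {..<d}\<bar>)"
      using that unfolding near_def \<sigma>1_def[symmetric] dist_PS_def PS S by simp
    from N.gap[OF this] show ?thesis
      unfolding up_def \<sigma>1_def[symmetric] PS N.aw_def N.bw_def .
  qed
qed

text \<open>With \<open>q = lg (8 d^2)\<close>, Bernoulli's inequality and the choice of
  \<open>p\<close> give \<open>8 d^2 \<le> 2^q \<le> (1 + 1/n)^(n q) \<le> (1 + 1/n)^p\<close>; then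
  take \<open>p\<close>-th roots.\<close>

lemma power_bound:
  assumes "x ^ p \<le> M * y ^ p" "M \<le> 8 * real d * real d" "0 \<le> y"
  shows "x \<le> (1 + 1 / real n) * y"
proof -
  define q where "q = lg (8 * real d * real d)"
  have nq: "n * q \<le> p"
    using lg_upper[of "real n * real q"] unfolding q_def lp_def by (simp add: of_nat_le_iff[where 'a=real, symmetric])
  have "M \<le> 2 ^ q" using assms(2) lg_upper[of "8 * real d * real d"] by (simp add: q_def)
  also have "\<dots> \<le> ((1 + 1 / real n) ^ n) ^ q"
  proof (rule power_mono)
    have "1 + real n * (1 / real n) \<le> (1 + 1 / real n) ^ n"
      by (rule Bernoulli_inequality) (use n in \<open>auto intro: order.trans[of _ 0]\<close>)
    then show "2 \<le> (1 + 1 / real n) ^ n" using n by simp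
  qed simp
  also have "\<dots> = (1 + 1 / real n) ^ (n * q)" by (simp add: power_mult)
  also have "\<dots> \<le> (1 + 1 / real n) ^ p" by (rule power_increasing[OF nq]) simp
  finally have "M * y ^ p \<le> (1 + 1 / real n) ^ p * y ^ p" using assms(3) by (intro mult_right_mono) auto
  then have "x ^ p \<le> ((1 + 1 / real n) * y) ^ p" using assms(1) by (simp add: power_mult_distrib)
  moreover have "p = Suc (p - 1)" by simp
  ultimately have "x ^ Suc (p - 1) \<le> ((1 + 1 / real n) * y) ^ Suc (p - 1)" by metis
  then show ?thesis by (rule power_le_imp_le_base) (use assms(3) in simp)
qed

lemma dd: "1 \<le> real d * real d" "real d \<le> real d * real d"
  using mult_mono[of 1 "real d" 1 "real d"] mult_mono[of 1 "real d" "real d" "real d"] d by auto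

lemma theta_estimates:
  assumes I: "Inv t \<sigma> j c" and sp: "Spec \<sigma> V \<mu>" and go: "0 < av \<sigma> 12"
    and nb: "\<not> Bad (kk t) \<sigma> (\<lambda>i. \<omega> (fl \<sigma> + i))" and a: "a < d"
  shows "\<mu> a \<le> (1 + 1 / real n) * th d A \<omega> n \<sigma>" "1 / ((1 + 1 / real n) * th' d A \<omega> n \<sigma>) \<le> \<mu> a"
proof -
  note ev = evaluation[OF I sp go nb]
  have pos: "0 < \<mu> a" using sp a by (simp add: Spec_def)
  have M: "2 * real d \<le> 8 * real d * real d" using dd by simp
  show "\<mu> a \<le> (1 + 1 / real n) * th d A \<omega> n \<sigma>"
    by (rule power_bound[OF _ M]) (use ev a in \<open>auto simp: less_imp_le\<close>)
  have "1 / \<mu> a \<le> (1 + 1 / real n) * th' d A \<omega> n \<sigma>"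
    by (rule power_bound[OF _ M]) (use ev a in \<open>auto simp: less_imp_le\<close>)
  moreover have "0 < (1 + 1 / real n) * th' d A \<omega> n \<sigma>" using ev(2) by (intro mult_pos_pos) (auto intro: add_pos_nonneg)
  ultimately show "1 / ((1 + 1 / real n) * th' d A \<omega> n \<sigma>) \<le> \<mu> a" using pos by (simp add: field_simps)
qed

lemma NN_quad: "ip d x (mv d (NN A \<sigma>) x) = ip d (\<lambda>i. vv \<sigma> 1 i * x i) (mv d A (\<lambda>i. vv \<sigma> 1 i * x i))
      + av \<sigma> 5 * (\<Sum>i<d. vv \<sigma> 0 i * (vv \<sigma> 1 i * x i)\<^sup>2)"
  unfolding NN_def by (rule Nmat_quad)

lemma n_small: "1 / real n \<le> 1 / 10" "0 < 1 / real n" using n by (auto simp: field_simps)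

text \<open>Halving \<mu> keeps the quadratic form below the old one and above half of it, so the
  new eigenvalues lie between \<open>1 / (2 (1 + e) \<theta>')\<close> and
  \<open>(1 + e) \<theta>\<close>. Their ratio is at most
  \<open>2 (1 + e)^2 \<theta> \<theta>' \<le> 10/4 \<theta> \<theta>'\<close>, which explains the 10
  in \<open>Bnew\<close> and the 4 in \<open>Good\<close>.\<close>

lemma near_step:
  assumes I: "Inv t \<sigma> j c" and G: "Good \<sigma> c" and go: "0 < av \<sigma> 12"
    and nb: "\<not> Bad (kk t) \<sigma> (\<lambda>i. \<omega> (fl \<sigma> + i))" and near: "near d A \<omega> n \<sigma>"
  shows "Good (hsem d A \<omega> (bodyp n) \<sigma>) 0"
proof -
  define \<sigma>' where "\<sigma>' = hsem d A \<omega> (bodyp n) \<sigma>"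
  define \<theta> where "\<theta> = th d A \<omega> n \<sigma>"
  define \<theta>' where "\<theta>' = th' d A \<omega> n \<sigma>"
  define e where "e = 1 / real n"
  have e: "0 < e" "e \<le> 1 / 10" using n_small by (auto simp: e_def)
  from G obtain V \<mu> where sp: "Spec \<sigma> V \<mu>" by (auto simp: Good_def)
  interpret N: spectral d "NN A \<sigma>" V \<mu> using sp by (simp add: Spec_def)
  have t: "0 < \<theta>" "0 < \<theta>'" using evaluation(1,2)[OF I sp go nb] by (auto simp: \<theta>_def \<theta>'_def)
  have mb: "\<mu> a \<le> (1 + e) * \<theta>" "1 / ((1 + e) * \<theta>') \<le> \<mu> a" if "a < d" for a
    using theta_estimates[OF I sp go nb that] by (auto simp: \<theta>_def \<theta>'_def e_def)
  have s': "av \<sigma>' 6 = 10 * (\<theta> * \<theta>')" "av \<sigma>' 7 = 2 * \<theta>" "av \<sigma>' 5 = av \<sigma> 5 / 2" "vv \<sigma>' 0 = vv \<sigma> 0"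
      "\<And>i. i < d \<Longrightarrow> vv \<sigma>' 1 i = vv \<sigma> 1 i"
    unfolding \<sigma>'_def \<theta>_def \<theta>'_def using near by (simp_all add: body_correct Bnew_def)
  have mu: "0 \<le> av \<sigma> 5" using I by (simp add: Inv_def)
  have D: "0 \<le> (\<Sum>i<d. vv \<sigma> 0 i * (vv \<sigma> 1 i * x i)\<^sup>2)" for x
    using I A_diag by (intro sum_nonneg) (auto simp: Inv_def Static_def less_imp_le)
  have q': "ip d x (mv d (NN A \<sigma>') x) = ip d (\<lambda>i. vv \<sigma> 1 i * x i) (mv d A (\<lambda>i. vv \<sigma> 1 i * x i))
      + av \<sigma> 5 / 2 * (\<Sum>i<d. vv \<sigma> 0 i * (vv \<sigma> 1 i * x i)\<^sup>2)" for x
    unfolding NN_quad s' by (intro arg_cong2[where f="(+)"] arg_cong2[where f="(*)"] quad_cong sum.cong refl) (simp_all add: s')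
  have le: "ip d x (mv d (NN A \<sigma>') x) \<le> (1 + e) * \<theta> * ip d x x" for x
  proof -
    have "ip d x (mv d (NN A \<sigma>') x) \<le> ip d x (mv d (NN A \<sigma>) x)"
      unfolding q' NN_quad[of _ \<sigma>] using mu D[of x] by (simp add: mult_right_mono)
    also have "\<dots> \<le> (1 + e) * \<theta> * ip d x x" by (rule N.quad_le) (rule mb)
    finally show ?thesis .
  qed
  have ge: "1 / (2 * ((1 + e) * \<theta>')) * ip d x x \<le> ip d x (mv d (NN A \<sigma>') x)" for x
  proof -
    have "1 / ((1 + e) * \<theta>') * ip d x x \<le> ip d x (mv d (NN A \<sigma>) x)" by (rule N.quad_ge) (rule mb)
    also have "\<dots> \<le> 2 * ip d x (mv d (NN A \<sigma>') x)"
      unfolding q' NN_quad[of _ \<sigma>] using A_psd[of "\<lambda>i. vv \<sigma> 1 i * x i"] by (simp add: algebra_simps)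
    finally have "1 / ((1 + e) * \<theta>') * ip d x x \<le> 2 * ip d x (mv d (NN A \<sigma>') x)" .
    moreover have "1 / (2 * ((1 + e) * \<theta>')) * ip d x x = 1 / ((1 + e) * \<theta>') * ip d x x / 2" by simp
    moreover have "u \<le> 2 * v \<Longrightarrow> u / 2 \<le> v" for u v :: real by simp
    ultimately show ?thesis by presburger
  qed
  have "sym_mat d (NN A \<sigma>')" unfolding NN_def by (rule Nmat_sym[OF A_props(2)])
  then obtain V' \<mu>' where sp': "spectral d (NN A \<sigma>') V' \<mu>'" by (rule spectral_exists)
  interpret N': spectral d "NN A \<sigma>'" V' \<mu>' by fact
  have b: "\<mu>' a \<le> (1 + e) * \<theta>" "1 / (2 * ((1 + e) * \<theta>')) \<le> \<mu>' a" if "a < d" for a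
    using N'.eig_le[OF le that] N'.eig_ge[OF ge that] by auto
  have pos: "0 < \<mu>' a" if "a < d" for a
  proof -
    have "0 < 1 / (2 * ((1 + e) * \<theta>'))" using t e by simp
    then show ?thesis using b(2)[OF that] by linarith
  qed
  have inv: "1 \<le> (2 * (1 + e) * \<theta>') * \<mu>' a" if "a < d" for a
    using b(2)[OF that] t e by (simp add: divide_le_eq mult_ac)
  have S': "Spec \<sigma>' V' \<mu>'"
    unfolding Spec_def
  proof (intro conjI sp' allI impI)
    fix a assume a: "a < d"
    show "0 < \<mu>' a" by (rule pos[OF a])
    have "(1 + e) * \<theta> \<le> 2 * \<theta>" using e t by (intro mult_right_mono) auto
    then show "\<mu>' a \<le> av \<sigma>' 7" using b(1)[OF a] by (simp add: s')
    have "2 * (1 + e) * (\<theta>' * \<mu>' a) \<le> 5 * (\<theta>' * \<mu>' a)" using e t pos[OF a] by (intro mult_right_mono) auto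
    then have "1 \<le> 5 * (\<theta>' * \<mu>' a)" using inv[OF a] by (simp add: mult.assoc)
    then have "2 * \<theta> * 1 \<le> 2 * \<theta> * (5 * (\<theta>' * \<mu>' a))" using t by (intro mult_left_mono) auto
    then show "av \<sigma>' 7 \<le> av \<sigma>' 6 * \<mu>' a" by (simp add: s' mult_ac)
  qed
  have "pot d p \<mu>' \<le> (real d)\<^sup>2 * (2 * (1 + e)\<^sup>2 * (\<theta> * \<theta>')) ^ p"
  proof (rule pot_le[OF pos])
    fix a b' assume a: "a < d" "b' < d"
    have "\<mu>' a * 1 \<le> ((1 + e) * \<theta>) * ((2 * (1 + e) * \<theta>') * \<mu>' b')"
      using b(1)[OF a(1)] inv[OF a(2)] pos[OF a(1)] t e by (intro mult_mono) auto
    then show "\<mu>' a \<le> 2 * (1 + e)\<^sup>2 * (\<theta> * \<theta>') * \<mu>' b'" by (simp add: power2_eq_square mult_ac)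
  qed
  also have "\<dots> \<le> (real d)\<^sup>2 * (10 * (\<theta> * \<theta>') / 4) ^ p"
  proof (intro mult_left_mono power_mono)
    have "(1 + e)\<^sup>2 \<le> (11 / 10)\<^sup>2" using e by (intro power_mono) auto
    then have "2 * (1 + e)\<^sup>2 \<le> 10 / 4" by (simp add: power2_eq_square)
    then have "2 * (1 + e)\<^sup>2 * (\<theta> * \<theta>') \<le> 10 / 4 * (\<theta> * \<theta>')" using t by (intro mult_right_mono) auto
    then show "2 * (1 + e)\<^sup>2 * (\<theta> * \<theta>') \<le> 10 * (\<theta> * \<theta>') / 4" by (simp only: times_divide_eq_left)
  qed (use t in auto)
  finally have "pot d p \<mu>' \<le> (real d)\<^sup>2 * (av \<sigma>' 6 / 4) ^ p * (1 - 1 / (64 * (real n)\<^sup>2)) ^ 0" by (simp add: s')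
  then have "Good \<sigma>' 0" unfolding Good_def using S' by blast
  then show ?thesis by (simp add: \<sigma>'_def)
qed

text \<open>The value \<open>2 \<theta>\<close> stored in cell 7 belongs to the matrix before the
  update, and \<open>B\<close> is not renewed. Both remain valid: by the decrease of the potential
  the new condition number is at most \<open>(1 + e) B / 4\<close>, and one update changes the
  quadratic form by a factor of at most \<open>rr^2\<close>, close to 1.\<close>

lemma far_step:
  assumes I: "Inv t \<sigma> j c" and G: "Good \<sigma> c" and go: "0 < av \<sigma> 12"
    and nb: "\<not> Bad (kk t) \<sigma> (\<lambda>i. \<omega> (fl \<sigma> + i))" and far: "\<not> near d A \<omega> n \<sigma>"
  shows "Good (hsem d A \<omega> (bodyp n) \<sigma>) (Suc c)"
proof -
  define \<sigma>' where "\<sigma>' = hsem d A \<omega> (bodyp n) \<sigma>"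
  define \<theta> where "\<theta> = th d A \<omega> n \<sigma>"
  define e where "e = 1 / real n"
  define B where "B = av \<sigma> 6"
  have e: "0 < e" "e \<le> 1 / 10" using n_small by (auto simp: e_def)
  from G obtain V \<mu> where sp: "Spec \<sigma> V \<mu>"
    and pt: "pot d p \<mu> \<le> (real d)\<^sup>2 * (B / 4) ^ p * (1 - 1 / (64 * (real n)\<^sup>2)) ^ c" by (auto simp: Good_def B_def)
  interpret N: spectral d "NN A \<sigma>" V \<mu> using sp by (simp add: Spec_def)
  have B: "0 \<le> B" using I by (simp add: Inv_def B_def)
  have t: "0 < \<theta>" using evaluation(1)[OF I sp go nb] by (auto simp: \<theta>_def)
  have mb: "\<mu> a \<le> (1 + e) * \<theta>" "0 < \<mu> a" if "a < d" for a
    using theta_estimates(1)[OF I sp go nb that] sp that by (auto simp: \<theta>_def e_def Spec_def)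
  define f where "f i = (if up d A \<omega> n \<sigma> i then rr else 1 / rr)" for i
  have r: "0 < rr" "rr\<^sup>2 \<le> 1 + 1 / 80"
  proof -
    show "0 < rr" using rr(1) by simp
    have "2 \<le> (2::nat) ^ (l + 2)" by (simp add: power_add)
    then have "rr\<^sup>2 \<le> rr ^ (2 ^ (l + 2))" by (rule power_increasing[OF _ rr(1)])
    moreover have "1 / (8 * real n) \<le> 1 / 80" using n by (intro divide_left_mono) auto
    ultimately show "rr\<^sup>2 \<le> 1 + 1 / 80" unfolding rr(2) by linarith
  qed
  have f: "0 < f i" "(f i)\<^sup>2 \<le> rr\<^sup>2" "(1 / f i)\<^sup>2 \<le> rr\<^sup>2" for i
  proof -
    have "1 / rr \<le> rr" using rr(1) mult_mono[OF rr(1) rr(1)] by (simp add: divide_le_eq)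
    then show "0 < f i" "(f i)\<^sup>2 \<le> rr\<^sup>2" "(1 / f i)\<^sup>2 \<le> rr\<^sup>2"
      using r by (auto simp: f_def simp del: power_divide intro!: power_mono)
  qed
  have s': "av \<sigma>' 6 = B" "av \<sigma>' 7 = 2 * \<theta>" "av \<sigma>' 5 = av \<sigma> 5" "vv \<sigma>' 0 = vv \<sigma> 0"
      "\<And>i. i < d \<Longrightarrow> vv \<sigma>' 1 i = vv \<sigma> 1 i * f i"
    unfolding \<sigma>'_def \<theta>_def f_def B_def using far I by (simp_all add: body_correct Inv_def Static_def)
  have sc: "NN A \<sigma>' i j = f i * NN A \<sigma> i j * f j" if "i < d" "j < d" for i j
    using that by (simp add: NN_def Nmat_def s')
  have sc': "NN A \<sigma> i j = (1 / f i) * NN A \<sigma>' i j * (1 / f j)" if "i < d" "j < d" for i j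
    using sc[OF that] f(1)[of i] f(1)[of j] by simp
  have "sym_mat d (NN A \<sigma>')" unfolding NN_def by (rule Nmat_sym[OF A_props(2)])
  then obtain V' \<mu>' where sp': "spectral d (NN A \<sigma>') V' \<mu>'" by (rule spectral_exists)
  interpret N': spectral d "NN A \<sigma>'" V' \<mu>' by fact
  have le: "ip d x (mv d (NN A \<sigma>') x) \<le> rr\<^sup>2 * ((1 + e) * \<theta>) * ip d x x" for x
  proof -
    have "ip d x (mv d (NN A \<sigma>') x) = ip d (\<lambda>i. f i * x i) (mv d (NN A \<sigma>) (\<lambda>i. f i * x i))" by (rule ip_scaled[OF sc])
    also have "\<dots> \<le> (1 + e) * \<theta> * ip d (\<lambda>i. f i * x i) (\<lambda>i. f i * x i)" by (rule N.quad_le) (rule mb)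
    also have "ip d (\<lambda>i. f i * x i) (\<lambda>i. f i * x i) \<le> (\<Sum>i<d. rr\<^sup>2 * (x i * x i))"
      unfolding ip_def
    proof (rule sum_mono)
      fix i
      have "(f i)\<^sup>2 * (x i * x i) \<le> rr\<^sup>2 * (x i * x i)" by (rule mult_right_mono[OF f(2)]) simp
      then show "f i * x i * (f i * x i) \<le> rr\<^sup>2 * (x i * x i)" by (simp add: power2_eq_square mult_ac)
    qed
    finally show ?thesis using t e by (simp add: ip_def sum_distrib_left mult_ac)
  qed
  \<comment> \<open>A crude bound from the old state; it only serves to make the new eigenvalues
    positive, so that the potential can be used.\<close>
  define lo where "lo = 1 / rr\<^sup>2 * (av \<sigma> 7 / B)"
  have pos': "0 < \<mu>' a" if a: "a < d" for a
  proof -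
    have Bm: "0 < B" "0 < av \<sigma> 7"
    proof -
      have "0 < av \<sigma> 7" using sp a by (force simp: Spec_def)
      then show "0 < av \<sigma> 7" .
      have "av \<sigma> 7 \<le> B * \<mu> a" using sp a by (simp add: Spec_def B_def)
      then have "0 < B * \<mu> a" using \<open>0 < av \<sigma> 7\<close> by linarith
      then show "0 < B" using mb(2)[OF a] by (simp add: zero_less_mult_iff)
    qed
    have "lo * ip d x x \<le> ip d x (mv d (NN A \<sigma>') x)" for x
    proof -
      have "(1 / rr\<^sup>2) * ip d x x \<le> ip d (\<lambda>i. f i * x i) (\<lambda>i. f i * x i)"
        unfolding ip_def sum_distrib_left
      proof (rule sum_mono)
        fix i
        have "1 / rr\<^sup>2 \<le> (f i)\<^sup>2" using f(1)[of i] f(3)[of i] r(1) by (simp add: power_divide field_simps)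
        then have "1 / rr\<^sup>2 * (x i * x i) \<le> (f i)\<^sup>2 * (x i * x i)" by (rule mult_right_mono) simp
        then show "1 / rr\<^sup>2 * (x i * x i) \<le> f i * x i * (f i * x i)" by (simp add: power2_eq_square mult_ac)
      qed
      then have "(av \<sigma> 7 / B) * ((1 / rr\<^sup>2) * ip d x x) \<le> (av \<sigma> 7 / B) * ip d (\<lambda>i. f i * x i) (\<lambda>i. f i * x i)"
        using Bm by (intro mult_left_mono) auto
      also have "\<dots> \<le> ip d (\<lambda>i. f i * x i) (mv d (NN A \<sigma>) (\<lambda>i. f i * x i))"
      proof (rule N.quad_ge)
        show "av \<sigma> 7 / B \<le> \<mu> b" if "b < d" for b
          using sp that Bm by (simp add: Spec_def B_def divide_le_eq mult.commute)
      qed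
      also have "\<dots> = ip d x (mv d (NN A \<sigma>') x)" by (rule ip_scaled[OF sc, symmetric])
      finally show ?thesis by (simp add: lo_def mult_ac)
    qed
    from N'.eig_ge[OF this a] have "lo \<le> \<mu>' a" .
    moreover have "0 < lo" using Bm r by (simp add: lo_def)
    ultimately show ?thesis by linarith
  qed
  \<comment> \<open>Here \<open>\<rho> = 1 / (4 n)\<close>, so that \<open>\<rho>^2 / 4\<close> is
    the \<open>1 / (64 n^2)\<close> of \<open>Good\<close>.\<close>
  have "pot d p \<mu>' \<le> (1 - (1 / (4 * real n))\<^sup>2 / 4) * pot d p \<mu>"
  proof (rule pot_contraction[OF N.spectral_axioms sp' d mb(2) pos', where c="rr ^ (2 * 2 ^ l)" and r=rr and f=f
        and X="{i\<in>{..<d}. up d A \<omega> n \<sigma> i}"])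
    show "(rr ^ (2 * 2 ^ l))\<^sup>2 = 1 + 1 / (4 * real n) / 2"
      using rr(2) by (simp add: power_mult[symmetric] power_add mult_ac)
    show "1 / (4 * real n) \<le> sum (N.dg (\<lambda>a. (1 / \<mu> a) ^ 2 ^ l)) {i \<in> {..<d}. up d A \<omega> n \<sigma> i} / sum (N.dg (\<lambda>a. (1 / \<mu> a) ^ 2 ^ l)) {..<d} -
      sum (N.dg (\<lambda>a. \<mu> a ^ 2 ^ l)) {i \<in> {..<d}. up d A \<omega> n \<sigma> i} / sum (N.dg (\<lambda>a. \<mu> a ^ 2 ^ l)) {..<d}"
      by (rule evaluation(6)[OF I sp go nb far])
  qed (use r sc in \<open>auto simp: f_def\<close>)
  also have "1 - (1 / (4 * real n))\<^sup>2 / 4 = 1 - 1 / (64 * (real n)\<^sup>2)" by (simp add: power_divide power_mult_distrib)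
  finally have c1: "pot d p \<mu>' \<le> (1 - 1 / (64 * (real n)\<^sup>2)) * pot d p \<mu>" .
  have \<rho>: "0 \<le> 1 - 1 / (64 * (real n)\<^sup>2)" "1 - 1 / (64 * (real n)\<^sup>2) \<le> 1"
  proof -
    have "1 * 1 \<le> 64 * (real n)\<^sup>2" using n by (intro mult_mono) auto
    then have "1 / (64 * (real n)\<^sup>2) \<le> 1" by (subst divide_le_eq_1_pos) (use n in auto)
    then show "0 \<le> 1 - 1 / (64 * (real n)\<^sup>2)" by simp
  qed simp
  have c2: "pot d p \<mu>' \<le> (real d)\<^sup>2 * (B / 4) ^ p * (1 - 1 / (64 * (real n)\<^sup>2)) ^ Suc c"
    using c1 mult_left_mono[OF pt \<rho>(1)] by (simp add: mult_ac)
  also have "\<dots> \<le> (real d)\<^sup>2 * (B / 4) ^ p * 1"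
    using \<rho> B by (intro mult_left_mono power_le_one) auto
  finally have c3: "pot d p \<mu>' \<le> (real d)\<^sup>2 * (B / 4) ^ p" by simp
  \<comment> \<open>The potential bounds the \<open>p\<close>-th power of every ratio of
    eigenvalues, and \<open>power_bound\<close> reduces the factor \<open>d^2\<close> to
    \<open>1 + 1 / n\<close>.\<close>
  have cr: "\<mu>' b \<le> (1 + e) * (B / 4) * \<mu>' a" if "a < d" "b < d" for a b
  proof -
    have "(\<mu>' b / \<mu>' a) ^ p \<le> pot d p \<mu>'" by (rule pot_ge_ratio[OF pos' that(2,1)])
    then have "(\<mu>' b / \<mu>' a) ^ p \<le> (real d)\<^sup>2 * (B / 4) ^ p" using c3 by linarith
    then have "\<mu>' b / \<mu>' a \<le> (1 + 1 / real n) * (B / 4)"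
      by (rule power_bound) (use B in \<open>auto simp: power2_eq_square\<close>)
    then show ?thesis using pos'[OF that(1)] by (simp add: e_def divide_le_eq)
  qed
  have S': "Spec \<sigma>' V' \<mu>'"
    unfolding Spec_def
  proof (intro conjI sp' allI impI)
    fix a assume a: "a < d"
    show "0 < \<mu>' a" by (rule pos'[OF a])
    have re: "rr\<^sup>2 * (1 + e) \<le> (1 + 1 / 80) * (11 / 10)" using r e by (intro mult_mono) auto
    have "rr\<^sup>2 * (1 + e) * \<theta> \<le> 2 * \<theta>" using re t by (intro mult_right_mono) auto
    then show "\<mu>' a \<le> av \<sigma>' 7" using N'.eig_le[OF le a] by (simp add: s' mult.assoc)
    \<comment> \<open>\<open>\<theta>\<close> is at most the largest eigenvalue of the old matrix,
      which is compared with the new matrix by undoing the scaling.\<close>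
    have "\<theta> \<le> rr\<^sup>2 * ((1 + e) * (B / 4) * \<mu>' a)"
      unfolding \<theta>_def
    proof (rule evaluation(5)[OF I sp go nb, rule_format])
      fix x
      have "ip d x (mv d (NN A \<sigma>) x) = ip d (\<lambda>i. 1 / f i * x i) (mv d (NN A \<sigma>') (\<lambda>i. 1 / f i * x i))" by (rule ip_scaled[OF sc'])
      also have "\<dots> \<le> (1 + e) * (B / 4) * \<mu>' a * ip d (\<lambda>i. 1 / f i * x i) (\<lambda>i. 1 / f i * x i)"
        by (rule N'.quad_le) (rule cr[OF a])
      also have "\<dots> \<le> (1 + e) * (B / 4) * \<mu>' a * (\<Sum>i<d. rr\<^sup>2 * (x i * x i))"
      proof (rule mult_left_mono)
        show "ip d (\<lambda>i. 1 / f i * x i) (\<lambda>i. 1 / f i * x i) \<le> (\<Sum>i<d. rr\<^sup>2 * (x i * x i))"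
          unfolding ip_def
        proof (rule sum_mono)
          fix i
          have "(1 / f i)\<^sup>2 * (x i * x i) \<le> rr\<^sup>2 * (x i * x i)" by (rule mult_right_mono[OF f(3)]) simp
          then show "1 / f i * x i * (1 / f i * x i) \<le> rr\<^sup>2 * (x i * x i)" by (simp add: power2_eq_square mult_ac)
        qed
        show "0 \<le> (1 + e) * (B / 4) * \<mu>' a" using e B pos'[OF a] by simp
      qed
      also have "\<dots> = rr\<^sup>2 * ((1 + e) * (B / 4) * \<mu>' a) * ip d x x"
        by (simp add: ip_def sum_distrib_left mult_ac)
      finally show "ip d x (mv d (NN A \<sigma>) x) \<le> rr\<^sup>2 * ((1 + e) * (B / 4) * \<mu>' a) * ip d x x" .
    qed
    also have "\<dots> = rr\<^sup>2 * (1 + e) * (B * \<mu>' a / 4)" by simp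
    also have "\<dots> \<le> 2 * (B * \<mu>' a / 4)" using re B pos'[OF a] by (intro mult_right_mono) auto
    finally show "av \<sigma>' 7 \<le> av \<sigma>' 6 * \<mu>' a" by (simp add: s')
  qed
  have "Good \<sigma>' (Suc c)" unfolding Good_def using S' c2 by (auto simp: s'(1))
  then show ?thesis by (simp add: \<sigma>'_def)
qed

text \<open>The potential is at least 1, while \<open>Good\<close> bounds it by
  \<open>d^2 (B / 4)^p exp (- c / (64 n^2))\<close>. With \<open>d^2 \<le> 2^p\<close> and
  \<open>B / 2 \<le> exp (2 sqrt B)\<close> this limits \<open>c\<close> to
  \<open>128 n^2 p sqrt B\<close>, which is 1 less than the cap.\<close>

lemma cap_not_reached:
  assumes I: "Inv t \<sigma> j c" and G: "Good \<sigma> c"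
  shows "real c < capv n \<sigma>"
proof -
  define B where "B = av \<sigma> 6"
  from G obtain V \<mu> where sp: "Spec \<sigma> V \<mu>"
    and pt: "pot d p \<mu> \<le> (real d)\<^sup>2 * (B / 4) ^ p * (1 - 1 / (64 * (real n)\<^sup>2)) ^ c" by (auto simp: Good_def B_def)
  have B: "0 \<le> B" using I by (simp add: Inv_def B_def)
  have pos: "0 < \<mu> a" if "a < d" for a using sp that by (simp add: Spec_def)
  have "(\<mu> 0 / \<mu> 0) ^ p \<le> pot d p \<mu>" by (rule pot_ge_ratio[OF pos]) (use d in auto)
  then have 1: "1 \<le> pot d p \<mu>" using pos[of 0] d by simp
  define x where "x = 1 / (64 * (real n)\<^sup>2)"
  have x: "0 < x" "x \<le> 1"
  proof -
    have "1 * 1 \<le> 64 * (real n)\<^sup>2" using n by (intro mult_mono) auto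
    then show "x \<le> 1" unfolding x_def by (subst divide_le_eq_1_pos) (use n in auto)
    show "0 < x" using n by (simp add: x_def)
  qed
  have "(real d)\<^sup>2 \<le> 2 ^ p"
  proof -
    have "(real d)\<^sup>2 \<le> 8 * real d * real d" by (simp add: power2_eq_square)
    also have "\<dots> \<le> 2 ^ lg (8 * real d * real d)" by (rule lg_upper)
    also have "\<dots> \<le> 2 ^ p"
    proof (rule power_increasing)
      have "1 * lg (8 * real d * real d) \<le> n * lg (8 * real d * real d)" using n by (intro mult_right_mono) auto
      also have "\<dots> \<le> p"
        using lg_upper[of "real n * real (lg (8 * real d * real d))"] unfolding lp_def by (simp add: of_nat_le_iff[where 'a=real, symmetric])
      finally show "lg (8 * real d * real d) \<le> p" by simp
    qed simp
    finally show ?thesis .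
  qed
  then have "(real d)\<^sup>2 * (B / 4) ^ p \<le> 2 ^ p * (B / 4) ^ p" using B by (intro mult_right_mono) auto
  also have "\<dots> = (B / 2) ^ p" unfolding power_mult_distrib[symmetric] by simp
  also have "\<dots> \<le> exp (2 * sqrt B) ^ p"
  proof (rule power_mono)
    have "sqrt B \<le> exp (sqrt B)" using exp_ge_add_one_self[of "sqrt B"] by linarith
    then have "(sqrt B)\<^sup>2 \<le> (exp (sqrt B))\<^sup>2" using B by (intro power_mono) auto
    then have "B \<le> exp (2 * sqrt B)" using B by (simp add: exp_double)
    then show "B / 2 \<le> exp (2 * sqrt B)" using B by linarith
  qed (use B in simp)
  also have "\<dots> = exp (real p * (2 * sqrt B))" by (simp add: exp_of_nat_mult[symmetric])
  finally have 2: "(real d)\<^sup>2 * (B / 4) ^ p \<le> exp (real p * (2 * sqrt B))" .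
  have "(1 - x) ^ c \<le> exp (- x) ^ c" using exp_ge_add_one_self[of "- x"] x by (intro power_mono) auto
  also have "\<dots> = exp (- (real c * x))" by (simp add: exp_of_nat_mult[symmetric])
  finally have 3: "(1 - x) ^ c \<le> exp (- (real c * x))" .
  have "1 \<le> exp (real p * (2 * sqrt B)) * exp (- (real c * x))"
  proof -
    have "(real d)\<^sup>2 * (B / 4) ^ p * (1 - x) ^ c \<le> exp (real p * (2 * sqrt B)) * exp (- (real c * x))"
      using 2 3 x by (intro mult_mono) auto
    then show ?thesis using 1 pt by (simp add: x_def)
  qed
  then have "1 \<le> exp (real p * (2 * sqrt B) - real c * x)" by (simp add: exp_diff exp_minus field_simps)
  then have "real c * x \<le> real p * (2 * sqrt B)" by simp
  then have "real c \<le> 128 * (real n)\<^sup>2 * (real p * sqrt B)" using n by (simp add: x_def field_simps)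
  then show ?thesis using I by (simp add: capv_def Inv_def Static_def B_def mult_ac)
qed

text \<open>The scaled \<open>K\<close> is positive semidefinite with unit diagonal, so its
  eigenvalues are nonnegative with sum \<open>d\<close>; adding \<open>d\<close> times the identity
  puts those of \<open>N\<close> between \<open>d\<close> and \<open>2 d\<close>.\<close>

lemma Good_init: "Good (st \<omega> 0) 0"
proof -
  define \<sigma> where "\<sigma> = st \<omega> 0"
  note ini = init_correct[OF d n1, where A=A and \<omega>=\<omega> and \<delta>=\<delta>]
  have s: "av \<sigma> 5 = real d" "av \<sigma> 6 = 10" "av \<sigma> 7 = 2 * real d"
    "\<And>i. i < d \<Longrightarrow> vv \<sigma> 0 i = A i i" "\<And>i. i < d \<Longrightarrow> vv \<sigma> 1 i = 1 / sqrt (A i i)"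
    unfolding \<sigma>_def st_0 using ini by auto
  have "sym_mat d (NN A \<sigma>)" unfolding NN_def by (rule Nmat_sym[OF A_props(2)])
  then obtain V \<mu> where sp: "spectral d (NN A \<sigma>) V \<mu>" by (rule spectral_exists)
  interpret N: spectral d "NN A \<sigma>" V \<mu> by fact
  have ge: "real d * ip d x x \<le> ip d x (mv d (NN A \<sigma>) x)" for x
  proof -
    have "(\<Sum>i<d. vv \<sigma> 0 i * (vv \<sigma> 1 i * x i)\<^sup>2) = ip d x x"
      unfolding ip_def
    proof (intro sum.cong refl)
      fix i assume "i \<in> {..<d}"
      then have "i < d" "0 < A i i" using A_diag by auto
      then show "vv \<sigma> 0 i * (vv \<sigma> 1 i * x i)\<^sup>2 = x i * x i"
        by (simp add: s power_divide power_mult_distrib power2_eq_square)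
    qed
    then show ?thesis unfolding NN_quad s using A_psd[of "\<lambda>i. vv \<sigma> 1 i * x i"] by simp
  qed
  have lo: "real d \<le> \<mu> a" if "a < d" for a by (rule N.eig_ge[OF ge that])
  have "(\<Sum>a<d. \<mu> a) = (\<Sum>i<d. NN A \<sigma> i i)"
    by (rule trans[OF N.sum_dg[symmetric]], rule sum.cong[OF refl]) (simp add: N.dec N.dg_def power2_eq_square mult.assoc)
  also have "\<dots> = (\<Sum>i<d. 1 + real d)"
  proof (intro sum.cong refl)
    fix i assume "i \<in> {..<d}"
    then have i: "i < d" by simp
    have "NN A \<sigma> i i = (A i i + real d * A i i) / (sqrt (A i i) * sqrt (A i i))" using i by (simp add: NN_def Nmat_def s)
    then show "NN A \<sigma> i i = 1 + real d" using A_diag[OF i] by (simp add: add_divide_distrib)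
  qed
  finally have sm: "(\<Sum>a<d. \<mu> a - real d) = real d" by (simp add: sum_subtractf algebra_simps)
  have hi: "\<mu> a \<le> 2 * real d" if "a < d" for a
  proof -
    have "\<mu> a - real d \<le> (\<Sum>a<d. \<mu> a - real d)" using lo that by (intro member_le_sum) auto
    then show ?thesis using sm by simp
  qed
  have pos: "0 < \<mu> a" if "a < d" for a using lo[OF that] d by linarith
  have S: "Spec \<sigma> V \<mu>"
    unfolding Spec_def s using sp lo hi pos by force
  have "pot d p \<mu> \<le> (real d)\<^sup>2 * 2 ^ p"
  proof (rule pot_le[OF pos])
    fix a b assume "a < d" "b < d"
    then show "\<mu> a \<le> 2 * \<mu> b" using hi[of a] lo[of b] by linarith
  qed
  also have "\<dots> \<le> (real d)\<^sup>2 * (10 / 4) ^ p" by (intro mult_left_mono power_mono) auto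
  finally have "pot d p \<mu> \<le> (real d)\<^sup>2 * (av \<sigma> 6 / 4) ^ p * (1 - 1 / (64 * (real n)\<^sup>2)) ^ 0" by (simp add: s)
  then show ?thesis unfolding Good_def \<sigma>_def[symmetric] using S by blast
qed

theorem Good_reachable:
  assumes "\<forall>s<t. \<not> BadT s \<omega>"
  shows "0 < av (st \<omega> t) 12 \<Longrightarrow> \<exists>j c. Inv t (st \<omega> t) j c \<and> Good (st \<omega> t) c"
  using assms
proof (induction t)
  case 0
  then show ?case using Inv_init Good_init by blast
next
  case (Suc t)
  from go_Suc[OF Suc.prems(1)] have g: "0 < av (st \<omega> t) 12" "st \<omega> (Suc t) = hsem d A \<omega> (bodyp n) (st \<omega> t)" by auto
  from Suc.IH[OF g(1)] Suc.prems(2) obtain j c where I: "Inv t (st \<omega> t) j c" "Good (st \<omega> t) c" by auto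
  have nb: "\<not> Bad (kk t) (st \<omega> t) (\<lambda>i. \<omega> (fl (st \<omega> t) + i))" using Suc.prems(2) by (auto simp: BadT_def)
  have s: "if near d A \<omega> n (st \<omega> t) then Inv (Suc t) (st \<omega> (Suc t)) (Suc j) 0 else Inv (Suc t) (st \<omega> (Suc t)) j (Suc c)"
    using Inv_step[OF I(1), of \<omega>] Suc.prems(1) g(2) by simp
  show ?case
  proof (cases "near d A \<omega> n (st \<omega> t)")
    case True
    then show ?thesis using s near_step[OF I g(1) nb True] g(2) by auto
  next
    case False
    then show ?thesis using s far_step[OF I g(1) nb False] g(2) by auto
  qed
qed

text \<open>By \<open>cap_not_reached\<close> the loop can only have ended at the stopping test, so
  the diagonals nearly agree and the last estimates are certified. The test makes the \<mu>-term
  small against the lower bound for the eigenvalues of \<open>N\<close>: dropping it costs a factor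
  \<open>1 - e\<close>, and the comparison with the optimum another one. The two factors
  \<open>1 + e\<close> come from \<open>p\<close>-th roots.\<close>

lemma final_step:
  assumes I: "Inv t \<sigma> j c" and G: "Good \<sigma> c" and go: "0 < av \<sigma> 12"
    and nb: "\<not> Bad (kk t) \<sigma> (\<lambda>i. \<omega> (fl \<sigma> + i))" and stop: "\<not> 0 < av (hsem d A \<omega> (bodyp n) \<sigma>) 12"
    and w: "\<forall>i<d. w $ i = (vv (hsem d A \<omega> (bodyp n) \<sigma>) 1 i)\<^sup>2"
  shows "positive_definite d (outer_scale d K w) \<and> cond_number (outer_scale d K w) \<le> (1 + 5 / real n) * \<kappa>"
proof -
  have near: "near d A \<omega> n \<sigma>"
    using stop cap_not_reached[OF I G] I by (auto simp: body_correct Inv_def split: if_splits)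
  define \<theta> where "\<theta> = th d A \<omega> n \<sigma>"
  define \<theta>' where "\<theta>' = th' d A \<omega> n \<sigma>"
  define e where "e = 1 / real n"
  define \<nu> where "\<nu> = av \<sigma> 5"
  define s where "s i = vv \<sigma> 1 i" for i
  define M where "M = outer_scale d K w"
  have e: "0 < e" "e \<le> 1 / 10" using n_small by (auto simp: e_def)
  have small: "\<nu> * (10 * (\<theta> * \<theta>')) < e"
    using stop near I by (auto simp: body_correct Inv_def Static_def Bnew_def \<theta>_def \<theta>'_def \<nu>_def e_def split: if_splits)
  have nu: "0 \<le> \<nu>" using I by (simp add: Inv_def \<nu>_def)
  have ws: "w $ i = (s i)\<^sup>2" "0 < s i" "vv \<sigma> 0 i = A i i" if "i < d" for i
    using w near that I by (simp_all add: body_correct s_def Inv_def Static_def)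
  from G obtain V \<mu> where sp: "Spec \<sigma> V \<mu>" by (auto simp: Good_def)
  interpret N: spectral d "NN A \<sigma>" V \<mu> using sp by (simp add: Spec_def)
  have t: "0 < \<theta>" "0 < \<theta>'" using evaluation(1,2)[OF I sp go nb] by (auto simp: \<theta>_def \<theta>'_def)
  have mb: "\<mu> a \<le> (1 + e) * \<theta>" "1 / ((1 + e) * \<theta>') \<le> \<mu> a" if "a < d" for a
    using theta_estimates[OF I sp go nb that] by (auto simp: \<theta>_def \<theta>'_def e_def)
  have Mij: "fm M i j = s i * A i j * s j" if "i < d" "j < d" for i j
  proof -
    have "sqrt (w $ i) = s i" if "i < d" for i
      unfolding ws(1)[OF that] by (rule real_sqrt_unique) (use ws(2)[OF that] in auto)
    then show ?thesis unfolding M_def outer_scale_fm[OF A_props(1) that] using that by simp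
  qed
  have MQ: "ip d x (mv d (fm M) x) = ip d (\<lambda>i. s i * x i) (mv d A (\<lambda>i. s i * x i))" for x
    by (rule ip_scaled[OF Mij])
  have NQ: "ip d x (mv d (NN A \<sigma>) x) = ip d x (mv d (fm M) x) + \<nu> * (\<Sum>i<d. A i i * (s i)\<^sup>2 * (x i)\<^sup>2)" for x
  proof -
    have "(\<Sum>i<d. vv \<sigma> 0 i * (s i * x i)\<^sup>2) = (\<Sum>i<d. A i i * (s i)\<^sup>2 * (x i)\<^sup>2)"
      by (rule sum.cong[OF refl]) (simp add: ws(3) power_mult_distrib)
    then show ?thesis unfolding NN_quad MQ \<nu>_def s_def[symmetric] by simp
  qed
  have D: "0 \<le> (\<Sum>i<d. A i i * (s i)\<^sup>2 * (x i)\<^sup>2)" for x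
    using A_diag by (intro sum_nonneg) (auto simp: less_imp_le)
  have hi: "ip d x (mv d (fm M) x) \<le> (1 + e) * \<theta> * ip d x x" for x
  proof -
    have "ip d x (mv d (fm M) x) \<le> ip d x (mv d (NN A \<sigma>) x)" unfolding NQ using nu D[of x] by simp
    also have "\<dots> \<le> (1 + e) * \<theta> * ip d x x" by (rule N.quad_le) (rule mb)
    finally show ?thesis .
  qed
  define lo where "lo = (1 - e) / ((1 + e) * \<theta>')"
  have lo0: "0 < lo" using e t by (simp add: lo_def)
  have lo: "lo * ip d x x \<le> ip d x (mv d (fm M) x)" for x
  proof -
    \<comment> \<open>Diagonal entries are at most the largest eigenvalue, so the dropped part is at
      most \<open>\<nu> (1 + e) \<theta>\<close> times the identity.\<close>
    have di: "A i i * (s i)\<^sup>2 \<le> (1 + e) * \<theta>" if i: "i < d" for i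
    proof -
      have "ip d (\<lambda>j. of_bool (j = i)) (\<lambda>j. of_bool (j = i)) = (1::real)" using i by (simp add: ip_def)
      then show ?thesis
        using hi[of "\<lambda>j. of_bool (j = i)"] unfolding diag_quad[OF i] Mij[OF i i] by (simp add: power2_eq_square mult_ac)
    qed
    have "(\<Sum>i<d. A i i * (s i)\<^sup>2 * (x i)\<^sup>2) \<le> (\<Sum>i<d. (1 + e) * \<theta> * (x i)\<^sup>2)"
      using di by (intro sum_mono mult_right_mono) auto
    also have "\<dots> = (1 + e) * \<theta> * ip d x x" by (simp add: ip_def sum_distrib_left power2_eq_square)
    finally have "\<nu> * (\<Sum>i<d. A i i * (s i)\<^sup>2 * (x i)\<^sup>2) \<le> \<nu> * ((1 + e) * \<theta> * ip d x x)"
      using nu by (rule mult_left_mono)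
    moreover have "1 / ((1 + e) * \<theta>') * ip d x x \<le> ip d x (mv d (NN A \<sigma>) x)" by (rule N.quad_ge) (rule mb)
    ultimately have 1: "(1 / ((1 + e) * \<theta>') - \<nu> * ((1 + e) * \<theta>)) * ip d x x \<le> ip d x (mv d (fm M) x)"
      unfolding NQ by (simp add: algebra_simps)
    have "lo \<le> 1 / ((1 + e) * \<theta>') - \<nu> * ((1 + e) * \<theta>)"
    proof -
      \<comment> \<open>The factor 10 in the stopping test gives
        \<open>\<nu> \<theta> \<theta>' < e / 10\<close>, which leaves room for
        \<open>(1 + e)^2 \<le> 2\<close>.\<close>
      have "(\<nu> * (\<theta> * \<theta>')) * (1 + e)\<^sup>2 \<le> (e / 10) * 2"
      proof (rule mult_mono)
        have "(1 + e)\<^sup>2 \<le> (11 / 10)\<^sup>2" using e by (intro power_mono) auto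
        then show "(1 + e)\<^sup>2 \<le> 2" by (simp add: power2_eq_square)
      qed (use small e in auto)
      then have "(\<nu> * (\<theta> * \<theta>')) * (1 + e)\<^sup>2 \<le> e" using e by linarith
      then have "\<nu> * ((1 + e) * \<theta>) * ((1 + e) * \<theta>') \<le> e" by (simp add: power2_eq_square mult_ac)
      then have "\<nu> * ((1 + e) * \<theta>) \<le> e / ((1 + e) * \<theta>')" using t e by (simp add: pos_le_divide_eq)
      then show ?thesis by (simp add: lo_def diff_divide_distrib)
    qed
    then have "lo * ip d x x \<le> (1 / ((1 + e) * \<theta>') - \<nu> * ((1 + e) * \<theta>)) * ip d x x"
      by (rule mult_right_mono) (simp add: ip_def sum_nonneg)
    then show ?thesis using 1 by linarith
  qed
  have sym: "sym_mat d (fm M)" using A_props(2) by (auto simp: sym_mat_def Mij mult_ac)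
  have Mc: "M \<in> carrier_mat d d" unfolding M_def by (rule outer_scale_carrier[OF A_props(1)])
  note cn = cond_number_le[OF Mc sym d lo0 lo hi]
  have "(1 + e) * \<theta> / lo = (1 + e)\<^sup>2 / (1 - e) * (\<theta> * \<theta>')" by (simp add: lo_def power2_eq_square)
  also have "\<dots> \<le> (1 + e)\<^sup>2 / (1 - e) * (\<kappa> / (1 - e))"
  proof (rule mult_left_mono)
    have "(1 - e) * (\<theta> * \<theta>') \<le> \<kappa>"
      using Bnew_bound(1)[of \<sigma> \<omega>] near I nu by (auto simp: Inv_def e_def \<theta>_def \<theta>'_def)
    then show "\<theta> * \<theta>' \<le> \<kappa> / (1 - e)" using e by (simp add: pos_le_divide_eq mult.commute)
  qed (use e in simp)
  also have "\<dots> = (1 + e)\<^sup>2 / (1 - e)\<^sup>2 * \<kappa>" by (simp add: power2_eq_square)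
  also have "\<dots> \<le> (1 + 5 * e) * \<kappa>"
  proof (rule mult_right_mono)
    \<comment> \<open>The two sides of the inequality below differ by
      \<open>e - 10 e^2 + 5 e^3\<close>, which is nonnegative because
      \<open>e \<le> 1 / 10\<close>.\<close>
    have "e * (10 * e) \<le> e * 1" using e by (intro mult_left_mono) auto
    moreover have "0 \<le> e ^ 3" using e by simp
    ultimately have "(1 + e)\<^sup>2 \<le> (1 + 5 * e) * (1 - e)\<^sup>2"
      by (simp add: power2_eq_square power3_eq_cube algebra_simps)
    then show "(1 + e)\<^sup>2 / (1 - e)\<^sup>2 \<le> 1 + 5 * e" using e by (subst pos_divide_le_eq) auto
  qed (use kappa in simp)
  finally show ?thesis using cn by (simp add: M_def e_def)
qed

lemma st_stopped: "\<not> 0 < av (st \<omega> t) 12 \<Longrightarrow> t \<le> u \<Longrightarrow> st \<omega> u = st \<omega> t"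
  by (induction u) (auto simp: st_Suc le_Suc_eq)

text \<open>The first stopping time is positive, so there is a last executed round, to which
  \<open>final_step\<close> applies; freezing carries its result on to \<open>Gm\<close>.\<close>

theorem output_correct:
  assumes nb: "\<forall>t<Gm. \<not> BadT t \<omega>" and w: "\<forall>i<d. w $ i = (vv (st \<omega> Gm) 1 i)\<^sup>2"
  shows "positive_definite d (outer_scale d K w) \<and> cond_number (outer_scale d K w) \<le> (1 + 5 / real n) * \<kappa>"
proof -
  define s where "s = (LEAST s. \<not> 0 < av (st \<omega> s) 12)"
  have s: "\<not> 0 < av (st \<omega> s) 12" unfolding s_def by (rule LeastI[where P="\<lambda>s. \<not> 0 < av (st \<omega> s) 12"]) (rule stops)
  have sG: "s \<le> Gm" unfolding s_def by (rule Least_le) (rule stops)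
  have "0 < av (st \<omega> 0) 12" unfolding st_0 using init_correct(9)[OF d n1] by simp
  then have "s \<noteq> 0" using s by metis
  then obtain t where t: "s = Suc t" by (cases s) auto
  then have go: "0 < av (st \<omega> t) 12" using not_less_Least[of t "\<lambda>s. \<not> 0 < av (st \<omega> s) 12"] by (auto simp: s_def)
  have tG: "t < Gm" using t sG by simp
  obtain j c where I: "Inv t (st \<omega> t) j c" "Good (st \<omega> t) c" using Good_reachable[OF _ go] nb tG by auto
  have e: "st \<omega> Gm = hsem d A \<omega> (bodyp n) (st \<omega> t)"
    using st_stopped[OF s sG] go t by (simp add: st_Suc)
  show ?thesis
  proof (rule final_step[OF I go])
    show "\<not> Bad (kk t) (st \<omega> t) (\<lambda>i. \<omega> (fl (st \<omega> t) + i))" using nb tG by (simp add: BadT_def)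
    show "\<not> 0 < av (hsem d A \<omega> (bodyp n) (st \<omega> t)) 12" using s t go by (simp add: st_Suc)
    show "\<forall>i<d. w $ i = (vv (hsem d A \<omega> (bodyp n) (st \<omega> t)) 1 i)\<^sup>2" using w e by simp
  qed
qed

end

section \<open>The main theorem\<close>

theorem theorem5p2:
  fixes \<epsilon> :: real
  assumes "\<epsilon> > 0"
  shows "\<exists>(P :: prog) (C :: real). \<forall>(d :: nat) (K :: real mat) (T :: real) (\<delta> :: real).
    1 \<le> d \<longrightarrow> positive_definite d K \<longrightarrow> vec_space.rank d K = d \<longrightarrow> real d \<le> T \<longrightarrow>
    0 < \<delta> \<longrightarrow> \<delta> < 1 \<longrightarrow>
      (\<forall>\<omega>. \<exists>t s. exec K T \<omega> P (init_state d \<delta>) t s \<and>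
          t \<le> C * time_bound d K T \<delta> \<and> nonneg_vec d (output_vec d s)) \<and>
      measure fair_coins {\<omega>. \<exists>t s. exec K T \<omega> P (init_state d \<delta>) t s \<and>
          positive_definite d (outer_scale d K (output_vec d s)) \<and>
          cond_number (outer_scale d K (output_vec d s)) \<le> (1 + \<epsilon>) * opt_outer_cond d K}
        \<ge> 1 - \<delta>"
proof -
  \<comment> \<open>The loss in \<open>final_step\<close> is \<open>5 / n\<close>, and the analysis
    requires \<open>n \<ge> 10\<close>.\<close>
  define n where "n = max 10 (nat \<lceil>5 / \<epsilon>\<rceil>)"
  have n: "10 \<le> n" by (simp add: n_def)
  have n\<epsilon>: "5 / real n \<le> \<epsilon>"
  proof -
    have "5 / \<epsilon> \<le> real n" unfolding n_def by linarith
    then show ?thesis using n assms by (simp add: field_simps)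
  qed
  \<comment> \<open>Both witnesses depend on \<open>n\<close> alone: the exponent \<open>p\<close>
    and the factor \<open>r\<close>, which depend on \<open>d\<close>, are computed at run
    time.\<close>
  show ?thesis
  proof (intro exI[of _ "mainp n"] exI[of _ "algorithm.C0 n"] allI impI)
    fix d :: nat and K :: "real mat" and T \<delta> :: real
    assume d: "1 \<le> d" and K: "positive_definite d K" and T: "real d \<le> T" and \<delta>: "0 < \<delta>" "\<delta> < 1"
    interpret algorithm d K n \<delta> using d K n \<delta> by unfold_locales
    have T0: "0 \<le> T" using T d by linarith
    have ex: "\<exists>t s. exec K T \<omega> (mainp n) (init_state d \<delta>) t s \<and> t \<le> C0 * time_bound d K T \<delta> \<and>
        (\<forall>i<d. rmem s i = (vv (st \<omega> Gm) 1 i)\<^sup>2)" for \<omega>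
    proof -
      have ram: "ram d K T" by unfold_locales (use A_props(1) d T in auto)
      have fmK: "ram.A K = fm K" by (intro ext) (simp add: fm_def ram.A_def[OF ram])
      have Cb: "0 \<le> Cb" unfolding Cb_def using kappa by (intro add_nonneg_nonneg mult_nonneg_nonneg) auto
      obtain t s where ts: "exec K T \<omega> (mainp n) (init_state d \<delta>) t s"
          "t \<le> (18 + hcost d (fm K) \<omega> (initp n) (vstate0 \<delta>) + real Gm * (1 + Cb)) * T"
          "\<forall>i<d. rmem s i = (vv (st \<omega> Gm) 1 i)\<^sup>2"
        using ram.mainp_sim[OF ram, where n=n and G=Gm and C=Cb and \<delta>=\<delta>, unfolded fmK, folded st_def, OF Cb cost_bound stops] by blast
      note ts(2)
      also have "(18 + hcost d (fm K) \<omega> (initp n) (vstate0 \<delta>) + real Gm * (1 + Cb)) * T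
          \<le> (C0 * (\<kappa> powr 1.5 * LL d \<kappa> \<delta> ^ 8)) * T"
        using total_time init_correct(17)[OF d n1, where A="fm K" and \<omega>=\<omega> and \<delta>=\<delta>] T0
        by (intro mult_right_mono) linarith+
      also have "\<dots> = C0 * time_bound d K T \<delta>" by (simp add: time_bound_def LL_def mult_ac)
      finally show ?thesis using ts by blast
    qed
    have out: "output_vec d s $ i = rmem s i" if "i < d" for s i
      using that by (simp add: output_vec_def read_vec_def)
    show "(\<forall>\<omega>. \<exists>t s. exec K T \<omega> (mainp n) (init_state d \<delta>) t s \<and>
          t \<le> C0 * time_bound d K T \<delta> \<and> nonneg_vec d (output_vec d s)) \<and>
      measure fair_coins {\<omega>. \<exists>t s. exec K T \<omega> (mainp n) (init_state d \<delta>) t s \<and>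
          positive_definite d (outer_scale d K (output_vec d s)) \<and>
          cond_number (outer_scale d K (output_vec d s)) \<le> (1 + \<epsilon>) * opt_outer_cond d K}
        \<ge> 1 - \<delta>"
    proof (intro conjI allI)
      fix \<omega>
      from ex[of \<omega>] obtain t s where ts: "exec K T \<omega> (mainp n) (init_state d \<delta>) t s" "t \<le> C0 * time_bound d K T \<delta>"
        "\<forall>i<d. rmem s i = (vv (st \<omega> Gm) 1 i)\<^sup>2" by blast
      then have "nonneg_vec d (output_vec d s)"
        unfolding nonneg_vec_def using out by (auto simp: output_vec_def read_vec_def)
      then show "\<exists>t s. exec K T \<omega> (mainp n) (init_state d \<delta>) t s \<and>
          t \<le> C0 * time_bound d K T \<delta> \<and> nonneg_vec d (output_vec d s)" using ts by blast
    next
      define ov where "ov \<sigma> = Matrix.vec d (\<lambda>i. (vv \<sigma> 1 i)\<^sup>2)" for \<sigma> :: vstate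
      define Q where "Q \<sigma> \<longleftrightarrow> positive_definite d (outer_scale d K (ov \<sigma>)) \<and>
        cond_number (outer_scale d K (ov \<sigma>)) \<le> (1 + \<epsilon>) * \<kappa>" for \<sigma> :: vstate
      \<comment> \<open>As \<open>exec\<close> is deterministic, the existential event is a property
        of the final state, hence of finitely many coins; this makes it measurable, with a
        probability given by \<open>pavg\<close>.\<close>
      have eqv: "(\<exists>t s. exec K T \<omega> (mainp n) (init_state d \<delta>) t s \<and>
          positive_definite d (outer_scale d K (output_vec d s)) \<and>
          cond_number (outer_scale d K (output_vec d s)) \<le> (1 + \<epsilon>) * opt_outer_cond d K) \<longleftrightarrow> Q (st \<omega> Gm)" for \<omega>
      proof -
        from ex[of \<omega>] obtain t s where ts: "exec K T \<omega> (mainp n) (init_state d \<delta>) t s"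
          "\<forall>i<d. rmem s i = (vv (st \<omega> Gm) 1 i)\<^sup>2" by blast
        have "output_vec d s = ov (st \<omega> Gm)"
          using ts(2) by (auto simp: output_vec_def read_vec_def ov_def)
        then show ?thesis unfolding Q_def using ts(1) exec_deterministic[OF ts(1)] by metis
      qed
      have dQ: "dep (nt Gm) (\<lambda>\<omega>. Q (st \<omega> Gm))" by (rule dep_comp[OF dep_st])
      have good: "Q (st \<omega> Gm)" if "\<not> (\<exists>t\<in>{..<Gm}. BadT t \<omega>)" for \<omega>
      proof -
        have *: "positive_definite d (outer_scale d K (ov (st \<omega> Gm))) \<and>
          cond_number (outer_scale d K (ov (st \<omega> Gm))) \<le> (1 + 5 / real n) * \<kappa>"
          by (rule output_correct) (use that in \<open>auto simp: ov_def\<close>)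
        have "(1 + 5 / real n) * \<kappa> \<le> (1 + \<epsilon>) * \<kappa>" using n\<epsilon> kappa by (intro mult_right_mono) auto
        then show ?thesis unfolding Q_def using * by linarith
      qed
      have "1 = pavg (nt Gm) (\<lambda>_. 1 :: real)" by (simp only: pavg_const)
      \<comment> \<open>Whatever the coins, the output is good or some round was bad.\<close>
      also have "\<dots> \<le> pavg (nt Gm) (\<lambda>\<omega>. of_bool (Q (st \<omega> Gm)) + of_bool (\<exists>t\<in>{..<Gm}. BadT t \<omega>))"
        by (rule pavg_mono) (use good in auto)
      also have "\<dots> \<le> pavg (nt Gm) (\<lambda>\<omega>. of_bool (Q (st \<omega> Gm))) + \<delta>"
        unfolding pavg_add using failure_prob by simp
      finally have "1 - \<delta> \<le> measure fair_coins {\<omega>. Q (st \<omega> Gm)}"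
        using measure_fair_coins[OF dQ] by simp
      then show "measure fair_coins {\<omega>. \<exists>t s. exec K T \<omega> (mainp n) (init_state d \<delta>) t s \<and>
          positive_definite d (outer_scale d K (output_vec d s)) \<and>
          cond_number (outer_scale d K (output_vec d s)) \<le> (1 + \<epsilon>) * opt_outer_cond d K}
        \<ge> 1 - \<delta>" unfolding eqv .
    qed
  qed
qed

end
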